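(* Let $d\ge1$ and let $\Lambda,\Omega\subset\mathbb R^d$ be bounded Lipschitz domains (for $d\ge2$) or open bounded intervals (for $d=1$). Let $q\in(0,1]$. Then there is a constant $C_q$, which may depend on $\Lambda$ and $\Omega$, such that for any $\alpha\ge2$ $$\|\chi_\Lambda\,P_{\Omega,\alpha}\,(I-\chi_\Lambda)\|_{\mathfrak S_q}\le C_q\,\big(\alpha^{d-1}\log\alpha\big)^{\frac1q}.$$
   Context: For $0<q<\infty$, $\mathfrak S_q$ is the set of compact operators $A$ on a Hilbert space (here $L^2(\mathbb R^d)$) with singular values $s_k(A)$ such that $\|A\|_{\mathfrak S_q}=(\sum_k s_k(A)^q)^{1/q}<\infty$. $I$ is the identity operator; $B(\mathbf z,r)$ is the open ball of radius $r$ centred at $\mathbf z$. Lipschitz domains ($d\ge2$): $\Lambda_0\subset\mathbb R^d$ is a basic domain if, with a suitable choice of Cartesian coordinates $\mathbf x=(\hat{\mathbf x},x_d)$, $\hat{\mathbf x}\in\mathbb R^{d-1}$, one has $\Lambda_0=\{\mathbf x: x_d>\Phi(\hat{\mathbf x})\}$ with a function $\Phi$ that is uniformly Lipschitz on $\mathbb R^{d-1}$. A domain $\Lambda$ is Lipschitz if for every $\mathbf z\in\mathbb R^d$ there are $r>0$ and a basic domain $\Lambda_0=\Lambda_0(\mathbf z)$ with $B(\mathbf z,r)\cap\Lambda=B(\mathbf z,r)\cap\Lambda_0$. $\chi_\Lambda$ is the operator of multiplication by the characteristic function of $\Lambda$, and $P_{\Omega,\alpha}=\mathrm{Op}_\alpha(\chi_\Omega)$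 is the projection $$(P_{\Omega,\alpha}u)(\mathbf x)=\Big(\frac{\alpha}{2\pi}\Big)^d\iint e^{i\alpha(\mathbf x-\mathbf y)\cdot\boldsymbol\xi}\chi_\Omega(\boldsymbol\xi)u(\mathbf y)\,d\mathbf y\,d\boldsymbol\xi$$ (for Schwartz $u$, extended to $L^2(\mathbb R^d)$). *)

theory Defs
  imports "HOL-Analysis.Analysis"
begin

text \<open>
  Borel representatives suffice: every Lebesgue measurable function agrees almost everywhere
  with a Borel measurable one.
\<close>

definition square_integrable :: "('a::euclidean_space \<Rightarrow> complex) \<Rightarrow> bool" where
  "square_integrable f \<longleftrightarrow>
     f \<in> borel_measurable borel \<and> integrable lborel (\<lambda>x. (cmod (f x))\<^sup>2)"

definition L2_rel :: "('a::euclidean_space \<Rightarrow> complex) \<Rightarrow> ('a \<Rightarrow> complex) \<Rightarrow> bool" where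
  "L2_rel f g \<longleftrightarrow>
     square_integrable f \<and> square_integrable g \<and> (AE x in lborel. f x = g x)"

lemma square_integrable_zero: "square_integrable (\<lambda>_. 0)"
  by (simp add: square_integrable_def)

lemma square_integrable_cong_AE:
  assumes "square_integrable f" "g \<in> borel_measurable borel" "AE x in lborel. f x = g x"
  shows "square_integrable g"
proof -
  have "integrable lborel (\<lambda>x. (cmod (g x))\<^sup>2) = integrable lborel (\<lambda>x. (cmod (f x))\<^sup>2)"
    by (rule integrable_cong_AE) (use assms in \<open>auto simp: square_integrable_def\<close>)
  with assms show ?thesis by (simp add: square_integrable_def)
qed

lemma square_integrable_scale:
  assumes "square_integrable f"
  shows "square_integrable (\<lambda>x. c * f x)"
  using assms by (auto simp: square_integrable_def norm_mult power_mult_distrib intro: borel_measurable_times)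

lemma square_integrable_add:
  assumes "square_integrable f" "square_integrable g"
  shows "square_integrable (\<lambda>x. f x + g x)"
proof -
  have [measurable]: "f \<in> borel_measurable borel" "g \<in> borel_measurable borel"
    using assms by (auto simp: square_integrable_def)
  have "integrable lborel (\<lambda>x. (cmod (f x + g x))\<^sup>2)"
  proof (rule Bochner_Integration.integrable_bound)
    show "integrable lborel (\<lambda>x. 2 * (cmod (f x))\<^sup>2 + 2 * (cmod (g x))\<^sup>2)"
      using assms by (auto simp: square_integrable_def)
    have "(cmod (f x + g x))\<^sup>2 \<le> 2 * (cmod (f x))\<^sup>2 + 2 * (cmod (g x))\<^sup>2" for x
    proof -
      have "(cmod (f x + g x))\<^sup>2 \<le> (cmod (f x) + cmod (g x))\<^sup>2"
        by (simp add: norm_triangle_ineq power_mono)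
      also have "\<dots> \<le> 2 * (cmod (f x))\<^sup>2 + 2 * (cmod (g x))\<^sup>2"
        using zero_le_power2[of "cmod (f x) - cmod (g x)"]
        by (simp add: power2_eq_square algebra_simps)
      finally show ?thesis .
    qed
    then show "AE x in lborel. norm ((cmod (f x + g x))\<^sup>2)
        \<le> norm (2 * (cmod (f x))\<^sup>2 + 2 * (cmod (g x))\<^sup>2)"
      by (intro AE_I2) (simp add: abs_of_nonneg)
  qed measurable
  then show ?thesis by (simp add: square_integrable_def)
qed

lemma borel_measurable_mult_cnj:
  fixes f g :: "'a::euclidean_space \<Rightarrow> complex"
  assumes "f \<in> borel_measurable borel" "g \<in> borel_measurable borel"
  shows "(\<lambda>x. f x * cnj (g x)) \<in> borel_measurable borel"
proof (rule borel_measurable_times[OF assms(1)])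
  have "cnj \<in> borel_measurable borel"
    by (intro borel_measurable_continuous_onI continuous_intros)
  with assms(2) show "(\<lambda>x. cnj (g x)) \<in> borel_measurable borel"
    by (rule measurable_compose)
qed

lemma square_integrable_mult_cnj:
  assumes "square_integrable f" "square_integrable g"
  shows "integrable lborel (\<lambda>x. f x * cnj (g x))"
proof (rule Bochner_Integration.integrable_bound)
  show "integrable lborel (\<lambda>x. (cmod (f x))\<^sup>2 + (cmod (g x))\<^sup>2)"
    using assms by (auto simp: square_integrable_def)
  show "(\<lambda>x. f x * cnj (g x)) \<in> borel_measurable lborel"
    using assms by (simp add: square_integrable_def borel_measurable_mult_cnj)
  have "cmod (f x * cnj (g x)) \<le> (cmod (f x))\<^sup>2 + (cmod (g x))\<^sup>2" for x
  proof -
    have "2 * (cmod (f x) * cmod (g x)) \<le> (cmod (f x))\<^sup>2 + (cmod (g x))\<^sup>2"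
      using zero_le_power2[of "cmod (f x) - cmod (g x)"]
      by (simp add: power2_eq_square algebra_simps)
    moreover have "0 \<le> cmod (f x) * cmod (g x)" by simp
    ultimately show ?thesis unfolding norm_mult complex_mod_cnj by linarith
  qed
  then show "AE x in lborel. norm (f x * cnj (g x))
      \<le> norm ((cmod (f x))\<^sup>2 + (cmod (g x))\<^sup>2)"
    by (intro AE_I2) (simp add: abs_of_nonneg)
qed

quotient_type (overloaded) 'a L2 = "'a::euclidean_space \<Rightarrow> complex" / partial: L2_rel
proof (rule part_equivpI)
  show "\<exists>f. L2_rel f f"
    by (rule exI[of _ "\<lambda>_. 0"]) (simp add: L2_rel_def square_integrable_zero)
  show "symp L2_rel"
    by (auto simp: symp_def L2_rel_def)
  show "transp L2_rel"
    by (auto simp: transp_def L2_rel_def)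
qed

instantiation L2 :: (euclidean_space) ab_group_add
begin

lift_definition zero_L2 :: "'a L2" is "\<lambda>_. 0"
  by (simp add: L2_rel_def square_integrable_zero)

lift_definition plus_L2 :: "'a L2 \<Rightarrow> 'a L2 \<Rightarrow> 'a L2" is "\<lambda>f g x. f x + g x"
  by (auto simp: L2_rel_def square_integrable_add)

lift_definition uminus_L2 :: "'a L2 \<Rightarrow> 'a L2" is "\<lambda>f x. - f x"
  using square_integrable_scale[of _ "-1"] by (auto simp: L2_rel_def)

definition minus_L2 :: "'a L2 \<Rightarrow> 'a L2 \<Rightarrow> 'a L2" where
  "minus_L2 u v = u + - v"

instance
proof
  fix u v w :: "'a L2"
  show "u + v + w = u + (v + w)"
    by transfer (auto simp: L2_rel_def square_integrable_add add.assoc)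
  show "u + v = v + u"
    by transfer (auto simp: L2_rel_def square_integrable_add add.commute)
  show "0 + u = u"
    by transfer (auto simp: L2_rel_def)
  show "- u + u = 0"
    by transfer (auto simp: L2_rel_def square_integrable_zero)
  show "u - v = u + - v"
    by (rule minus_L2_def)
qed

end

lift_definition scaleC :: "complex \<Rightarrow> 'a::euclidean_space L2 \<Rightarrow> 'a L2" is "\<lambda>c f x. c * f x"
  by (auto simp: L2_rel_def square_integrable_scale)

global_interpretation cL2: vector_space "scaleC :: complex \<Rightarrow> 'a::euclidean_space L2 \<Rightarrow> 'a L2"
proof
  fix a b :: complex and u v :: "'a L2"
  show "scaleC a (u + v) = scaleC a u + scaleC a v"
    by transfer
      (auto simp: L2_rel_def distrib_left intro!: square_integrable_add square_integrable_scale)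
  show "scaleC (a + b) u = scaleC a u + scaleC b u"
    by transfer
      (auto simp: L2_rel_def distrib_right intro!: square_integrable_add square_integrable_scale)
  show "scaleC a (scaleC b u) = scaleC (a * b) u"
    by transfer (auto simp: L2_rel_def mult.assoc intro!: square_integrable_scale)
  show "scaleC 1 u = u"
    by transfer (auto simp: L2_rel_def)
qed

lift_definition cinner :: "'a::euclidean_space L2 \<Rightarrow> 'a L2 \<Rightarrow> complex"
  is "\<lambda>f g. LINT x|lborel. f x * cnj (g x)"
  by (rule integral_cong_AE) (auto simp: L2_rel_def square_integrable_def borel_measurable_mult_cnj)

text \<open>
  The norm, metric and topology of $L^2$ come from the library class of real inner product
  spaces, via the real part of the complex inner product.
\<close>

instantiation L2 :: (euclidean_space) real_inner
begin

definition scaleR_L2 :: "real \<Rightarrow> 'a L2 \<Rightarrow> 'a L2" where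
  "scaleR_L2 r u = scaleC (complex_of_real r) u"

definition inner_L2 :: "'a L2 \<Rightarrow> 'a L2 \<Rightarrow> real" where
  "inner_L2 u v = Re (cinner u v)"

definition norm_L2 :: "'a L2 \<Rightarrow> real" where
  "norm_L2 u = sqrt (inner u u)"

definition sgn_L2 :: "'a L2 \<Rightarrow> 'a L2" where
  "sgn_L2 u = scaleR (inverse (norm u)) u"

definition dist_L2 :: "'a L2 \<Rightarrow> 'a L2 \<Rightarrow> real" where
  "dist_L2 u v = norm (u - v)"

definition uniformity_L2 :: "('a L2 \<times> 'a L2) filter" where
  "uniformity_L2 = (INF e\<in>{0<..}. principal {(u, v). dist u v < e})"

definition open_L2 :: "'a L2 set \<Rightarrow> bool" where
  "open_L2 U \<longleftrightarrow> (\<forall>u\<in>U. \<forall>\<^sub>F (u', v) in uniformity. u' = u \<longrightarrow> v \<in> U)"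

instance
proof
  fix a b r :: real and u v w :: "'a L2"
  show "a *\<^sub>R (u + v) = a *\<^sub>R u + a *\<^sub>R v"
    by (simp add: scaleR_L2_def cL2.scale_right_distrib)
  show "(a + b) *\<^sub>R u = a *\<^sub>R u + b *\<^sub>R u"
    by (simp add: scaleR_L2_def cL2.scale_left_distrib)
  show "a *\<^sub>R b *\<^sub>R u = (a * b) *\<^sub>R u"
    by (simp add: scaleR_L2_def)
  show "1 *\<^sub>R u = u"
    by (simp add: scaleR_L2_def)
  show "sgn u = scaleR (inverse (norm u)) u"
    by (rule sgn_L2_def)
  show "dist u v = norm (u - v)"
    by (rule dist_L2_def)
  show "uniformity = (INF e\<in>{0<..}. principal {(u :: 'a L2, v). dist u v < e})"
    by (rule uniformity_L2_def)
  show "open U \<longleftrightarrow> (\<forall>u\<in>U. \<forall>\<^sub>F (u', v) in uniformity. u' = u \<longrightarrow> v \<in> U)" for U :: "'a L2 set"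
    by (rule open_L2_def)
  show "norm u = sqrt (inner u u)"
    by (rule norm_L2_def)
  have "cinner u v = cnj (cinner v u)"
  proof transfer
    fix f g :: "'a \<Rightarrow> complex"
    assume "L2_rel f f" "L2_rel g g"
    then have "integrable lborel (\<lambda>x. g x * cnj (f x))"
      by (simp add: L2_rel_def square_integrable_mult_cnj)
    from integral_bounded_linear[OF bounded_linear_cnj this]
    show "(LINT x|lborel. f x * cnj (g x)) = cnj (LINT x|lborel. g x * cnj (f x))"
      by (simp add: mult.commute)
  qed
  then show "inner u v = inner v u"
    by (simp add: inner_L2_def)
  show "inner (u + v) w = inner u w + inner v w"
    unfolding inner_L2_def
    by transfer (simp add: L2_rel_def distrib_right square_integrable_mult_cnj
        Bochner_Integration.integral_add)
  show "inner (r *\<^sub>R u) v = r * inner u v"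
    unfolding inner_L2_def scaleR_L2_def
    by transfer (simp add: mult.assoc)
  have inner_self: "Re (LINT x|lborel. f x * cnj (f x)) = (LINT x|lborel. (cmod (f x))\<^sup>2)"
    for f :: "'a \<Rightarrow> complex"
    by (simp only: complex_norm_square[symmetric] of_real_power[symmetric]
        integral_complex_of_real Re_complex_of_real)
  show "0 \<le> inner u u"
    unfolding inner_L2_def by transfer (simp add: inner_self)
  show "inner u u = 0 \<longleftrightarrow> u = 0"
    unfolding inner_L2_def
  proof transfer
    fix f :: "'a \<Rightarrow> complex"
    assume "L2_rel f f"
    then have f: "square_integrable f" by (simp add: L2_rel_def)
    then have "(LINT x|lborel. (cmod (f x))\<^sup>2) = 0 \<longleftrightarrow> (AE x in lborel. (cmod (f x))\<^sup>2 = 0)"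
      by (intro integral_nonneg_eq_0_iff_AE) (auto simp: square_integrable_def)
    then show "Re (LINT x|lborel. f x * cnj (f x)) = 0 \<longleftrightarrow> L2_rel f (\<lambda>_. 0)"
      using f by (simp add: inner_self L2_rel_def square_integrable_zero)
  qed
qed

end

definition bounded_clinear :: "('a::euclidean_space L2 \<Rightarrow> 'a L2) \<Rightarrow> bool" where
  "bounded_clinear A \<longleftrightarrow>
     bounded_linear A \<and> (\<forall>c u. A (scaleC c u) = scaleC c (A u))"

definition compact_operator :: "('a::euclidean_space L2 \<Rightarrow> 'a L2) \<Rightarrow> bool" where
  "compact_operator A \<longleftrightarrow>
     bounded_clinear A \<and> (\<forall>B. bounded B \<longrightarrow> compact (closure (A ` B)))"

definition cadjoint :: "('a::euclidean_space L2 \<Rightarrow> 'a L2) \<Rightarrow> 'a L2 \<Rightarrow> 'a L2" where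
  "cadjoint A = (SOME B. \<forall>u v. cinner (A u) v = cinner u (B v))"

definition eigenspace :: "('a::euclidean_space L2 \<Rightarrow> 'a L2) \<Rightarrow> complex \<Rightarrow> 'a L2 set" where
  "eigenspace A l = {u. A u = scaleC l u}"

text \<open>
  The singular values of a compact operator \<open>A\<close> are the square roots of the eigenvalues of
  \<open>A\<^sup>* A\<close>, listed in nonincreasing order, the positive ones repeated according
  to multiplicity; if there are only finitely many positive ones, the list continues with zeros.
  For compact \<open>A\<close> this determines the sequence. The finiteness requirement is needed
  because the cardinality of an infinite set is 0 by convention.
\<close>

definition is_singular_value_sequence ::
    "('a::euclidean_space L2 \<Rightarrow> 'a L2) \<Rightarrow> (nat \<Rightarrow> real) \<Rightarrow> bool" where
  "is_singular_value_sequence A s \<longleftrightarrow>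
     decseq s \<and> (\<forall>k. 0 \<le> s k) \<and>
     (\<forall>t>0. finite {k. s k = t} \<and>
        card {k. s k = t} = cL2.dim (eigenspace (cadjoint A \<circ> A) (complex_of_real (t\<^sup>2))))"

definition singular_value :: "('a::euclidean_space L2 \<Rightarrow> 'a L2) \<Rightarrow> nat \<Rightarrow> real" where
  "singular_value A = (THE s. is_singular_value_sequence A s)"

definition schatten_class :: "real \<Rightarrow> ('a::euclidean_space L2 \<Rightarrow> 'a L2) set" where
  "schatten_class q =
     {A. compact_operator A \<and> summable (\<lambda>k. singular_value A k powr q)}"

definition schatten_norm :: "real \<Rightarrow> ('a::euclidean_space L2 \<Rightarrow> 'a L2) \<Rightarrow> real" where
  "schatten_norm q A = (\<Sum>k. singular_value A k powr q) powr (1 / q)"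

text \<open>
  \<open>iterated_partial bs f\<close> differentiates \<open>f\<close> successively in the directions listed
  in \<open>bs\<close>; lists over the standard basis give all partial derivatives.
\<close>

primrec iterated_partial ::
    "'a::euclidean_space list \<Rightarrow> ('a \<Rightarrow> complex) \<Rightarrow> 'a \<Rightarrow> complex" where
  "iterated_partial [] f = f"
| "iterated_partial (b # bs) f = (\<lambda>x. frechet_derivative (iterated_partial bs f) (at x) b)"

definition schwartz :: "('a::euclidean_space \<Rightarrow> complex) \<Rightarrow> bool" where
  "schwartz f \<longleftrightarrow>
     (\<forall>bs. set bs \<subseteq> Basis \<longrightarrow>
        iterated_partial bs f differentiable_on UNIV \<and>
        (\<forall>m::nat. bounded (range (\<lambda>x. norm x ^ m *\<^sub>R iterated_partial bs f x))))"

definition Op_formula ::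
    "real \<Rightarrow> ('a::euclidean_space \<Rightarrow> complex) \<Rightarrow> ('a \<Rightarrow> complex) \<Rightarrow> 'a \<Rightarrow> complex" where
  "Op_formula \<alpha> a u x =
     complex_of_real ((\<alpha> / (2 * pi)) ^ DIM('a)) *
     (LINT \<xi>|lborel. LINT y|lborel.
        exp (\<i> * complex_of_real (\<alpha> * ((x - y) \<bullet> \<xi>))) * a \<xi> * u y)"

text \<open>
  The unique bounded operator on $L^2$ that is given by the integral formula on Schwartz
  functions (which are dense).
\<close>

definition Op :: "real \<Rightarrow> ('a::euclidean_space \<Rightarrow> complex) \<Rightarrow> 'a L2 \<Rightarrow> 'a L2" where
  "Op \<alpha> a = (THE T. bounded_clinear T \<and>
     (\<forall>u. schwartz u \<longrightarrow> (AE x in lborel. rep_L2 (T (abs_L2 u)) x = Op_formula \<alpha> a u x)))"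

definition P_op :: "'a::euclidean_space set \<Rightarrow> real \<Rightarrow> 'a L2 \<Rightarrow> 'a L2" where
  "P_op \<Omega> \<alpha> = Op \<alpha> (indicator \<Omega>)"

definition chi_op :: "'a::euclidean_space set \<Rightarrow> 'a L2 \<Rightarrow> 'a L2" where
  "chi_op \<Lambda> u = abs_L2 (\<lambda>x. indicator \<Lambda> x * rep_L2 u x)"

text \<open>
  Coordinates $x = (\hat x, x_d)$ are fixed by the unit vector \<open>e\<close> of the $x_d$-axis:
  $x_d = x \cdot e$, and $\hat x$ is the projection of \<open>x\<close> to the hyperplane orthogonal to
  \<open>e\<close>, which plays the role of $\mathbb{R}^{d-1}$. A shift of the origin is absorbed
  in \<open>\<Phi>\<close>.
\<close>

definition basic_domain :: "'a::euclidean_space set \<Rightarrow> bool" where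
  "basic_domain \<Lambda> \<longleftrightarrow>
     (\<exists>e \<Phi> L. norm e = 1 \<and> L-lipschitz_on {y. y \<bullet> e = 0} \<Phi> \<and>
        \<Lambda> = {x. x \<bullet> e > \<Phi> (x - (x \<bullet> e) *\<^sub>R e)})"

definition lipschitz_domain :: "'a::euclidean_space set \<Rightarrow> bool" where
  "lipschitz_domain \<Lambda> \<longleftrightarrow>
     open \<Lambda> \<and> connected \<Lambda> \<and>
     (\<forall>z. \<exists>r>0. \<exists>\<Lambda>\<^sub>0. basic_domain \<Lambda>\<^sub>0 \<and> ball z r \<inter> \<Lambda> = ball z r \<inter> \<Lambda>\<^sub>0)"

text \<open>In dimension 1, the boxes \<open>box a b\<close> are the bounded open intervals.\<close>

definition admissible_domain :: "'a::euclidean_space set \<Rightarrow> bool" where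
  "admissible_domain \<Lambda> \<longleftrightarrow>
     (if DIM('a) = 1 then \<exists>a b. \<Lambda> = box a b else bounded \<Lambda> \<and> lipschitz_domain \<Lambda>)"

end

theory Submission
  imports Defs "HOL-Probability.Characteristic_Functions" "HOL-Probability.Sinc_Integral"
begin

text \<open>Write \<open>P\<close> for the projection onto the frequencies in \<open>E = \<alpha> \<Omega>\<close>. The operator
  \<open>T = \<chi>\<^sub>\<Lambda> P (1 - \<chi>\<^sub>\<Lambda>)\<close> is resolved into wave packets that are adapted to both boundaries:
  windows, as smooth as the decay in frequency requires, of width \<open>\<rho>\<close> around points \<open>y\<close> of \<open>\<Lambda>\<close>, modulated by a frequency \<open>\<eta>\<close>, where \<open>\<rho>\<close> is
  proportional to the distance of \<open>y\<close> from the boundary of \<open>\<Lambda>\<close>, but at least \<open>1 / \<alpha>\<close>.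

  A packet of width \<open>\<rho>\<close> is concentrated at frequencies within about \<open>1 / \<rho>\<close> of \<open>\<eta>\<close>. If \<open>\<eta>\<close> has
  distance \<open>\<delta>\<close> from the boundary of \<open>E\<close>, then up to errors of the order of a high negative power
  of \<open>1 + \<rho> \<delta>\<close> the projection either annihilates the packet or reproduces it; in the latter case a window inside \<open>\<Lambda>\<close> is
  killed by \<open>1 - \<chi>\<^sub>\<Lambda>\<close>. Thus only packets with frequency near the boundary of \<open>E\<close> contribute
  (\<open>packet_bound\<close>). The layer of width \<open>1 / \<rho>\<close> around that boundary has volume of order
  \<open>\<alpha>\<^sup>d\<^sup>-\<^sup>1 / \<rho>\<close> (\<open>boundary_decay_integral\<close>), and in phase space one packet occupies unit volume, so a
  window of width \<open>\<rho>\<close> contributes about \<open>\<rho>\<^sup>d \<alpha>\<^sup>d\<^sup>-\<^sup>1 / \<rho>\<close>. On each dyadic scale there are at most about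
  \<open>\<rho>\<^sup>1\<^sup>-\<^sup>d\<close> windows, since they lie in a layer of width \<open>\<rho>\<close> around the boundary of \<open>\<Lambda>\<close>; hence each scale
  between \<open>1 / \<alpha>\<close> and \<open>1\<close> contributes \<open>\<alpha>\<^sup>d\<^sup>-\<^sup>1\<close>, and the number of scales is the logarithm
  (\<open>scale_sum_bound\<close>).

  The passage from packets to the quasi-norm is \<open>schatten_frame_criterion\<close>: for an operator whose
  norm \<open>\<parallel>T u\<parallel>\<close> is controlled by the squared coefficients of \<open>u\<close> in a continuous frame, the sum of the
  \<open>q\<close>th powers of the singular values is bounded by a weighted integral of the \<open>q\<close>th powers of the norms of the
  frame vectors. It is an interpolation between Bessel's inequality and the trivial bound for one
  coefficient, and it holds uniformly in the number of packets although for \<open>q < 1\<close> the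
  triangle inequality fails.
  The frame itself comes from Plancherel's theorem applied in each window (\<open>covering_schatten_bound\<close>).

  The volumes of boundary layers use the Lipschitz condition only through disjoint translates of the layer
  along the axis of a local graph (\<open>layer_volume\<close>). The identification of \<open>P\<close> with the quantisation
  of the indicator, which is specified by its values on Schwartz functions, is a density argument
  (\<open>P_op_eq_freq_proj\<close>).\<close>

section \<open>The Hilbert space\<close>

lemma L2_rel_self: "L2_rel f f \<longleftrightarrow> square_integrable f"
  by (auto simp: L2_rel_def)

lemma square_integrable_rep: "square_integrable (rep_L2 u)"
  using Quotient3_rep_reflp[OF Quotient3_L2, of u] by (simp add: L2_rel_self)

lemma abs_rep_L2: "abs_L2 (rep_L2 u) = u"
  by (rule Quotient3_abs_rep[OF Quotient3_L2])

lemma abs_L2_eqI: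
  assumes "square_integrable f" "square_integrable g" "AE x in lborel. f x = g x"
  shows "abs_L2 f = abs_L2 g"
  using Quotient3_rel_abs[OF Quotient3_L2, of f g] assms by (simp add: L2_rel_def)

lemma rep_abs_L2:
  assumes "square_integrable f"
  shows "AE x in lborel. rep_L2 (abs_L2 f) x = f x"
  using rep_abs_rsp_left[OF Quotient3_L2, of f f] assms
  by (simp add: L2_rel_self) (simp add: L2_rel_def)

lemma L2_cases:
  obtains f where "square_integrable f" "u = abs_L2 f"
  using square_integrable_rep[of u] abs_rep_L2[of u] by metis

lemma borel_square_integrable[measurable_dest]:
  "square_integrable f \<Longrightarrow> f \<in> borel_measurable borel"
  by (simp add: square_integrable_def)

lemma integrable_square_integrable:
  "square_integrable f \<Longrightarrow> integrable lborel (\<lambda>x. (cmod (f x))\<^sup>2)"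
  by (simp add: square_integrable_def)

lemma abs_L2_add:
  "square_integrable f \<Longrightarrow> square_integrable g \<Longrightarrow>
    abs_L2 f + abs_L2 g = abs_L2 (\<lambda>x. f x + g x)"
  by (rule plus_L2.abs_eq) (simp_all add: L2_rel_self)

lemma abs_L2_scaleC:
  "square_integrable f \<Longrightarrow> scaleC c (abs_L2 f) = abs_L2 (\<lambda>x. c * f x)"
  by (rule scaleC.abs_eq) (simp_all add: L2_rel_self)

lemma abs_L2_uminus:
  "square_integrable f \<Longrightarrow> - abs_L2 f = abs_L2 (\<lambda>x. - f x)"
  by (rule uminus_L2.abs_eq) (simp_all add: L2_rel_self)

lemma square_integrable_uminus:
  "square_integrable f \<Longrightarrow> square_integrable (\<lambda>x. - f x)"
  using square_integrable_scale[of f "-1"] by simp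

lemma square_integrable_diff:
  "square_integrable f \<Longrightarrow> square_integrable g \<Longrightarrow> square_integrable (\<lambda>x. f x - g x)"
  using square_integrable_add[of f "\<lambda>x. - g x"] square_integrable_uminus[of g] by simp

lemma abs_L2_diff:
  assumes "square_integrable f" "square_integrable g"
  shows "abs_L2 f - abs_L2 g = abs_L2 (\<lambda>x. f x - g x)"
  using assms by (simp add: minus_L2_def abs_L2_uminus abs_L2_add square_integrable_uminus)

lemma abs_L2_zero: "abs_L2 (\<lambda>_. 0) = 0"
  by (simp add: zero_L2.abs_eq)

lemma cinner_abs_L2:
  "square_integrable f \<Longrightarrow> square_integrable g \<Longrightarrow>
    cinner (abs_L2 f) (abs_L2 g) = (LINT x|lborel. f x * cnj (g x))"
  by (rule cinner.abs_eq) (simp_all add: L2_rel_self)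

lemma scaleR_scaleC: "r *\<^sub>R (u :: 'a::euclidean_space L2) = scaleC (complex_of_real r) u"
  by (simp add: scaleR_L2_def)

lemma cinner_commute: "cinner u v = cnj (cinner v u)"
proof -
  obtain f where f: "square_integrable f" "u = abs_L2 f" by (rule L2_cases)
  obtain g where g: "square_integrable g" "v = abs_L2 g" by (rule L2_cases)
  have "integrable lborel (\<lambda>x. g x * cnj (f x))"
    using f g by (simp add: square_integrable_mult_cnj)
  from integral_bounded_linear[OF bounded_linear_cnj this]
  show ?thesis using f g by (simp add: cinner_abs_L2 mult.commute)
qed

lemma cinner_add_left: "cinner (u + v) w = cinner u w + cinner v w"
proof -
  obtain f where f: "square_integrable f" "u = abs_L2 f" by (rule L2_cases)
  obtain g where g: "square_integrable g" "v = abs_L2 g" by (rule L2_cases)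
  obtain h where h: "square_integrable h" "w = abs_L2 h" by (rule L2_cases)
  show ?thesis using f g h
    by (simp add: cinner_abs_L2 abs_L2_add square_integrable_add square_integrable_mult_cnj
        distrib_right)
qed

lemma cinner_scaleC_left: "cinner (scaleC c u) v = c * cinner u v"
proof -
  obtain f where f: "square_integrable f" "u = abs_L2 f" by (rule L2_cases)
  obtain g where g: "square_integrable g" "v = abs_L2 g" by (rule L2_cases)
  show ?thesis using f g
    by (simp add: cinner_abs_L2 abs_L2_scaleC square_integrable_scale mult.assoc)
qed

lemma cinner_add_right: "cinner w (u + v) = cinner w u + cinner w v"
  by (metis cinner_commute cinner_add_left complex_cnj_add)

lemma cinner_scaleC_right: "cinner u (scaleC c v) = cnj c * cinner u v"
  by (metis cinner_commute cinner_scaleC_left complex_cnj_mult complex_cnj_cnj)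

lemma cinner_zero_left [simp]: "cinner 0 v = 0"
  using cinner_scaleC_left[of 0 0 v] by simp

lemma cinner_zero_right [simp]: "cinner v 0 = 0"
  by (metis cinner_commute cinner_zero_left complex_cnj_zero)

lemma cinner_minus_left: "cinner (- u) v = - cinner u v"
  using cinner_add_left[of u "-u" v] by (simp add: eq_neg_iff_add_eq_0 add.commute)

lemma cinner_minus_right: "cinner u (- v) = - cinner u v"
  by (metis cinner_commute cinner_minus_left complex_cnj_minus)

lemma cinner_diff_left: "cinner (u - v) w = cinner u w - cinner v w"
  using cinner_add_left[of u "-v" w] by (simp add: cinner_minus_left)

lemma cinner_sum_left: "cinner (\<Sum>i\<in>I. f i) v = (\<Sum>i\<in>I. cinner (f i) v)"
  by (induction I rule: infinite_finite_induct) (auto simp: cinner_add_left)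

lemma cinner_sum_right: "cinner v (\<Sum>i\<in>I. f i) = (\<Sum>i\<in>I. cinner v (f i))"
  by (induction I rule: infinite_finite_induct) (auto simp: cinner_add_right)

lemma cinner_self: "cinner u u = complex_of_real ((norm u)\<^sup>2)"
proof -
  have "Im (cinner u u) = 0"
    using arg_cong[OF cinner_commute[of u u], of Im] by simp
  then show ?thesis
    by (simp add: complex_eq_iff power2_norm_eq_inner inner_L2_def)
qed

lemma norm_abs_L2:
  assumes "square_integrable f"
  shows "(norm (abs_L2 f))\<^sup>2 = (LINT x|lborel. (cmod (f x))\<^sup>2)"
proof -
  have "complex_of_real ((norm (abs_L2 f))\<^sup>2) = (LINT x|lborel. f x * cnj (f x))"
    using assms by (simp only: cinner_self[symmetric] cinner_abs_L2)
  also have "\<dots> = complex_of_real (LINT x|lborel. (cmod (f x))\<^sup>2)"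
    by (simp only: complex_norm_square[symmetric] of_real_power[symmetric] integral_complex_of_real)
  finally show ?thesis by (simp only: of_real_eq_iff)
qed

lemma ennreal_norm_abs_L2:
  assumes "square_integrable f"
  shows "ennreal ((norm (abs_L2 f))\<^sup>2) = (\<integral>\<^sup>+x. ennreal ((cmod (f x))\<^sup>2) \<partial>lborel)"
  using assms by (subst nn_integral_eq_integral)
    (auto simp: norm_abs_L2 integrable_square_integrable)

lemma square_integrableI_nn:
  assumes "f \<in> borel_measurable borel" "(\<integral>\<^sup>+x. ennreal ((cmod (f x))\<^sup>2) \<partial>lborel) < \<infinity>"
  shows "square_integrable f"
  unfolding square_integrable_def using assms by (auto intro!: integrableI_bounded)

lemma norm_scaleC: "norm (scaleC c u) = cmod c * norm u"
proof -
  have "complex_of_real ((norm (scaleC c u))\<^sup>2) = c * cnj c * cinner u u"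
    by (simp only: cinner_self[symmetric] cinner_scaleC_left cinner_scaleC_right mult_ac)
  also have "\<dots> = complex_of_real ((cmod c * norm u)\<^sup>2)"
    by (simp add: cinner_self complex_norm_square[symmetric] power_mult_distrib)
  finally have "(norm (scaleC c u))\<^sup>2 = (cmod c * norm u)\<^sup>2" by (simp only: of_real_eq_iff)
  then show ?thesis by simp
qed

lemma cinner_Cauchy_Schwarz: "cmod (cinner u v) \<le> norm u * norm v"
proof (cases "cinner u v = 0")
  case False
  define c where "c = cnj (sgn (cinner u v))"
  have c: "cmod c = 1" using False by (simp add: c_def norm_sgn)
  have "cinner (scaleC c u) v = complex_of_real (cmod (cinner u v))"
    using False by (simp add: cinner_scaleC_left c_def sgn_eq mult.commute complex_norm_square[symmetric]
        power2_eq_square)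
  then have "cmod (cinner u v) = inner (scaleC c u) v" by (simp add: inner_L2_def)
  also have "\<dots> \<le> norm (scaleC c u) * norm v" by (rule norm_cauchy_schwarz)
  finally show ?thesis by (simp add: norm_scaleC c)
qed simp

lemma norm_add_orthogonal:
  assumes "cinner u v = 0"
  shows "(norm (u + v))\<^sup>2 = (norm u)\<^sup>2 + (norm v)\<^sup>2"
proof -
  have "inner u v = 0" using assms by (simp add: inner_L2_def)
  then show ?thesis by (simp add: power2_norm_eq_inner inner_add_left inner_add_right inner_commute)
qed

lemma bounded_bilinear_cinner: "bounded_bilinear cinner"
proof
  fix a a' b b' :: "'a L2" and r :: real
  show "cinner (r *\<^sub>R a) b = r *\<^sub>R cinner a b"
    by (simp add: scaleR_scaleC cinner_scaleC_left scaleR_conv_of_real)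
  show "cinner a (r *\<^sub>R b) = r *\<^sub>R cinner a b"
    by (simp add: scaleR_scaleC cinner_scaleC_right scaleR_conv_of_real)
  show "\<exists>K. \<forall>a b::'a L2. norm (cinner a b) \<le> norm a * norm b * K"
    using cinner_Cauchy_Schwarz by (intro exI[of _ 1]) auto
qed (auto simp: cinner_add_left cinner_add_right)

lemmas tendsto_cinner = bounded_bilinear.tendsto[OF bounded_bilinear_cinner]

lemma L2_eqI:
  assumes "\<And>w. cinner u w = cinner v w"
  shows "u = v"
proof -
  have "cinner (u - v) (u - v) = 0" using assms by (simp add: cinner_diff_left)
  then show ?thesis by (simp add: cinner_self)
qed

text \<open>The Riesz--Fischer argument: increments with geometrically decaying norms are summable almost
  everywhere, so representatives converge pointwise, and Fatou's lemma identifies the pointwise limit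
  as the limit in norm.\<close>

lemma L2_summable_increments_convergent:
  fixes X :: "nat \<Rightarrow> 'a::euclidean_space L2"
  assumes X: "\<And>n. norm (X (Suc n) - X n) \<le> (1/2) ^ n"
  shows "convergent X"
proof -
  define f where "f n = rep_L2 (X n)" for n
  have f: "square_integrable (f n)" "X n = abs_L2 (f n)" for n
    by (auto simp: f_def square_integrable_rep abs_rep_L2)
  have [measurable]: "f n \<in> borel_measurable borel" for n
    using f(1) by (rule borel_square_integrable)
  define N where "N g = (\<integral>\<^sup>+x. ennreal ((cmod (g x))\<^sup>2) \<partial>(lborel::'a measure))" for g
  have N_diff: "N (\<lambda>x. f m x - f n x) = ennreal ((norm (X m - X n))\<^sup>2)" for m n
    unfolding N_def f(2)
    by (subst abs_L2_diff[OF f(1) f(1)], subst ennreal_norm_abs_L2)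
      (auto intro: square_integrable_diff f)
  \<comment> \<open>The squared increments remain integrable with the weights \<open>(3/2)^n\<close>, as their integrals decay
     like \<open>4^-n\<close>; these weights make the increments themselves summable by Cauchy--Schwarz.\<close>
  have "(\<integral>\<^sup>+x. (\<Sum>n. ennreal ((3/2)^n * (cmod (f (Suc n) x - f n x))\<^sup>2)) \<partial>lborel)
      = (\<Sum>n. ennreal ((3/2)^n) * N (\<lambda>x. f (Suc n) x - f n x))"
    unfolding N_def by (subst nn_integral_suminf) (auto simp: ennreal_mult nn_integral_cmult)
  also have "\<dots> \<le> (\<Sum>n. ennreal ((3/8)^n))"
  proof (rule suminf_le)
    fix n
    have "(norm (X (Suc n) - X n))\<^sup>2 \<le> ((1/2)^n)\<^sup>2" using X[of n] by (intro power_mono) auto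
    also have "((1/2)^n)\<^sup>2 = (1/4::real)^n" by (simp add: power2_eq_square power_mult_distrib[symmetric])
    finally have "(3/2)^n * (norm (X (Suc n) - X n))\<^sup>2 \<le> (3/2)^n * (1/4::real)^n"
      by (intro mult_left_mono) auto
    also have "\<dots> = (3/8)^n" by (simp add: power_mult_distrib[symmetric])
    finally show "ennreal ((3/2)^n) * N (\<lambda>x. f (Suc n) x - f n x) \<le> ennreal ((3/8)^n)"
      by (simp add: N_diff ennreal_mult[symmetric])
  qed auto
  also have "\<dots> < \<infinity>"
    by (subst suminf_ennreal2) (auto simp: summable_geometric less_top)
  finally have "AE x in lborel. (\<Sum>n. ennreal ((3/2)^n * (cmod (f (Suc n) x - f n x))\<^sup>2)) \<noteq> \<infinity>"
    by (intro nn_integral_noteq_infinite) (auto simp: less_top)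
  then have conv: "AE x in lborel. convergent (\<lambda>n. f n x)"
  proof (eventually_elim)
    case (elim x)
    let ?a = "\<lambda>n. cmod (f (Suc n) x - f n x)"
    have s1: "summable (\<lambda>n. (3/2)^n * (?a n)\<^sup>2)"
      using elim by (intro summable_suminf_not_top) auto
    have s2: "summable (\<lambda>n. (2/3::real)^n)" by (simp add: summable_geometric)
    have "summable ?a"
    proof (rule summable_comparison_test'[OF summable_add[OF s1 s2], of 0])
      fix n
      have "2 * ?a n = 2 * ((3/2)^n * ?a n) * (2/3)^n"
        by (simp add: power_mult_distrib[symmetric] mult.assoc mult.commute[of _ "(2/3)^n"]
            mult.left_commute[of _ "(2/3)^n"])
      also have "\<dots> \<le> (3/2)^n * (?a n)\<^sup>2 + (2/3)^n"
      proof -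
        have "0 \<le> (2/3)^n * ((3/2)^n * ?a n - 1)\<^sup>2" by simp
        also have "\<dots> = ((2/3)^n * (3/2)^n) * ((3/2)^n * (?a n)\<^sup>2) - 2 * ((3/2)^n * ?a n) * (2/3)^n + (2/3)^n"
          by (simp add: power2_eq_square algebra_simps)
        also have "((2/3)^n * (3/2)^n) = (1::real)" by (simp add: power_mult_distrib[symmetric])
        finally show ?thesis by simp
      qed
      finally show "norm (?a n) \<le> (3/2)^n * (?a n)\<^sup>2 + (2/3)^n"
        using norm_ge_zero[of "f (Suc n) x - f n x"] unfolding real_norm_def abs_norm_cancel by linarith
    qed
    then have "summable (\<lambda>n. f (Suc n) x - f n x)" by (rule summable_norm_cancel)
    then have "convergent (\<lambda>n. \<Sum>i<n. f (Suc i) x - f i x)"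
      by (simp add: summable_iff_convergent)
    then have "convergent (\<lambda>n. f n x - f 0 x)"
      by (simp add: sum_lessThan_telescope[of "\<lambda>i. f i x"])
    from convergent_add[OF this convergent_const[of "f 0 x"]] show ?case by simp
  qed
  define g where "g x = lim (\<lambda>n. f n x)" for x
  have [measurable]: "g \<in> borel_measurable borel" unfolding g_def
    using borel_measurable_lim_metric[of f borel] by simp
  have lim: "AE x in lborel. (\<lambda>n. f n x) \<longlonglongrightarrow> g x"
    using conv by eventually_elim (simp add: g_def convergent_LIMSEQ_iff)
  have dist_le: "norm (X n - X m) \<le> 2 * (1/2)^m" if "m \<le> n" for m n
  proof -
    have "norm (X n - X m) \<le> 2 * (1/2)^m - 2 * (1/2)^n" using that
    proof (induction n rule: dec_induct)
      case (step n)
      have "norm (X (Suc n) - X m) \<le> norm (X (Suc n) - X n) + norm (X n - X m)"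
        using norm_triangle_ineq[of "X (Suc n) - X n" "X n - X m"] by simp
      then show ?case using step X[of n] by simp
    qed simp
    moreover have "(0::real) \<le> 2 * (1/2)^n" by simp
    ultimately show ?thesis by linarith
  qed
  have Fatou: "N (\<lambda>x. g x - f m x) \<le> ennreal ((2 * (1/2)^m)\<^sup>2)" for m
  proof -
    have "N (\<lambda>x. g x - f m x) = (\<integral>\<^sup>+x. liminf (\<lambda>n. ennreal ((cmod (f n x - f m x))\<^sup>2)) \<partial>lborel)"
      unfolding N_def
    proof (rule nn_integral_cong_AE, use lim in eventually_elim)
      case (elim x)
      have "(\<lambda>n. ennreal ((cmod (f n x - f m x))\<^sup>2)) \<longlonglongrightarrow> ennreal ((cmod (g x - f m x))\<^sup>2)"
        using elim by (intro tendsto_intros)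
      from lim_imp_Liminf[OF trivial_limit_sequentially this] show ?case by simp
    qed
    also have "\<dots> \<le> liminf (\<lambda>n. N (\<lambda>x. f n x - f m x))"
      unfolding N_def by (rule nn_integral_liminf) auto
    also have "\<dots> \<le> ennreal ((2 * (1/2)^m)\<^sup>2)"
    proof (rule Liminf_le)
      show "eventually (\<lambda>n. N (\<lambda>x. f n x - f m x) \<le> ennreal ((2 * (1/2)^m)\<^sup>2)) sequentially"
        using eventually_ge_at_top[of m]
      proof eventually_elim
        case (elim n)
        show ?case unfolding N_diff
          by (intro ennreal_leI power_mono dist_le elim) auto
      qed
    qed auto
    finally show ?thesis .
  qed
  have "square_integrable (\<lambda>x. g x - f 0 x)"
    by (rule square_integrableI_nn) (use Fatou[of 0] in \<open>auto simp: N_def intro: le_less_trans\<close>)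
  from square_integrable_add[OF this f(1)[of 0]] have g: "square_integrable g" by simp
  have "norm (abs_L2 g - X m) \<le> 2 * (1/2)^m" for m
  proof -
    have "ennreal ((norm (abs_L2 g - X m))\<^sup>2) = N (\<lambda>x. g x - f m x)"
      unfolding N_def f(2)
      by (subst abs_L2_diff[OF g f(1)], subst ennreal_norm_abs_L2)
        (auto intro: square_integrable_diff f g)
    with Fatou[of m] have "ennreal ((norm (abs_L2 g - X m))\<^sup>2) \<le> ennreal ((2 * (1/2)^m)\<^sup>2)"
      by (simp only:)
    then have "(norm (abs_L2 g - X m))\<^sup>2 \<le> (2 * (1/2)^m)\<^sup>2"
      by (subst (asm) ennreal_le_iff) auto
    then show ?thesis by (rule power2_le_imp_le) simp
  qed
  then have bound: "norm (X m - abs_L2 g) \<le> 2 * (1/2)^m" for m by (simp add: norm_minus_commute)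
  have "(\<lambda>m. 2 * (1/2)^m) \<longlonglongrightarrow> (0::real)"
    by (intro tendsto_mult_right_zero LIMSEQ_realpow_zero) auto
  then have "(\<lambda>m. X m - abs_L2 g) \<longlonglongrightarrow> 0"
    by (rule Lim_null_comparison[rotated]) (use bound in \<open>auto intro: always_eventually\<close>)
  then have "X \<longlonglongrightarrow> abs_L2 g" by (simp add: LIM_zero_iff)
  then show ?thesis by (auto simp: convergent_def)
qed

lemma complete_UNIV_L2: "complete (UNIV :: 'a::euclidean_space L2 set)"
  unfolding complete_def
proof (intro allI impI)
  fix X :: "nat \<Rightarrow> 'a L2"
  assume "(\<forall>n. X n \<in> UNIV) \<and> Cauchy X"
  then have C: "Cauchy X" by simp
  have "\<exists>r. strict_mono r \<and> (\<forall>n. norm (X (r (Suc n)) - X (r n)) \<le> (1/2) ^ n)"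
  proof -
    have "\<exists>M. \<forall>m\<ge>M. \<forall>k\<ge>M. norm (X m - X k) < (1/2)^n" for n
      using C by (simp add: Cauchy_iff)
    then obtain M where M: "\<And>n m k. m \<ge> M n \<Longrightarrow> k \<ge> M n \<Longrightarrow> norm (X m - X k) < (1/2)^n"
      by metis
    define r where "r = rec_nat (M 0) (\<lambda>n k. max (Suc k) (M (Suc n)))"
    have r: "r (Suc n) = max (Suc (r n)) (M (Suc n))" "r 0 = M 0" for n by (auto simp: r_def)
    have "strict_mono r" by (rule strict_monoI_Suc) (simp add: r)
    moreover have "norm (X (r (Suc n)) - X (r n)) \<le> (1/2) ^ n" for n
    proof -
      have "r n \<ge> M n" by (cases n) (auto simp: r)
      moreover have "r (Suc n) \<ge> r n" by (simp add: r)
      ultimately show ?thesis using M[of n "r (Suc n)" "r n"] by simp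
    qed
    ultimately show ?thesis by blast
  qed
  then obtain r where r: "strict_mono r" "\<And>n. norm (X (r (Suc n)) - X (r n)) \<le> (1/2) ^ n" by auto
  have "convergent (\<lambda>n. X (r n))"
    by (rule L2_summable_increments_convergent) (use r(2) in auto)
  then obtain l where "(X \<circ> r) \<longlonglongrightarrow> l" by (auto simp: convergent_def o_def)
  with C r(1) have "X \<longlonglongrightarrow> l" by (meson Cauchy_converges_subseq)
  then show "\<exists>l\<in>UNIV. X \<longlonglongrightarrow> l" by auto
qed

section \<open>Orthonormal families, adjoints and compactness\<close>

definition adjoint_pair :: "('a::euclidean_space L2 \<Rightarrow> 'a L2) \<Rightarrow> ('a L2 \<Rightarrow> 'a L2) \<Rightarrow> bool" where
  "adjoint_pair A B \<longleftrightarrow> (\<forall>u v. cinner (A u) v = cinner u (B v))"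

lemma adjoint_pairD: "adjoint_pair A B \<Longrightarrow> cinner (A u) v = cinner u (B v)"
  by (simp add: adjoint_pair_def)

lemma adjoint_pair_sym: "adjoint_pair A B \<Longrightarrow> adjoint_pair B A"
  unfolding adjoint_pair_def by (metis cinner_commute)

lemma cadjoint_eq:
  assumes "adjoint_pair A B"
  shows "cadjoint A = B"
  unfolding cadjoint_def
proof (rule some_equality)
  show "\<forall>u v. cinner (A u) v = cinner u (B v)" using assms by (simp add: adjoint_pair_def)
  fix C assume C: "\<forall>u v. cinner (A u) v = cinner u (C v)"
  show "C = B"
  proof (rule ext, rule L2_eqI)
    fix v w show "cinner (C v) w = cinner (B v) w"
      by (metis C assms adjoint_pairD cinner_commute)
  qed
qed

lemma bounded_clinearD:
  assumes "bounded_clinear A"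
  shows "A (u + v) = A u + A v" "A (scaleC c u) = scaleC c (A u)" "A 0 = 0"
    "A (u - v) = A u - A v" "bounded_linear A" "A (sum f I) = (\<Sum>i\<in>I. A (f i))"
proof -
  have bl: "bounded_linear A" using assms by (simp add: bounded_clinear_def)
  then interpret bounded_linear A .
  show "A (u + v) = A u + A v" "A 0 = 0" "A (u - v) = A u - A v" "bounded_linear A"
    "A (sum f I) = (\<Sum>i\<in>I. A (f i))"
    by (fact add zero diff bl sum)+
  show "A (scaleC c u) = scaleC c (A u)" using assms by (simp add: bounded_clinear_def)
qed

lemma bounded_clinearI:
  assumes "\<And>u v. A (u + v) = A u + A v" "\<And>c u. A (scaleC c u) = scaleC c (A u)"
    and "\<And>u. norm (A u) \<le> K * norm u"
  shows "bounded_clinear A"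
  unfolding bounded_clinear_def
proof (intro conjI allI)
  show "bounded_linear A"
    by (rule bounded_linear_intro[where K = K])
      (use assms in \<open>auto simp: scaleR_scaleC mult.commute\<close>)
qed (use assms in auto)

lemma bounded_clinear_comp:
  "bounded_clinear A \<Longrightarrow> bounded_clinear B \<Longrightarrow> bounded_clinear (A \<circ> B)"
  by (auto simp: bounded_clinear_def o_def intro: bounded_linear_compose)

lemma adjoint_pair_comp:
  "adjoint_pair A A' \<Longrightarrow> adjoint_pair B B' \<Longrightarrow> adjoint_pair (A \<circ> B) (B' \<circ> A')"
  by (simp add: adjoint_pair_def)

lemma bounded_clinear_bound:
  assumes "bounded_clinear A"
  obtains K where "K > 0" "\<And>u. norm (A u) \<le> K * norm u"
  using bounded_linear.pos_bounded[OF bounded_clinearD(5)[OF assms]]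
  by (metis mult.commute)

lemma adjoint_bounded_clinear:
  assumes "bounded_clinear A" "adjoint_pair A B"
  shows "bounded_clinear B"
proof -
  note ad = adjoint_pairD[OF adjoint_pair_sym[OF assms(2)]]
  obtain K where K: "K > 0" "\<And>u. norm (A u) \<le> K * norm u"
    using bounded_clinear_bound[OF assms(1)] by auto
  show ?thesis
  proof (rule bounded_clinearI[where K = K])
    show "B (u + v) = B u + B v" for u v
      by (rule L2_eqI) (simp add: ad cinner_add_left)
    show "B (scaleC c u) = scaleC c (B u)" for c u
      by (rule L2_eqI) (simp add: ad cinner_scaleC_left)
    show "norm (B v) \<le> K * norm v" for v
    proof (cases "norm (B v) = 0")
      case False
      have "(norm (B v))\<^sup>2 = cmod (cinner (B v) (B v))"
      by (simp only: cinner_self norm_of_real) simp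
      also have "\<dots> = cmod (cinner v (A (B v)))" by (simp add: ad)
      also have "\<dots> \<le> norm v * (K * norm (B v))"
        by (rule order_trans[OF cinner_Cauchy_Schwarz]) (intro mult_left_mono K; simp)
      finally have "norm (B v) * norm (B v) \<le> (K * norm v) * norm (B v)"
        by (simp add: power2_eq_square mult_ac)
      then show ?thesis using False by (simp add: mult_le_cancel_right)
    qed (use K in simp)
  qed
qed

definition orthonormal :: "('i \<Rightarrow> 'a::euclidean_space L2) \<Rightarrow> 'i set \<Rightarrow> bool" where
  "orthonormal x I \<longleftrightarrow> (\<forall>i\<in>I. \<forall>j\<in>I. cinner (x i) (x j) = (if i = j then 1 else 0))"

lemma cinner_self_eq_1_iff: "cinner u u = 1 \<longleftrightarrow> norm u = 1"
proof -
  have "cinner u u = 1 \<longleftrightarrow> (norm u)\<^sup>2 = 1" by (simp only: cinner_self of_real_eq_1_iff)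
  also have "\<dots> \<longleftrightarrow> norm u = 1" using norm_ge_zero[of u] by (auto simp: power2_eq_1_iff simp del: norm_ge_zero)
  finally show ?thesis .
qed

lemma orthonormal_norm: "orthonormal x I \<Longrightarrow> i \<in> I \<Longrightarrow> norm (x i) = 1"
  by (simp add: orthonormal_def cinner_self_eq_1_iff[symmetric])

lemma cinner_sum_orthonormal:
  assumes "finite I" "orthonormal x I" "j \<in> I"
  shows "cinner (\<Sum>i\<in>I. scaleC (c i) (x i)) (x j) = c j"
proof -
  have "cinner (\<Sum>i\<in>I. scaleC (c i) (x i)) (x j) = (\<Sum>i\<in>I. c i * (if i = j then 1 else 0))"
    unfolding cinner_sum_left using assms
    by (intro sum.cong) (auto simp: cinner_scaleC_left orthonormal_def)
  also have "\<dots> = c j" using assms by (simp add: sum.delta' if_distrib cong: if_cong)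
  finally show ?thesis .
qed

lemma norm_sum_orthonormal:
  assumes "finite I" "orthonormal x I"
  shows "(norm (\<Sum>i\<in>I. scaleC (c i) (x i)))\<^sup>2 = (\<Sum>i\<in>I. (cmod (c i))\<^sup>2)"
proof -
  let ?u = "\<Sum>i\<in>I. scaleC (c i) (x i)"
  have "complex_of_real ((norm ?u)\<^sup>2) = (\<Sum>j\<in>I. cnj (c j) * cinner ?u (x j))"
    by (simp only: cinner_self[symmetric]) (simp add: cinner_sum_right cinner_scaleC_right)
  also have "\<dots> = (\<Sum>j\<in>I. complex_of_real ((cmod (c j))\<^sup>2))"
    by (rule sum.cong[OF refl], subst cinner_sum_orthonormal[OF assms])
      (simp_all only: complex_norm_square mult.commute)
  finally have "complex_of_real ((norm ?u)\<^sup>2) = complex_of_real (\<Sum>j\<in>I. (cmod (c j))\<^sup>2)"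
    by simp
  then show ?thesis by (simp only: of_real_eq_iff)
qed

lemma orthonormal_decomposition:
  assumes "finite I" "orthonormal x I"
  defines "p \<equiv> \<lambda>u. \<Sum>i\<in>I. scaleC (cinner u (x i)) (x i)"
  shows "i \<in> I \<Longrightarrow> cinner (u - p u) (x i) = 0"
    and "(norm u)\<^sup>2 = (\<Sum>i\<in>I. (cmod (cinner u (x i)))\<^sup>2) + (norm (u - p u))\<^sup>2"
proof -
  show 1: "cinner (u - p u) (x i) = 0" if "i \<in> I" for i
    using cinner_sum_orthonormal[OF assms(1,2) that, of "\<lambda>i. cinner u (x i)"]
    by (simp add: cinner_diff_left p_def)
  have "cinner (u - p u) (p u) = 0"
    by (simp add: p_def cinner_sum_right cinner_scaleC_right 1[unfolded p_def])
  from norm_add_orthogonal[OF this] norm_sum_orthonormal[OF assms(1,2)]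
  show "(norm u)\<^sup>2 = (\<Sum>i\<in>I. (cmod (cinner u (x i)))\<^sup>2) + (norm (u - p u))\<^sup>2"
    by (simp add: p_def)
qed

lemma Bessel_inequality:
  assumes "finite I" "orthonormal x I"
  shows "(\<Sum>i\<in>I. (cmod (cinner u (x i)))\<^sup>2) \<le> (norm u)\<^sup>2"
  using orthonormal_decomposition(2)[OF assms, of u] by simp

text \<open>Finite orthonormal families suffice to express that the Hilbert--Schmidt norm is finite, and no
  orthonormal basis has to be constructed.\<close>

definition hilbert_schmidt_bounded :: "('a::euclidean_space L2 \<Rightarrow> 'a L2) \<Rightarrow> bool" where
  "hilbert_schmidt_bounded A \<longleftrightarrow>
    (\<exists>C. \<forall>n x. orthonormal x {..<n::nat} \<longrightarrow> (\<Sum>i<n. (norm (A (x i)))\<^sup>2) \<le> C)"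

text \<open>An orthonormal family that nearly exhausts the supremum of the Hilbert--Schmidt sums leaves
  no room for a further direction in which the operator is large.\<close>

lemma hilbert_schmidt_small_on_complement:
  assumes A: "bounded_clinear A" and "hilbert_schmidt_bounded A" and e: "e > 0"
  obtains n x where "orthonormal x {..<n::nat}"
    "\<And>u. (\<And>i. i < n \<Longrightarrow> cinner u (x i) = 0) \<Longrightarrow> norm (A u) \<le> e * norm u"
proof -
  obtain C where C: "\<And>n x. orthonormal x {..<n::nat} \<Longrightarrow> (\<Sum>i<n. (norm (A (x i)))\<^sup>2) \<le> C"
    using assms(2) by (auto simp: hilbert_schmidt_bounded_def)
  define S where "S = {(\<Sum>i<n. (norm (A (x i)))\<^sup>2) | n x. orthonormal x {..<n::nat}}"
  have "(\<Sum>i<(0::nat). (norm (A (0::'a L2)))\<^sup>2) \<in> S"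
    unfolding S_def by (intro CollectI exI[of _ 0] exI[of _ "\<lambda>_. 0"]) (auto simp: orthonormal_def)
  then have ne: "S \<noteq> {}" by blast
  have bdd: "bdd_above S" using C by (auto simp: S_def bdd_above_def)
  have "Sup S - e\<^sup>2 < Sup S" using e by simp
  then obtain y where y: "y \<in> S" "Sup S - e\<^sup>2 < y" using less_cSup_iff[OF ne bdd] by blast
  then obtain n x where nx: "orthonormal x {..<n::nat}" "y = (\<Sum>i<n. (norm (A (x i)))\<^sup>2)"
    by (auto simp: S_def)
  show ?thesis
  proof (rule that[OF nx(1)])
    fix u assume u: "\<And>i. i < n \<Longrightarrow> cinner u (x i) = 0"
    show "norm (A u) \<le> e * norm u"
    proof (cases "u = 0")
      case False
      define v where "v = scaleC (complex_of_real (1 / norm u)) u"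
      have nv: "cinner v v = 1" using False
        by (simp add: cinner_self_eq_1_iff v_def norm_scaleC norm_divide)
      have vx: "cinner v (x i) = 0" "cinner (x i) v = 0" if "i < n" for i
        using u[OF that] cinner_commute[of "x i" v] by (simp_all add: v_def cinner_scaleC_left)
      have "orthonormal (x(n := v)) {..<Suc n}"
        using nx(1) nv vx unfolding orthonormal_def by (auto simp: less_Suc_eq)
      then have "(\<Sum>i<Suc n. (norm (A ((x(n := v)) i)))\<^sup>2) \<in> S" unfolding S_def by blast
      then have "(\<Sum>i<Suc n. (norm (A ((x(n := v)) i)))\<^sup>2) \<le> Sup S"
        by (rule cSup_upper[OF _ bdd])
      then have "y + (norm (A v))\<^sup>2 \<le> Sup S" by (simp add: nx(2))
      with y have "(norm (A v))\<^sup>2 \<le> e\<^sup>2" by simp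
      then have "norm (A v) \<le> e" using e by (meson less_imp_le power2_le_imp_le)
      then show ?thesis using False
        by (simp add: v_def bounded_clinearD(2)[OF A] norm_scaleC divide_le_eq norm_divide)
    qed (simp add: bounded_clinearD(3)[OF A])
  qed
qed

lemma compact_scaleC_cball: "compact ((\<lambda>c. scaleC c v) ` cball 0 R)"
proof (rule compact_continuous_image)
  have "bounded_linear (\<lambda>c. scaleC c v)"
    by (rule bounded_linear_intro[where K = "norm v"])
      (auto simp: cL2.scale_left_distrib scaleR_scaleC norm_scaleC scaleR_conv_of_real)
  then show "continuous_on (cball 0 R) (\<lambda>c. scaleC c v)"
    by (rule linear_continuous_on)
qed simp

lemma compact_combinations:
  fixes v :: "'i \<Rightarrow> 'a::euclidean_space L2"
  assumes "finite I"
  shows "\<exists>K. compact K \<and> (\<forall>c. (\<forall>i\<in>I. cmod (c i) \<le> R) \<longrightarrow> (\<Sum>i\<in>I. scaleC (c i) (v i)) \<in> K)"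
  using assms
proof (induction I)
  case empty
  show ?case by (intro exI[of _ "{0}"]) auto
next
  case (insert j I)
  then obtain K where K: "compact K"
    "\<And>c. (\<forall>i\<in>I. cmod (c i) \<le> R) \<Longrightarrow> (\<Sum>i\<in>I. scaleC (c i) (v i)) \<in> K" by auto
  let ?K = "{x + y | x y. x \<in> (\<lambda>c. scaleC c (v j)) ` cball 0 R \<and> y \<in> K}"
  have "compact ?K" by (rule compact_sums[OF compact_scaleC_cball K(1)])
  moreover have "(\<Sum>i\<in>insert j I. scaleC (c i) (v i)) \<in> ?K" if "\<forall>i\<in>insert j I. cmod (c i) \<le> R" for c
  proof -
    have "(\<Sum>i\<in>insert j I. scaleC (c i) (v i)) = scaleC (c j) (v j) + (\<Sum>i\<in>I. scaleC (c i) (v i))"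
      using insert.hyps by simp
    moreover have "scaleC (c j) (v j) \<in> (\<lambda>c. scaleC c (v j)) ` cball 0 R" using that by auto
    moreover have "(\<Sum>i\<in>I. scaleC (c i) (v i)) \<in> K" using that K(2) by simp
    ultimately show ?thesis by blast
  qed
  ultimately show ?case by blast
qed

text \<open>Up to a small error the operator only depends on finitely many bounded coefficients, so that the
  image of a bounded set is totally bounded.\<close>

lemma hilbert_schmidt_compact:
  fixes A :: "'a::euclidean_space L2 \<Rightarrow> 'a L2"
  assumes A: "bounded_clinear A" and hs: "hilbert_schmidt_bounded A"
  shows "compact_operator A"
  unfolding compact_operator_def
proof (intro conjI allI impI A)
  fix B :: "'a L2 set" assume "bounded B"
  then obtain R where R: "R > 0" "\<And>u. u \<in> B \<Longrightarrow> norm u \<le> R" by (auto simp: bounded_pos)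
  show "compact (closure (A ` B))"
    unfolding compact_eq_totally_bounded
  proof (intro conjI allI impI)
    show "complete (closure (A ` B))"
      using complete_Int_closed[OF complete_UNIV_L2 closed_closure] by simp
    fix e :: real assume e: "e > 0"
    obtain n x where x: "orthonormal x {..<n::nat}"
      and small: "\<And>u. (\<And>i. i < n \<Longrightarrow> cinner u (x i) = 0) \<Longrightarrow> norm (A u) \<le> e / (4 * R) * norm u"
      using hilbert_schmidt_small_on_complement[OF A hs, of "e / (4 * R)"] e R(1)
      by (metis divide_pos_pos mult_pos_pos zero_less_numeral)
    obtain K where K: "compact K"
      "\<And>c. (\<forall>i\<in>{..<n}. cmod (c i) \<le> R) \<Longrightarrow> (\<Sum>i\<in>{..<n}. scaleC (c i) (A (x i))) \<in> K"
      using compact_combinations[of "{..<n}" R "\<lambda>i. A (x i)"] by auto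
    obtain F where F: "finite F" "K \<subseteq> (\<Union>y\<in>F. ball y (e/4))"
      using K(1) e by (metis compact_eq_totally_bounded divide_pos_pos zero_less_numeral)
    have "A u \<in> (\<Union>y\<in>F. cball y (e/2))" if u: "u \<in> B" for u
    proof -
      let ?p = "\<Sum>i\<in>{..<n}. scaleC (cinner u (x i)) (x i)"
      note dec = orthonormal_decomposition[OF finite_lessThan x, where u = u]
      have "(norm (u - ?p))\<^sup>2 \<le> (norm u)\<^sup>2"
        using dec(2) sum_nonneg[of "{..<n}" "\<lambda>i. (cmod (cinner u (x i)))\<^sup>2"] by simp
      then have "norm (u - ?p) \<le> norm u" by (rule power2_le_imp_le) simp
      then have "norm (u - ?p) \<le> R" using R(2)[OF u] by simp
      have "norm (A (u - ?p)) \<le> e / (4 * R) * norm (u - ?p)"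
        by (rule small) (use dec(1) in auto)
      also have "\<dots> \<le> e / (4 * R) * R"
        using \<open>norm (u - ?p) \<le> R\<close> e R(1) by (intro mult_left_mono) auto
      finally have 1: "norm (A u - A ?p) \<le> e / 4"
        using R(1) by (simp add: bounded_clinearD(4)[OF A])
      have "A ?p = (\<Sum>i\<in>{..<n}. scaleC (cinner u (x i)) (A (x i)))"
        by (simp add: bounded_clinearD[OF A])
      also have "\<dots> \<in> K"
      proof (rule K(2), rule ballI)
        fix i assume "i \<in> {..<n}"
        then have "norm (x i) = 1" by (rule orthonormal_norm[OF x])
        then show "cmod (cinner u (x i)) \<le> R"
          using cinner_Cauchy_Schwarz[of u "x i"] R(2)[OF u] by simp
      qed
      finally obtain y where y: "y \<in> F" "A ?p \<in> ball y (e/4)" using F(2) by blast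
      have "dist y (A u) \<le> dist y (A ?p) + dist (A ?p) (A u)" by (rule dist_triangle)
      also have "\<dots> \<le> e/4 + e/4" using 1 y(2) by (intro add_mono) (auto simp: dist_norm norm_minus_commute)
      finally show ?thesis using y(1) by auto
    qed
    then have "closure (A ` B) \<subseteq> (\<Union>y\<in>F. cball y (e/2))"
      using F(1) by (intro closure_minimal closed_UN) auto
    also have "\<dots> \<subseteq> (\<Union>y\<in>F. ball y e)" using e by (auto intro!: bexI)
    finally show "\<exists>k. finite k \<and> closure (A ` B) \<subseteq> (\<Union>x\<in>k. ball x e)" using F(1) by blast
  qed
qed

lemma compact_operator_subsequence:
  assumes A: "compact_operator A" and u: "\<And>n. norm (u n) \<le> 1"
  obtains r w where "strict_mono (r :: nat \<Rightarrow> nat)" "(\<lambda>n. A (u (r n))) \<longlonglongrightarrow> w"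
proof -
  have "compact (closure (A ` cball 0 1))" using A by (simp add: compact_operator_def)
  moreover have "\<forall>n. A (u n) \<in> closure (A ` cball 0 1)"
    using u by (auto intro!: closure_subset[THEN subsetD])
  ultimately obtain w r where "strict_mono (r :: nat \<Rightarrow> nat)" "((\<lambda>n. A (u n)) \<circ> r) \<longlonglongrightarrow> w"
    unfolding compact_def by (metis (no_types, lifting))
  then show thesis using that by (simp add: o_def)
qed

section \<open>Singular values\<close>

lemma orthonormal_subset: "orthonormal x I \<Longrightarrow> J \<subseteq> I \<Longrightarrow> orthonormal x J"
  unfolding orthonormal_def by blast

text \<open>The vectors are normalised or zero; a zero vector is taken once the operator vanishes on the
  orthogonal complement of the earlier ones, so that no choice is needed for operators of finite
  rank.\<close>

definition singular_system ::
    "('a::euclidean_space L2 \<Rightarrow> 'a L2) \<Rightarrow> ('a L2 \<Rightarrow> 'a L2) \<Rightarrow> (nat \<Rightarrow> 'a L2) \<Rightarrow> bool" where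
  "singular_system A B x \<longleftrightarrow>
    (\<forall>k. (norm (x k) = 1 \<or> x k = 0) \<and> (\<forall>j<k. cinner (x k) (x j) = 0) \<and>
      (\<forall>u. (\<forall>j<k. cinner u (x j) = 0) \<longrightarrow> norm (A u) \<le> norm (A (x k)) * norm u) \<and>
      B (A (x k)) = scaleC (complex_of_real ((norm (A (x k)))\<^sup>2)) (x k))"

text \<open>Maximisers of \<open>\<parallel>A u\<parallel>\<close> on the unit sphere of an invariant subspace are eigenvectors of
  \<open>A\<^sup>*A\<close>: along a maximising sequence \<open>A\<^sup>*A u - m\<^sup>2 u\<close> tends to zero, and compactness provides
  a limit.\<close>

lemma compact_operator_maximizer:
  fixes A B :: "'a::euclidean_space L2 \<Rightarrow> 'a L2"
  assumes comp: "compact_operator A" and ad: "adjoint_pair A B"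
    and X: "\<And>z. z \<in> X \<Longrightarrow> \<exists>l. B (A z) = scaleC l z"
  shows "\<exists>x. (norm x = 1 \<or> x = 0) \<and> (\<forall>z\<in>X. cinner x z = 0) \<and>
    (\<forall>u. (\<forall>z\<in>X. cinner u z = 0) \<longrightarrow> norm (A u) \<le> norm (A x) * norm u) \<and>
    B (A x) = scaleC (complex_of_real ((norm (A x))\<^sup>2)) x"
proof -
  have A: "bounded_clinear A" using comp by (simp add: compact_operator_def)
  have B: "bounded_clinear B" by (rule adjoint_bounded_clinear[OF A ad])
  note AB = adjoint_pairD[OF ad] and BA = adjoint_pairD[OF adjoint_pair_sym[OF ad]]
  obtain K where K: "K > 0" "\<And>u. norm (A u) \<le> K * norm u"
    using bounded_clinear_bound[OF A] by auto
  define V where "V = {u. \<forall>z\<in>X. cinner u z = 0}"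
  have V_scale: "scaleC c u \<in> V" if "u \<in> V" for c u
    using that by (simp add: V_def cinner_scaleC_left)
  have V_R: "B (A u) \<in> V" if "u \<in> V" for u
    unfolding V_def
  proof (intro CollectI ballI)
    fix z assume z: "z \<in> X"
    obtain l where l: "B (A z) = scaleC l z" using X[OF z] by blast
    have "cinner (B (A u)) z = cinner u (B (A z))" by (simp add: AB BA)
    then show "cinner (B (A u)) z = 0" using that z by (simp add: l cinner_scaleC_right V_def)
  qed
  define S where "S = {norm (A u) | u. u \<in> V \<and> norm u \<le> 1}"
  have "norm (A 0) \<in> S" unfolding S_def by (intro CollectI exI[of _ 0]) (simp add: V_def)
  then have ne: "S \<noteq> {}" and S0: "0 \<in> S" by (auto simp: bounded_clinearD(3)[OF A])
  have bdd: "bdd_above S"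
  proof (rule bdd_aboveI)
    fix y assume "y \<in> S"
    then obtain u where "y = norm (A u)" "norm u \<le> 1" by (auto simp: S_def)
    moreover have "K * norm u \<le> K * 1" using K(1) \<open>norm u \<le> 1\<close> by (intro mult_left_mono) auto
    ultimately show "y \<le> K" using K(2)[of u] by simp
  qed
  define m where "m = Sup S"
  have m0: "m \<ge> 0" unfolding m_def by (rule cSup_upper[OF S0 bdd])
  have m_le: "norm (A u) \<le> m * norm u" if u: "u \<in> V" for u
  proof (cases "u = 0")
    case False
    let ?v = "scaleC (complex_of_real (1 / norm u)) u"
    have "norm (A ?v) \<in> S" unfolding S_def using False V_scale[OF u]
      by (intro CollectI exI[of _ ?v]) (simp add: norm_scaleC norm_divide)
    then have "norm (A ?v) \<le> m" unfolding m_def by (rule cSup_upper[OF _ bdd])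
    then show ?thesis using False
      by (simp add: bounded_clinearD(2)[OF A] norm_scaleC norm_divide divide_le_eq)
  qed (simp add: bounded_clinearD(3)[OF A])
  show ?thesis
  proof (cases "m = 0")
    case True
    then show ?thesis using m_le
      by (intro exI[of _ 0]) (auto simp: V_def bounded_clinearD(3)[OF A] bounded_clinearD(3)[OF B])
  next
    case False
    then have m: "m > 0" using m0 by simp
    have "\<exists>u. u \<in> V \<and> norm u \<le> 1 \<and> m - 1 / Suc n < norm (A u)" for n
    proof -
      have "m - 1 / Suc n < Sup S" by (simp add: m_def)
      then obtain y where "y \<in> S" "m - 1 / Suc n < y" using less_cSup_iff[OF ne bdd] by blast
      then show ?thesis by (auto simp: S_def)
    qed
    then obtain u where u: "\<And>n. u n \<in> V" "\<And>n. norm (u n) \<le> 1" "\<And>n. m - 1 / Suc n < norm (A (u n))"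
      by metis
    have lim_norm: "(\<lambda>n. norm (A (u n))) \<longlonglongrightarrow> m"
    proof (rule tendsto_sandwich)
      show "\<forall>\<^sub>F n in sequentially. m - 1 / Suc n \<le> norm (A (u n))"
        using u(3) by (intro always_eventually) (auto intro: less_imp_le)
      show "\<forall>\<^sub>F n in sequentially. norm (A (u n)) \<le> m"
      proof (intro always_eventually allI)
        fix n show "norm (A (u n)) \<le> m"
          using m_le[OF u(1), of n] mult_left_mono[OF u(2)[of n] m0] by simp
      qed
      show "(\<lambda>n. m - 1 / real (Suc n)) \<longlonglongrightarrow> m"
        using tendsto_diff[OF tendsto_const[of m] LIMSEQ_inverse_real_of_nat]
        by (simp add: inverse_eq_divide)
    qed simp
    obtain r w where r: "strict_mono (r :: nat \<Rightarrow> nat)" and w: "(\<lambda>n. A (u (r n))) \<longlonglongrightarrow> w"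
      using compact_operator_subsequence[OF comp, of u] u(2) by blast
    have defect: "(norm (B (A v) - scaleC (complex_of_real (m\<^sup>2)) v))\<^sup>2 \<le> m\<^sup>2 * (m\<^sup>2 - (norm (A v))\<^sup>2)"
      if v: "v \<in> V" "norm v \<le> 1" for v
    proof -
      have "(norm (B (A v)))\<^sup>2 = cmod (cinner (B (A v)) (B (A v)))"
        by (simp only: cinner_self norm_of_real) simp
      also have "\<dots> = cmod (cinner (A v) (A (B (A v))))" by (simp add: BA)
      also have "\<dots> \<le> norm (A v) * (m * norm (B (A v)))"
        by (rule order_trans[OF cinner_Cauchy_Schwarz]) (intro mult_left_mono m_le V_R v; simp)
      finally have "norm (B (A v)) * norm (B (A v)) \<le> (m * norm (A v)) * norm (B (A v))"
        by (simp add: power2_eq_square mult_ac)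
      then have "norm (B (A v)) \<le> m * norm (A v)"
        using m0 by (cases "norm (B (A v)) = 0") (auto simp: mult_le_cancel_right)
      then have 1: "(norm (B (A v)))\<^sup>2 \<le> m\<^sup>2 * (norm (A v))\<^sup>2"
        by (metis norm_ge_zero power_mono power_mult_distrib)
      have "inner (B (A v)) v = Re (cinner (A v) (A v))" by (simp add: inner_L2_def BA)
      then have 2: "inner (B (A v)) v = (norm (A v))\<^sup>2" by (simp add: cinner_self)
      have "(norm v)\<^sup>2 \<le> 1" using v(2) by (simp add: power_le_one)
      then have 3: "m^4 * (norm v)\<^sup>2 \<le> m^4" using mult_left_mono[of "(norm v)\<^sup>2" 1 "m^4"] by simp
      have "(norm (B (A v) - m\<^sup>2 *\<^sub>R v))\<^sup>2 =
          (norm (B (A v)))\<^sup>2 - 2 * m\<^sup>2 * inner (B (A v)) v + m^4 * (norm v)\<^sup>2"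
        unfolding power2_norm_eq_inner
        by (simp add: inner_diff_left inner_diff_right inner_commute
            algebra_simps power2_eq_square power4_eq_xxxx)
      also have "\<dots> \<le> m\<^sup>2 * (m\<^sup>2 - (norm (A v))\<^sup>2)"
        using 1 3 unfolding 2 by (simp add: algebra_simps power2_eq_square power4_eq_xxxx)
      finally show ?thesis by (simp add: scaleR_scaleC)
    qed
    have "(\<lambda>n. B (A (u (r n))) - scaleC (complex_of_real (m\<^sup>2)) (u (r n))) \<longlonglongrightarrow> 0"
    proof (rule Lim_null_comparison[where g = "\<lambda>n. sqrt (m\<^sup>2 * (m\<^sup>2 - (norm (A (u (r n))))\<^sup>2))"])
      show "\<forall>\<^sub>F n in sequentially. norm (B (A (u (r n))) - scaleC (complex_of_real (m\<^sup>2)) (u (r n)))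
          \<le> sqrt (m\<^sup>2 * (m\<^sup>2 - (norm (A (u (r n))))\<^sup>2))"
        by (intro always_eventually allI real_le_rsqrt defect u)
      have "(\<lambda>n. norm (A (u (r n)))) \<longlonglongrightarrow> m"
        using LIMSEQ_subseq_LIMSEQ[OF lim_norm r] by (simp add: o_def)
      then have "(\<lambda>n. sqrt (m\<^sup>2 * (m\<^sup>2 - (norm (A (u (r n))))\<^sup>2))) \<longlonglongrightarrow> sqrt (m\<^sup>2 * (m\<^sup>2 - m\<^sup>2))"
        by (intro tendsto_intros)
      then show "(\<lambda>n. sqrt (m\<^sup>2 * (m\<^sup>2 - (norm (A (u (r n))))\<^sup>2))) \<longlonglongrightarrow> 0" by simp
    qed
    moreover have "(\<lambda>n. B (A (u (r n)))) \<longlonglongrightarrow> B w"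
      by (rule bounded_linear.tendsto[OF bounded_clinearD(5)[OF B] w])
    ultimately have "(\<lambda>n. B (A (u (r n))) - (B (A (u (r n))) - scaleC (complex_of_real (m\<^sup>2)) (u (r n))))
        \<longlonglongrightarrow> B w - 0" by (rule tendsto_diff[rotated])
    then have "(\<lambda>n. m\<^sup>2 *\<^sub>R u (r n)) \<longlonglongrightarrow> B w" by (simp add: scaleR_scaleC)
    from tendsto_scaleR[OF tendsto_const[of "1 / m\<^sup>2"] this]
    have ux: "(\<lambda>n. u (r n)) \<longlonglongrightarrow> (1 / m\<^sup>2) *\<^sub>R B w" (is "_ \<longlonglongrightarrow> ?x") using m by simp
    have wA: "w = A ?x"
      using LIMSEQ_unique[OF w bounded_linear.tendsto[OF bounded_clinearD(5)[OF A] ux]] .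
    have xV: "?x \<in> V" unfolding V_def
    proof (intro CollectI ballI)
      fix z assume z: "z \<in> X"
      have "(\<lambda>n. cinner (u (r n)) z) \<longlonglongrightarrow> cinner ?x z"
        by (intro tendsto_cinner ux tendsto_const)
      moreover have "(\<lambda>n. cinner (u (r n)) z) = (\<lambda>n. 0)" using u(1) z by (auto simp: V_def)
      ultimately show "cinner ?x z = 0" by (metis LIMSEQ_unique tendsto_const)
    qed
    have nA: "norm (A ?x) = m"
    proof (rule LIMSEQ_unique)
      show "(\<lambda>n. norm (A (u (r n)))) \<longlonglongrightarrow> norm (A ?x)"
        using tendsto_norm[OF w] by (simp only: wA[symmetric])
      show "(\<lambda>n. norm (A (u (r n)))) \<longlonglongrightarrow> m"
        using LIMSEQ_subseq_LIMSEQ[OF lim_norm r] by (simp add: o_def)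
    qed
    have le1: "norm ?x \<le> 1"
      using ux by (rule LIMSEQ_le_const2[OF tendsto_norm]) (use u(2) in auto)
    have "m * 1 \<le> m * norm ?x" using m_le[OF xV] by (simp only: nA mult_1_right)
    then have "1 \<le> norm ?x" by (rule mult_left_le_imp_le) (rule m)
    with le1 have nx: "norm ?x = 1" by (rule antisym)
    have Rx: "B (A ?x) = m\<^sup>2 *\<^sub>R ?x" using m by (simp add: wA[symmetric])
    show ?thesis
    proof (intro exI[of _ ?x] conjI)
      show "norm ?x = 1 \<or> ?x = 0" using nx by blast
      show "\<forall>z\<in>X. cinner ?x z = 0" using xV unfolding V_def by blast
      show "\<forall>u. (\<forall>z\<in>X. cinner u z = 0) \<longrightarrow> norm (A u) \<le> norm (A ?x) * norm u"
        unfolding nA using m_le unfolding V_def by blast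
      show "B (A ?x) = scaleC (complex_of_real ((norm (A ?x))\<^sup>2)) ?x"
        using Rx by (simp only: nA scaleR_scaleC[symmetric])
    qed
  qed
qed

lemma singular_system_exists:
  fixes A B :: "'a::euclidean_space L2 \<Rightarrow> 'a L2"
  assumes "compact_operator A" "adjoint_pair A B"
  obtains x where "singular_system A B x"
proof -
  let ?P = "\<lambda>(x :: nat \<Rightarrow> 'a L2) (k :: nat) y. (norm y = 1 \<or> y = 0) \<and> (\<forall>j<k. cinner y (x j) = 0) \<and>
      (\<forall>u. (\<forall>j<k. cinner u (x j) = 0) \<longrightarrow> norm (A u) \<le> norm (A y) * norm u) \<and>
      B (A y) = scaleC (complex_of_real ((norm (A y))\<^sup>2)) y"
  have "\<exists>x. \<forall>k. ?P x k (x k)"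
  proof (rule dependent_wf_choice[of less_than ?P])
    show "wf less_than" by simp
    fix f g :: "nat \<Rightarrow> 'a L2" and k y
    assume "\<And>z. (z, k) \<in> less_than \<Longrightarrow> f z = g z"
    then have "\<And>z. z < k \<Longrightarrow> f z = g z" by simp
    then show "?P f k y = ?P g k y" by (auto simp: )
  next
    fix k and f :: "nat \<Rightarrow> 'a L2"
    assume "\<And>j. (j, k) \<in> less_than \<Longrightarrow> ?P f j (f j)"
    then have "\<exists>l. B (A z) = scaleC l z" if "z \<in> f ` {..<k}" for z using that by auto
    have *: "(\<forall>z\<in>f ` {..<k}. Q z) \<longleftrightarrow> (\<forall>j<k. Q (f j))" for Q by auto
    from compact_operator_maximizer[OF assms, of "f ` {..<k}", OF \<open>\<And>z. z \<in> f ` {..<k} \<Longrightarrow> _\<close>]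
    show "\<exists>y. ?P f k y" unfolding * .
  qed
  then show thesis using that by (auto simp: singular_system_def)
qed

context
  fixes A B :: "'a::euclidean_space L2 \<Rightarrow> 'a L2" and x :: "nat \<Rightarrow> 'a L2"
  assumes A: "bounded_clinear A" and ad: "adjoint_pair A B" and sys: "singular_system A B x"
begin

lemma singular_system_decseq: "decseq (\<lambda>k. norm (A (x k)))"
proof (rule decseq_SucI)
  fix k
  have "norm (A (x (Suc k))) \<le> norm (A (x k)) * norm (x (Suc k))"
    using sys by (simp add: singular_system_def)
  also have "\<dots> \<le> norm (A (x k)) * 1"
    using sys by (intro mult_left_mono) (auto simp: singular_system_def, metis norm_zero order_refl zero_le_one)
  finally show "norm (A (x (Suc k))) \<le> norm (A (x k))" by simp
qed

lemma singular_system_orthonormal: "orthonormal x {k. norm (A (x k)) > 0}"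
proof -
  have "cinner (x i) (x j) = 0" if "i \<noteq> j" for i j
    using that sys by (metis cinner_commute complex_cnj_zero nat_neq_iff singular_system_def)
  moreover have "cinner (x i) (x i) = 1" if "norm (A (x i)) > 0" for i
    using that sys by (metis bounded_clinearD(3)[OF A] cinner_self_eq_1_iff less_irrefl norm_zero singular_system_def)
  ultimately show ?thesis by (auto simp: orthonormal_def)
qed

lemma singular_system_image_orthogonal:
  "cinner (A (x i)) (A u) = complex_of_real ((norm (A (x i)))\<^sup>2) * cinner (x i) u"
proof -
  have "cinner (A (x i)) (A u) = cinner (B (A (x i))) u"
    by (simp add: adjoint_pairD[OF adjoint_pair_sym[OF ad]])
  also have "B (A (x i)) = scaleC (complex_of_real ((norm (A (x i)))\<^sup>2)) (x i)"
    using sys by (simp add: singular_system_def)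
  finally show ?thesis by (simp add: cinner_scaleC_left)
qed

lemma singular_system_norm_image:
  assumes J: "finite J" "J \<subseteq> {k. norm (A (x k)) > 0}"
  shows "(norm (A (\<Sum>k\<in>J. scaleC (c k) (x k))))\<^sup>2 = (\<Sum>k\<in>J. (cmod (c k))\<^sup>2 * (norm (A (x k)))\<^sup>2)"
proof -
  let ?u = "\<Sum>k\<in>J. scaleC (c k) (x k)"
  have on: "orthonormal x J" by (rule orthonormal_subset[OF singular_system_orthonormal J(2)])
  have "complex_of_real ((norm (A ?u))\<^sup>2) = (\<Sum>k\<in>J. c k * cinner (A (x k)) (A ?u))"
    by (simp only: cinner_self[symmetric])
      (simp add: bounded_clinearD[OF A] cinner_sum_left cinner_scaleC_left)
  also have "\<dots> = (\<Sum>k\<in>J. complex_of_real ((cmod (c k))\<^sup>2 * (norm (A (x k)))\<^sup>2))"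
  proof (rule sum.cong[OF refl])
    fix k assume "k \<in> J"
    then have "cinner (x k) ?u = cnj (c k)"
      by (subst cinner_commute) (simp add: cinner_sum_orthonormal[OF J(1) on])
    then have "c k * cinner (A (x k)) (A ?u) = (c k * cnj (c k)) * complex_of_real ((norm (A (x k)))\<^sup>2)"
      by (simp only: singular_system_image_orthogonal) (simp add: mult_ac)
    then show "c k * cinner (A (x k)) (A ?u) = complex_of_real ((cmod (c k))\<^sup>2 * (norm (A (x k)))\<^sup>2)"
      by (simp only: of_real_mult complex_norm_square)
  qed
  also have "\<dots> = complex_of_real (\<Sum>k\<in>J. (cmod (c k))\<^sup>2 * (norm (A (x k)))\<^sup>2)" by simp
  finally show ?thesis by (simp only: of_real_eq_iff)
qed

text \<open>The images \<open>A (x k)\<close> are orthogonal; infinitely many of norm at least \<open>t\<close> would have no convergent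
  subsequence.\<close>

lemma singular_system_finite_large:
  assumes comp: "compact_operator A" and t: "t > 0"
  shows "finite {k. norm (A (x k)) \<ge> t}"
proof (rule ccontr)
  assume inf: "infinite {k. norm (A (x k)) \<ge> t}"
  have large: "norm (A (x k)) \<ge> t" for k
  proof -
    obtain l where "l \<ge> k" "norm (A (x l)) \<ge> t"
      using inf by (metis (mono_tags, lifting) infinite_nat_iff_unbounded_le mem_Collect_eq)
    then show ?thesis using decseqD[OF singular_system_decseq, of k l] by linarith
  qed
  then have pos: "norm (A (x k)) > 0" for k using t by (meson less_le_trans)
  have "norm (x k) = 1" for k
    using orthonormal_norm[OF singular_system_orthonormal] pos by simp
  then obtain r w where r: "strict_mono (r :: nat \<Rightarrow> nat)" and w: "(\<lambda>n. A (x (r n))) \<longlonglongrightarrow> w"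
    using compact_operator_subsequence[OF comp, of x] by (metis order_refl)
  have "Cauchy (\<lambda>n. A (x (r n)))" using w by (rule LIMSEQ_imp_Cauchy)
  then obtain M where M: "\<And>m n. m \<ge> M \<Longrightarrow> n \<ge> M \<Longrightarrow> norm (A (x (r m)) - A (x (r n))) < t"
    using t unfolding Cauchy_iff by blast
  have ne: "r M \<noteq> r (Suc M)" using r by (metis lessI less_irrefl strict_mono_less)
  then have "cinner (x (r M)) (x (r (Suc M))) = 0"
    using singular_system_orthonormal pos by (auto simp: orthonormal_def)
  then have "cinner (A (x (r M))) (- A (x (r (Suc M)))) = 0"
    by (simp add: singular_system_image_orthogonal cinner_minus_right)
  from norm_add_orthogonal[OF this]
  have "(norm (A (x (r M)) - A (x (r (Suc M)))))\<^sup>2 \<ge> (norm (A (x (r M))))\<^sup>2" by simp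
  then have "norm (A (x (r M)) - A (x (r (Suc M)))) \<ge> norm (A (x (r M)))"
    by (rule power2_le_imp_le) simp
  with M[of M "Suc M"] large[of "r M"] show False by simp
qed

text \<open>An eigenvector of \<open>A\<^sup>*A\<close> with eigenvalue \<open>t\<^sup>2 > 0\<close> that is orthogonal to all \<open>x k\<close> with
  \<open>\<parallel>A (x k)\<parallel> = t\<close> is orthogonal to every \<open>x k\<close>; the maximality of the \<open>x k\<close> then bounds
  \<open>t\<close> by singular values that become smaller than \<open>t\<close>.\<close>

lemma singular_system_is_singular_value_sequence:
  assumes comp: "compact_operator A"
  shows "is_singular_value_sequence A (\<lambda>k. norm (A (x k)))"
  unfolding is_singular_value_sequence_def
proof (intro conjI allI impI)
  fix t :: real assume t: "t > 0"
  let ?J = "{k. norm (A (x k)) = t}"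
  show fin: "finite ?J"
    by (rule finite_subset[OF _ singular_system_finite_large[OF comp t]]) auto
  have on: "orthonormal x ?J" by (rule orthonormal_subset[OF singular_system_orthonormal]) (use t in auto)
  have inj: "inj_on x ?J"
  proof (rule inj_onI)
    fix i j assume ij: "i \<in> ?J" "j \<in> ?J" "x i = x j"
    have "cinner (x i) (x j) = (if i = j then 1 else 0)" using on ij(1,2) unfolding orthonormal_def by blast
    moreover have "cinner (x i) (x j) = 1" using on ij unfolding orthonormal_def by (metis (mono_tags, lifting))
    ultimately show "i = j" by (metis zero_neq_one)
  qed
  let ?E = "eigenspace (cadjoint A \<circ> A) (complex_of_real (t\<^sup>2))"
  have E: "u \<in> ?E \<longleftrightarrow> B (A u) = scaleC (complex_of_real (t\<^sup>2)) u" for u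
    by (simp add: eigenspace_def cadjoint_eq[OF ad])
  have B: "bounded_clinear B" by (rule adjoint_bounded_clinear[OF A ad])
  have xE: "x k \<in> ?E" if "k \<in> ?J" for k
    using that sys unfolding E singular_system_def by (metis (mono_tags, lifting) mem_Collect_eq)
  have "cL2.dim ?E = card (x ` ?J)"
  proof (rule cL2.dim_unique[OF _ _ _ refl])
    show "x ` ?J \<subseteq> ?E" using xE by blast
    show "cL2.independent (x ` ?J)"
    proof (rule cL2.independent_if_scalars_zero)
      show "finite (x ` ?J)" using fin by simp
      fix f u assume z: "(\<Sum>v\<in>x ` ?J. scaleC (f v) v) = 0" and "u \<in> x ` ?J"
      then obtain k where k: "k \<in> ?J" "u = x k" by auto
      have "(\<Sum>j\<in>?J. scaleC (f (x j)) (x j)) = 0" using z by (simp add: sum.reindex[OF inj] o_def)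
      then show "f u = 0" using cinner_sum_orthonormal[OF fin on k(1), of "\<lambda>j. f (x j)"] k(2) by simp
    qed
    show "?E \<subseteq> cL2.span (x ` ?J)"
    proof
      fix u assume u: "u \<in> ?E"
      let ?p = "\<Sum>j\<in>?J. scaleC (cinner u (x j)) (x j)"
      define v where "v = u - ?p"
      have v_J: "cinner v (x k) = 0" if "k \<in> ?J" for k
        using orthonormal_decomposition(1)[OF fin on that] by (simp add: v_def)
      have "B (A ?p) = (\<Sum>j\<in>?J. scaleC (cinner u (x j)) (B (A (x j))))"
        by (simp add: bounded_clinearD[OF A] bounded_clinearD[OF B])
      also have "\<dots> = (\<Sum>j\<in>?J. scaleC (complex_of_real (t\<^sup>2)) (scaleC (cinner u (x j)) (x j)))"
          by (intro sum.cong refl, subst xE[unfolded E]) (simp_all only: cL2.scale_left_commute)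
      also have "\<dots> = scaleC (complex_of_real (t\<^sup>2)) ?p" by (simp add: cL2.scale_sum_right)
      finally have Rp: "B (A ?p) = scaleC (complex_of_real (t\<^sup>2)) ?p" .
      have Rv: "B (A v) = scaleC (complex_of_real (t\<^sup>2)) v"
        by (simp only: v_def bounded_clinearD(4)[OF A] bounded_clinearD(4)[OF B] u[unfolded E] Rp
            cL2.scale_right_diff_distrib)
      have orth: "cinner v (x k) = 0" for k
      proof (cases "k \<in> ?J")
        case False
        have "complex_of_real (t\<^sup>2) * cinner v (x k) = cinner (B (A v)) (x k)"
          by (simp only: Rv cinner_scaleC_left)
        also have "\<dots> = cinner v (B (A (x k)))"
          by (simp add: adjoint_pairD[OF ad] adjoint_pairD[OF adjoint_pair_sym[OF ad]])
        also have "B (A (x k)) = scaleC (complex_of_real ((norm (A (x k)))\<^sup>2)) (x k)"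
          using sys by (simp add: singular_system_def)
        finally have "complex_of_real (t\<^sup>2) * cinner v (x k) =
            complex_of_real ((norm (A (x k)))\<^sup>2) * cinner v (x k)"
          by (simp add: cinner_scaleC_right)
        moreover have "t\<^sup>2 \<noteq> (norm (A (x k)))\<^sup>2"
          using False t by (simp add: power2_eq_iff) (smt (verit) norm_ge_zero)
        ultimately show ?thesis by (metis mult_cancel_right of_real_eq_iff)
      qed (rule v_J)
      obtain k where k: "norm (A (x k)) < t"
      proof -
        have "{k. norm (A (x k)) \<ge> t} \<noteq> UNIV"
          using singular_system_finite_large[OF comp t] by (metis infinite_UNIV_nat)
        then obtain k where "k \<notin> {k. norm (A (x k)) \<ge> t}" by auto
        then show thesis using that[of k] by simp
      qed
      have "norm (A v) \<le> norm (A (x k)) * norm v"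
        using sys orth by (simp add: singular_system_def)
      moreover have "norm (A v) = t * norm v"
      proof -
        have "complex_of_real ((norm (A v))\<^sup>2) = cinner (B (A v)) v"
          by (simp only: cinner_self[symmetric] adjoint_pairD[OF adjoint_pair_sym[OF ad]])
        also have "\<dots> = complex_of_real ((t * norm v)\<^sup>2)"
          by (simp only: Rv cinner_scaleC_left cinner_self of_real_mult[symmetric] power_mult_distrib)
        finally have "(norm (A v))\<^sup>2 = (t * norm v)\<^sup>2" by (simp only: of_real_eq_iff)
        then show ?thesis using t by (metis less_imp_le mult_nonneg_nonneg norm_ge_zero power2_eq_imp_eq)
      qed
      ultimately have "v = 0" using k by (metis mult_le_cancel_right norm_le_zero_iff not_less)
      then have "u = ?p" by (simp add: v_def)
      also have "\<dots> \<in> cL2.span (x ` ?J)"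
        by (intro cL2.span_sum cL2.span_scale cL2.span_base) auto
      finally show "u \<in> cL2.span (x ` ?J)" .
    qed
  qed
  then show "card ?J = cL2.dim ?E" by (simp add: card_image[OF inj])
qed (use singular_system_decseq in auto)

end

text \<open>At the first index where two nonincreasing sequences differ, the larger value occurs more often in
  one of them than in the other, contradicting that the multiplicities are prescribed.\<close>

lemma is_singular_value_sequence_unique:
  assumes s: "is_singular_value_sequence A s" and s': "is_singular_value_sequence A s'"
  shows "s = s'"
proof (rule ccontr)
  assume "s \<noteq> s'"
  then have "\<exists>k. s k \<noteq> s' k" by auto
  then obtain k where k: "s k \<noteq> s' k" "\<And>j. j < k \<Longrightarrow> s j = s' j"
    using exists_least_iff[of "\<lambda>k. s k \<noteq> s' k"] by auto
  have False if a: "is_singular_value_sequence A a" and b: "is_singular_value_sequence A b"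
    and eq: "\<And>j. j < k \<Longrightarrow> a j = b j" and gt: "a k > b k" for a b
  proof -
    have t: "a k > 0" using gt b by (metis is_singular_value_sequence_def le_less_trans)
    have db: "decseq b" using b by (simp add: is_singular_value_sequence_def)
    have sub: "{j. b j = a k} \<subseteq> {j. a j = a k} - {k}"
    proof
      fix j assume j: "j \<in> {j. b j = a k}"
      have "j < k"
      proof (rule ccontr)
        assume "\<not> j < k"
        then have "b j \<le> b k" using db by (simp add: decseqD)
        then show False using j gt by simp
      qed
      then show "j \<in> {j. a j = a k} - {k}" using j eq by auto
    qed
    have fin: "finite {j. a j = a k}" using a t by (simp add: is_singular_value_sequence_def)
    have "card {j. b j = a k} \<le> card ({j. a j = a k} - {k})"
      by (rule card_mono[OF _ sub]) (use fin in simp)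
    also have "\<dots> < card {j. a j = a k}" using fin by (intro card_Diff1_less) auto
    finally show False using a b t by (simp add: is_singular_value_sequence_def)
  qed
  from this[OF s s'] this[OF s' s] k show False by (metis less_linear)
qed

lemma singular_value_eq:
  assumes "is_singular_value_sequence A s"
  shows "singular_value A = s"
  unfolding singular_value_def
  using assms is_singular_value_sequence_unique by (intro the_equality) auto

section \<open>Schatten norms from continuous frames\<close>

text \<open>The orthogonality amounts to \<open>k\<close> homogeneous linear equations for \<open>k + 1\<close> unknown coefficients.\<close>

lemma nontrivial_combination_orthogonal:
  fixes x y :: "nat \<Rightarrow> 'a::euclidean_space L2"
  assumes y: "\<And>i j. i < k \<Longrightarrow> j < k \<Longrightarrow> i \<noteq> j \<Longrightarrow> cinner (y i) (y j) = 0"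
  obtains c where "\<exists>j\<le>k. c j \<noteq> 0" "\<And>i. i < k \<Longrightarrow> cinner (\<Sum>j\<le>k. scaleC (c j) (x j)) (y i) = 0"
proof -
  define z where "z j = (\<Sum>i<k. scaleC (cinner (x j) (y i)) (y i))" for j
  have "\<exists>c. (\<exists>j\<le>k. c j \<noteq> 0) \<and> (\<Sum>j\<le>k. scaleC (c j) (z j)) = 0"
  proof (cases "inj_on z {..k}")
    case False
    then obtain a b where ab: "a \<le> k" "b \<le> k" "a \<noteq> b" "z a = z b" by (auto simp: inj_on_def)
    define c where "c j = (if j = a then 1 else if j = b then -1 else 0 :: complex)" for j
    have "(\<Sum>j\<le>k. scaleC (c j) (z j)) = (\<Sum>j\<in>{a,b}. scaleC (c j) (z j))"
      using ab by (intro sum.mono_neutral_right) (auto simp: c_def)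
    also have "\<dots> = 0" using ab by (simp add: c_def)
    finally show ?thesis using ab by (intro exI[of _ c]) (auto simp: c_def)
  next
    case True
    have sub: "z ` {..k} \<subseteq> cL2.span (y ` {..<k})"
      unfolding z_def
      by (intro image_subsetI cL2.span_sum cL2.span_scale cL2.span_base) auto
    have "\<not> cL2.independent (z ` {..k})"
    proof
      assume "cL2.independent (z ` {..k})"
      from cL2.independent_span_bound[OF _ this sub]
      have "card (z ` {..k}) \<le> card (y ` {..<k})" by simp
      also have "\<dots> \<le> k" using card_image_le[of "{..<k}" y] by simp
      finally show False using True by (simp add: card_image)
    qed
    then obtain f where f: "\<exists>v\<in>z ` {..k}. f v \<noteq> 0" "(\<Sum>v\<in>z ` {..k}. scaleC (f v) v) = 0"
      using cL2.dependent_finite[of "z ` {..k}"] by auto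
    then show ?thesis
      by (intro exI[of _ "\<lambda>j. f (z j)"]) (auto simp: sum.reindex[OF True])
  qed
  then obtain c where c: "\<exists>j\<le>k. c j \<noteq> 0" "(\<Sum>j\<le>k. scaleC (c j) (z j)) = 0" by auto
  let ?u = "\<Sum>j\<le>k. scaleC (c j) (x j)"
  show ?thesis
  proof (rule that[OF c(1)])
    fix i assume i: "i < k"
    have "(\<Sum>j\<le>k. scaleC (c j) (z j)) = (\<Sum>i<k. scaleC (cinner ?u (y i)) (y i))"
    proof -
      have "(\<Sum>j\<le>k. scaleC (c j) (z j)) = (\<Sum>j\<le>k. \<Sum>i<k. scaleC (c j * cinner (x j) (y i)) (y i))"
        by (simp add: z_def cL2.scale_sum_right)
      also have "\<dots> = (\<Sum>i<k. \<Sum>j\<le>k. scaleC (c j * cinner (x j) (y i)) (y i))" by (rule sum.swap)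
      also have "\<dots> = (\<Sum>i<k. scaleC (cinner ?u (y i)) (y i))"
        by (simp add: cinner_sum_left cinner_scaleC_left cL2.scale_sum_left)
      finally show ?thesis .
    qed
    then have "0 = cinner (\<Sum>i<k. scaleC (cinner ?u (y i)) (y i)) (y i)" using c(2) by simp
    also have "\<dots> = (\<Sum>j<k. if j = i then cinner ?u (y i) * cinner (y i) (y i) else 0)"
      unfolding cinner_sum_left using y i by (intro sum.cong) (auto simp: cinner_scaleC_left)
    also have "\<dots> = cinner ?u (y i) * cinner (y i) (y i)" using i by simp
    finally have "cinner ?u (y i) = 0 \<or> y i = 0" by (auto simp: cinner_self)
    then show "cinner ?u (y i) = 0" by (metis cinner_zero_right)
  qed
qed

text \<open>The min-max principle: some combination of the \<open>k + 1\<close> leading singular vectors of \<open>T\<close> is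
  orthogonal to the \<open>k\<close> leading ones of \<open>T'\<close>. On it \<open>T\<close> is at least as large as its \<open>k\<close>th singular
  value and \<open>T'\<close> at most as large as its own.\<close>

lemma singular_system_mono:
  fixes T T' :: "'a::euclidean_space L2 \<Rightarrow> 'a L2"
  assumes T: "bounded_clinear T" "adjoint_pair T Ta" "singular_system T Ta x"
    and T': "singular_system T' Ta' x'"
    and le: "\<And>u. norm (T u) \<le> K * norm (T' u)" and K: "K \<ge> 0"
  shows "norm (T (x k)) \<le> K * norm (T' (x' k))"
proof (cases "norm (T (x k)) = 0")
  case True
  then show ?thesis using K by simp
next
  case False
  note dec = decseqD[OF singular_system_decseq[OF T]]
  have pos: "{..k} \<subseteq> {j. norm (T (x j)) > 0}"
    using False dec[of _ k] by (auto simp: less_le_trans) (metis norm_le_zero_iff norm_zero)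
  have "cinner (x' i) (x' j) = 0" if "i \<noteq> j" for i j
    using that T' by (metis cinner_commute complex_cnj_zero nat_neq_iff singular_system_def)
  then obtain c where c: "\<exists>j\<le>k. c j \<noteq> 0"
    "\<And>i. i < k \<Longrightarrow> cinner (\<Sum>j\<le>k. scaleC (c j) (x j)) (x' i) = 0"
    using nontrivial_combination_orthogonal[of k x' x] by metis
  let ?u = "\<Sum>j\<le>k. scaleC (c j) (x j)"
  have on: "orthonormal x {..k}"
    by (rule orthonormal_subset[OF singular_system_orthonormal[OF T] pos])
  have nu: "(norm ?u)\<^sup>2 = (\<Sum>j\<le>k. (cmod (c j))\<^sup>2)"
    by (rule norm_sum_orthonormal[OF _ on]) simp
  have "(norm (T (x k)) * norm ?u)\<^sup>2 = (\<Sum>j\<le>k. (cmod (c j))\<^sup>2 * (norm (T (x k)))\<^sup>2)"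
    by (simp add: power_mult_distrib nu sum_distrib_left mult.commute)
  also have "\<dots> \<le> (\<Sum>j\<le>k. (cmod (c j))\<^sup>2 * (norm (T (x j)))\<^sup>2)"
    by (intro sum_mono mult_left_mono power_mono dec) auto
  also have "\<dots> = (norm (T ?u))\<^sup>2"
    by (rule singular_system_norm_image[OF T _ pos, symmetric]) simp
  finally have "norm (T (x k)) * norm ?u \<le> norm (T ?u)" by (rule power2_le_imp_le) simp
  also have "\<dots> \<le> K * norm (T' ?u)" by (rule le)
  also have "\<dots> \<le> K * (norm (T' (x' k)) * norm ?u)"
    using T' c(2) K by (intro mult_left_mono) (auto simp: singular_system_def)
  finally have *: "norm (T (x k)) * norm ?u \<le> (K * norm (T' (x' k))) * norm ?u" by (simp add: mult_ac)
  obtain j where j: "j \<le> k" "c j \<noteq> 0" using c(1) by auto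
  have "0 < (\<Sum>j\<le>k. (cmod (c j))\<^sup>2)" by (rule sum_pos2[of _ j]) (use j in auto)
  then have "norm ?u > 0" using nu by (metis norm_ge_zero less_eq_real_def power_zero_numeral less_irrefl)
  with * show ?thesis by (rule mult_right_le_imp_le)
qed

text \<open>Hoelder's inequality interpolates the weight \<open>s\<^sup>q\<^sup>-\<^sup>2\<close> between \<open>s\<^sup>-\<^sup>2\<close> and \<open>1\<close>.\<close>

lemma sum_powr_interpolation:
  fixes s a :: "'i \<Rightarrow> real"
  assumes J: "finite J" and s: "\<And>k. k \<in> J \<Longrightarrow> s k > 0" and a: "\<And>k. k \<in> J \<Longrightarrow> a k \<ge> 0"
    and q: "0 < q" "q < 2"
    and X: "(\<Sum>k\<in>J. a k / (s k)\<^sup>2) \<le> b\<^sup>2" and Y: "(\<Sum>k\<in>J. a k) \<le> g\<^sup>2"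
    and bg: "b \<ge> 0" "g \<ge> 0"
  shows "(\<Sum>k\<in>J. s k powr (q - 2) * a k) \<le> b powr (2 - q) * g powr q"
proof (cases "\<forall>k\<in>J. a k = 0")
  case True
  then show ?thesis by simp
next
  case False
  then obtain k0 where k0: "k0 \<in> J" "a k0 > 0" using a by force
  define A where "A = (\<Sum>k\<in>J. a k / (s k)\<^sup>2)"
  define B where "B = (\<Sum>k\<in>J. a k)"
  have A: "A > 0" unfolding A_def using k0 s[OF k0(1)] a J by (intro sum_pos2[of _ k0]) auto
  have B: "B > 0" unfolding B_def using k0 a J by (intro sum_pos2[of _ k0]) auto
  let ?t = "1 - q/2" and ?r = "q/2"
  have "(\<Sum>k\<in>J. s k powr (q - 2) * a k) \<le>
      (\<Sum>k\<in>J. (A powr ?t * B powr ?r) * (?t * (a k / (s k)\<^sup>2 / A) + ?r * (a k / B)))"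
  proof (rule sum_mono)
    fix k assume k: "k \<in> J"
    show "s k powr (q - 2) * a k \<le> (A powr ?t * B powr ?r) * (?t * (a k / (s k)\<^sup>2 / A) + ?r * (a k / B))"
    proof (cases "a k = 0")
      case False
      then have ak: "a k > 0" using a[OF k] by simp
      have "(a k / (s k)\<^sup>2 / A) powr ?t * (a k / B) powr ?r \<le> ?t * (a k / (s k)\<^sup>2 / A) + ?r * (a k / B)"
        by (rule Youngs_inequality_0) (use q ak A B s[OF k] in auto)
      then have "(A powr ?t * B powr ?r) * ((a k / (s k)\<^sup>2 / A) powr ?t * (a k / B) powr ?r) \<le>
          (A powr ?t * B powr ?r) * (?t * (a k / (s k)\<^sup>2 / A) + ?r * (a k / B))"
        by (intro mult_left_mono) auto
      moreover have "(A powr ?t * B powr ?r) * ((a k / (s k)\<^sup>2 / A) powr ?t * (a k / B) powr ?r) =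
          (a k powr ?t * a k powr ?r) / ((s k)\<^sup>2 powr ?t)"
      proof -
        have *: "(\<alpha> * \<beta>) * ((x / z / \<alpha>) * (y / \<beta>)) = (x * y) / z" if "\<alpha> \<noteq> 0" "\<beta> \<noteq> 0" for \<alpha> \<beta> x y z :: real
          using that by simp
        have 1: "(a k / (s k)\<^sup>2 / A) powr ?t = a k powr ?t / ((s k)\<^sup>2 powr ?t) / A powr ?t"
          using A ak by (simp only: powr_divide less_imp_le zero_le_power2 divide_nonneg_nonneg)
        have 2: "(a k / B) powr ?r = a k powr ?r / B powr ?r"
          using B ak by (simp only: powr_divide less_imp_le)
        show ?thesis unfolding 1 2 by (rule *) (use A B in auto)
      qed
      moreover have "a k powr ?t * a k powr ?r = a k"
        using ak by (simp add: powr_add[symmetric])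
      moreover have "(s k)\<^sup>2 powr ?t = s k powr (2 - q)"
      proof -
        have "(s k)\<^sup>2 = s k powr 2" using s[OF k] by simp
        then show ?thesis by (simp only: powr_powr) (simp add: algebra_simps)
      qed
      moreover have "a k / s k powr (2 - q) = s k powr (q - 2) * a k"
        using s[OF k] by (metis divide_inverse minus_diff_eq mult.commute powr_minus)
      ultimately show ?thesis by simp
    qed simp
  qed
  also have "\<dots> = A powr ?t * B powr ?r"
  proof -
    have "(\<Sum>k\<in>J. ?t * (a k / (s k)\<^sup>2 / A) + ?r * (a k / B)) = ?t * (A / A) + ?r * (B / B)"
      by (simp only: sum.distrib sum_distrib_left[symmetric] sum_divide_distrib[symmetric] A_def B_def)
    also have "\<dots> = 1" using A B by simp
    finally show ?thesis by (simp only: sum_distrib_left[symmetric] mult_1_right)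
  qed
  also have "\<dots> \<le> (b\<^sup>2) powr ?t * (g\<^sup>2) powr ?r"
    using A B X Y q by (intro mult_mono powr_mono2) (auto simp: A_def B_def)
  also have "\<dots> = b powr (2 - q) * g powr q"
  proof -
    have "(z\<^sup>2) powr p = z powr (2 * p)" if "z \<ge> 0" for z p :: real
    proof (cases "z = 0")
      case False
      then have "z\<^sup>2 = z powr 2" using that by simp
      then show ?thesis by (simp only: powr_powr)
    qed simp
    then show ?thesis using bg by simp
  qed
  finally show ?thesis .
qed

text \<open>The quasi-norm is estimated through a continuous frame: if \<open>\<parallel>T' u\<parallel>\<^sup>2\<close> is at most the integral of
  \<open>|\<langle>u, g\<rangle>|\<^sup>2\<close> over the frame vectors \<open>g\<close>, then for each singular pair \<open>(s, x)\<close> of \<open>T'\<close> the power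
  \<open>s\<^sup>q\<close> is at most the integral of \<open>s\<^sup>q\<^sup>-\<^sup>2 |\<langle>x, g\<rangle>|\<^sup>2\<close>. Summed over the pairs, the integrand is controlled
  by interpolation: the exponent \<open>0\<close> in place of \<open>q - 2\<close> is Bessel's inequality, and the
  exponent \<open>-2\<close> is the hypothesis that a single frame vector sees at most \<open>\<parallel>T' u\<parallel>\<close>. No triangle
  inequality for the quasi-norm enters, so the number of frame vectors costs nothing. The operator
  of interest only has to be dominated by \<open>T'\<close>, which may therefore be chosen smoother.\<close>

lemma schatten_frame_criterion:
  fixes T T' :: "'a::euclidean_space L2 \<Rightarrow> 'a L2" and g :: "'i \<Rightarrow> 'b \<Rightarrow> 'a L2"
  assumes T: "bounded_clinear T" "adjoint_pair T Ta"
    and T': "bounded_clinear T'" "adjoint_pair T' Ta'"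
    and q: "0 < q" "q < 2" and K: "K \<ge> 0" and dom: "\<And>u. norm (T u) \<le> K * norm (T' u)"
    and I: "finite I" and meas: "\<And>i u. i \<in> I \<Longrightarrow> (\<lambda>\<eta>. cinner u (g i \<eta>)) \<in> borel_measurable M"
    and frame: "\<And>u. ennreal ((norm (T' u))\<^sup>2) \<le> (\<Sum>i\<in>I. \<integral>\<^sup>+\<eta>. ennreal ((cmod (cinner u (g i \<eta>)))\<^sup>2) \<partial>M)"
    and single: "\<And>i \<eta> u. i \<in> I \<Longrightarrow> cmod (cinner u (g i \<eta>)) \<le> b i * norm (T' u)"
    and b: "\<And>i. i \<in> I \<Longrightarrow> b i \<ge> 0"
    and G: "\<And>i. i \<in> I \<Longrightarrow> G i \<in> borel_measurable M"
      "\<And>i \<eta>. i \<in> I \<Longrightarrow> ennreal (norm (g i \<eta>) powr q) \<le> G i \<eta>"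
    and total: "(\<Sum>i\<in>I. ennreal (b i powr (2 - q)) * (\<integral>\<^sup>+\<eta>. G i \<eta> \<partial>M)) \<le> ennreal F" and F: "F \<ge> 0"
  shows "T \<in> schatten_class q" and "schatten_norm q T \<le> (K powr q * F) powr (1 / q)"
proof -
  obtain L where L: "L > 0" "\<And>u. norm (T' u) \<le> L * norm u"
    using bounded_clinear_bound[OF T'(1)] by auto
  have g_bound: "norm (g i \<eta>) \<le> b i * L" if i: "i \<in> I" for i \<eta>
  proof (cases "norm (g i \<eta>) = 0")
    case False
    have "(norm (g i \<eta>))\<^sup>2 = cmod (cinner (g i \<eta>) (g i \<eta>))" by (simp only: cinner_self norm_of_real) simp
    also have "\<dots> \<le> b i * norm (T' (g i \<eta>))" by (rule single[OF i])
    also have "\<dots> \<le> b i * (L * norm (g i \<eta>))" by (intro mult_left_mono L b i)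
    finally have "norm (g i \<eta>) * norm (g i \<eta>) \<le> (b i * L) * norm (g i \<eta>)"
      by (simp add: power2_eq_square mult_ac)
    then show ?thesis using False by (simp add: mult_le_cancel_right)
  qed (use b[OF i] L(1) in simp)
  have sum_frame: "(\<Sum>j\<in>J. ennreal (c j) * ennreal ((norm (T' (x j)))\<^sup>2)) \<le>
      (\<Sum>i\<in>I. \<integral>\<^sup>+\<eta>. ennreal (\<Sum>j\<in>J. c j * (cmod (cinner (x j) (g i \<eta>)))\<^sup>2) \<partial>M)"
    if J: "finite J" and c: "\<And>j. j \<in> J \<Longrightarrow> c j \<ge> 0" for J :: "nat set" and c x
  proof -
    have "(\<Sum>j\<in>J. ennreal (c j) * ennreal ((norm (T' (x j)))\<^sup>2)) \<le>
        (\<Sum>j\<in>J. ennreal (c j) * (\<Sum>i\<in>I. \<integral>\<^sup>+\<eta>. ennreal ((cmod (cinner (x j) (g i \<eta>)))\<^sup>2) \<partial>M))"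
      by (intro sum_mono mult_left_mono frame) auto
    also have "\<dots> = (\<Sum>j\<in>J. \<Sum>i\<in>I. \<integral>\<^sup>+\<eta>. ennreal (c j * (cmod (cinner (x j) (g i \<eta>)))\<^sup>2) \<partial>M)"
    proof (rule sum.cong[OF refl])
      fix j assume j: "j \<in> J"
      show "ennreal (c j) * (\<Sum>i\<in>I. \<integral>\<^sup>+\<eta>. ennreal ((cmod (cinner (x j) (g i \<eta>)))\<^sup>2) \<partial>M) =
          (\<Sum>i\<in>I. \<integral>\<^sup>+\<eta>. ennreal (c j * (cmod (cinner (x j) (g i \<eta>)))\<^sup>2) \<partial>M)"
        unfolding sum_distrib_left
      proof (rule sum.cong[OF refl])
        fix i assume i: "i \<in> I"
        note [measurable] = meas[OF i]
        show "ennreal (c j) * (\<integral>\<^sup>+\<eta>. ennreal ((cmod (cinner (x j) (g i \<eta>)))\<^sup>2) \<partial>M) =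
            (\<integral>\<^sup>+\<eta>. ennreal (c j * (cmod (cinner (x j) (g i \<eta>)))\<^sup>2) \<partial>M)"
          using c[OF j] by (subst nn_integral_cmult[symmetric]) (auto simp: ennreal_mult)
      qed
    qed
    also have "\<dots> = (\<Sum>i\<in>I. \<Sum>j\<in>J. \<integral>\<^sup>+\<eta>. ennreal (c j * (cmod (cinner (x j) (g i \<eta>)))\<^sup>2) \<partial>M)"
      by (rule sum.swap)
    also have "\<dots> = (\<Sum>i\<in>I. \<integral>\<^sup>+\<eta>. ennreal (\<Sum>j\<in>J. c j * (cmod (cinner (x j) (g i \<eta>)))\<^sup>2) \<partial>M)"
    proof (rule sum.cong[OF refl])
      fix i assume i: "i \<in> I"
      note [measurable] = meas[OF i]
      show "(\<Sum>j\<in>J. \<integral>\<^sup>+\<eta>. ennreal (c j * (cmod (cinner (x j) (g i \<eta>)))\<^sup>2) \<partial>M) =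
          (\<integral>\<^sup>+\<eta>. ennreal (\<Sum>j\<in>J. c j * (cmod (cinner (x j) (g i \<eta>)))\<^sup>2) \<partial>M)"
        using c by (subst nn_integral_sum[symmetric]) (auto intro!: nn_integral_cong sum_ennreal)
    qed
    finally show ?thesis .
  qed
  have total': "(\<Sum>i\<in>I. \<integral>\<^sup>+\<eta>. ennreal (b i powr (2 - q)) * G i \<eta> \<partial>M) \<le> ennreal F"
    using total by (simp add: nn_integral_cmult G(1) cong: sum.cong)
  have hs': "hilbert_schmidt_bounded T'"
    unfolding hilbert_schmidt_bounded_def
  proof (intro exI allI impI)
    fix n :: nat and x :: "nat \<Rightarrow> 'a L2" assume on: "orthonormal x {..<n}"
    have "ennreal (\<Sum>j<n. (norm (T' (x j)))\<^sup>2) = (\<Sum>j<n. ennreal 1 * ennreal ((norm (T' (x j)))\<^sup>2))"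
      by (simp add: sum_ennreal)
    also have "\<dots> \<le> (\<Sum>i\<in>I. \<integral>\<^sup>+\<eta>. ennreal (\<Sum>j<n. 1 * (cmod (cinner (x j) (g i \<eta>)))\<^sup>2) \<partial>M)"
      by (rule sum_frame) auto
    also have "\<dots> \<le> (\<Sum>i\<in>I. \<integral>\<^sup>+\<eta>. ennreal (L powr (2 - q)) * (ennreal (b i powr (2 - q)) * G i \<eta>) \<partial>M)"
    proof (intro sum_mono nn_integral_mono)
      fix i \<eta> assume i: "i \<in> I"
      have "(\<Sum>j<n. 1 * (cmod (cinner (x j) (g i \<eta>)))\<^sup>2) = (\<Sum>j<n. (cmod (cinner (g i \<eta>) (x j)))\<^sup>2)"
        by (subst cinner_commute) simp
      also have "\<dots> \<le> (norm (g i \<eta>))\<^sup>2" by (rule Bessel_inequality[OF _ on]) simp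
      also have "\<dots> = norm (g i \<eta>) powr (2 - q) * norm (g i \<eta>) powr q"
        by (cases "norm (g i \<eta>) = 0") (simp_all add: powr_add[symmetric])
      also have "\<dots> \<le> (b i * L) powr (2 - q) * norm (g i \<eta>) powr q"
        using q by (intro mult_right_mono powr_mono2 g_bound i) auto
      also have "\<dots> = L powr (2 - q) * (b i powr (2 - q) * norm (g i \<eta>) powr q)"
        using b[OF i] L(1) by (simp add: powr_mult)
      finally have "ennreal (\<Sum>j<n. 1 * (cmod (cinner (x j) (g i \<eta>)))\<^sup>2) \<le>
          ennreal (L powr (2 - q)) * (ennreal (b i powr (2 - q)) * ennreal (norm (g i \<eta>) powr q))"
        by (simp add: ennreal_mult[symmetric] ennreal_leI)
      also have "\<dots> \<le> ennreal (L powr (2 - q)) * (ennreal (b i powr (2 - q)) * G i \<eta>)"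
        by (intro mult_left_mono G(2) i) auto
      finally show "ennreal (\<Sum>j<n. 1 * (cmod (cinner (x j) (g i \<eta>)))\<^sup>2) \<le>
          ennreal (L powr (2 - q)) * (ennreal (b i powr (2 - q)) * G i \<eta>)" .
    qed
    also have "\<dots> = ennreal (L powr (2 - q)) * (\<Sum>i\<in>I. \<integral>\<^sup>+\<eta>. ennreal (b i powr (2 - q)) * G i \<eta> \<partial>M)"
      unfolding sum_distrib_left
      by (intro sum.cong refl nn_integral_cmult) (use G(1) in auto)
    also have "\<dots> \<le> ennreal (L powr (2 - q)) * ennreal F" by (intro mult_left_mono total') auto
    also have "\<dots> = ennreal (L powr (2 - q) * F)" using F by (simp add: ennreal_mult)
    finally show "(\<Sum>j<n. (norm (T' (x j)))\<^sup>2) \<le> L powr (2 - q) * F" using F by simp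
  qed
  have hs: "hilbert_schmidt_bounded T"
  proof -
    obtain C where C: "\<And>n x. orthonormal x {..<n::nat} \<Longrightarrow> (\<Sum>i<n. (norm (T' (x i)))\<^sup>2) \<le> C"
      using hs' by (auto simp: hilbert_schmidt_bounded_def)
    show ?thesis unfolding hilbert_schmidt_bounded_def
    proof (intro exI allI impI)
      fix n :: nat and x :: "nat \<Rightarrow> 'a L2" assume on: "orthonormal x {..<n}"
      have "(\<Sum>i<n. (norm (T (x i)))\<^sup>2) \<le> (\<Sum>i<n. (K * norm (T' (x i)))\<^sup>2)"
        by (intro sum_mono power_mono dom) auto
      also have "\<dots> = K\<^sup>2 * (\<Sum>i<n. (norm (T' (x i)))\<^sup>2)" by (simp add: power_mult_distrib sum_distrib_left)
      also have "\<dots> \<le> K\<^sup>2 * C" by (intro mult_left_mono C on) auto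
      finally show "(\<Sum>i<n. (norm (T (x i)))\<^sup>2) \<le> K\<^sup>2 * C" .
    qed
  qed
  have comp: "compact_operator T" and comp': "compact_operator T'"
    using hilbert_schmidt_compact T(1) T'(1) hs hs' by auto
  obtain x where x: "singular_system T Ta x" using singular_system_exists[OF comp T(2)] .
  obtain x' where x': "singular_system T' Ta' x'" using singular_system_exists[OF comp' T'(2)] .
  define s where "s k = norm (T (x k))" for k
  define s' where "s' k = norm (T' (x' k))" for k
  have sv: "singular_value T = s"
    unfolding s_def by (rule singular_value_eq, rule singular_system_is_singular_value_sequence[OF T x comp])
  have s_le: "s k \<le> K * s' k" for k
    unfolding s_def s'_def by (rule singular_system_mono[OF T x x' dom K])
  have s'_sum: "(\<Sum>k<n. s' k powr q) \<le> F" for n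
  proof -
    define J where "J = {k. k < n \<and> s' k > 0}"
    have J: "finite J" "J \<subseteq> {k. norm (T' (x' k)) > 0}" by (auto simp: J_def s'_def)
    have on: "orthonormal x' J"
      by (rule orthonormal_subset[OF singular_system_orthonormal[OF T' x'] J(2)])
    have sJ: "s' k > 0" if "k \<in> J" for k using that by (simp add: J_def)
    have "(\<Sum>k<n. s' k powr q) = (\<Sum>k\<in>J. s' k powr q)"
      by (rule sum.mono_neutral_right) (auto simp: J_def s'_def)
    also have "\<dots> = (\<Sum>k\<in>J. s' k powr (q - 2) * (s' k)\<^sup>2)"
    proof (rule sum.cong[OF refl])
      fix k assume k: "k \<in> J"
      have "s' k powr q = s' k powr (q - 2) * s' k powr 2" by (simp add: powr_add[symmetric])
      then show "s' k powr q = s' k powr (q - 2) * (s' k)\<^sup>2" using sJ[OF k] by simp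
    qed
    finally have "ennreal (\<Sum>k<n. s' k powr q) = (\<Sum>k\<in>J. ennreal (s' k powr (q - 2)) * ennreal ((norm (T' (x' k)))\<^sup>2))"
      by (simp add: sum_ennreal[symmetric] ennreal_mult s'_def)
    also have "\<dots> \<le> (\<Sum>i\<in>I. \<integral>\<^sup>+\<eta>. ennreal (\<Sum>k\<in>J. s' k powr (q - 2) * (cmod (cinner (x' k) (g i \<eta>)))\<^sup>2) \<partial>M)"
      by (rule sum_frame[OF J(1)]) simp
    also have "\<dots> \<le> (\<Sum>i\<in>I. \<integral>\<^sup>+\<eta>. ennreal (b i powr (2 - q)) * G i \<eta> \<partial>M)"
    proof (intro sum_mono nn_integral_mono)
      fix i \<eta> assume i: "i \<in> I"
      let ?a = "\<lambda>k. (cmod (cinner (x' k) (g i \<eta>)))\<^sup>2"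
      have Y: "(\<Sum>k\<in>J. ?a k) \<le> (norm (g i \<eta>))\<^sup>2"
        using Bessel_inequality[OF J(1) on, of "g i \<eta>"] by (subst cinner_commute) simp
      have X: "(\<Sum>k\<in>J. ?a k / (s' k)\<^sup>2) \<le> (b i)\<^sup>2"
      proof -
        define X where "X = (\<Sum>k\<in>J. ?a k / (s' k)\<^sup>2)"
        \<comment> \<open>With these coefficients both \<open>\<langle>u, g\<rangle>\<close> and \<open>\<parallel>T' u\<parallel>\<^sup>2\<close> equal the sum to be bounded.\<close>
        define c where "c k = cinner (g i \<eta>) (x' k) / complex_of_real ((s' k)\<^sup>2)" for k
        let ?u = "\<Sum>k\<in>J. scaleC (c k) (x' k)"
        have X0: "X \<ge> 0" by (auto simp: X_def intro!: sum_nonneg)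
        have "cinner ?u (g i \<eta>) = complex_of_real X"
        proof -
          have "c k * cinner (x' k) (g i \<eta>) = complex_of_real (?a k / (s' k)\<^sup>2)" for k
          proof -
            have "cinner (g i \<eta>) (x' k) * cinner (x' k) (g i \<eta>) = complex_of_real (?a k)"
              by (simp only: complex_norm_square cinner_commute[of "g i \<eta>" "x' k"] mult.commute)
            then show ?thesis by (simp add: c_def field_simps)
          qed
          then show ?thesis by (simp add: cinner_sum_left cinner_scaleC_left X_def)
        qed
        moreover have "(norm (T' ?u))\<^sup>2 = X"
        proof -
          have "(norm (T' ?u))\<^sup>2 = (\<Sum>k\<in>J. (cmod (c k))\<^sup>2 * (s' k)\<^sup>2)"
            unfolding s'_def by (rule singular_system_norm_image[OF T' x' J])
          also have "\<dots> = X" unfolding X_def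
          proof (rule sum.cong[OF refl])
            fix k assume k: "k \<in> J"
            have "cmod (c k) = cmod (cinner (x' k) (g i \<eta>)) / (s' k)\<^sup>2"
              unfolding c_def by (subst cinner_commute) (simp add: norm_divide norm_power)
            then show "(cmod (c k))\<^sup>2 * (s' k)\<^sup>2 = ?a k / (s' k)\<^sup>2"
              using sJ[OF k] by (simp add: power_divide power2_eq_square)
          qed
          finally show ?thesis .
        qed
        ultimately have "X \<le> b i * sqrt X"
          using single[OF i, of ?u \<eta>] X0 by (metis abs_of_nonneg norm_of_real norm_ge_zero real_sqrt_unique)
        then have "sqrt X * sqrt X \<le> b i * sqrt X" using X0 by simp
        then have "X = 0 \<or> sqrt X \<le> b i"
          using X0 mult_right_le_imp_le[of "sqrt X" "sqrt X" "b i"] by (cases "X = 0") auto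
        then have "X \<le> (b i)\<^sup>2" using X0 by (auto simp: sqrt_le_D)
        then show ?thesis by (simp add: X_def)
      qed
      have "(\<Sum>k\<in>J. s' k powr (q - 2) * ?a k) \<le> b i powr (2 - q) * norm (g i \<eta>) powr q"
        by (rule sum_powr_interpolation[OF J(1) sJ _ q X Y b[OF i]]) auto
      then have "ennreal (\<Sum>k\<in>J. s' k powr (q - 2) * ?a k) \<le>
          ennreal (b i powr (2 - q)) * ennreal (norm (g i \<eta>) powr q)"
        by (simp add: ennreal_mult[symmetric] ennreal_leI)
      also have "\<dots> \<le> ennreal (b i powr (2 - q)) * G i \<eta>" by (intro mult_left_mono G(2) i) auto
      finally show "ennreal (\<Sum>k\<in>J. s' k powr (q - 2) * ?a k) \<le> ennreal (b i powr (2 - q)) * G i \<eta>" .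
    qed
    also have "\<dots> \<le> ennreal F" by (rule total')
    finally show ?thesis using F by simp
  qed
  have s_sum: "(\<Sum>k<n. s k powr q) \<le> K powr q * F" for n
  proof -
    have "(\<Sum>k<n. s k powr q) \<le> (\<Sum>k<n. K powr q * s' k powr q)"
    proof (rule sum_mono)
      fix k
      have "s k powr q \<le> (K * s' k) powr q"
        using q by (intro powr_mono2 s_le) (auto simp: s_def)
      also have "\<dots> = K powr q * s' k powr q" using K by (simp add: powr_mult s'_def)
      finally show "s k powr q \<le> K powr q * s' k powr q" .
    qed
    also have "\<dots> \<le> K powr q * F" unfolding sum_distrib_left[symmetric]
      by (intro mult_left_mono s'_sum) auto
    finally show ?thesis .
  qed
  have summ: "summable (\<lambda>k. s k powr q)"
    by (rule summableI_nonneg_bounded[OF _ s_sum]) auto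
  show "T \<in> schatten_class q" using comp summ by (simp add: schatten_class_def sv)
  have "(\<Sum>k. s k powr q) \<le> K powr q * F" by (rule suminf_le_const[OF summ s_sum])
  then show "schatten_norm q T \<le> (K powr q * F) powr (1 / q)"
    unfolding schatten_norm_def sv using q summ by (intro powr_mono2) (auto intro: suminf_nonneg)
qed

section \<open>Convergence and density in the Hilbert space\<close>

lemma square_integrable_dominated:
  fixes f :: "'a::euclidean_space \<Rightarrow> complex"
  assumes "f \<in> borel_measurable borel" "integrable lborel (\<lambda>x. (h x)\<^sup>2)"
    "AE x in lborel. cmod (f x) \<le> h x"
  shows "square_integrable f"
  unfolding square_integrable_def
proof (intro conjI assms(1))
  show "integrable lborel (\<lambda>x. (cmod (f x))\<^sup>2)"
  proof (rule Bochner_Integration.integrable_bound[OF assms(2)])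
    show "(\<lambda>x. (cmod (f x))\<^sup>2) \<in> borel_measurable lborel" using assms(1) by measurable
    show "AE x in lborel. norm ((cmod (f x))\<^sup>2) \<le> norm ((h x)\<^sup>2)"
      using assms(3) by eventually_elim (simp add: power_mono)
  qed
qed

lemma abs_L2_dominated_convergence:
  fixes f :: "nat \<Rightarrow> 'a::euclidean_space \<Rightarrow> complex"
  assumes [measurable]: "\<And>n. f n \<in> borel_measurable borel" "g \<in> borel_measurable borel"
    and lim: "AE x in lborel. (\<lambda>n. f n x) \<longlonglongrightarrow> g x"
    and h: "integrable lborel (\<lambda>x. (h x)\<^sup>2)"
    and dom: "\<And>n. AE x in lborel. cmod (f n x) \<le> h x"
  shows "(\<lambda>n. abs_L2 (f n)) \<longlonglongrightarrow> abs_L2 g"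
proof -
  have fs: "square_integrable (f n)" for n
    by (rule square_integrable_dominated[OF _ h dom]) simp
  have g_dom: "AE x in lborel. cmod (g x) \<le> h x"
  proof -
    have "AE x in lborel. \<forall>n. cmod (f n x) \<le> h x" using dom by (simp add: AE_all_countable)
    with lim show ?thesis
    proof eventually_elim
      case (elim x)
      show ?case by (rule LIMSEQ_le_const2[OF tendsto_norm[OF elim(1)]]) (use elim(2) in auto)
    qed
  qed
  have gs: "square_integrable g"
    by (rule square_integrable_dominated[OF _ h g_dom]) simp
  have "(\<lambda>n. LINT x|lborel. (cmod (f n x - g x))\<^sup>2) \<longlonglongrightarrow> (LINT x|(lborel :: 'a measure). (0::real))"
  proof (rule integral_dominated_convergence[where w = "\<lambda>x. 4 * (h x)\<^sup>2"])
    show "integrable lborel (\<lambda>x. 4 * (h x)\<^sup>2)" using h by simp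
    show "AE x in lborel. (\<lambda>n. (cmod (f n x - g x))\<^sup>2) \<longlonglongrightarrow> 0" using lim
    proof eventually_elim
      case (elim x)
      have "(\<lambda>n. (cmod (f n x - g x))\<^sup>2) \<longlonglongrightarrow> (cmod (g x - g x))\<^sup>2" by (intro tendsto_intros elim)
      then show ?case by simp
    qed
    show "AE x in lborel. norm ((cmod (f n x - g x))\<^sup>2) \<le> 4 * (h x)\<^sup>2" for n
      using dom[of n] g_dom
    proof eventually_elim
      case (elim x)
      have "cmod (f n x - g x) \<le> 2 * h x" using norm_triangle_ineq4[of "f n x" "g x"] elim by simp
      then have "(cmod (f n x - g x))\<^sup>2 \<le> (2 * h x)\<^sup>2" by (rule power_mono) simp
      then show ?case by (simp add: power_mult_distrib)
    qed
  qed auto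
  then have "(\<lambda>n. (norm (abs_L2 (f n) - abs_L2 g))\<^sup>2) \<longlonglongrightarrow> 0"
    by (simp add: abs_L2_diff fs gs norm_abs_L2 square_integrable_diff)
  then have "(\<lambda>n. sqrt ((norm (abs_L2 (f n) - abs_L2 g))\<^sup>2)) \<longlonglongrightarrow> sqrt 0"
    by (rule tendsto_real_sqrt)
  then have "(\<lambda>n. norm (abs_L2 (f n) - abs_L2 g)) \<longlonglongrightarrow> 0" by simp
  then show ?thesis by (simp add: LIM_zero_iff tendsto_norm_zero_iff)
qed

lemma L2_Fatou:
  fixes F :: "nat \<Rightarrow> 'a::euclidean_space \<Rightarrow> complex"
  assumes F: "\<And>n. square_integrable (F n)" and [measurable]: "f \<in> borel_measurable borel"
    and lim: "AE x in lborel. (\<lambda>n. F n x) \<longlonglongrightarrow> f x"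
    and bound: "\<forall>\<^sub>F n in sequentially. norm (abs_L2 (F n)) \<le> c" and c: "c \<ge> 0"
  shows "square_integrable f" and "norm (abs_L2 f) \<le> c"
proof -
  have [measurable]: "F n \<in> borel_measurable borel" for n by (rule borel_square_integrable[OF F])
  have "(\<integral>\<^sup>+x. ennreal ((cmod (f x))\<^sup>2) \<partial>lborel)
      = (\<integral>\<^sup>+x. liminf (\<lambda>n. ennreal ((cmod (F n x))\<^sup>2)) \<partial>lborel)"
  proof (rule nn_integral_cong_AE, use lim in eventually_elim)
    case (elim x)
    have "(\<lambda>n. ennreal ((cmod (F n x))\<^sup>2)) \<longlonglongrightarrow> ennreal ((cmod (f x))\<^sup>2)"
      using elim by (intro tendsto_intros)
    from lim_imp_Liminf[OF trivial_limit_sequentially this] show ?case by simp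
  qed
  also have "\<dots> \<le> liminf (\<lambda>n. \<integral>\<^sup>+x. ennreal ((cmod (F n x))\<^sup>2) \<partial>lborel)"
    by (rule nn_integral_liminf) auto
  also have "\<dots> \<le> ennreal (c\<^sup>2)"
  proof (rule Liminf_le)
    show "\<forall>\<^sub>F n in sequentially. (\<integral>\<^sup>+x. ennreal ((cmod (F n x))\<^sup>2) \<partial>lborel) \<le> ennreal (c\<^sup>2)"
      using bound
    proof eventually_elim
      case (elim n)
      then show ?case unfolding ennreal_norm_abs_L2[OF F, symmetric]
        by (intro ennreal_leI power_mono) auto
    qed
  qed auto
  finally have le: "(\<integral>\<^sup>+x. ennreal ((cmod (f x))\<^sup>2) \<partial>lborel) \<le> ennreal (c\<^sup>2)" .
  show f: "square_integrable f"
    by (rule square_integrableI_nn) (use le in \<open>auto intro: le_less_trans\<close>)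
  have "ennreal ((norm (abs_L2 f))\<^sup>2) \<le> ennreal (c\<^sup>2)" unfolding ennreal_norm_abs_L2[OF f] by (rule le)
  then have "(norm (abs_L2 f))\<^sup>2 \<le> c\<^sup>2" by (subst (asm) ennreal_le_iff) auto
  then show "norm (abs_L2 f) \<le> c" by (rule power2_le_imp_le) (rule c)
qed

lemma square_integrable_indicator:
  assumes "A \<in> sets borel" "emeasure lborel A < \<infinity>"
  shows "square_integrable (indicator A :: 'a::euclidean_space \<Rightarrow> complex)"
proof (rule square_integrableI_nn)
  have "(\<integral>\<^sup>+x. ennreal ((cmod (indicator A x))\<^sup>2) \<partial>lborel) = (\<integral>\<^sup>+x. indicator A x \<partial>lborel)"
    by (intro nn_integral_cong) (auto simp: indicator_def)
  also have "\<dots> = emeasure lborel A" using assms by simp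
  finally show "(\<integral>\<^sup>+x. ennreal ((cmod (indicator A x))\<^sup>2) \<partial>lborel) < \<infinity>" using assms by simp
qed (use assms in measurable)

lemma square_integrable_mult_indicator:
  assumes "square_integrable f" "A \<in> sets borel"
  shows "square_integrable (\<lambda>x. indicator A x * f x)"
proof (rule square_integrable_dominated[where h = "\<lambda>x. cmod (f x)"])
  note [measurable] = borel_square_integrable[OF assms(1)] assms(2)
  show "(\<lambda>x. indicator A x * f x) \<in> borel_measurable borel" by measurable
  show "integrable lborel (\<lambda>x. (cmod (f x))\<^sup>2)" by (rule integrable_square_integrable[OF assms(1)])
qed (auto simp: indicator_def)

lemma abs_L2_sum:
  assumes "finite S" "\<And>i. i \<in> S \<Longrightarrow> square_integrable (f i)"
  shows "square_integrable (\<lambda>x. \<Sum>i\<in>S. f i x) \<and> abs_L2 (\<lambda>x. \<Sum>i\<in>S. f i x) = (\<Sum>i\<in>S. abs_L2 (f i))"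
  using assms
  by (induction S) (auto simp: square_integrable_zero abs_L2_zero abs_L2_add[symmetric] square_integrable_add)

text \<open>Boxes generate the Borel sets and are closed under intersection, so a closed subspace that
  contains their indicators contains the indicators of all Borel sets of finite extent, hence the
  simple functions, hence everything.\<close>

lemma L2_closed_subspace_UNIV:
  fixes V :: "'a::euclidean_space L2 set"
  assumes add: "\<And>u v. u \<in> V \<Longrightarrow> v \<in> V \<Longrightarrow> u + v \<in> V"
    and scale: "\<And>c u. u \<in> V \<Longrightarrow> scaleC c u \<in> V"
    and lim: "\<And>X u. (\<And>n::nat. X n \<in> V) \<Longrightarrow> X \<longlonglongrightarrow> u \<Longrightarrow> u \<in> V"
    and boxes: "\<And>a b. abs_L2 (indicator (box a b)) \<in> V"
  shows "u \<in> V"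
proof -
  define B where "B n = box (- (real n *\<^sub>R One)) (real n *\<^sub>R One :: 'a)" for n
  have [measurable]: "B n \<in> sets borel" for n by (simp add: B_def)
  have B_fin: "emeasure lborel (B n) < \<infinity>" for n
    unfolding B_def by (rule emeasure_lborel_box_finite)
  have fin: "emeasure lborel (A \<inter> B n) < \<infinity>" if "A \<in> sets borel" for A n
    by (rule le_less_trans[OF emeasure_mono B_fin[of n]]) auto
  have zero: "0 \<in> V" using scale[OF boxes, of 0] by simp
  have sum: "(\<Sum>i\<in>S. f i) \<in> V" if "finite S" "\<And>i. i \<in> S \<Longrightarrow> f i \<in> V" for S :: "'c set" and f
    using that by (induction S) (auto intro: zero add)
  have ind: "abs_L2 (indicator (A \<inter> B n)) \<in> V" if "A \<in> sets borel" for A n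
  proof -
    have "Int_stable (range (\<lambda>(a, b). box a b :: 'a set))"
      by (auto simp: Int_stable_def box_Int_box)
    moreover have "range (\<lambda>(a, b). box a b :: 'a set) \<subseteq> Pow UNIV" by simp
    moreover have "A \<in> sigma_sets UNIV (range (\<lambda>(a, b). box a b :: 'a set))"
      using that unfolding borel_eq_box by (subst (asm) sets_measure_of) auto
    ultimately show ?thesis
    proof (induction rule: sigma_sets_induct_disjoint)
      case (basic A)
      then show ?case by (auto simp: B_def box_Int_box boxes)
    next
      case empty
      have "(indicator ({} \<inter> B n) :: 'a \<Rightarrow> complex) = (\<lambda>_. 0)" by (auto simp: indicator_def)
      then show ?case by (simp only: abs_L2_zero zero)
    next
      case (compl A)
      then have [measurable]: "A \<in> sets borel"
        unfolding borel_eq_box by (subst sets_measure_of) auto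
      have "(indicator ((UNIV - A) \<inter> B n) :: 'a \<Rightarrow> complex) =
          (\<lambda>x. indicator (UNIV \<inter> B n) x + (- 1) * indicator (A \<inter> B n) x)"
        by (auto simp: indicator_def)
      then have "abs_L2 (indicator ((UNIV - A) \<inter> B n)) =
          abs_L2 (indicator (B n)) + scaleC (- 1) (abs_L2 (indicator (A \<inter> B n)))"
        using B_fin fin
        by (simp only:) (subst abs_L2_scaleC, simp add: square_integrable_indicator fin,
            subst abs_L2_add, auto intro!: square_integrable_indicator square_integrable_scale
              square_integrable_uminus simp: fin)
      moreover have "abs_L2 (indicator (B n)) \<in> V" by (simp add: B_def boxes)
      ultimately show ?case using add[OF _ scale[OF compl(2), of "- 1"]] by (simp only:)
    next
      case (union A)
      have [measurable]: "A i \<in> sets borel" for i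
        using union(2) unfolding borel_eq_box by (subst sets_measure_of) auto
      have disj: "disjoint_family A" by fact
      have *: "(\<Sum>i<m. indicator (A i \<inter> B n) x) = (indicator ((\<Union>i<m. A i) \<inter> B n) x :: complex)" for m x
      proof (induction m)
        case (Suc m)
        have "x \<in> A m \<Longrightarrow> x \<notin> (\<Union>i<m. A i)" 
        proof
          assume x: "x \<in> A m" "x \<in> (\<Union>i<m. A i)"
          then obtain i where i: "i < m" "x \<in> A i" by auto
          then have "A i \<inter> A m = {}" using disj by (simp add: disjoint_family_on_def)
          then show False using i x by auto
        qed
        then show ?case using Suc by (auto simp: indicator_def less_Suc_eq)
      qed simp
      have "(\<lambda>m. \<Sum>i<m. abs_L2 (indicator (A i \<inter> B n))) \<longlonglongrightarrow> abs_L2 (indicator ((\<Union>i. A i) \<inter> B n))"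
      proof -
        have "(\<Sum>i<m. abs_L2 (indicator (A i \<inter> B n))) =
            abs_L2 (indicator ((\<Union>i<m. A i) \<inter> B n) :: 'a \<Rightarrow> complex)" for m
        proof -
          have sq: "square_integrable (indicator (A i \<inter> B n) :: 'a \<Rightarrow> complex)" for i
            by (intro square_integrable_indicator fin) auto
          show ?thesis using abs_L2_sum[of "{..<m}" "\<lambda>i. indicator (A i \<inter> B n)", OF finite_lessThan sq]
            by (simp add: *)
        qed
        moreover have "(\<lambda>m. abs_L2 (indicator ((\<Union>i<m. A i) \<inter> B n) :: 'a \<Rightarrow> complex))
            \<longlonglongrightarrow> abs_L2 (indicator ((\<Union>i. A i) \<inter> B n))"
        proof (rule abs_L2_dominated_convergence[where h = "\<lambda>x. cmod (indicator (B n) x)"])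
          show "AE x in lborel. (\<lambda>m. indicator ((\<Union>i<m. A i) \<inter> B n) x)
              \<longlonglongrightarrow> (indicator ((\<Union>i. A i) \<inter> B n) x :: complex)"
          proof (rule AE_I2)
            fix x :: 'a
            have "\<forall>\<^sub>F m in sequentially. x \<in> (\<Union>i. A i) \<longrightarrow> x \<in> (\<Union>i<m. A i)"
            proof (cases "x \<in> (\<Union>i. A i)")
              case True
              then obtain i where i: "x \<in> A i" by auto
              show ?thesis using eventually_gt_at_top[of i]
                by eventually_elim (use i in auto)
            qed simp
            then have "\<forall>\<^sub>F m in sequentially. indicator ((\<Union>i<m. A i) \<inter> B n) x =
                (indicator ((\<Union>i. A i) \<inter> B n) x :: complex)"
              by eventually_elim (auto simp: indicator_def)
            then show "(\<lambda>m. indicator ((\<Union>i<m. A i) \<inter> B n) x)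
              \<longlonglongrightarrow> (indicator ((\<Union>i. A i) \<inter> B n) x :: complex)"
              by (rule tendsto_eventually)
          qed
          show "integrable lborel (\<lambda>x. (cmod (indicator (B n) x))\<^sup>2)"
            using square_integrable_indicator[of "B n"] B_fin by (simp add: square_integrable_def)
        qed (auto simp: indicator_def)
        ultimately show ?thesis by simp
      qed
      then show ?case by (rule lim[rotated]) (auto intro!: sum union)
    qed
  qed
  obtain f where f: "square_integrable f" "u = abs_L2 f" by (rule L2_cases)
  note [measurable] = borel_square_integrable[OF f(1)]
  obtain F where F: "\<And>i. simple_function borel (F i)" "\<And>x. (\<lambda>i. F i x) \<longlonglongrightarrow> f x"
    "\<And>i x. cmod (F i x) \<le> 2 * cmod (f x)"
    using borel_measurable_implies_sequence_metric[of f borel 0] by auto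
  have [measurable]: "F i \<in> borel_measurable borel" for i
    by (rule borel_measurable_simple_function[OF F(1)])
  define s where "s i x = F i x * indicator (B i) x" for i x
  have [measurable]: "s i \<in> borel_measurable borel" for i unfolding s_def by measurable
  have "(\<lambda>i. abs_L2 (s i)) \<longlonglongrightarrow> u" unfolding f(2)
  proof (rule abs_L2_dominated_convergence[where h = "\<lambda>x. 2 * cmod (f x)"])
    show "AE x in lborel. (\<lambda>i. s i x) \<longlonglongrightarrow> f x"
    proof (rule AE_I2)
      fix x
      obtain m where m: "x \<in> B m" using UN_box_eq_UNIV unfolding B_def by blast
      have "\<forall>\<^sub>F i in sequentially. F i x = s i x"
        using eventually_ge_at_top[of m]
      proof eventually_elim
        case (elim i)
        have "B m \<subseteq> B i" unfolding B_def using elim by (auto simp: mem_box)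
          (smt (verit, best) of_nat_mono)+
        then show ?case using m by (auto simp: s_def)
      qed
      from Lim_transform_eventually[OF F(2) this] show "(\<lambda>i. s i x) \<longlonglongrightarrow> f x" .
    qed
    show "integrable lborel (\<lambda>x. (2 * cmod (f x))\<^sup>2)"
      using integrable_square_integrable[OF f(1)] by (simp add: power_mult_distrib)
    show "AE x in lborel. cmod (s i x) \<le> 2 * cmod (f x)" for i
      using F(3) by (auto simp: s_def indicator_def)
  qed auto
  moreover have "abs_L2 (s i) \<in> V" for i
  proof -
    have fr: "finite (range (F i))" using F(1)[of i] by (auto simp: simple_function_def)
    have meas: "F i -` {c} \<in> sets borel" for c
      using measurable_sets[of "F i" borel borel "{c}"] by simp
    have s_eq: "s i = (\<lambda>x. \<Sum>c\<in>range (F i). c * indicator (F i -` {c} \<inter> B i) x)"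
    proof
      fix x
      have "(\<Sum>c\<in>range (F i). c * indicator (F i -` {c} \<inter> B i) x) =
          (\<Sum>c\<in>range (F i). if c = F i x then F i x * indicator (B i) x else 0)"
        by (intro sum.cong) (auto simp: indicator_def)
      then show "s i x = (\<Sum>c\<in>range (F i). c * indicator (F i -` {c} \<inter> B i) x)"
        using fr by (simp add: s_def)
    qed
    have "abs_L2 (s i) = (\<Sum>c\<in>range (F i). abs_L2 (\<lambda>x. c * indicator (F i -` {c} \<inter> B i) x))"
    proof -
      have sq: "square_integrable (\<lambda>x. c * indicator (F i -` {c} \<inter> B i) x)" for c
        by (intro square_integrable_scale square_integrable_indicator fin meas sets.Int) auto
      show ?thesis unfolding s_eq
        using abs_L2_sum[of "range (F i)" "\<lambda>c x. c * indicator (F i -` {c} \<inter> B i) x", OF fr sq]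
        by blast
    qed
    also have "\<dots> = (\<Sum>c\<in>range (F i). scaleC c (abs_L2 (indicator (F i -` {c} \<inter> B i))))"
      by (intro sum.cong refl, subst abs_L2_scaleC)
        (auto intro!: square_integrable_indicator fin meas)
    also have "\<dots> \<in> V" by (intro sum fr scale ind meas)
    finally show ?thesis .
  qed
  ultimately show "u \<in> V" by (rule lim[rotated])
qed

section \<open>The Plancherel theorem\<close>

lemma borel_measurable_cis [measurable (raw)]:
  assumes "f \<in> borel_measurable M"
  shows "(\<lambda>x. cis (f x)) \<in> borel_measurable M"
proof (rule measurable_compose[OF assms])
  show "cis \<in> borel_measurable borel"
    unfolding cis_conv_exp[abs_def] by (intro borel_measurable_continuous_onI continuous_intros)
qed

lemma borel_measurable_cnj [measurable (raw)]:
  assumes "f \<in> borel_measurable M"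
  shows "(\<lambda>x. cnj (f x)) \<in> borel_measurable M"
  by (rule measurable_compose[OF assms]) (intro borel_measurable_continuous_onI continuous_intros)

lemma lborel_integrable_prod:
  fixes f :: "'a::euclidean_space \<Rightarrow> real \<Rightarrow> complex"
  assumes f: "\<And>b. b \<in> Basis \<Longrightarrow> integrable lborel (f b)"
  shows "integrable lborel (\<lambda>x::'a. \<Prod>b\<in>Basis. f b (x \<bullet> b))"
    and "(LINT x|lborel. (\<Prod>b\<in>Basis. f b ((x::'a) \<bullet> b))) = (\<Prod>b\<in>Basis. (LINT t|lborel. f b t))"
proof -
  interpret product_sigma_finite "\<lambda>_::'a. lborel :: real measure" by standard
  let ?P = "\<Pi>\<^sub>M b\<in>Basis. lborel :: ('a \<Rightarrow> real) measure"
  let ?T = "\<lambda>f. \<Sum>b\<in>Basis. f b *\<^sub>R (b::'a)"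
  have eq: "lborel = distr ?P borel ?T"
    by (subst lborel_def) (simp add: lborel_eq_real)
  have [measurable]: "f b \<in> borel_measurable borel" if "b \<in> Basis" for b
    using borel_measurable_integrable[OF f[OF that]] by simp
  have T[measurable]: "?T \<in> measurable ?P borel" by measurable
  have m: "(\<lambda>x::'a. \<Prod>b\<in>Basis. f b (x \<bullet> b)) \<in> borel_measurable borel"
    by (intro borel_measurable_prod) measurable
  have T_inner: "(\<Prod>b\<in>Basis. f b (?T g \<bullet> b)) = (\<Prod>b\<in>Basis. f b (g b))" for g
    by (intro prod.cong refl) simp
  show "integrable lborel (\<lambda>x::'a. \<Prod>b\<in>Basis. f b (x \<bullet> b))"
    unfolding eq by (subst integrable_distr_eq[OF T m], simp only: T_inner)
      (rule product_integrable_prod[OF finite_Basis f])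
  show "(LINT x|lborel. (\<Prod>b\<in>Basis. f b ((x::'a) \<bullet> b))) = (\<Prod>b\<in>Basis. (LINT t|lborel. f b t))"
    unfolding eq by (subst integral_distr[OF T m], simp only: T_inner)
      (rule product_integral_prod[OF finite_Basis f])
qed

lemma lborel_integral_affine:
  fixes f :: "'a::euclidean_space \<Rightarrow> 'b::{banach, second_countable_topology}"
  assumes [measurable]: "f \<in> borel_measurable borel" and c: "c \<noteq> 0"
  shows "(LINT x|lborel. f x) = \<bar>c\<bar> ^ DIM('a) *\<^sub>R (LINT x|lborel. f (t + c *\<^sub>R x))"
proof -
  have "(LINT x|lborel. f x) =
      integral\<^sup>L (density (distr lborel borel (\<lambda>x::'a. t + c *\<^sub>R x)) (\<lambda>_. ennreal (\<bar>c\<bar> ^ DIM('a)))) f"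
    by (subst lborel_affine[OF c, of t]) simp
  also have "\<dots> = (LINT x|distr lborel borel (\<lambda>x::'a. t + c *\<^sub>R x). \<bar>c\<bar> ^ DIM('a) *\<^sub>R f x)"
    by (rule integral_density) auto
  also have "\<dots> = (LINT x|lborel. \<bar>c\<bar> ^ DIM('a) *\<^sub>R f (t + c *\<^sub>R x))"
    by (rule integral_distr) auto
  finally show ?thesis by simp
qed

lemma lborel_nn_integral_affine:
  fixes f :: "'a::euclidean_space \<Rightarrow> ennreal"
  assumes [measurable]: "f \<in> borel_measurable borel" and c: "c \<noteq> 0"
  shows "(\<integral>\<^sup>+x. f x \<partial>lborel) = ennreal (\<bar>c\<bar> ^ DIM('a)) * (\<integral>\<^sup>+x. f (t + c *\<^sub>R x) \<partial>lborel)"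
proof -
  have "(\<integral>\<^sup>+x. f x \<partial>lborel) =
      integral\<^sup>N (density (distr lborel borel (\<lambda>x::'a. t + c *\<^sub>R x)) (\<lambda>_. ennreal (\<bar>c\<bar> ^ DIM('a)))) f"
    by (subst lborel_affine[OF c, of t]) simp
  also have "\<dots> = (\<integral>\<^sup>+x. ennreal (\<bar>c\<bar> ^ DIM('a)) * f (t + c *\<^sub>R x) \<partial>lborel)"
    by (subst nn_integral_density) (auto simp: nn_integral_distr)
  also have "\<dots> = ennreal (\<bar>c\<bar> ^ DIM('a)) * (\<integral>\<^sup>+x. f (t + c *\<^sub>R x) \<partial>lborel)"
    by (rule nn_integral_cmult) auto
  finally show ?thesis .
qed

definition fourier :: "('a::euclidean_space \<Rightarrow> complex) \<Rightarrow> 'a \<Rightarrow> complex" where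
  "fourier f \<xi> = (LINT x|lborel. cis (- (x \<bullet> \<xi>)) * f x)"

definition gauss :: "'a::euclidean_space \<Rightarrow> real" where
  "gauss \<xi> = exp (- (norm \<xi>)\<^sup>2 / 2)"

lemma gauss_borel [measurable]: "gauss \<in> borel_measurable borel"
  unfolding gauss_def by measurable

lemma gauss_bounds: "0 < gauss \<xi>" "gauss \<xi> \<le> 1"
  by (auto simp: gauss_def)

lemma gauss_real_fourier:
  "integrable lborel (\<lambda>t. cis (- (t * s)) * complex_of_real (exp (- t\<^sup>2 / 2)))"
  "(LINT t|lborel. cis (- (t * s)) * complex_of_real (exp (- t\<^sup>2 / 2))) =
    complex_of_real (sqrt (2 * pi) * exp (- s\<^sup>2 / 2))"
proof -
  have e: "exp (- t\<^sup>2 / 2) = sqrt (2 * pi) * std_normal_density t" for t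
    by (simp add: std_normal_density_def)
  have int: "integrable lborel (\<lambda>t. sqrt (2 * pi) * std_normal_density t)"
    by (intro integrable_mult_right integrable_normal_density) simp
  show 1: "integrable lborel (\<lambda>t. cis (- (t * s)) * complex_of_real (exp (- t\<^sup>2 / 2)))"
    unfolding e by (rule Bochner_Integration.integrable_bound[OF int]) (auto simp: norm_mult)
  have "(LINT t|lborel. cis (- (t * s)) * complex_of_real (exp (- t\<^sup>2 / 2))) =
      complex_of_real (sqrt (2 * pi)) * (LINT t|lborel. std_normal_density t *\<^sub>R cis ((- s) * t))"
    unfolding e by (subst integral_mult_right_zero[symmetric])
      (auto intro!: Bochner_Integration.integral_cong simp: scaleR_conv_of_real mult_ac)
  also have "(LINT t|lborel. std_normal_density t *\<^sub>R cis ((- s) * t)) = char std_normal_distribution (- s)"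
    unfolding char_def by (subst integral_density) (auto simp: cis_conv_exp)
  also have "\<dots> = complex_of_real (exp (- s\<^sup>2 / 2))" by (simp add: char_std_normal_distribution)
  finally show "(LINT t|lborel. cis (- (t * s)) * complex_of_real (exp (- t\<^sup>2 / 2))) =
    complex_of_real (sqrt (2 * pi) * exp (- s\<^sup>2 / 2))" by simp
qed

lemma cis_inner_prod:
  fixes x \<xi> :: "'a::euclidean_space"
  shows "cis (- (x \<bullet> \<xi>)) = (\<Prod>b\<in>Basis. cis (- ((x \<bullet> b) * (\<xi> \<bullet> b))))"
  unfolding cis_conv_exp euclidean_inner[of x \<xi>]
  by (simp add: exp_sum sum_negf[symmetric] sum_distrib_left)

lemma gauss_prod: "gauss (x::'a::euclidean_space) = (\<Prod>b\<in>Basis. exp (- (x \<bullet> b)\<^sup>2 / 2))"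
  unfolding gauss_def power2_norm_eq_inner euclidean_inner[of x x]
  by (simp add: exp_sum[symmetric] sum_negf[symmetric] sum_divide_distrib power2_eq_square)

lemma gauss_fourier:
  fixes z :: "'a::euclidean_space"
  shows "integrable lborel (\<lambda>\<xi>::'a. cis (- (\<xi> \<bullet> z)) * complex_of_real (gauss \<xi>))"
    and "fourier (\<lambda>\<xi>. complex_of_real (gauss \<xi>)) z = complex_of_real (sqrt (2 * pi) ^ DIM('a) * gauss z)"
proof -
  have eq: "cis (- (\<xi> \<bullet> z)) * complex_of_real (gauss \<xi>) =
      (\<Prod>b\<in>Basis. cis (- ((\<xi> \<bullet> b) * (z \<bullet> b))) * complex_of_real (exp (- (\<xi> \<bullet> b)\<^sup>2 / 2)))" for \<xi> :: 'a
    by (simp add: cis_inner_prod gauss_prod prod.distrib)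
  show "integrable lborel (\<lambda>\<xi>::'a. cis (- (\<xi> \<bullet> z)) * complex_of_real (gauss \<xi>))"
    unfolding eq
    by (rule lborel_integrable_prod(1)[of "\<lambda>b t. cis (- (t * (z \<bullet> b))) * complex_of_real (exp (- t\<^sup>2 / 2))"])
      (rule gauss_real_fourier(1))
  have "fourier (\<lambda>\<xi>. complex_of_real (gauss \<xi>)) z =
      (\<Prod>b\<in>(Basis::'a set). (LINT t|lborel. cis (- (t * (z \<bullet> b))) * complex_of_real (exp (- t\<^sup>2 / 2))))"
    unfolding fourier_def eq
    by (rule lborel_integrable_prod(2)[of "\<lambda>b t. cis (- (t * (z \<bullet> b))) * complex_of_real (exp (- t\<^sup>2 / 2))"])
      (rule gauss_real_fourier(1))
  also have "\<dots> = complex_of_real (sqrt (2 * pi) ^ DIM('a) * gauss z)"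
    unfolding gauss_real_fourier(2) gauss_prod by (simp add: prod.distrib)
  finally show "fourier (\<lambda>\<xi>. complex_of_real (gauss \<xi>)) z = complex_of_real (sqrt (2 * pi) ^ DIM('a) * gauss z)" .
qed

lemma integrable_gauss: "integrable lborel (gauss :: 'a::euclidean_space \<Rightarrow> real)"
proof -
  have "integrable lborel (\<lambda>\<xi>::'a. cmod (cis (- (\<xi> \<bullet> 0)) * complex_of_real (gauss \<xi>)))"
    by (rule integrable_norm[OF gauss_fourier(1)])
  then show ?thesis by (simp add: norm_mult gauss_bounds(1) less_imp_le)
qed

lemma integral_gauss: "(LINT \<xi>|lborel. gauss (\<xi>::'a::euclidean_space)) = sqrt (2 * pi) ^ DIM('a)"
proof -
  have "complex_of_real (LINT \<xi>|lborel. gauss (\<xi>::'a)) = fourier (\<lambda>\<xi>::'a. complex_of_real (gauss \<xi>)) 0"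
    by (simp add: fourier_def)
  also have "\<dots> = complex_of_real (sqrt (2 * pi) ^ DIM('a))"
    by (simp only: gauss_fourier(2)) (simp add: gauss_def)
  finally show ?thesis by (simp only: of_real_eq_iff)
qed

lemma integrable_gauss_scaled:
  assumes e: "e > 0"
  shows "integrable lborel (\<lambda>\<xi>::'a::euclidean_space. gauss (e *\<^sub>R \<xi>))"
proof -
  have "integrable (density (distr lborel borel (\<lambda>x::'a. 0 + e *\<^sub>R x)) (\<lambda>_. ennreal (\<bar>e\<bar> ^ DIM('a)))) (\<lambda>\<xi>::'a. gauss \<xi>)"
    using lborel_affine[of e "0::'a"] e integrable_gauss by simp
  then show ?thesis using e
    by (subst (asm) integrable_density) (auto simp: integrable_distr_eq)
qed

lemma gauss_scaled_fourier:
  fixes z :: "'a::euclidean_space"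
  assumes e: "e > 0"
  shows "(LINT \<xi>|lborel. cis (- (z \<bullet> \<xi>)) * complex_of_real (gauss (e *\<^sub>R \<xi>))) =
    complex_of_real (sqrt (2 * pi) ^ DIM('a) * gauss ((1 / e) *\<^sub>R z) / e ^ DIM('a))"
proof -
  have "fourier (\<lambda>\<xi>. complex_of_real (gauss \<xi>)) ((1 / e) *\<^sub>R z) =
      \<bar>e\<bar> ^ DIM('a) *\<^sub>R (LINT \<xi>|lborel. cis (- ((0 + e *\<^sub>R \<xi>) \<bullet> ((1 / e) *\<^sub>R z))) *
        complex_of_real (gauss (0 + e *\<^sub>R \<xi>)))"
    unfolding fourier_def by (rule lborel_integral_affine) (use e in auto)
  also have "\<dots> = complex_of_real (e ^ DIM('a)) *
      (LINT \<xi>|lborel. cis (- (z \<bullet> \<xi>)) * complex_of_real (gauss (e *\<^sub>R \<xi>)))"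
    using e by (simp add: scaleR_conv_of_real inner_commute)
  finally show ?thesis using e by (simp add: gauss_fourier(2) field_simps)
qed

lemma integrable_cis_mult:
  assumes "integrable M f" "g \<in> borel_measurable M"
  shows "integrable M (\<lambda>x. cis (g x) * f x)"
proof (rule Bochner_Integration.integrable_bound[OF assms(1)])
  show "(\<lambda>x. cis (g x) * f x) \<in> borel_measurable M"
    using assms borel_measurable_integrable[OF assms(1)] by measurable
qed (simp add: norm_mult)

lemma fourier_borel [measurable]:
  assumes [measurable]: "f \<in> borel_measurable borel"
  shows "fourier f \<in> borel_measurable borel"
  unfolding fourier_def by measurable

lemma fourier_bound:
  assumes "integrable lborel f"
  shows "cmod (fourier f \<xi>) \<le> (LINT x|lborel. cmod (f x))"
proof -
  have "cmod (fourier f \<xi>) \<le> (LINT x|lborel. cmod (cis (- (x \<bullet> \<xi>)) * f x))"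
    unfolding fourier_def by (rule integral_norm_bound)
  then show ?thesis by (simp add: norm_mult)
qed

lemma fourier_diff:
  assumes "integrable lborel f" "integrable lborel g"
  shows "fourier (\<lambda>x. f x - g x) \<xi> = fourier f \<xi> - fourier g \<xi>"
  unfolding fourier_def
  by (subst Bochner_Integration.integral_diff[symmetric])
    (auto intro!: integrable_cis_mult assms simp: right_diff_distrib)

text \<open>The Gaussian factor makes the triple integral behind \<open>|\<hat>f|\<^sup>2\<close> absolutely convergent; by Fubini's
  theorem its Fourier transform, a narrow Gaussian, then averages \<open>f\<close> at scale \<open>e\<close>.\<close>

lemma fourier_gauss_mean:
  fixes f :: "'a::euclidean_space \<Rightarrow> complex"
  assumes f: "integrable lborel f" and e: "e > 0"
  shows "complex_of_real (LINT \<xi>|lborel. (cmod (fourier f \<xi>))\<^sup>2 * gauss (e *\<^sub>R \<xi>)) =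
    (LINT x|lborel. f x * (LINT z|lborel. cnj (f (x - e *\<^sub>R z)) * complex_of_real (sqrt (2 * pi) ^ DIM('a) * gauss z)))"
proof -
  have fm[measurable]: "f \<in> borel_measurable borel" using borel_measurable_integrable[OF f] by simp
  let ?M = "lborel \<Otimes>\<^sub>M lborel :: ('a \<times> 'a) measure"
  let ?g = "\<lambda>p. f (fst p) * cnj (f (snd p))"
  interpret P: pair_sigma_finite lborel ?M ..
  have g: "integrable ?M ?g"
  proof (rule lborel_pair.Fubini_integrable)
    show "integrable lborel (\<lambda>x. LINT y|lborel. norm (?g (x, y)))"
      using f by (simp add: norm_mult)
    show "AE x in lborel. integrable lborel (\<lambda>y. ?g (x, y))" using f by simp
  qed measurable
  note ge = integrable_gauss_scaled[OF e, where 'a = 'a]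
  let ?h = "\<lambda>\<xi> p. cis (- ((fst p - snd p) \<bullet> \<xi>)) * complex_of_real (gauss (e *\<^sub>R \<xi>)) * ?g p"
  have int: "integrable (lborel \<Otimes>\<^sub>M ?M) (case_prod ?h)"
  proof (rule P.Fubini_integrable)
    show "case_prod ?h \<in> borel_measurable (lborel \<Otimes>\<^sub>M ?M)" by measurable
    show "integrable lborel (\<lambda>\<xi>. LINT p|?M. norm (case (\<xi>, p) of (\<xi>, p) \<Rightarrow> ?h \<xi> p))"
      using ge by (simp add: norm_mult gauss_bounds less_imp_le mult.assoc integrable_mult_left)
    show "AE \<xi> in lborel. integrable ?M (\<lambda>p. case (\<xi>, p) of (\<xi>, p) \<Rightarrow> ?h \<xi> p)"
    proof (rule AE_I2)
      fix \<xi> :: 'a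
      show "integrable ?M (\<lambda>p. case (\<xi>, p) of (\<xi>, p) \<Rightarrow> ?h \<xi> p)"
        by (rule Bochner_Integration.integrable_bound[OF g])
          (auto simp: norm_mult gauss_bounds less_imp_le intro!: mult_left_le_one_le)
    qed
  qed
  have sq: "complex_of_real ((cmod (fourier f \<xi>))\<^sup>2 * gauss (e *\<^sub>R \<xi>)) = (LINT p|?M. ?h \<xi> p)" for \<xi>
  proof -
    let ?k = "\<lambda>(x, y). (cis (- (x \<bullet> \<xi>)) * f x) * cnj (cis (- (y \<bullet> \<xi>)) * f y)"
    have k: "?k p = cis (- ((fst p - snd p) \<bullet> \<xi>)) * ?g p" for p
      by (cases p) (simp add: cis_cnj cis_mult inner_diff_left mult_ac)
    have ik: "integrable ?M ?k"
    proof (rule Bochner_Integration.integrable_bound[OF g])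
      show "?k \<in> borel_measurable ?M" by measurable
    qed (auto simp: norm_mult)
    have "complex_of_real ((cmod (fourier f \<xi>))\<^sup>2) = fourier f \<xi> * cnj (fourier f \<xi>)"
      by (rule complex_norm_square)
    also have "cnj (fourier f \<xi>) = (LINT y|lborel. cnj (cis (- (y \<bullet> \<xi>)) * f y))"
      unfolding fourier_def
      by (rule integral_bounded_linear[OF bounded_linear_cnj, symmetric]) (intro integrable_cis_mult f; measurable)
    also have "fourier f \<xi> * \<dots> = (LINT x|lborel. LINT y|lborel. ?k (x, y))"
      unfolding fourier_def by simp
    also have "\<dots> = (LINT p|?M. ?k p)" by (rule lborel_pair.integral_fst'[OF ik])
    finally have "complex_of_real ((cmod (fourier f \<xi>))\<^sup>2 * gauss (e *\<^sub>R \<xi>)) =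
        complex_of_real (gauss (e *\<^sub>R \<xi>)) * (LINT p|?M. cis (- ((fst p - snd p) \<bullet> \<xi>)) * ?g p)"
      unfolding k by (simp only: of_real_mult mult.commute)
    also have "\<dots> = (LINT p|?M. complex_of_real (gauss (e *\<^sub>R \<xi>)) * (cis (- ((fst p - snd p) \<bullet> \<xi>)) * ?g p))"
      by (rule integral_mult_right_zero[symmetric])
    also have "\<dots> = (LINT p|?M. ?h \<xi> p)"
      by (intro Bochner_Integration.integral_cong refl) (simp only: mult_ac)
    finally show ?thesis .
  qed
  have "complex_of_real (LINT \<xi>|lborel. (cmod (fourier f \<xi>))\<^sup>2 * gauss (e *\<^sub>R \<xi>)) =
      (LINT \<xi>|lborel. LINT p|?M. ?h \<xi> p)"
    by (subst integral_complex_of_real[symmetric]) (simp only: sq)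
  also have "\<dots> = (LINT p|?M. LINT \<xi>|lborel. ?h \<xi> p)" by (rule P.Fubini_integral[OF int, symmetric])
  also have "\<dots> = (LINT p|?M. ?g p * complex_of_real (sqrt (2 * pi) ^ DIM('a) *
      gauss ((1 / e) *\<^sub>R (fst p - snd p)) / e ^ DIM('a)))"
    unfolding integral_mult_left_zero gauss_scaled_fourier[OF e] by (simp only: mult.commute)
  also have "\<dots> = (LINT x|lborel. LINT y|lborel. ?g (x, y) * complex_of_real (sqrt (2 * pi) ^ DIM('a) *
      gauss ((1 / e) *\<^sub>R (x - y)) / e ^ DIM('a)))"
  proof -
    have "integrable ?M (\<lambda>p. ?g p * complex_of_real (sqrt (2 * pi) ^ DIM('a) *
      gauss ((1 / e) *\<^sub>R (fst p - snd p)) / e ^ DIM('a)))"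
    proof (rule Bochner_Integration.integrable_bound)
      show "integrable ?M (\<lambda>p. ?g p * complex_of_real (sqrt (2 * pi) ^ DIM('a) / e ^ DIM('a)))"
        using g by simp
      show "AE p in ?M. norm (?g p * complex_of_real (sqrt (2 * pi) ^ DIM('a) *
          gauss ((1 / e) *\<^sub>R (fst p - snd p)) / e ^ DIM('a))) \<le>
          norm (?g p * complex_of_real (sqrt (2 * pi) ^ DIM('a) / e ^ DIM('a)))"
        using e by (intro AE_I2) (auto simp: norm_mult norm_divide gauss_bounds less_imp_le
            abs_mult intro!: mult_left_mono divide_right_mono mult_right_le_one_le)
    qed measurable
    from lborel_pair.integral_fst'[OF this, symmetric] show ?thesis by (simp only: fst_conv snd_conv)
  qed
  also have "\<dots> = (LINT x|lborel. f x * (LINT z|lborel. cnj (f (x - e *\<^sub>R z)) * complex_of_real (sqrt (2 * pi) ^ DIM('a) * gauss z)))"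
  proof (rule Bochner_Integration.integral_cong[OF refl])
    fix x :: 'a
    let ?r = "\<lambda>y. cnj (f y) * complex_of_real (sqrt (2 * pi) ^ DIM('a) * gauss ((1 / e) *\<^sub>R (x - y)) / e ^ DIM('a))"
    have "(LINT y|lborel. ?g (x, y) * complex_of_real (sqrt (2 * pi) ^ DIM('a) *
        gauss ((1 / e) *\<^sub>R (x - y)) / e ^ DIM('a))) = f x * (LINT y|lborel. ?r y)"
      by (simp add: mult.assoc)
    also have "(LINT y|lborel. ?r y) = \<bar>- e\<bar> ^ DIM('a) *\<^sub>R (LINT z|lborel. ?r (x + (- e) *\<^sub>R z))"
      by (rule lborel_integral_affine) (use e in auto)
    also have "\<dots> = (LINT z|lborel. cnj (f (x - e *\<^sub>R z)) * complex_of_real (sqrt (2 * pi) ^ DIM('a) * gauss z))"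
      unfolding integral_scaleR_right[symmetric]
      using e by (intro Bochner_Integration.integral_cong refl) (simp add: scaleR_conv_of_real)
    finally show "(LINT y|lborel. ?g (x, y) * complex_of_real (sqrt (2 * pi) ^ DIM('a) *
        gauss ((1 / e) *\<^sub>R (x - y)) / e ^ DIM('a))) =
        f x * (LINT z|lborel. cnj (f (x - e *\<^sub>R z)) * complex_of_real (sqrt (2 * pi) ^ DIM('a) * gauss z))" .
  qed
  finally show ?thesis .
qed

text \<open>As the Gaussian regularisation is removed, the frequency integral converges monotonically; the
  space integral converges by dominated convergence, because the averages of \<open>f\<close> converge at its
  points of continuity.\<close>

lemma Plancherel_AE_continuous:
  fixes f :: "'a::euclidean_space \<Rightarrow> complex"
  assumes f: "integrable lborel f" and C: "\<And>x. cmod (f x) \<le> C" and cont: "AE x in lborel. isCont f x"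
  shows "(\<integral>\<^sup>+\<xi>. ennreal ((cmod (fourier f \<xi>))\<^sup>2) \<partial>lborel) =
    ennreal ((2 * pi) ^ DIM('a) * (LINT x|lborel. (cmod (f x))\<^sup>2))"
proof -
  have [measurable]: "f \<in> borel_measurable borel" using borel_measurable_integrable[OF f] by simp
  define c where "c = sqrt (2 * pi) ^ DIM('a)"
  have c: "c > 0" by (simp add: c_def)
  have cc: "c * c = (2 * pi) ^ DIM('a)" unfolding c_def power_mult_distrib[symmetric] by simp
  have C0: "C \<ge> 0" using C[of 0] norm_ge_zero order_trans by blast
  define e where "e n = 1 / real (Suc n)" for n
  have e: "e n > 0" for n by (simp add: e_def)
  have e_lim: "e \<longlonglongrightarrow> 0"
    using LIMSEQ_inverse_real_of_nat by (simp add: e_def[abs_def] inverse_eq_divide)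
  define J where "J n = (LINT \<xi>|lborel. (cmod (fourier f \<xi>))\<^sup>2 * gauss (e n *\<^sub>R \<xi>))" for n
  define K where "K n x = (LINT z|lborel. cnj (f (x - e n *\<^sub>R z)) * complex_of_real (c * gauss z))" for n x
  have [measurable]: "K n \<in> borel_measurable borel" for n unfolding K_def by measurable
  have JK: "complex_of_real (J n) = (LINT x|lborel. f x * K n x)" for n
    unfolding J_def K_def c_def by (rule fourier_gauss_mean[OF f e])
  have dom: "integrable lborel (\<lambda>z::'a. C * (c * gauss z))"
    by (intro integrable_mult_right integrable_gauss)
  have le: "cmod (cnj (f y) * complex_of_real (c * gauss z)) \<le> C * (c * gauss z)" for y z :: 'a
    using C[of y] c gauss_bounds(1)[of z] by (auto simp: norm_mult abs_mult intro!: mult_right_mono)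
  have K_bound: "cmod (K n x) \<le> C * (c * c)" for n x
  proof -
    have "cmod (K n x) \<le> (LINT z|lborel. C * (c * gauss (z::'a)))"
      unfolding K_def
    proof (rule order_trans[OF integral_norm_bound integral_mono[OF integrable_norm dom le]])
      show "integrable lborel (\<lambda>z. cnj (f (x - e n *\<^sub>R z)) * complex_of_real (c * gauss z))"
      proof (rule Bochner_Integration.integrable_bound[OF dom])
        show "AE z in lborel. norm (cnj (f (x - e n *\<^sub>R z)) * complex_of_real (c * gauss z)) \<le> norm (C * (c * gauss z))"
          unfolding real_norm_def by (intro AE_I2 order_trans[OF le abs_ge_self])
      qed measurable
    qed
    also have "\<dots> = C * (c * c)" by (simp add: integral_gauss c_def)
    finally show ?thesis .
  qed
  have K_lim: "(\<lambda>n. K n x) \<longlonglongrightarrow> cnj (f x) * complex_of_real (c * c)" if x: "isCont f x" for x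
  proof -
    have "(\<lambda>n. K n x) \<longlonglongrightarrow> (LINT z|lborel. cnj (f x) * complex_of_real (c * gauss (z::'a)))"
      unfolding K_def
    proof (rule integral_dominated_convergence[where w = "\<lambda>z. C * (c * gauss z)"])
      show "AE z in lborel. (\<lambda>n. cnj (f (x - e n *\<^sub>R z)) * complex_of_real (c * gauss z))
          \<longlonglongrightarrow> cnj (f x) * complex_of_real (c * gauss z)"
      proof (intro AE_I2 tendsto_mult tendsto_cnj tendsto_const)
        fix z :: 'a
        have "(\<lambda>n. x - e n *\<^sub>R z) \<longlonglongrightarrow> x - 0 *\<^sub>R z" by (intro tendsto_intros e_lim)
        then show "(\<lambda>n. f (x - e n *\<^sub>R z)) \<longlonglongrightarrow> f x"
          using isCont_tendsto_compose[OF x] by simp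
      qed
    qed (use dom le in auto)
    also have "(LINT z|lborel. cnj (f x) * complex_of_real (c * gauss (z::'a))) =
        cnj (f x) * complex_of_real (c * (LINT z|lborel. gauss (z::'a)))"
      by (simp only: integral_mult_right_zero integral_complex_of_real)
    finally show ?thesis by (simp only: integral_gauss c_def)
  qed
  have "(\<lambda>n. LINT x|lborel. f x * K n x) \<longlonglongrightarrow> (LINT x|lborel. f x * (cnj (f x) * complex_of_real (c * c)))"
  proof (rule integral_dominated_convergence[where w = "\<lambda>x. cmod (f x) * (C * (c * c))"])
    show "AE x in lborel. (\<lambda>n. f x * K n x) \<longlonglongrightarrow> f x * (cnj (f x) * complex_of_real (c * c))"
      using cont by eventually_elim (intro tendsto_mult tendsto_const K_lim)
    show "integrable lborel (\<lambda>x. cmod (f x) * (C * (c * c)))" using f by simp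
    show "AE x in lborel. norm (f x * K n x) \<le> cmod (f x) * (C * (c * c))" for n
      unfolding norm_mult by (intro AE_I2 mult_left_mono K_bound) simp
  qed measurable
  also have "(LINT x|lborel. f x * (cnj (f x) * complex_of_real (c * c))) =
      (LINT x|lborel. complex_of_real ((cmod (f x))\<^sup>2 * (c * c)))"
    by (intro Bochner_Integration.integral_cong refl)
      (simp only: mult.assoc[symmetric] complex_norm_square[symmetric] of_real_mult)
  also have "\<dots> = complex_of_real ((2 * pi) ^ DIM('a) * (LINT x|lborel. (cmod (f x))\<^sup>2))"
    by (simp only: integral_complex_of_real cc integral_mult_left_zero mult.commute)
  finally have "(\<lambda>n. complex_of_real (J n)) \<longlonglongrightarrow>
      complex_of_real ((2 * pi) ^ DIM('a) * (LINT x|lborel. (cmod (f x))\<^sup>2))"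
    by (simp only: JK)
  then have J_lim: "J \<longlonglongrightarrow> (2 * pi) ^ DIM('a) * (LINT x|lborel. (cmod (f x))\<^sup>2)"
    by (simp only: tendsto_of_real_iff)
  have nn_J: "(\<integral>\<^sup>+\<xi>. ennreal ((cmod (fourier f \<xi>))\<^sup>2 * gauss (e n *\<^sub>R \<xi>)) \<partial>lborel) = ennreal (J n)" for n
    unfolding J_def
  proof (rule nn_integral_eq_integral)
    let ?b = "(LINT x|lborel. cmod (f x))\<^sup>2"
    show "integrable lborel (\<lambda>\<xi>. (cmod (fourier f \<xi>))\<^sup>2 * gauss (e n *\<^sub>R \<xi>))"
    proof (rule Bochner_Integration.integrable_bound)
      show "integrable lborel (\<lambda>\<xi>::'a. ?b * gauss (e n *\<^sub>R \<xi>))"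
        by (intro integrable_mult_right integrable_gauss_scaled e)
      show "AE \<xi> in lborel. norm ((cmod (fourier f \<xi>))\<^sup>2 * gauss (e n *\<^sub>R \<xi>)) \<le> norm (?b * gauss (e n *\<^sub>R \<xi>))"
        using fourier_bound[OF f] gauss_bounds(1)
        by (auto simp: abs_mult less_imp_le intro!: mult_right_mono power_mono)
    qed measurable
  qed (auto simp: gauss_bounds less_imp_le)
  have "(\<lambda>n. \<integral>\<^sup>+\<xi>. ennreal ((cmod (fourier f \<xi>))\<^sup>2 * gauss (e n *\<^sub>R \<xi>)) \<partial>lborel)
      \<longlonglongrightarrow> (\<integral>\<^sup>+\<xi>. ennreal ((cmod (fourier f \<xi>))\<^sup>2) \<partial>lborel)"
  proof (rule nn_integral_LIMSEQ)
    show "incseq (\<lambda>n \<xi>. ennreal ((cmod (fourier f \<xi>))\<^sup>2 * gauss (e n *\<^sub>R \<xi>)))"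
    proof (intro monoI le_funI ennreal_leI mult_left_mono)
      fix m n :: nat and \<xi> :: 'a assume "m \<le> n"
      then have "e n \<le> e m" by (simp add: e_def frac_le)
      then have "(norm (e n *\<^sub>R \<xi>))\<^sup>2 \<le> (norm (e m *\<^sub>R \<xi>))\<^sup>2"
        using e[of n] by (intro power_mono) (auto intro!: mult_right_mono)
      then show "gauss (e m *\<^sub>R \<xi>) \<le> gauss (e n *\<^sub>R \<xi>)" by (simp add: gauss_def)
    qed simp
    fix \<xi> :: 'a
    have "(\<lambda>n. ennreal ((cmod (fourier f \<xi>))\<^sup>2 * exp (- (norm (e n *\<^sub>R \<xi>))\<^sup>2 / 2)))
        \<longlonglongrightarrow> ennreal ((cmod (fourier f \<xi>))\<^sup>2 * exp (- (norm (0 *\<^sub>R \<xi>))\<^sup>2 / 2))"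
      by (intro tendsto_intros e_lim) auto
    then show "(\<lambda>n. ennreal ((cmod (fourier f \<xi>))\<^sup>2 * gauss (e n *\<^sub>R \<xi>))) \<longlonglongrightarrow> ennreal ((cmod (fourier f \<xi>))\<^sup>2)"
      by (simp add: gauss_def)
  qed measurable
  then have "(\<lambda>n. ennreal (J n)) \<longlonglongrightarrow> (\<integral>\<^sup>+\<xi>. ennreal ((cmod (fourier f \<xi>))\<^sup>2) \<partial>lborel)"
    by (simp only: nn_J)
  from LIMSEQ_unique[OF this tendsto_ennrealI[OF J_lim]] show ?thesis .
qed

definition bounded_support :: "('a::euclidean_space \<Rightarrow> complex) \<Rightarrow> bool" where
  "bounded_support f \<longleftrightarrow> (\<exists>R. \<forall>x. norm x > R \<longrightarrow> f x = 0)"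

lemma bounded_support_box:
  fixes f :: "'a::euclidean_space \<Rightarrow> complex"
  assumes "bounded_support f"
  shows "\<exists>a b. \<forall>x. x \<notin> box a b \<longrightarrow> f x = 0"
proof -
  obtain R where R: "\<And>x. norm x > R \<Longrightarrow> f x = 0" using assms by (auto simp: bounded_support_def)
  have "bounded (cball 0 R :: 'a set)" by simp
  then obtain a where "(cball 0 R :: 'a set) \<subseteq> box (- a) a" using bounded_subset_box_symmetric by blast
  then show ?thesis using R by (intro exI[of _ "- a"] exI[of _ a]) (force simp: not_less)
qed

lemma square_integrable_indicator_box:
  "square_integrable (indicator (box a b) :: 'a::euclidean_space \<Rightarrow> complex)"
  by (rule square_integrable_indicator[OF _ emeasure_lborel_box_finite]) simp

lemma square_integrable_imp_integrable:
  fixes f :: "'a::euclidean_space \<Rightarrow> complex"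
  assumes f: "square_integrable f" and "bounded_support f"
  shows "integrable lborel f"
proof -
  obtain a b where ab: "\<And>x. x \<notin> box a b \<Longrightarrow> f x = 0" using bounded_support_box[OF assms(2)] by blast
  have "integrable lborel (\<lambda>x. f x * cnj (indicator (box a b) x))"
    by (intro square_integrable_mult_cnj f square_integrable_indicator_box)
  moreover have "(\<lambda>x. f x * cnj (indicator (box a b) x)) = f"
    using ab by (intro ext) (auto simp: indicator_def)
  ultimately show ?thesis by simp
qed

text \<open>By Cauchy--Schwarz, convergence in norm inside one box forces uniform convergence of the
  transforms.\<close>

lemma fourier_box_bound:
  fixes f :: "'a::euclidean_space \<Rightarrow> complex"
  assumes f: "square_integrable f" and ab: "\<And>x. x \<notin> box a b \<Longrightarrow> f x = 0"
  shows "cmod (fourier f \<xi>) \<le> norm (abs_L2 f) * norm (abs_L2 (indicator (box a b)))"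
proof -
  have ind: "square_integrable (indicator (box a b) :: 'a \<Rightarrow> complex)"
    by (rule square_integrable_indicator_box)
  note [measurable] = borel_square_integrable[OF f] borel_square_integrable[OF ind]
  let ?g = "\<lambda>x. cis (x \<bullet> \<xi>) * indicator (box a b) x"
  have n: "(\<lambda>x. (cmod (?g x))\<^sup>2) = (\<lambda>x. (cmod (indicator (box a b) x))\<^sup>2)" by (auto simp: norm_mult)
  have g: "square_integrable ?g"
    unfolding square_integrable_def n by (intro conjI integrable_square_integrable[OF ind]) measurable
  have ng: "norm (abs_L2 ?g) = norm (abs_L2 (indicator (box a b)))"
  proof -
    have "(norm (abs_L2 ?g))\<^sup>2 = (norm (abs_L2 (indicator (box a b))))\<^sup>2"
      unfolding norm_abs_L2[OF g] norm_abs_L2[OF ind] n ..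
    then show ?thesis by simp
  qed
  have "fourier f \<xi> = cinner (abs_L2 f) (abs_L2 ?g)"
    unfolding cinner_abs_L2[OF f g] fourier_def
    by (intro Bochner_Integration.integral_cong refl) (use ab in \<open>auto simp: cis_cnj indicator_def mult.commute\<close>)
  then show ?thesis using cinner_Cauchy_Schwarz[of "abs_L2 f" "abs_L2 ?g"] by (simp add: ng)
qed

text \<open>A vector space of functions that contains the indicators of boxes, hence is dense, and to which
  the preceding form of Plancherel's theorem applies.\<close>

definition tame :: "('a::euclidean_space \<Rightarrow> complex) \<Rightarrow> bool" where
  "tame f \<longleftrightarrow> f \<in> borel_measurable borel \<and> (\<exists>C. \<forall>x. cmod (f x) \<le> C) \<and> bounded_support f \<and>
    (AE x in lborel. isCont f x)"

lemma tame_square_integrable: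
  fixes f :: "'a::euclidean_space \<Rightarrow> complex"
  assumes "tame f"
  shows "square_integrable f"
proof -
  obtain C where C: "\<And>x. cmod (f x) \<le> C" using assms by (auto simp: tame_def)
  obtain a b where ab: "\<And>x. x \<notin> box a b \<Longrightarrow> f x = 0"
    using bounded_support_box assms unfolding tame_def by blast
  have ind: "square_integrable (indicator (box a b) :: 'a \<Rightarrow> complex)"
    by (rule square_integrable_indicator_box)
  show ?thesis
  proof (rule square_integrable_dominated[where h = "\<lambda>x. C * cmod (indicator (box a b) x)"])
    show "f \<in> borel_measurable borel" using assms by (simp add: tame_def)
    show "integrable lborel (\<lambda>x. (C * cmod (indicator (box a b) x))\<^sup>2)"
      using integrable_square_integrable[OF ind] by (simp add: power_mult_distrib)
  qed (use C ab in \<open>auto simp: indicator_def\<close>)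
qed

lemma tame_scale:
  assumes "tame f"
  shows "tame (\<lambda>x. c * f x)"
  unfolding tame_def
proof (intro conjI)
  show "(\<lambda>x. c * f x) \<in> borel_measurable borel" using assms by (auto simp: tame_def)
  obtain C where "\<And>x. cmod (f x) \<le> C" using assms by (auto simp: tame_def)
  then show "\<exists>C. \<forall>x. cmod (c * f x) \<le> C"
    by (intro exI[of _ "cmod c * C"]) (auto simp: norm_mult intro!: mult_left_mono)
  show "bounded_support (\<lambda>x. c * f x)" using assms by (auto simp: tame_def bounded_support_def)
  have "AE x in lborel. isCont f x" using assms by (simp add: tame_def)
  then show "AE x in lborel. isCont (\<lambda>x. c * f x) x"
    by eventually_elim (intro continuous_intros)
qed

lemma tame_add:
  assumes "tame f" "tame g"
  shows "tame (\<lambda>x. f x + g x)"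
  unfolding tame_def
proof (intro conjI)
  show "(\<lambda>x. f x + g x) \<in> borel_measurable borel" using assms by (auto simp: tame_def)
  obtain C D where "\<And>x. cmod (f x) \<le> C" "\<And>x. cmod (g x) \<le> D" using assms by (auto simp: tame_def)
  then show "\<exists>C. \<forall>x. cmod (f x + g x) \<le> C"
    by (intro exI[of _ "C + D"] allI order_trans[OF norm_triangle_ineq] add_mono)
  obtain R S where "\<And>x. norm x > R \<Longrightarrow> f x = 0" "\<And>x. norm x > S \<Longrightarrow> g x = 0"
    using assms unfolding tame_def bounded_support_def by blast
  then show "bounded_support (\<lambda>x. f x + g x)"
    unfolding bounded_support_def by (intro exI[of _ "max R S"]) auto
  have "AE x in lborel. isCont f x" "AE x in lborel. isCont g x" using assms by (auto simp: tame_def)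
  then show "AE x in lborel. isCont (\<lambda>x. f x + g x) x"
    by eventually_elim (intro continuous_intros)
qed

lemma AE_isCont_indicator_box:
  "AE x in lborel. isCont (indicator (box a b) :: 'a::euclidean_space \<Rightarrow> complex) x"
proof (rule AE_I')
  show "cbox a b - box a b \<in> null_sets lborel"
  proof (rule null_setsI)
    show "cbox a b - box a b \<in> sets lborel" by simp
    have "emeasure lborel (cbox a b - box a b) = emeasure lborel (cbox a b) - emeasure lborel (box a b)"
      by (rule emeasure_Diff) (use box_subset_cbox[of a b] less_imp_neq[OF emeasure_lborel_box_finite[of a b]] in auto)
    also have "\<dots> = 0" by (simp add: emeasure_lborel_cbox_eq emeasure_lborel_box_eq)
    finally show "emeasure lborel (cbox a b - box a b) = 0" .
  qed
  show "{x \<in> space lborel. \<not> isCont (indicator (box a b) :: 'a \<Rightarrow> complex) x} \<subseteq> cbox a b - box a b"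
  proof (rule ccontr)
    assume "\<not> ?thesis"
    then obtain x where x: "\<not> isCont (indicator (box a b) :: 'a \<Rightarrow> complex) x" "x \<in> box a b \<or> x \<notin> cbox a b"
      by auto
    have 1: "continuous_on (box a b) (indicator (box a b) :: 'a \<Rightarrow> complex)"
      by (rule continuous_on_eq[of _ "\<lambda>_. 1"]) auto
    have 2: "continuous_on (- cbox a b) (indicator (box a b) :: 'a \<Rightarrow> complex)"
      by (rule continuous_on_eq[of _ "\<lambda>_. 0"]) (use box_subset_cbox in \<open>auto simp: indicator_def\<close>)
    show False
      using x 1 2 continuous_on_eq_continuous_at[OF open_box]
        continuous_on_eq_continuous_at[OF open_Compl[OF closed_cbox]] by blast
  qed
qed

lemma tame_indicator_box: "tame (indicator (box a b) :: 'a::euclidean_space \<Rightarrow> complex)"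
  unfolding tame_def
proof (intro conjI AE_isCont_indicator_box)
  show "\<exists>C. \<forall>x::'a. cmod (indicator (box a b) x) \<le> C" by (intro exI[of _ 1]) (auto simp: indicator_def)
  obtain R where "\<forall>x\<in>box a b. norm x \<le> R" using bounded_box[of a b] by (auto simp: bounded_iff)
  then show "bounded_support (indicator (box a b) :: 'a \<Rightarrow> complex)"
    unfolding bounded_support_def by (intro exI[of _ R]) (force simp: indicator_def)
qed simp

lemma tame_mult_indicator_box:
  assumes "tame f"
  shows "tame (\<lambda>x. indicator (box a b) x * f x)"
  unfolding tame_def
proof (intro conjI)
  show "(\<lambda>x. indicator (box a b) x * f x) \<in> borel_measurable borel" using assms by (auto simp: tame_def)
  obtain C where C: "\<And>x. cmod (f x) \<le> C" using assms by (auto simp: tame_def)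
  have "C \<ge> 0" using C[of 0] norm_ge_zero order_trans by blast
  then show "\<exists>C. \<forall>x. cmod (indicator (box a b) x * f x) \<le> C"
    using C by (intro exI[of _ C]) (auto simp: indicator_def)
  show "bounded_support (\<lambda>x. indicator (box a b) x * f x)"
    using assms by (auto simp: tame_def bounded_support_def)
  have "AE x in lborel. isCont f x" using assms by (simp add: tame_def)
  with AE_isCont_indicator_box[of a b]
  show "AE x in lborel. isCont (\<lambda>x. indicator (box a b) x * f x) x"
    by eventually_elim (intro continuous_intros)
qed

lemma tame_dense:
  fixes u :: "'a::euclidean_space L2"
  assumes "e > 0"
  shows "\<exists>f. tame f \<and> norm (u - abs_L2 f) < e"
proof -
  define V where "V = {u :: 'a L2. \<forall>e>0. \<exists>f. tame f \<and> norm (u - abs_L2 f) < e}"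
  have "u \<in> V"
  proof (rule L2_closed_subspace_UNIV)
    fix a b :: 'a
    show "abs_L2 (indicator (box a b)) \<in> V"
      unfolding V_def using tame_indicator_box[of a b]
      by (intro CollectI allI impI exI[of _ "indicator (box a b)"]) simp
  next
    fix u v assume uv: "u \<in> V" "v \<in> V"
    show "u + v \<in> V" unfolding V_def
    proof (intro CollectI allI impI)
      fix e :: real assume "e > 0"
      then have "e / 2 > 0" by simp
      with uv obtain f g where fg: "tame f" "norm (u - abs_L2 f) < e/2" "tame g" "norm (v - abs_L2 g) < e/2"
        unfolding V_def by blast
      have "norm (u + v - (abs_L2 f + abs_L2 g)) \<le> norm (u - abs_L2 f) + norm (v - abs_L2 g)"
        by (rule norm_diff_triangle_ineq)
      then show "\<exists>f. tame f \<and> norm (u + v - abs_L2 f) < e"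
        using fg by (intro exI[of _ "\<lambda>x. f x + g x"])
          (simp add: tame_add abs_L2_add[symmetric] tame_square_integrable)
    qed
  next
    fix c u assume u: "u \<in> V"
    show "scaleC c u \<in> V" unfolding V_def
    proof (intro CollectI allI impI)
      fix e :: real assume e: "e > 0"
      then have "e / (cmod c + 1) > 0" by (intro divide_pos_pos) (auto simp: add_nonneg_pos)
      then obtain f where f: "tame f" "norm (u - abs_L2 f) < e / (cmod c + 1)"
        using u unfolding V_def by blast
      have "norm (scaleC c u - scaleC c (abs_L2 f)) = cmod c * norm (u - abs_L2 f)"
        by (simp add: cL2.scale_right_diff_distrib[symmetric] norm_scaleC)
      also have "\<dots> \<le> (cmod c + 1) * norm (u - abs_L2 f)" by (intro mult_right_mono) auto
      also have "\<dots> < e" using f(2) by (simp add: less_divide_eq add_nonneg_pos mult.commute split: if_splits)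
      finally show "\<exists>f. tame f \<and> norm (scaleC c u - abs_L2 f) < e"
        using f by (intro exI[of _ "\<lambda>x. c * f x"])
          (simp add: tame_scale abs_L2_scaleC[symmetric] tame_square_integrable)
    qed
  next
    fix X :: "nat \<Rightarrow> 'a L2" and u assume X: "\<And>n. X n \<in> V" "X \<longlonglongrightarrow> u"
    show "u \<in> V" unfolding V_def
    proof (intro CollectI allI impI)
      fix e :: real assume e: "e > 0"
      then obtain n where n: "norm (X n - u) < e/2"
        using X(2) by (metis LIMSEQ_iff half_gt_zero order_refl)
      obtain f where f: "tame f" "norm (X n - abs_L2 f) < e/2"
        using X(1)[of n] half_gt_zero[OF e] unfolding V_def by blast
      have "norm (u - abs_L2 f) \<le> norm (X n - u) + norm (X n - abs_L2 f)"
        using norm_triangle_ineq4[of "X n - abs_L2 f" "X n - u"] by simp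
      then show "\<exists>f. tame f \<and> norm (u - abs_L2 f) < e" using f n by (intro exI[of _ f]) auto
    qed
  qed
  then show ?thesis using assms by (simp add: V_def)
qed

lemma Plancherel_tame:
  fixes f :: "'a::euclidean_space \<Rightarrow> complex"
  assumes "tame f"
  shows "square_integrable (fourier f)"
    and "norm (abs_L2 (fourier f)) = sqrt ((2 * pi) ^ DIM('a)) * norm (abs_L2 f)"
proof -
  have f: "square_integrable f" by (rule tame_square_integrable[OF assms])
  have [measurable]: "f \<in> borel_measurable borel" using assms by (simp add: tame_def)
  have int: "integrable lborel f"
    using square_integrable_imp_integrable[OF f] assms by (simp add: tame_def)
  obtain C where C: "\<And>x. cmod (f x) \<le> C" using assms by (auto simp: tame_def)
  have *: "(\<integral>\<^sup>+\<xi>. ennreal ((cmod (fourier f \<xi>))\<^sup>2) \<partial>lborel) =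
    ennreal ((2 * pi) ^ DIM('a) * (norm (abs_L2 f))\<^sup>2)"
    unfolding norm_abs_L2[OF f]
    by (rule Plancherel_AE_continuous[OF int C]) (use assms in \<open>simp add: tame_def\<close>)
  show 1: "square_integrable (fourier f)"
    by (rule square_integrableI_nn) (auto simp: *)
  have "(norm (abs_L2 (fourier f)))\<^sup>2 = (2 * pi) ^ DIM('a) * (norm (abs_L2 f))\<^sup>2"
    using * unfolding ennreal_norm_abs_L2[OF 1, symmetric] by (subst (asm) ennreal_inj) auto
  also have "\<dots> = (sqrt ((2 * pi) ^ DIM('a)) * norm (abs_L2 f))\<^sup>2" by (simp add: power_mult_distrib)
  finally show "norm (abs_L2 (fourier f)) = sqrt ((2 * pi) ^ DIM('a)) * norm (abs_L2 f)"
    by (rule power2_eq_imp_eq) auto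
qed

text \<open>The Fourier transform is an honest integral for bounded support. Approximants supported in one
  common box have transforms that converge uniformly as well as in the norm, and the two limits agree.\<close>

theorem Plancherel:
  fixes f :: "'a::euclidean_space \<Rightarrow> complex"
  assumes f: "square_integrable f" and supp: "bounded_support f"
  shows "square_integrable (fourier f)"
    and "(norm (abs_L2 (fourier f)))\<^sup>2 = (2 * pi) ^ DIM('a) * (norm (abs_L2 f))\<^sup>2"
proof -
  let ?c = "sqrt ((2 * pi) ^ DIM('a))"
  obtain a b where ab: "\<And>x. x \<notin> box a b \<Longrightarrow> f x = 0" using bounded_support_box[OF supp] by blast
  have "\<exists>g. tame g \<and> norm (abs_L2 f - abs_L2 g) < 1 / Suc n" for n
    by (rule tame_dense) simp
  then obtain g where g: "\<And>n. tame (g n)" "\<And>n. norm (abs_L2 f - abs_L2 (g n)) < 1 / Suc n" by metis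
  define h where "h n x = indicator (box a b) x * g n x" for n x
  have h: "tame (h n)" for n unfolding h_def by (rule tame_mult_indicator_box[OF g(1)])
  have hs: "square_integrable (h n)" for n by (rule tame_square_integrable[OF h])
  have gs: "square_integrable (g n)" for n by (rule tame_square_integrable[OF g(1)])
  have int: "integrable lborel (h n)" for n
    using square_integrable_imp_integrable[OF hs] h by (simp add: tame_def)
  have intf: "integrable lborel f" by (rule square_integrable_imp_integrable[OF f supp])
  have close: "norm (abs_L2 f - abs_L2 (h n)) < 1 / Suc n" for n
  proof -
    have "(norm (abs_L2 f - abs_L2 (h n)))\<^sup>2 \<le> (norm (abs_L2 f - abs_L2 (g n)))\<^sup>2"
      unfolding abs_L2_diff[OF f hs] abs_L2_diff[OF f gs]
        norm_abs_L2[OF square_integrable_diff[OF f hs]] norm_abs_L2[OF square_integrable_diff[OF f gs]]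
    proof (rule integral_mono)
      show "(cmod (f x - h n x))\<^sup>2 \<le> (cmod (f x - g n x))\<^sup>2" for x
        using ab[of x] by (cases "x \<in> box a b") (auto simp: h_def)
    qed (auto intro!: integrable_square_integrable square_integrable_diff f hs gs)
    then have "norm (abs_L2 f - abs_L2 (h n)) \<le> norm (abs_L2 f - abs_L2 (g n))"
      by (rule power2_le_imp_le) simp
    then show ?thesis using g(2)[of n] by simp
  qed
  have hdiff: "tame (\<lambda>x. h m x - h n x)" for m n
    using tame_add[OF h[of m] tame_scale[OF h[of n], of "- 1"]] by simp
  have Fdiff: "(\<lambda>\<xi>. fourier (h m) \<xi> - fourier (h n) \<xi>) = fourier (\<lambda>x. h m x - h n x)" for m n
    by (rule ext) (rule fourier_diff[OF int int, symmetric])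
  have inv_lim: "(\<lambda>n. 1 / real (Suc n)) \<longlonglongrightarrow> 0"
    using LIMSEQ_inverse_real_of_nat by (simp add: inverse_eq_divide)
  have h_lim: "(\<lambda>n. abs_L2 (h n)) \<longlonglongrightarrow> abs_L2 f"
  proof -
    have "(\<lambda>n. abs_L2 (h n) - abs_L2 f) \<longlonglongrightarrow> 0"
      by (rule Lim_null_comparison[OF _ inv_lim])
        (use close in \<open>auto intro!: always_eventually simp: norm_minus_commute less_imp_le\<close>)
    then show ?thesis by (simp add: LIM_zero_iff)
  qed
  have pw: "(\<lambda>n. fourier (h n) \<xi>) \<longlonglongrightarrow> fourier f \<xi>" for \<xi>
  proof -
    let ?K = "norm (abs_L2 (indicator (box a b) :: 'a \<Rightarrow> complex))"
    have "(\<lambda>n. fourier (h n) \<xi> - fourier f \<xi>) \<longlonglongrightarrow> 0"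
    proof (rule Lim_null_comparison)
      show "\<forall>\<^sub>F n in sequentially. norm (fourier (h n) \<xi> - fourier f \<xi>) \<le> norm (abs_L2 (h n) - abs_L2 f) * ?K"
      proof (intro always_eventually allI)
        fix n
        have "norm (fourier (\<lambda>x. h n x - f x) \<xi>) \<le> norm (abs_L2 (\<lambda>x. h n x - f x)) * ?K"
        proof (rule fourier_box_bound)
          show "square_integrable (\<lambda>x. h n x - f x)" by (intro square_integrable_diff hs f)
        qed (simp add: h_def ab)
        then show "norm (fourier (h n) \<xi> - fourier f \<xi>) \<le> norm (abs_L2 (h n) - abs_L2 f) * ?K"
          by (simp add: fourier_diff[OF int intf] abs_L2_diff[OF hs f])
      qed
      have "(\<lambda>n. norm (abs_L2 (h n) - abs_L2 f) * ?K) \<longlonglongrightarrow> norm (abs_L2 f - abs_L2 f) * ?K"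
        by (intro tendsto_intros h_lim)
      then show "(\<lambda>n. norm (abs_L2 (h n) - abs_L2 f) * ?K) \<longlonglongrightarrow> 0" by simp
    qed
    then show ?thesis by (simp add: LIM_zero_iff)
  qed
  have [measurable]: "f \<in> borel_measurable borel" by (rule borel_square_integrable[OF f])
  have Fh: "square_integrable (fourier (h n))" for n by (rule Plancherel_tame(1)[OF h])
  have Fdist: "norm (abs_L2 (\<lambda>\<xi>. fourier (h m) \<xi> - fourier (h n) \<xi>)) \<le> ?c * (2 / Suc n)" if "n \<le> m" for m n
  proof -
    have "norm (abs_L2 (h m) - abs_L2 (h n)) \<le> norm (abs_L2 f - abs_L2 (h n)) + norm (abs_L2 f - abs_L2 (h m))"
      using norm_triangle_ineq4[of "abs_L2 f - abs_L2 (h n)" "abs_L2 f - abs_L2 (h m)"] by simp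
    also have "\<dots> \<le> 1 / Suc n + 1 / Suc m" using close by (intro add_mono less_imp_le)
    also have "\<dots> \<le> 1 / Suc n + 1 / Suc n" using that by (intro add_left_mono) (simp add: frac_le)
    finally have "norm (abs_L2 (h m) - abs_L2 (h n)) \<le> 2 / Suc n" by simp
    then show ?thesis
      unfolding Fdiff Plancherel_tame(2)[OF hdiff] abs_L2_diff[OF hs hs, symmetric]
      by (intro mult_left_mono) auto
  qed
  have lim_n: "square_integrable (\<lambda>\<xi>. fourier f \<xi> - fourier (h n) \<xi>) \<and>
      norm (abs_L2 (\<lambda>\<xi>. fourier f \<xi> - fourier (h n) \<xi>)) \<le> ?c * (2 / Suc n)" for n
  proof (intro conjI)
    note sq = square_integrable_diff[OF Fh Fh]
    have lim: "AE \<xi> in lborel. (\<lambda>m. fourier (h m) \<xi> - fourier (h n) \<xi>) \<longlonglongrightarrow> fourier f \<xi> - fourier (h n) \<xi>"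
      by (intro AE_I2 tendsto_intros pw)
    have bd: "\<forall>\<^sub>F m in sequentially. norm (abs_L2 (\<lambda>\<xi>. fourier (h m) \<xi> - fourier (h n) \<xi>)) \<le> ?c * (2 / Suc n)"
      using eventually_ge_at_top[of n] by eventually_elim (rule Fdist)
    have m: "(\<lambda>\<xi>. fourier f \<xi> - fourier (h n) \<xi>) \<in> borel_measurable borel"
      using borel_square_integrable[OF hs[of n]] by measurable
    show "square_integrable (\<lambda>\<xi>. fourier f \<xi> - fourier (h n) \<xi>)"
      by (rule L2_Fatou(1)[OF sq m lim bd]) simp
    show "norm (abs_L2 (\<lambda>\<xi>. fourier f \<xi> - fourier (h n) \<xi>)) \<le> ?c * (2 / Suc n)"
      by (rule L2_Fatou(2)[OF sq m lim bd]) simp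
  qed
  show F: "square_integrable (fourier f)"
    using square_integrable_add[OF conjunct1[OF lim_n[of 0]] Fh[of 0]] by simp
  have "(\<lambda>n. abs_L2 (fourier f) - abs_L2 (fourier (h n))) \<longlonglongrightarrow> 0"
  proof (rule Lim_null_comparison)
    show "\<forall>\<^sub>F n in sequentially. norm (abs_L2 (fourier f) - abs_L2 (fourier (h n))) \<le> ?c * (2 * (1 / Suc n))"
      using lim_n by (intro always_eventually) (simp add: abs_L2_diff[OF F Fh])
    have "(\<lambda>n. ?c * (2 * (1 / real (Suc n)))) \<longlonglongrightarrow> ?c * (2 * 0)" by (intro tendsto_intros inv_lim)
    then show "(\<lambda>n. ?c * (2 * (1 / real (Suc n)))) \<longlonglongrightarrow> 0" by simp
  qed
  from tendsto_diff[OF tendsto_const[of "abs_L2 (fourier f)"] this]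
  have "(\<lambda>n. norm (abs_L2 (fourier (h n)))) \<longlonglongrightarrow> norm (abs_L2 (fourier f))"
    by (intro tendsto_norm) simp
  moreover have "(\<lambda>n. norm (abs_L2 (fourier (h n)))) \<longlonglongrightarrow> ?c * norm (abs_L2 f)"
    unfolding Plancherel_tame(2)[OF h] by (intro tendsto_intros h_lim)
  ultimately have "norm (abs_L2 (fourier f)) = ?c * norm (abs_L2 f)" by (rule LIMSEQ_unique)
  then show "(norm (abs_L2 (fourier f)))\<^sup>2 = (2 * pi) ^ DIM('a) * (norm (abs_L2 f))\<^sup>2"
    by (simp add: power_mult_distrib)
qed

section \<open>Frequency projections\<close>

lemma square_integrable_affine:
  fixes f :: "'a::euclidean_space \<Rightarrow> complex"
  assumes f: "square_integrable f" and c: "\<bar>c\<bar> = 1"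
  shows "square_integrable (\<lambda>x. f (t + c *\<^sub>R x))"
    and "norm (abs_L2 (\<lambda>x. f (t + c *\<^sub>R x))) = norm (abs_L2 f)"
proof -
  note [measurable] = borel_square_integrable[OF f]
  have c0: "c \<noteq> 0" using c by auto
  have eq: "(\<integral>\<^sup>+x. ennreal ((cmod (f x))\<^sup>2) \<partial>lborel) = (\<integral>\<^sup>+x. ennreal ((cmod (f (t + c *\<^sub>R x)))\<^sup>2) \<partial>lborel)"
    by (subst lborel_nn_integral_affine[OF _ c0, of _ t]) (auto simp: c)
  show 1: "square_integrable (\<lambda>x. f (t + c *\<^sub>R x))"
    by (rule square_integrableI_nn) (auto simp: eq[symmetric] ennreal_norm_abs_L2[OF f, symmetric])
  have "ennreal ((norm (abs_L2 (\<lambda>x. f (t + c *\<^sub>R x))))\<^sup>2) = ennreal ((norm (abs_L2 f))\<^sup>2)"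
    unfolding ennreal_norm_abs_L2[OF f] ennreal_norm_abs_L2[OF 1] eq ..
  then have "(norm (abs_L2 (\<lambda>x. f (t + c *\<^sub>R x))))\<^sup>2 = (norm (abs_L2 f))\<^sup>2"
    by (subst (asm) ennreal_inj) auto
  then show "norm (abs_L2 (\<lambda>x. f (t + c *\<^sub>R x))) = norm (abs_L2 f)" by simp
qed

text \<open>Cutting the frequencies off to a bounded set \<open>E\<close> is convolution with the inverse Fourier transform of
  its indicator. As this kernel is square integrable, the convolution makes sense for every square
  integrable function, whereas the Fourier transform is only used for bounded support.\<close>

definition proj_kernel :: "'a::euclidean_space set \<Rightarrow> 'a \<Rightarrow> complex" where
  "proj_kernel E z = complex_of_real (1 / (2 * pi) ^ DIM('a)) * fourier (indicator E) (- z)"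

definition proj_fun :: "'a::euclidean_space set \<Rightarrow> ('a \<Rightarrow> complex) \<Rightarrow> 'a \<Rightarrow> complex" where
  "proj_fun E f x = (LINT y|lborel. proj_kernel E (x - y) * f y)"

definition freq_proj :: "'a::euclidean_space set \<Rightarrow> 'a L2 \<Rightarrow> 'a L2" where
  "freq_proj E u = abs_L2 (proj_fun E (rep_L2 u))"

lemma truncation_tendsto:
  fixes f :: "'a::euclidean_space \<Rightarrow> complex"
  assumes f: "square_integrable f"
  obtains F where "\<And>n::nat. square_integrable (F n)" "\<And>n. bounded_support (F n)"
    "(\<lambda>n. abs_L2 (F n)) \<longlonglongrightarrow> abs_L2 f" "\<And>n. norm (abs_L2 (F n)) \<le> norm (abs_L2 f)"
proof -
  note [measurable] = borel_square_integrable[OF f]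
  define F where "F n x = indicator (cball 0 (real n)) x * f x" for n and x :: 'a
  have F: "square_integrable (F n)" for n
    unfolding F_def by (rule square_integrable_mult_indicator[OF f]) simp
  note [measurable] = borel_square_integrable[OF F]
  have le: "cmod (F n x) \<le> cmod (f x)" for n x by (auto simp: F_def indicator_def)
  show thesis
  proof (rule that[of F])
    show "square_integrable (F n)" for n by (rule F)
    show "bounded_support (F n)" for n
      unfolding bounded_support_def by (intro exI[of _ "real n"]) (auto simp: F_def)
    show "(\<lambda>n. abs_L2 (F n)) \<longlonglongrightarrow> abs_L2 f"
    proof (rule abs_L2_dominated_convergence[where h = "\<lambda>x. cmod (f x)"])
      show "AE x in lborel. (\<lambda>n. F n x) \<longlonglongrightarrow> f x"
      proof (rule AE_I2)
        fix x :: 'a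
        obtain m :: nat where m: "norm x \<le> real m" using real_arch_simple by blast
        have "\<forall>\<^sub>F n in sequentially. F n x = f x"
          using eventually_ge_at_top[of m]
          by eventually_elim (use m in \<open>auto simp: F_def indicator_def\<close>)
        then show "(\<lambda>n. F n x) \<longlonglongrightarrow> f x" by (rule tendsto_eventually)
      qed
      show "integrable lborel (\<lambda>x. (cmod (f x))\<^sup>2)" by (rule integrable_square_integrable[OF f])
    qed (use le in auto)
    show "norm (abs_L2 (F n)) \<le> norm (abs_L2 f)" for n
    proof (rule power2_le_imp_le)
      show "(norm (abs_L2 (F n)))\<^sup>2 \<le> (norm (abs_L2 f))\<^sup>2"
        unfolding norm_abs_L2[OF F] norm_abs_L2[OF f]
        by (intro integral_mono integrable_square_integrable F f power_mono le) auto
    qed simp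
  qed
qed

context
  fixes E :: "'a::euclidean_space set"
  assumes E_borel [measurable]: "E \<in> sets borel" and E_bounded: "bounded E"
begin

lemma square_integrable_indicator_E: "square_integrable (indicator E :: 'a \<Rightarrow> complex)"
  by (rule square_integrable_indicator[OF E_borel emeasure_bounded_finite[OF E_bounded]])

lemma bounded_support_mult_indicator_E: "bounded_support (\<lambda>x. indicator E x * f x)"
proof -
  obtain R where "\<forall>x\<in>E. norm x \<le> R" using E_bounded by (auto simp: bounded_iff)
  then show ?thesis unfolding bounded_support_def by (intro exI[of _ R]) (force simp: indicator_def)
qed

lemma bounded_support_indicator_E: "bounded_support (indicator E :: 'a \<Rightarrow> complex)"
  using bounded_support_mult_indicator_E[of "\<lambda>_. 1"] by simp

lemma integrable_indicator_E: "integrable lborel (indicator E :: 'a \<Rightarrow> complex)"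
  by (rule square_integrable_imp_integrable[OF square_integrable_indicator_E bounded_support_indicator_E])

lemma proj_kernel_borel [measurable]: "proj_kernel E \<in> borel_measurable borel"
  unfolding proj_kernel_def[abs_def] by measurable

lemma proj_kernel_alt:
  "proj_kernel E z = complex_of_real (1 / (2 * pi) ^ DIM('a)) * (LINT \<xi>|lborel. cis (z \<bullet> \<xi>) * indicator E \<xi>)"
  unfolding proj_kernel_def fourier_def by (simp add: inner_commute)

lemma cnj_proj_kernel: "cnj (proj_kernel E z) = proj_kernel E (- z)"
proof -
  have "cnj (LINT \<xi>|lborel. cis (z \<bullet> \<xi>) * indicator E \<xi>) = (LINT \<xi>|lborel. cnj (cis (z \<bullet> \<xi>) * indicator E \<xi>))"
    by (rule integral_bounded_linear[OF bounded_linear_cnj, symmetric])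
      (intro integrable_cis_mult integrable_indicator_E; measurable)
  also have "\<dots> = (LINT \<xi>|lborel. cis ((- z) \<bullet> \<xi>) * indicator E \<xi>)"
    by (intro Bochner_Integration.integral_cong refl) (simp add: cis_cnj indicator_def)
  finally show ?thesis unfolding proj_kernel_alt by simp
qed

lemma proj_kernel_bound: "\<exists>K. \<forall>z. cmod (proj_kernel E z) \<le> K"
proof (intro exI allI)
  fix z
  show "cmod (proj_kernel E z) \<le> 1 / (2 * pi) ^ DIM('a) * (LINT x|lborel. cmod (indicator E (x::'a)))"
    unfolding proj_kernel_def norm_mult norm_of_real
    by (intro mult_mono fourier_bound integrable_indicator_E) auto
qed

lemma square_integrable_proj_kernel: "square_integrable (\<lambda>y. cnj (proj_kernel E (x - y)))"
proof -
  have "square_integrable (\<lambda>y. complex_of_real (1 / (2 * pi) ^ DIM('a)) * fourier (indicator E) (x + (- 1) *\<^sub>R y))"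
    by (intro square_integrable_scale square_integrable_affine(1)
        Plancherel(1)[OF square_integrable_indicator_E bounded_support_indicator_E]) simp
  then show ?thesis unfolding cnj_proj_kernel unfolding proj_kernel_def
    using square_integrable_affine(1)[OF Plancherel(1)[OF square_integrable_indicator_E bounded_support_indicator_E], of 1 "- x"]
    by (auto intro!: square_integrable_scale simp: algebra_simps)
qed

lemma proj_fun_cinner:
  assumes "square_integrable f"
  shows "proj_fun E f x = cinner (abs_L2 f) (abs_L2 (\<lambda>y. cnj (proj_kernel E (x - y))))"
  unfolding proj_fun_def cinner_abs_L2[OF assms square_integrable_proj_kernel]
  by (intro Bochner_Integration.integral_cong refl) simp

lemma proj_fun_borel [measurable]:
  assumes [measurable]: "f \<in> borel_measurable borel"
  shows "proj_fun E f \<in> borel_measurable borel"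
  unfolding proj_fun_def[abs_def] by measurable

lemma proj_fun_fourier:
  assumes f: "integrable lborel f"
  shows "proj_fun E f x = complex_of_real (1 / (2 * pi) ^ DIM('a)) *
    (LINT \<xi>|lborel. cis (x \<bullet> \<xi>) * (indicator E \<xi> * fourier f \<xi>))"
proof -
  have [measurable]: "f \<in> borel_measurable borel" using borel_measurable_integrable[OF f] by simp
  let ?h = "\<lambda>\<xi> y. cis ((x - y) \<bullet> \<xi>) * indicator E \<xi> * f y"
  have int: "integrable (lborel \<Otimes>\<^sub>M lborel) (case_prod ?h)"
  proof (rule lborel_pair.Fubini_integrable)
    show "integrable lborel (\<lambda>\<xi>. LINT y|lborel. norm (case (\<xi>, y) of (\<xi>, y) \<Rightarrow> ?h \<xi> y))"
      using integrable_norm[OF integrable_indicator_E] by (simp add: norm_mult)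
    show "AE \<xi> in lborel. integrable lborel (\<lambda>y. case (\<xi>, y) of (\<xi>, y) \<Rightarrow> ?h \<xi> y)"
    proof (rule AE_I2)
      fix \<xi> :: 'a
      show "integrable lborel (\<lambda>y. case (\<xi>, y) of (\<xi>, y) \<Rightarrow> ?h \<xi> y)"
        by (rule Bochner_Integration.integrable_bound[OF f]) (auto simp: norm_mult indicator_def)
    qed
  qed measurable
  have h: "(LINT \<xi>|lborel. ?h \<xi> y) = (LINT \<xi>|lborel. cis ((x - y) \<bullet> \<xi>) * indicator E \<xi>) * f y" for y
    by (rule integral_mult_left_zero)
  have "proj_fun E f x = (LINT y|lborel. complex_of_real (1 / (2 * pi) ^ DIM('a)) * (LINT \<xi>|lborel. ?h \<xi> y))"
    unfolding proj_fun_def proj_kernel_alt h by (simp only: mult.assoc)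
  also have "\<dots> = complex_of_real (1 / (2 * pi) ^ DIM('a)) * (LINT y|lborel. (LINT \<xi>|lborel. ?h \<xi> y))"
    by (rule integral_mult_right_zero)
  also have "(LINT y|lborel. (LINT \<xi>|lborel. ?h \<xi> y)) = (LINT \<xi>|lborel. (LINT y|lborel. ?h \<xi> y))"
    by (rule lborel_pair.Fubini_integral[OF int])
  also have "\<dots> = (LINT \<xi>|lborel. cis (x \<bullet> \<xi>) * (indicator E \<xi> * fourier f \<xi>))"
  proof (intro Bochner_Integration.integral_cong refl)
    fix \<xi> :: 'a
    have "?h \<xi> y = (cis (x \<bullet> \<xi>) * indicator E \<xi>) * (cis (- (y \<bullet> \<xi>)) * f y)" for y
      by (simp add: inner_diff_left cis_mult[symmetric] mult_ac flip: cis_mult)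
        (simp add: cis_divide[symmetric] cis_mult mult_ac)
    then show "(LINT y|lborel. ?h \<xi> y) = cis (x \<bullet> \<xi>) * (indicator E \<xi> * fourier f \<xi>)"
      by (simp only: integral_mult_right_zero fourier_def mult.assoc)
  qed
  finally show ?thesis .
qed

lemma square_integrable_indicator_fourier:
  assumes "square_integrable f" "bounded_support f"
  shows "square_integrable (\<lambda>\<xi>. indicator E \<xi> * fourier f \<xi>)"
  by (rule square_integrable_mult_indicator[OF Plancherel(1)[OF assms] E_borel])

lemma proj_fun_bounded_support:
  assumes f: "square_integrable f" "bounded_support f"
  shows "square_integrable (proj_fun E f)"
    and "(norm (abs_L2 (proj_fun E f)))\<^sup>2 = (norm (abs_L2 (\<lambda>\<xi>. indicator E \<xi> * fourier f \<xi>)))\<^sup>2 / (2 * pi) ^ DIM('a)"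
    and "norm (abs_L2 (proj_fun E f)) \<le> norm (abs_L2 f)"
proof -
  let ?v = "\<lambda>\<xi>. indicator E \<xi> * fourier f \<xi>" and ?c = "1 / (2 * pi) ^ DIM('a)"
  note v = square_integrable_indicator_fourier[OF f] bounded_support_mult_indicator_E[of "fourier f"]
  note Fv = Plancherel[OF v]
  have eq: "proj_fun E f = (\<lambda>x. complex_of_real ?c * fourier ?v (0 + (- 1) *\<^sub>R x))"
    by (rule ext, subst proj_fun_fourier[OF square_integrable_imp_integrable[OF f]])
      (simp add: fourier_def inner_commute)
  note refl = square_integrable_affine[OF Fv(1), of "- 1" 0, simplified abs_minus abs_one, OF refl]
  show 1: "square_integrable (proj_fun E f)"
    unfolding eq by (rule square_integrable_scale[OF refl(1)])
  have "abs_L2 (proj_fun E f) = scaleC (complex_of_real ?c) (abs_L2 (\<lambda>x. fourier ?v (0 + (- 1) *\<^sub>R x)))"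
    unfolding eq by (rule abs_L2_scaleC[OF refl(1), symmetric])
  then have "norm (abs_L2 (proj_fun E f)) = ?c * norm (abs_L2 (fourier ?v))"
    by (simp only: norm_scaleC refl(2) norm_of_real) simp
  then have "(norm (abs_L2 (proj_fun E f)))\<^sup>2 = ?c\<^sup>2 * ((2 * pi) ^ DIM('a) * (norm (abs_L2 ?v))\<^sup>2)"
    by (simp only: power_mult_distrib Fv(2))
  also have "\<dots> = (norm (abs_L2 ?v))\<^sup>2 / (2 * pi) ^ DIM('a)" by (simp add: power2_eq_square)
  finally show 2: "(norm (abs_L2 (proj_fun E f)))\<^sup>2 = (norm (abs_L2 ?v))\<^sup>2 / (2 * pi) ^ DIM('a)" .
  have "(norm (abs_L2 ?v))\<^sup>2 \<le> (norm (abs_L2 (fourier f)))\<^sup>2"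
    unfolding norm_abs_L2[OF v(1)] norm_abs_L2[OF Plancherel(1)[OF f]]
    by (intro integral_mono integrable_square_integrable v Plancherel(1)[OF f]) (auto simp: indicator_def)
  then have "(norm (abs_L2 (proj_fun E f)))\<^sup>2 \<le> (norm (abs_L2 f))\<^sup>2"
    unfolding 2 Plancherel(2)[OF f] by (simp add: divide_le_eq mult.commute)
  then show "norm (abs_L2 (proj_fun E f)) \<le> norm (abs_L2 f)" by (rule power2_le_imp_le) simp
qed

text \<open>Truncations of \<open>f\<close> have bounded support, where Plancherel's theorem gives the bound; Fatou's lemma
  passes to the limit.\<close>

lemma proj_fun_L2:
  assumes f: "square_integrable f"
  shows "square_integrable (proj_fun E f)" and "norm (abs_L2 (proj_fun E f)) \<le> norm (abs_L2 f)"
proof -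
  obtain F where F: "\<And>n::nat. square_integrable (F n)" "\<And>n. bounded_support (F n)"
    "(\<lambda>n. abs_L2 (F n)) \<longlonglongrightarrow> abs_L2 f" "\<And>n. norm (abs_L2 (F n)) \<le> norm (abs_L2 f)"
    using truncation_tendsto[OF f] by blast
  note [measurable] = borel_square_integrable[OF f]
  have lim: "AE x in lborel. (\<lambda>n. proj_fun E (F n) x) \<longlonglongrightarrow> proj_fun E f x"
    unfolding proj_fun_cinner[OF F(1)] proj_fun_cinner[OF f]
    by (intro AE_I2 tendsto_cinner F(3) tendsto_const)
  have bd: "\<forall>\<^sub>F n in sequentially. norm (abs_L2 (proj_fun E (F n))) \<le> norm (abs_L2 f)"
    by (intro always_eventually allI order_trans[OF proj_fun_bounded_support(3)[OF F(1,2)] F(4)])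
  have m: "proj_fun E f \<in> borel_measurable borel" by measurable
  show "square_integrable (proj_fun E f)"
    by (rule L2_Fatou(1)[OF proj_fun_bounded_support(1)[OF F(1,2)] m lim bd]) simp
  show "norm (abs_L2 (proj_fun E f)) \<le> norm (abs_L2 f)"
    by (rule L2_Fatou(2)[OF proj_fun_bounded_support(1)[OF F(1,2)] m lim bd]) simp
qed

lemma freq_proj_abs:
  assumes f: "square_integrable f"
  shows "freq_proj E (abs_L2 f) = abs_L2 (proj_fun E f)"
proof -
  have "proj_fun E (rep_L2 (abs_L2 f)) = proj_fun E f"
    by (rule ext) (simp add: proj_fun_cinner f square_integrable_rep abs_rep_L2)
  then show ?thesis by (simp add: freq_proj_def)
qed

lemma norm_freq_proj_le: "norm (freq_proj E u) \<le> norm u"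
proof -
  obtain f where f: "square_integrable f" "u = abs_L2 f" by (rule L2_cases)
  show ?thesis unfolding f(2) freq_proj_abs[OF f(1)] by (rule proj_fun_L2(2)[OF f(1)])
qed

lemma bounded_clinear_freq_proj: "bounded_clinear (freq_proj E)"
proof (rule bounded_clinearI[where K = 1])
  fix u v :: "'a L2" and c :: complex
  obtain f where f: "square_integrable f" "u = abs_L2 f" by (rule L2_cases)
  obtain g where g: "square_integrable g" "v = abs_L2 g" by (rule L2_cases)
  have "proj_fun E (\<lambda>x. f x + g x) = (\<lambda>x. proj_fun E f x + proj_fun E g x)"
    by (rule ext) (simp add: proj_fun_cinner f g square_integrable_add abs_L2_add[symmetric] cinner_add_left)
  then show "freq_proj E (u + v) = freq_proj E u + freq_proj E v"
    by (simp add: f g abs_L2_add freq_proj_abs square_integrable_add proj_fun_L2)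
  have "proj_fun E (\<lambda>x. c * f x) = (\<lambda>x. c * proj_fun E f x)"
    by (rule ext) (simp add: proj_fun_cinner f square_integrable_scale abs_L2_scaleC[symmetric] cinner_scaleC_left)
  then show "freq_proj E (scaleC c u) = scaleC c (freq_proj E u)"
    by (simp add: f abs_L2_scaleC freq_proj_abs square_integrable_scale proj_fun_L2)
  show "norm (freq_proj E u) \<le> 1 * norm u" using norm_freq_proj_le by simp
qed

lemma freq_proj_self_adjoint: "adjoint_pair (freq_proj E) (freq_proj E)"
  unfolding adjoint_pair_def
proof (intro allI)
  fix u v :: "'a L2"
  have bs: "cinner (freq_proj E (abs_L2 f)) (abs_L2 g) = cinner (abs_L2 f) (freq_proj E (abs_L2 g))"
    if f: "square_integrable f" "bounded_support f" and g: "square_integrable g" "bounded_support g" for f g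
  proof -
    note [measurable] = borel_square_integrable[OF f(1)] borel_square_integrable[OF g(1)]
    note fi = square_integrable_imp_integrable[OF f] and gi = square_integrable_imp_integrable[OF g]
    obtain K where K: "\<And>z. cmod (proj_kernel E z) \<le> K" using proj_kernel_bound by blast
    let ?h = "\<lambda>x y. proj_kernel E (x - y) * f y * cnj (g x)"
    have int: "integrable (lborel \<Otimes>\<^sub>M lborel) (case_prod ?h)"
    proof (rule Bochner_Integration.integrable_bound)
      show "integrable (lborel \<Otimes>\<^sub>M lborel) (\<lambda>(x, y). complex_of_real K * (f y * cnj (g x)))"
      proof (rule lborel_pair.Fubini_integrable)
        show "integrable lborel (\<lambda>x. LINT y|lborel. norm (case (x, y) of (x, y) \<Rightarrow> complex_of_real K * (f y * cnj (g x))))"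
          using gi by (simp add: norm_mult)
        show "AE x in lborel. integrable lborel (\<lambda>y. case (x, y) of (x, y) \<Rightarrow> complex_of_real K * (f y * cnj (g x)))"
          using fi by simp
      qed measurable
      show "AE p in lborel \<Otimes>\<^sub>M lborel. norm (case_prod ?h p) \<le> norm (case p of (x, y) \<Rightarrow> complex_of_real K * (f y * cnj (g x)))"
      proof (intro AE_I2, clarify)
        fix x y
        have "cmod (proj_kernel E (x - y)) \<le> \<bar>K\<bar>" using K order_trans abs_ge_self by blast
        then show "norm (?h x y) \<le> norm (complex_of_real K * (f y * cnj (g x)))"
          by (simp add: norm_mult mult.assoc mult_right_mono)
      qed
    qed measurable
    have "cinner (freq_proj E (abs_L2 f)) (abs_L2 g) = (LINT x|lborel. (LINT y|lborel. ?h x y))"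
      unfolding freq_proj_abs[OF f(1)] cinner_abs_L2[OF proj_fun_L2(1)[OF f(1)] g(1)] proj_fun_def
      by simp
    also have "\<dots> = (LINT y|lborel. (LINT x|lborel. ?h x y))"
      by (rule lborel_pair.Fubini_integral[OF int, symmetric])
    also have "\<dots> = (LINT y|lborel. f y * cnj (proj_fun E g y))"
    proof (intro Bochner_Integration.integral_cong refl)
      fix y
      have "integrable lborel (\<lambda>x. proj_kernel E (y - x) * g x)"
      proof (rule Bochner_Integration.integrable_bound)
        show "integrable lborel (\<lambda>x. complex_of_real K * g x)" using gi by simp
        show "AE x in lborel. norm (proj_kernel E (y - x) * g x) \<le> norm (complex_of_real K * g x)"
          unfolding norm_mult norm_of_real
          by (intro AE_I2 mult_right_mono order_trans[OF K abs_ge_self]) auto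
      qed measurable
      then have "cnj (proj_fun E g y) = (LINT x|lborel. cnj (proj_kernel E (y - x) * g x))"
        unfolding proj_fun_def by (rule integral_bounded_linear[OF bounded_linear_cnj, symmetric])
      also have "\<dots> = (LINT x|lborel. proj_kernel E (x - y) * cnj (g x))"
        by (simp add: cnj_proj_kernel)
      finally show "(LINT x|lborel. ?h x y) = f y * cnj (proj_fun E g y)"
        by (simp only: integral_mult_right_zero[symmetric]) (simp add: mult_ac)
    qed
    also have "\<dots> = cinner (abs_L2 f) (freq_proj E (abs_L2 g))"
      unfolding freq_proj_abs[OF g(1)] cinner_abs_L2[OF f(1) proj_fun_L2(1)[OF g(1)]] ..
    finally show ?thesis .
  qed
  obtain f where f: "square_integrable f" "u = abs_L2 f" by (rule L2_cases)
  obtain g where g: "square_integrable g" "v = abs_L2 g" by (rule L2_cases)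
  obtain F where F: "\<And>n::nat. square_integrable (F n)" "\<And>n. bounded_support (F n)" "(\<lambda>n. abs_L2 (F n)) \<longlonglongrightarrow> abs_L2 f"
    "\<And>n. norm (abs_L2 (F n)) \<le> norm (abs_L2 f)"
    using truncation_tendsto[OF f(1)] by blast
  obtain G where G: "\<And>n::nat. square_integrable (G n)" "\<And>n. bounded_support (G n)" "(\<lambda>n. abs_L2 (G n)) \<longlonglongrightarrow> abs_L2 g"
    "\<And>n. norm (abs_L2 (G n)) \<le> norm (abs_L2 g)"
    using truncation_tendsto[OF g(1)] by blast
  note cont = bounded_linear.tendsto[OF bounded_clinearD(5)[OF bounded_clinear_freq_proj]]
  have "(\<lambda>n. cinner (freq_proj E (abs_L2 (F n))) (abs_L2 (G n))) \<longlonglongrightarrow> cinner (freq_proj E u) v"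
    unfolding f(2) g(2) by (intro tendsto_cinner cont F(3) G(3))
  moreover have "(\<lambda>n. cinner (abs_L2 (F n)) (freq_proj E (abs_L2 (G n)))) \<longlonglongrightarrow> cinner u (freq_proj E v)"
    unfolding f(2) g(2) by (intro tendsto_cinner cont F(3) G(3))
  ultimately show "cinner (freq_proj E u) v = cinner u (freq_proj E v)"
    unfolding bs[OF F(1,2) G(1,2)] by (rule LIMSEQ_unique)
qed

text \<open>This replaces idempotence: \<open>P f\<close> no longer has bounded support, so \<open>P (P f)\<close> is out of
  reach of the Fourier integral, but \<open>\<langle>P f, f\<rangle> = \<parallel>P f\<parallel>\<^sup>2\<close> is all that is needed for \<open>\<parallel>f - P f\<parallel>\<close>.\<close>

lemma cinner_freq_proj_self:
  assumes f: "square_integrable f" "bounded_support f"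
  shows "cinner (freq_proj E (abs_L2 f)) (abs_L2 f) = complex_of_real ((norm (freq_proj E (abs_L2 f)))\<^sup>2)"
proof -
  let ?v = "\<lambda>\<xi>. indicator E \<xi> * fourier f \<xi>" and ?c = "complex_of_real (1 / (2 * pi) ^ DIM('a))"
  note [measurable] = borel_square_integrable[OF f(1)]
  note fi = square_integrable_imp_integrable[OF f]
  note v = square_integrable_indicator_fourier[OF f]
  note vi = square_integrable_imp_integrable[OF v bounded_support_mult_indicator_E]
  let ?h = "\<lambda>x \<xi>. cis (x \<bullet> \<xi>) * ?v \<xi> * cnj (f x)"
  have int: "integrable (lborel \<Otimes>\<^sub>M lborel) (case_prod ?h)"
  proof (rule lborel_pair.Fubini_integrable)
    show "integrable lborel (\<lambda>x. LINT \<xi>|lborel. norm (case (x, \<xi>) of (x, \<xi>) \<Rightarrow> ?h x \<xi>))"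
      using fi by (simp add: norm_mult)
    show "AE x in lborel. integrable lborel (\<lambda>\<xi>. case (x, \<xi>) of (x, \<xi>) \<Rightarrow> ?h x \<xi>)"
      by (intro AE_I2) (use integrable_cis_mult[OF vi] in \<open>simp add: mult.assoc[symmetric]\<close>)
  qed measurable
  have h: "(LINT \<xi>|lborel. ?h x \<xi>) = (LINT \<xi>|lborel. cis (x \<bullet> \<xi>) * ?v \<xi>) * cnj (f x)" for x
    by (rule integral_mult_left_zero)
  have "cinner (freq_proj E (abs_L2 f)) (abs_L2 f) = (LINT x|lborel. ?c * (LINT \<xi>|lborel. ?h x \<xi>))"
    unfolding freq_proj_abs[OF f(1)] cinner_abs_L2[OF proj_fun_L2(1)[OF f(1)] f(1)] proj_fun_fourier[OF fi] h
    by (simp only: mult.assoc)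
  also have "\<dots> = ?c * (LINT x|lborel. (LINT \<xi>|lborel. ?h x \<xi>))" by (rule integral_mult_right_zero)
  also have "(LINT x|lborel. (LINT \<xi>|lborel. ?h x \<xi>)) = (LINT \<xi>|lborel. (LINT x|lborel. ?h x \<xi>))"
    by (rule lborel_pair.Fubini_integral[OF int, symmetric])
  also have "\<dots> = (LINT \<xi>|lborel. complex_of_real ((cmod (?v \<xi>))\<^sup>2))"
  proof (intro Bochner_Integration.integral_cong refl)
    fix \<xi> :: 'a
    have "cnj (fourier f \<xi>) = (LINT x|lborel. cnj (cis (- (x \<bullet> \<xi>)) * f x))"
      unfolding fourier_def
      by (rule integral_bounded_linear[OF bounded_linear_cnj, symmetric]) (intro integrable_cis_mult fi; measurable)
    then have "(LINT x|lborel. ?h x \<xi>) = ?v \<xi> * cnj (fourier f \<xi>)"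
      by (simp only: integral_mult_right_zero[symmetric]) (simp add: cis_cnj mult_ac)
    also have "\<dots> = ?v \<xi> * cnj (?v \<xi>)" by (simp add: indicator_def)
    finally show "(LINT x|lborel. ?h x \<xi>) = complex_of_real ((cmod (?v \<xi>))\<^sup>2)"
      by (simp only: complex_norm_square)
  qed
  also have "\<dots> = complex_of_real ((norm (abs_L2 ?v))\<^sup>2)"
    unfolding norm_abs_L2[OF v] by (rule integral_complex_of_real)
  finally show ?thesis
    unfolding freq_proj_abs[OF f(1)] proj_fun_bounded_support(2)[OF f] by simp
qed

lemma norm_freq_proj:
  assumes f: "square_integrable f" "bounded_support f"
  shows "ennreal ((norm (freq_proj E (abs_L2 f)))\<^sup>2) =
    ennreal (1 / (2 * pi) ^ DIM('a)) * (\<integral>\<^sup>+\<xi>. indicator E \<xi> * ennreal ((cmod (fourier f \<xi>))\<^sup>2) \<partial>lborel)"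
proof -
  note v = square_integrable_indicator_fourier[OF f]
  have "ennreal ((norm (freq_proj E (abs_L2 f)))\<^sup>2) = ennreal (1 / (2 * pi) ^ DIM('a)) *
      ennreal ((norm (abs_L2 (\<lambda>\<xi>. indicator E \<xi> * fourier f \<xi>)))\<^sup>2)"
    unfolding freq_proj_abs[OF f(1)] proj_fun_bounded_support(2)[OF f]
    by (subst ennreal_mult[symmetric]) auto
  also have "ennreal ((norm (abs_L2 (\<lambda>\<xi>. indicator E \<xi> * fourier f \<xi>)))\<^sup>2) =
      (\<integral>\<^sup>+\<xi>. indicator E \<xi> * ennreal ((cmod (fourier f \<xi>))\<^sup>2) \<partial>lborel)"
    unfolding ennreal_norm_abs_L2[OF v] by (intro nn_integral_cong) (auto simp: indicator_def)
  finally show ?thesis .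
qed

lemma norm_complement_freq_proj:
  assumes f: "square_integrable f" "bounded_support f"
  shows "ennreal ((norm (abs_L2 f - freq_proj E (abs_L2 f)))\<^sup>2) =
    ennreal (1 / (2 * pi) ^ DIM('a)) * (\<integral>\<^sup>+\<xi>. indicator (- E) \<xi> * ennreal ((cmod (fourier f \<xi>))\<^sup>2) \<partial>lborel)"
proof -
  let ?u = "abs_L2 f" and ?P = "freq_proj E (abs_L2 f)" and ?c = "1 / (2 * pi) ^ DIM('a)"
  let ?F = "\<lambda>\<xi>. ennreal ((cmod (fourier f \<xi>))\<^sup>2)"
  note [measurable] = borel_square_integrable[OF f(1)]
  have "inner ?P ?u = (norm ?P)\<^sup>2"
    unfolding inner_L2_def cinner_freq_proj_self[OF f] by simp
  then have "(norm (?u - ?P))\<^sup>2 + (norm ?P)\<^sup>2 = (norm ?u)\<^sup>2"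
    by (simp add: power2_norm_eq_inner inner_diff_left inner_diff_right inner_commute)
  then have "ennreal ((norm (?u - ?P))\<^sup>2) + ennreal ((norm ?P)\<^sup>2) = ennreal ((norm ?u)\<^sup>2)"
    by (subst ennreal_plus[symmetric]) auto
  also have "(norm ?u)\<^sup>2 = ?c * (norm (abs_L2 (fourier f)))\<^sup>2" by (simp add: Plancherel(2)[OF f])
  also have "ennreal \<dots> = ennreal ?c * (\<integral>\<^sup>+\<xi>. ?F \<xi> \<partial>lborel)"
    unfolding ennreal_norm_abs_L2[OF Plancherel(1)[OF f], symmetric] by (rule ennreal_mult) auto
  also have "(\<integral>\<^sup>+\<xi>. ?F \<xi> \<partial>lborel) = (\<integral>\<^sup>+\<xi>. indicator (- E) \<xi> * ?F \<xi> + indicator E \<xi> * ?F \<xi> \<partial>lborel)"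
    by (intro nn_integral_cong) (auto simp: indicator_def)
  also have "\<dots> = (\<integral>\<^sup>+\<xi>. indicator (- E) \<xi> * ?F \<xi> \<partial>lborel) + (\<integral>\<^sup>+\<xi>. indicator E \<xi> * ?F \<xi> \<partial>lborel)"
    by (rule nn_integral_add) auto
  also have "ennreal ?c * \<dots> = ennreal ?c * (\<integral>\<^sup>+\<xi>. indicator (- E) \<xi> * ?F \<xi> \<partial>lborel) + ennreal ((norm ?P)\<^sup>2)"
    unfolding norm_freq_proj[OF f] by (rule distrib_left)
  finally show ?thesis by (simp add: ennreal_add_left_cancel add.commute)
qed

end

section \<open>Schwartz functions and the quantisation of an indicator\<close>

lemma integrable_inverse_1_plus_sq: "integrable lborel (\<lambda>t::real. 1 / (1 + t\<^sup>2))"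
proof -
  have "einterval (- \<infinity>) \<infinity> = UNIV" by (auto simp: einterval_iff)
  then show ?thesis using integrable_inverse_1_plus_square
    by (simp add: set_integrable_def inverse_eq_divide)
qed

lemma lborel_integrable_prod_real:
  fixes f :: "'a::euclidean_space \<Rightarrow> real \<Rightarrow> real"
  assumes "\<And>b. b \<in> Basis \<Longrightarrow> integrable lborel (f b)"
  shows "integrable lborel (\<lambda>x::'a. \<Prod>b\<in>Basis. f b (x \<bullet> b))"
proof -
  have "integrable lborel (\<lambda>x::'a. \<Prod>b\<in>Basis. complex_of_real (f b (x \<bullet> b)))"
    by (rule lborel_integrable_prod(1)) (simp add: assms complex_of_real_integrable_eq)
  then have "integrable lborel (\<lambda>x::'a. complex_of_real (\<Prod>b\<in>Basis. f b (x \<bullet> b)))" by simp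
  then show ?thesis by (subst (asm) complex_of_real_integrable_eq)
qed

text \<open>A majorant of tensor form, whose integral is a product of one-dimensional ones.\<close>

definition prod_decay :: "'a::euclidean_space \<Rightarrow> real" where
  "prod_decay x = (\<Prod>b\<in>Basis. 1 / (1 + (x \<bullet> b)\<^sup>2))"

lemma prod_decay_bounds: "0 < prod_decay x" "prod_decay x \<le> 1"
  unfolding prod_decay_def
  by (auto intro!: prod_pos prod_le_1 simp: add_pos_nonneg field_simps)

lemma prod_decay_borel [measurable]: "prod_decay \<in> borel_measurable borel"
  unfolding prod_decay_def[abs_def] by measurable

lemma integrable_prod_decay: "integrable lborel prod_decay"
  unfolding prod_decay_def[abs_def]
  by (rule lborel_integrable_prod_real) (rule integrable_inverse_1_plus_sq)

lemma integrable_prod_decay_sq: "integrable lborel (\<lambda>x. (C * prod_decay x)\<^sup>2)"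
proof (rule Bochner_Integration.integrable_bound)
  show "integrable lborel (\<lambda>x::'a. C\<^sup>2 * prod_decay x)" by (intro integrable_mult_right integrable_prod_decay)
  show "AE x in lborel. norm ((C * prod_decay x)\<^sup>2) \<le> norm (C\<^sup>2 * prod_decay (x::'a))"
  proof (rule AE_I2)
    fix x :: 'a
    have "(prod_decay x)\<^sup>2 \<le> prod_decay x"
      using prod_decay_bounds[of x] mult_left_le[of "prod_decay x" "prod_decay x"] by (simp add: power2_eq_square)
    then show "norm ((C * prod_decay x)\<^sup>2) \<le> norm (C\<^sup>2 * prod_decay x)"
      using prod_decay_bounds[of x] by (simp add: power_mult_distrib abs_mult mult_left_mono)
  qed
qed measurable

lemma prod_decay_ge:
  fixes x :: "'a::euclidean_space"
  shows "1 \<le> prod_decay x * (1 + (norm x)\<^sup>2) ^ DIM('a)"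
proof -
  have "(\<Prod>b\<in>Basis. 1 + (x \<bullet> b)\<^sup>2) \<le> (\<Prod>b\<in>(Basis::'a set). 1 + (norm x)\<^sup>2)"
    by (intro prod_mono conjI add_left_mono power2_le_iff_abs_le[THEN iffD2] Basis_le_norm) auto
  moreover have "prod_decay x * (\<Prod>b\<in>Basis. 1 + (x \<bullet> b)\<^sup>2) = 1"
    unfolding prod_decay_def prod.distrib[symmetric]
    by (rule prod.neutral) (auto simp: add_nonneg_eq_0_iff)
  ultimately show ?thesis
    using mult_left_mono[of "\<Prod>b\<in>Basis. 1 + (x \<bullet> b)\<^sup>2" "\<Prod>b\<in>(Basis::'a set). 1 + (norm x)\<^sup>2" "prod_decay x"]
      prod_decay_bounds[of x] by simp
qed

lemma schwartz_decay:
  fixes u :: "'a::euclidean_space \<Rightarrow> complex"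
  assumes "schwartz u"
  obtains C where "\<And>x. cmod (u x) \<le> C * prod_decay x"
proof -
  let ?D = "DIM('a)"
  have b: "bounded (range (\<lambda>x. norm x ^ m *\<^sub>R u x))" for m
    using assms unfolding schwartz_def by (metis empty_iff empty_set iterated_partial.simps(1) subsetI)
  obtain C0 where C0: "\<And>x. cmod (u x) \<le> C0"
    using b[of 0] by (auto simp: bounded_iff)
  obtain C1 where C1: "\<And>x. norm x ^ (2 * ?D) * cmod (u x) \<le> C1"
    using b[of "2 * ?D"] by (auto simp: bounded_iff)
  have "cmod (u x) \<le> (2 ^ ?D * (C0 + C1)) * prod_decay x" for x
  proof -
    have "(1 + (norm x)\<^sup>2) ^ ?D \<le> (2 * max 1 ((norm x)\<^sup>2)) ^ ?D" by (intro power_mono) auto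
    also have "\<dots> = 2 ^ ?D * (max 1 ((norm x)\<^sup>2)) ^ ?D" by (rule power_mult_distrib)
    also have "(max 1 ((norm x)\<^sup>2)) ^ ?D \<le> 1 + norm x ^ (2 * ?D)"
      by (cases "1 \<le> (norm x)\<^sup>2") (auto simp: max_def power_mult)
    finally have 1: "(1 + (norm x)\<^sup>2) ^ ?D \<le> 2 ^ ?D * (1 + norm x ^ (2 * ?D))" by simp
    have "cmod (u x) \<le> cmod (u x) * (prod_decay x * (1 + (norm x)\<^sup>2) ^ ?D)"
      using prod_decay_ge[of x] mult_left_mono[of 1 _ "cmod (u x)"] by simp
    also have "\<dots> \<le> cmod (u x) * (prod_decay x * (2 ^ ?D * (1 + norm x ^ (2 * ?D))))"
      using prod_decay_bounds[of x] 1 by (intro mult_left_mono) auto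
    also have "\<dots> = (2 ^ ?D * (cmod (u x) + norm x ^ (2 * ?D) * cmod (u x))) * prod_decay x"
      by (simp add: algebra_simps)
    also have "\<dots> \<le> (2 ^ ?D * (C0 + C1)) * prod_decay x"
      using prod_decay_bounds[of x] by (intro mult_right_mono mult_left_mono add_mono C0 C1) auto
    finally show ?thesis .
  qed
  then show thesis by (rule that)
qed

lemma schwartz_borel:
  assumes "schwartz u"
  shows "u \<in> borel_measurable borel"
proof -
  have "u differentiable_on UNIV"
    using assms unfolding schwartz_def by (metis empty_iff empty_set iterated_partial.simps(1) subsetI)
  then show ?thesis by (intro borel_measurable_continuous_onI differentiable_imp_continuous_on)
qed

lemma schwartz_integrable:
  assumes u: "schwartz u"
  shows "square_integrable u" and "integrable lborel u"
proof -
  obtain C where C: "\<And>x. cmod (u x) \<le> C * prod_decay x" using schwartz_decay[OF u] by blast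
  note [measurable] = schwartz_borel[OF u]
  show "square_integrable u"
    by (rule square_integrable_dominated[OF _ integrable_prod_decay_sq]) (use C in auto)
  show "integrable lborel u"
  proof (rule Bochner_Integration.integrable_bound)
    show "integrable lborel (\<lambda>x. C * prod_decay x)" by (intro integrable_mult_right integrable_prod_decay)
    show "AE x in lborel. norm (u x) \<le> norm (C * prod_decay x)"
      unfolding real_norm_def by (intro AE_I2 order_trans[OF C abs_ge_self])
  qed measurable
qed

lemma Op_formula_indicator:
  fixes u :: "'a::euclidean_space \<Rightarrow> complex"
  assumes \<Omega>[measurable]: "\<Omega> \<in> sets borel" and b: "bounded \<Omega>" and \<alpha>: "\<alpha> > 0" and u: "integrable lborel u"
    and E: "E = (*\<^sub>R) \<alpha> ` \<Omega>" "E \<in> sets borel" "bounded E"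
  shows "Op_formula \<alpha> (indicator \<Omega>) u x = proj_fun E u x"
proof -
  note [measurable] = E(2)
  have [measurable]: "u \<in> borel_measurable borel" using borel_measurable_integrable[OF u] by simp
  let ?c = "complex_of_real (1 / (2 * pi) ^ DIM('a))"
  let ?g = "\<lambda>\<xi>. cis (x \<bullet> \<xi>) * (indicator E \<xi> * fourier u \<xi>)"
  have "proj_fun E u x = ?c * (LINT \<xi>|lborel. ?g \<xi>)" by (rule proj_fun_fourier[OF E(2,3) u])
  also have "(LINT \<xi>|lborel. ?g \<xi>) = \<bar>\<alpha>\<bar> ^ DIM('a) *\<^sub>R (LINT \<xi>|lborel. ?g (0 + \<alpha> *\<^sub>R \<xi>))"
    by (rule lborel_integral_affine) (use \<alpha> in auto)
  also have "(LINT \<xi>|lborel. ?g (0 + \<alpha> *\<^sub>R \<xi>)) = (LINT \<xi>|lborel. LINT y|lborel.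
      exp (\<i> * complex_of_real (\<alpha> * ((x - y) \<bullet> \<xi>))) * indicator \<Omega> \<xi> * u y)"
  proof (intro Bochner_Integration.integral_cong refl)
    fix \<xi> :: 'a
    have ind: "indicator E (\<alpha> *\<^sub>R \<xi>) = (indicator \<Omega> \<xi> :: complex)"
      using \<alpha> by (auto simp: E(1) indicator_def)
    have "exp (\<i> * complex_of_real (\<alpha> * ((x - y) \<bullet> \<xi>))) * indicator \<Omega> \<xi> * u y =
        (cis (x \<bullet> (\<alpha> *\<^sub>R \<xi>)) * indicator \<Omega> \<xi>) * (cis (- (y \<bullet> (\<alpha> *\<^sub>R \<xi>))) * u y)" for y
    proof -
      have "\<alpha> * ((x - y) \<bullet> \<xi>) = x \<bullet> (\<alpha> *\<^sub>R \<xi>) + - (y \<bullet> (\<alpha> *\<^sub>R \<xi>))"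
        by (simp add: inner_diff_left algebra_simps)
      then show ?thesis by (simp only: cis_conv_exp[symmetric] cis_mult[symmetric] mult_ac)
    qed
    then show "?g (0 + \<alpha> *\<^sub>R \<xi>) = (LINT y|lborel. exp (\<i> * complex_of_real (\<alpha> * ((x - y) \<bullet> \<xi>))) * indicator \<Omega> \<xi> * u y)"
      by (simp only: integral_mult_right_zero fourier_def add_0_left ind mult.assoc)
  qed
  finally show ?thesis using \<alpha>
    by (simp add: Op_formula_def scaleR_conv_of_real power_divide)
qed

lemma sum_le_prod_1_plus:
  fixes f :: "'i \<Rightarrow> real"
  assumes "\<And>i. f i \<ge> 0"
  shows "1 + sum f A \<le> (\<Prod>i\<in>A. 1 + f i)"
proof (induction A rule: infinite_finite_induct)
  case (insert i A)
  have "1 + sum f A + f i * 1 \<le> (\<Prod>i\<in>A. 1 + f i) + f i * (\<Prod>i\<in>A. 1 + f i)"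
    using assms by (intro add_mono mult_left_mono insert.IH prod_ge_1) auto
  then show ?case using insert.hyps by (simp add: algebra_simps)
qed auto

text \<open>Every partial derivative of a tensor is again a tensor, with the factors replaced by their
  derivatives.\<close>

lemma schwartz_tensor:
  fixes G :: "'a::euclidean_space \<Rightarrow> nat \<Rightarrow> real \<Rightarrow> real"
  assumes deriv: "\<And>b k t. b \<in> Basis \<Longrightarrow> (G b k has_real_derivative G b (Suc k) t) (at t)"
    and bound: "\<And>b k m. b \<in> Basis \<Longrightarrow> \<exists>C. \<forall>t. \<bar>t\<bar> ^ m * \<bar>G b k t\<bar> \<le> C"
  shows "schwartz (\<lambda>x::'a. complex_of_real (\<Prod>b\<in>Basis. G b 0 (x \<bullet> b)))"
proof -
  define H where "H k x = complex_of_real (\<Prod>b\<in>Basis. G b (k b) (x \<bullet> b))" for k and x :: 'a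
  have H: "(H k has_derivative (\<lambda>y. complex_of_real (\<Sum>b\<in>Basis. (y \<bullet> b) * G b (Suc (k b)) (x \<bullet> b) *
      (\<Prod>j\<in>Basis - {b}. G j (k j) (x \<bullet> j))))) (at x)" for k x
    unfolding H_def
  proof (rule has_derivative_of_real, rule has_derivative_prod)
    fix b :: 'a assume b: "b \<in> Basis"
    have "((\<lambda>x. G b (k b) (x \<bullet> b)) has_derivative (\<lambda>y. G b (Suc (k b)) (x \<bullet> b) * (y \<bullet> b))) (at x)"
      by (rule has_derivative_compose[where f = "\<lambda>x. x \<bullet> b" and g = "G b (k b)"])
        (use deriv[OF b] in \<open>auto intro!: derivative_eq_intros simp: has_field_derivative_def\<close>)
    then show "((\<lambda>x. G b (k b) (x \<bullet> b)) has_derivative (\<lambda>y. (y \<bullet> b) * G b (Suc (k b)) (x \<bullet> b))) (at x)"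
      by (simp only: mult.commute)
  qed
  have partial: "frechet_derivative (H k) (at x) c = H (k(c := Suc (k c))) x" if c: "c \<in> Basis" for k x c
  proof -
    have "frechet_derivative (H k) (at x) c = complex_of_real (\<Sum>b\<in>Basis. (c \<bullet> b) * G b (Suc (k b)) (x \<bullet> b) *
      (\<Prod>j\<in>Basis - {b}. G j (k j) (x \<bullet> j)))"
      by (rule fun_cong[OF frechet_derivative_at[OF H, symmetric]])
    also have "(\<Sum>b\<in>Basis. (c \<bullet> b) * G b (Suc (k b)) (x \<bullet> b) * (\<Prod>j\<in>Basis - {b}. G j (k j) (x \<bullet> j))) =
        (\<Sum>b\<in>Basis. if b = c then G c (Suc (k c)) (x \<bullet> c) * (\<Prod>j\<in>Basis - {c}. G j (k j) (x \<bullet> j)) else 0)"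
      using c by (intro sum.cong refl) (auto simp: inner_Basis)
    also have "\<dots> = G c (Suc (k c)) (x \<bullet> c) * (\<Prod>j\<in>Basis - {c}. G j (k j) (x \<bullet> j))" using c by simp
    also have "(\<Prod>j\<in>Basis - {c}. G j (k j) (x \<bullet> j)) = (\<Prod>j\<in>Basis - {c}. G j ((k(c := Suc (k c))) j) (x \<bullet> j))"
      by (intro prod.cong) auto
    also have "G c (Suc (k c)) (x \<bullet> c) * \<dots> = (\<Prod>j\<in>Basis. G j ((k(c := Suc (k c))) j) (x \<bullet> j))"
      using c by (subst prod.remove[of Basis c]) auto
    finally show ?thesis unfolding H_def[of "k(c := Suc (k c))" x] .
  qed
  have iter: "\<exists>k. iterated_partial bs (H (\<lambda>_. 0)) = H k" if "set bs \<subseteq> Basis" for bs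
    using that
  proof (induction bs)
    case (Cons c bs)
    then obtain k where "iterated_partial bs (H (\<lambda>_. 0)) = H k" by auto
    then have "iterated_partial (c # bs) (H (\<lambda>_. 0)) = H (k(c := Suc (k c)))"
      using Cons.prems by (auto simp: partial)
    then show ?case by blast
  qed auto
  have bdd: "bounded (range (\<lambda>x. norm x ^ m *\<^sub>R H k x))" for m k
  proof -
    have "\<exists>C. \<forall>t. (1 + \<bar>t\<bar>) ^ m * \<bar>G b (k b) t\<bar> \<le> C" if b: "b \<in> Basis" for b
    proof -
      obtain C0 C1 where C0: "\<And>t. \<bar>t\<bar> ^ 0 * \<bar>G b (k b) t\<bar> \<le> C0" and C1: "\<And>t. \<bar>t\<bar> ^ m * \<bar>G b (k b) t\<bar> \<le> C1"
        using bound[OF b] by metis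
      have "(1 + \<bar>t\<bar>) ^ m * \<bar>G b (k b) t\<bar> \<le> 2 ^ m * (C0 + C1)" for t
      proof -
        have "(1 + \<bar>t\<bar>) ^ m \<le> (2 * max 1 \<bar>t\<bar>) ^ m" by (intro power_mono) auto
        also have "\<dots> = 2 ^ m * (max 1 \<bar>t\<bar>) ^ m" by (rule power_mult_distrib)
        also have "(max 1 \<bar>t\<bar>) ^ m \<le> 1 + \<bar>t\<bar> ^ m" by (cases "1 \<le> \<bar>t\<bar>") (auto simp: max_def)
        finally have "(1 + \<bar>t\<bar>) ^ m * \<bar>G b (k b) t\<bar> \<le> 2 ^ m * (1 + \<bar>t\<bar> ^ m) * \<bar>G b (k b) t\<bar>"
          by (intro mult_right_mono) auto
        also have "\<dots> = 2 ^ m * (\<bar>t\<bar> ^ 0 * \<bar>G b (k b) t\<bar> + \<bar>t\<bar> ^ m * \<bar>G b (k b) t\<bar>)" by (simp add: algebra_simps)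
        also have "\<dots> \<le> 2 ^ m * (C0 + C1)" by (intro mult_left_mono add_mono C0 C1) auto
        finally show ?thesis .
      qed
      then show ?thesis by blast
    qed
    then obtain C where C: "\<And>b t. b \<in> Basis \<Longrightarrow> (1 + \<bar>t\<bar>) ^ m * \<bar>G b (k b) t\<bar> \<le> C b" by metis
    have "norm (norm x ^ m *\<^sub>R H k x) \<le> (\<Prod>b\<in>Basis. C b)" for x :: 'a
    proof -
      have "norm x \<le> (\<Sum>b\<in>Basis. \<bar>x \<bullet> b\<bar>)" by (rule norm_le_l1)
      also have "\<dots> \<le> (\<Prod>b\<in>Basis. 1 + \<bar>x \<bullet> b\<bar>)"
        using sum_le_prod_1_plus[of "\<lambda>b. \<bar>x \<bullet> b\<bar>" Basis] by simp
      finally have "norm x ^ m \<le> (\<Prod>b\<in>Basis. 1 + \<bar>x \<bullet> b\<bar>) ^ m" by (intro power_mono) auto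
      then have "norm (norm x ^ m *\<^sub>R H k x) \<le> (\<Prod>b\<in>Basis. 1 + \<bar>x \<bullet> b\<bar>) ^ m * (\<Prod>b\<in>Basis. \<bar>G b (k b) (x \<bullet> b)\<bar>)"
        by (simp add: H_def abs_prod norm_mult mult_right_mono prod_nonneg flip: of_real_prod)
      also have "\<dots> = (\<Prod>b\<in>Basis. (1 + \<bar>x \<bullet> b\<bar>) ^ m * \<bar>G b (k b) (x \<bullet> b)\<bar>)"
        by (simp add: prod_power_distrib prod.distrib)
      also have "\<dots> \<le> (\<Prod>b\<in>Basis. C b)" by (intro prod_mono conjI C) auto
      finally show ?thesis .
    qed
    then show ?thesis unfolding bounded_iff by blast
  qed
  have "schwartz (H (\<lambda>_. 0))"
    unfolding schwartz_def
  proof (intro allI impI)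
    fix bs :: "'a list" assume "set bs \<subseteq> Basis"
    then obtain k where k: "iterated_partial bs (H (\<lambda>_. 0)) = H k" using iter by blast
    show "iterated_partial bs (H (\<lambda>_. 0)) differentiable_on UNIV \<and>
        (\<forall>m::nat. bounded (range (\<lambda>x. norm x ^ m *\<^sub>R iterated_partial bs (H (\<lambda>_. 0)) x)))"
    proof (intro conjI allI)
      show "iterated_partial bs (H (\<lambda>_. 0)) differentiable_on UNIV"
        unfolding k differentiable_on_def differentiable_def using H by blast
    qed (simp only: k bdd)
  qed
  then show ?thesis by (simp add: H_def[abs_def])
qed

definition logistic :: "real \<Rightarrow> real" where
  "logistic t = 1 / (1 + exp (- t))"

lemma logistic_bounds: "0 < logistic t" "logistic t \<le> 1" "logistic t \<le> exp t"
proof -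
  have "logistic t \<le> 1 / exp (- t)"
    unfolding logistic_def by (intro divide_left_mono) (auto simp: add_pos_pos)
  then show "logistic t \<le> exp t" by (simp add: exp_minus inverse_eq_divide)
qed (auto simp: logistic_def add_pos_pos)

lemma logistic_deriv: "(logistic has_real_derivative logistic t * (1 - logistic t)) (at t)"
proof -
  have pos: "1 + exp (- t) \<noteq> 0" by (smt (verit) exp_gt_zero)
  show ?thesis unfolding logistic_def[abs_def]
    by (auto intro!: derivative_eq_intros simp: pos divide_simps power2_eq_square)
qed

text \<open>Uniqueness of the quantisation needs sufficiently many Schwartz functions. As \<open>r\<close> grows, products of
  these bumps over the coordinates approximate the indicators of boxes.\<close>

definition bump :: "real \<Rightarrow> real \<Rightarrow> real \<Rightarrow> real \<Rightarrow> real" where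
  "bump r a b t = logistic (r * (t - a)) * logistic (r * (b - t))"

lemma bump_bounds: "0 < bump r a b t" "bump r a b t \<le> 1"
  using logistic_bounds[of "r * (t - a)"] logistic_bounds[of "r * (b - t)"]
  by (auto simp: bump_def intro: mult_le_one)

lemma power_le_exp:
  assumes "x \<ge> (0::real)"
  shows "x ^ m \<le> real m ^ m * exp x"
proof (cases "m = 0")
  case False
  have "(x / m) ^ m \<le> (1 + x / m) ^ m" using assms by (intro power_mono) auto
  also have "\<dots> \<le> exp x" using assms False by (intro exp_ge_one_plus_x_over_n_power_n) auto
  finally show ?thesis using False by (simp add: power_divide divide_le_eq mult.commute)
qed (use assms in simp)

lemma bump_decay:
  "\<exists>C. \<forall>r\<ge>1. \<forall>t. \<bar>t\<bar> ^ m * bump r a b t \<le> C"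
proof (intro exI allI impI)
  fix r t :: real assume r: "r \<ge> 1"
  have *: "\<bar>t\<bar> ^ m * bump r a b t \<le> real m ^ m * exp \<bar>c\<bar>"
    if le: "bump r a b t \<le> exp (c - \<bar>t\<bar>)" for c
  proof -
    have "\<bar>t\<bar> ^ m * bump r a b t \<le> (real m ^ m * exp \<bar>t\<bar>) * exp (c - \<bar>t\<bar>)"
      using bump_bounds(1)[of r a b t] by (intro mult_mono power_le_exp le) auto
    also have "\<dots> = real m ^ m * exp c" by (simp add: exp_diff)
    also have "\<dots> \<le> real m ^ m * exp \<bar>c\<bar>" by (intro mult_left_mono) auto
    finally show ?thesis .
  qed
  have half: "logistic (r * s) \<le> exp s" if "s \<le> 0" for s
  proof -
    have "logistic (r * s) \<le> exp (r * s)" by (rule logistic_bounds)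
    also have "\<dots> \<le> exp s" using r that mult_right_mono_neg[of 1 r s] by simp
    finally show ?thesis .
  qed
  have le1: "bump r a b t \<le> logistic (r * (b - t))" "bump r a b t \<le> logistic (r * (t - a))"
    using logistic_bounds[of "r * (t - a)"] logistic_bounds[of "r * (b - t)"]
    by (auto simp: bump_def mult_left_le mult_left_le_one_le)
  have half': "logistic (r * s) \<le> exp s" for s
  proof (cases "s \<le> 0")
    case False
    have "logistic (r * s) \<le> 1" by (rule logistic_bounds)
    then show ?thesis using False by (smt (verit) one_le_exp_iff)
  qed (rule half)
  have "\<bar>t\<bar> ^ m * bump r a b t \<le> real m ^ m * exp \<bar>b\<bar> \<or> \<bar>t\<bar> ^ m * bump r a b t \<le> real m ^ m * exp \<bar>- a\<bar>"
  proof (cases "t \<ge> 0")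
    case True
    then show ?thesis using *[of b] order_trans[OF le1(1) half'] by simp
  next
    case False
    then show ?thesis using *[of "- a"] order_trans[OF le1(2) half'] by simp
  qed
  moreover have "0 \<le> real m ^ m * exp \<bar>b\<bar>" "0 \<le> real m ^ m * exp \<bar>- a\<bar>" by auto
  ultimately show "\<bar>t\<bar> ^ m * bump r a b t \<le> real m ^ m * exp \<bar>b\<bar> + real m ^ m * exp \<bar>- a\<bar>" by linarith
qed

inductive_set polynomials_in :: "(real \<Rightarrow> real) \<Rightarrow> (real \<Rightarrow> real) \<Rightarrow> (real \<Rightarrow> real) set"
  for p q where
  const: "(\<lambda>_. c) \<in> polynomials_in p q"
| fst: "p \<in> polynomials_in p q"
| snd: "q \<in> polynomials_in p q"
| add: "f \<in> polynomials_in p q \<Longrightarrow> g \<in> polynomials_in p q \<Longrightarrow> (\<lambda>t. f t + g t) \<in> polynomials_in p q"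
| mult: "f \<in> polynomials_in p q \<Longrightarrow> g \<in> polynomials_in p q \<Longrightarrow> (\<lambda>t. f t * g t) \<in> polynomials_in p q"

lemma polynomials_in_bounded:
  assumes "g \<in> polynomials_in p q" "\<And>t. \<bar>p t\<bar> \<le> 1" "\<And>t. \<bar>q t\<bar> \<le> 1"
  shows "\<exists>C\<ge>0. \<forall>t. \<bar>g t\<bar> \<le> C"
  using assms(1)
proof induction
  case (const c)
  show ?case by (intro exI[of _ "\<bar>c\<bar>"]) auto
next
  case (add f g)
  then obtain C D where "\<And>t. \<bar>f t\<bar> \<le> C" "\<And>t. \<bar>g t\<bar> \<le> D" "C \<ge> 0" "D \<ge> 0" by auto
  then show ?case by (intro exI[of _ "C + D"]) (auto intro: order_trans[OF abs_triangle_ineq add_mono])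
next
  case (mult f g)
  then obtain C D where "\<And>t. \<bar>f t\<bar> \<le> C" "\<And>t. \<bar>g t\<bar> \<le> D" "C \<ge> 0" "D \<ge> 0" by auto
  then show ?case by (intro exI[of _ "C * D"]) (auto simp: abs_mult intro: mult_mono)
qed (use assms(2,3) in \<open>auto intro!: exI[of _ 1]\<close>)

lemma polynomials_in_deriv:
  assumes "g \<in> polynomials_in p q"
    and p: "p' \<in> polynomials_in p q" "\<And>t. (p has_real_derivative p' t) (at t)"
    and q: "q' \<in> polynomials_in p q" "\<And>t. (q has_real_derivative q' t) (at t)"
  shows "\<exists>g'\<in>polynomials_in p q. \<forall>t. (g has_real_derivative g' t) (at t)"
  using assms(1)
proof induction
  case (const c)
  show ?case by (intro bexI[of _ "\<lambda>_. 0"] polynomials_in.const) auto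
next
  case (add f g)
  then obtain f' g' where "f' \<in> polynomials_in p q" "g' \<in> polynomials_in p q"
    "\<And>t. (f has_real_derivative f' t) (at t)" "\<And>t. (g has_real_derivative g' t) (at t)" by auto
  then show ?case
    by (intro bexI[of _ "\<lambda>t. f' t + g' t"] polynomials_in.intros) (auto intro!: derivative_eq_intros)
next
  case (mult f g)
  then obtain f' g' where "f' \<in> polynomials_in p q" "g' \<in> polynomials_in p q"
    "\<And>t. (f has_real_derivative f' t) (at t)" "\<And>t. (g has_real_derivative g' t) (at t)" by auto
  then show ?case using mult.hyps
    by (intro bexI[of _ "\<lambda>t. f' t * g t + g' t * f t"] polynomials_in.intros) (auto intro!: derivative_eq_intros)
qed (use p q in blast)+

text \<open>By the logistic equation \<open>\<sigma>' = \<sigma> (1 - \<sigma>)\<close> all derivatives are the bump times polynomials in its two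
  logistic factors, which are bounded.\<close>

lemma bump_derivatives:
  assumes r: "r \<ge> 1"
  obtains G :: "nat \<Rightarrow> real \<Rightarrow> real" where "G 0 = bump r a b"
    "\<And>k t. (G k has_real_derivative G (Suc k) t) (at t)"
    "\<And>k m. \<exists>C. \<forall>t. \<bar>t\<bar> ^ m * \<bar>G k t\<bar> \<le> C"
proof -
  define p where "p t = logistic (r * (t - a))" for t
  define q where "q t = logistic (r * (b - t))" for t
  let ?L = "polynomials_in p q"
  have p': "(p has_real_derivative r * (p t * (1 + (- 1) * p t))) (at t)" for t
  proof -
    have "((\<lambda>t. r * (t - a)) has_real_derivative r) (at t)" by (auto intro!: derivative_eq_intros)
    from DERIV_chain2[OF logistic_deriv this] show ?thesis
      unfolding p_def[abs_def] by (rule DERIV_cong) (simp add: algebra_simps)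
  qed
  have q': "(q has_real_derivative (- r) * (q t * (1 + (- 1) * q t))) (at t)" for t
  proof -
    have "((\<lambda>t. r * (b - t)) has_real_derivative - r) (at t)" by (auto intro!: derivative_eq_intros)
    from DERIV_chain2[OF logistic_deriv this] show ?thesis
      unfolding q_def[abs_def] by (rule DERIV_cong) (simp add: algebra_simps)
  qed
  have pL: "(\<lambda>t. r * (p t * (1 + (- 1) * p t))) \<in> ?L" and qL: "(\<lambda>t. (- r) * (q t * (1 + (- 1) * q t))) \<in> ?L"
    by (intro polynomials_in.intros)+
  have "\<exists>g2\<in>?L. \<forall>t. ((\<lambda>t. p t * q t * g t) has_real_derivative p t * q t * g2 t) (at t)" if g: "g \<in> ?L" for g
  proof -
    obtain g' where g': "g' \<in> ?L" "\<And>t. (g has_real_derivative g' t) (at t)"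
      using polynomials_in_deriv[OF g pL p' qL q'] by blast
    show ?thesis
    proof (intro bexI allI)
      show "(\<lambda>t. g' t + (r * (1 + (- 1) * p t) + (- r) * (1 + (- 1) * q t)) * g t) \<in> ?L"
        by (intro polynomials_in.intros g g')
      fix t
      show "((\<lambda>t. p t * q t * g t) has_real_derivative
          p t * q t * (g' t + (r * (1 + (- 1) * p t) + (- r) * (1 + (- 1) * q t)) * g t)) (at t)"
        by (rule derivative_eq_intros p' q' g' refl)+ (simp add: algebra_simps)
    qed
  qed
  then obtain nxt where nxt: "\<And>g. g \<in> ?L \<Longrightarrow> nxt g \<in> ?L"
    "\<And>g t. g \<in> ?L \<Longrightarrow> ((\<lambda>t. p t * q t * g t) has_real_derivative p t * q t * nxt g t) (at t)" by metis
  define g where "g = rec_nat (\<lambda>_. 1) (\<lambda>_. nxt)"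
  have g: "g k \<in> ?L" for k by (induction k) (auto simp: g_def intro: polynomials_in.const nxt)
  show thesis
  proof (rule that[of "\<lambda>k t. p t * q t * g k t"])
    show "(\<lambda>t. p t * q t * g 0 t) = bump r a b" by (simp add: g_def bump_def p_def q_def fun_eq_iff)
    show "((\<lambda>t. p t * q t * g k t) has_real_derivative p t * q t * g (Suc k) t) (at t)" for k t
      using nxt(2)[OF g[of k]] by (simp add: g_def)
    fix k m
    obtain C where C: "\<And>t. \<bar>t\<bar> ^ m * bump r a b t \<le> C" using bump_decay[of m a b] r by blast
    have "\<exists>D\<ge>0. \<forall>t. \<bar>g k t\<bar> \<le> D"
      by (rule polynomials_in_bounded[OF g]) (use logistic_bounds in \<open>auto simp: p_def q_def abs_le_iff less_imp_le
          intro: order_trans[of _ 0]\<close>)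
    then obtain D where D: "D \<ge> 0" "\<And>t. \<bar>g k t\<bar> \<le> D" by blast
    have "\<bar>t\<bar> ^ m * \<bar>p t * q t * g k t\<bar> \<le> C * D" for t
    proof -
      have "\<bar>t\<bar> ^ m * \<bar>p t * q t * g k t\<bar> = (\<bar>t\<bar> ^ m * bump r a b t) * \<bar>g k t\<bar>"
        using logistic_bounds(1) by (simp add: bump_def p_def q_def abs_mult less_imp_le)
      also have "\<dots> \<le> C * D"
        using C[of t] D bump_bounds(1)[of r a b t] by (intro mult_mono) (auto intro: order_trans[OF _ C[of t]])
      finally show ?thesis .
    qed
    then show "\<exists>C. \<forall>t. \<bar>t\<bar> ^ m * \<bar>p t * q t * g k t\<bar> \<le> C" by blast
  qed
qed

lemma logistic_limits:
  "s > 0 \<Longrightarrow> (\<lambda>n. logistic (real (Suc n) * s)) \<longlonglongrightarrow> 1"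
  "s < 0 \<Longrightarrow> (\<lambda>n. logistic (real (Suc n) * s)) \<longlonglongrightarrow> 0"
proof -
  have e: "(\<lambda>n. exp (real (Suc n) * s)) \<longlonglongrightarrow> 0" if "s < 0" for s :: real
  proof -
    have "(\<lambda>n. exp s ^ Suc n) \<longlonglongrightarrow> 0"
      using that by (intro LIMSEQ_Suc LIMSEQ_realpow_zero) auto
    then show ?thesis by (simp only: exp_of_nat_mult)
  qed
  show "(\<lambda>n. logistic (real (Suc n) * s)) \<longlonglongrightarrow> 1" if "s > 0"
  proof -
    have "(\<lambda>n. 1 / (1 + exp (real (Suc n) * (- s)))) \<longlonglongrightarrow> 1 / (1 + 0)"
      using that by (intro tendsto_intros e) auto
    then show ?thesis by (simp add: logistic_def)
  qed
  show "(\<lambda>n. logistic (real (Suc n) * s)) \<longlonglongrightarrow> 0" if "s < 0"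
    by (rule tendsto_sandwich[OF _ _ tendsto_const e[OF that]])
      (use logistic_bounds in \<open>auto intro!: always_eventually less_imp_le\<close>)
qed

lemma schwartz_approx_box:
  fixes a b :: "'a::euclidean_space"
  obtains u where "\<And>n::nat. schwartz (u n)" "(\<lambda>n. abs_L2 (u n)) \<longlonglongrightarrow> abs_L2 (indicator (box a b))"
proof -
  define u where "u n x = complex_of_real (\<Prod>i\<in>Basis. bump (real (Suc n)) (a \<bullet> i) (b \<bullet> i) (x \<bullet> i))"
    for n and x :: 'a
  have sch: "schwartz (u n)" for n
  proof -
    have "\<exists>G. G 0 = bump (real (Suc n)) (a \<bullet> i) (b \<bullet> i) \<and>
        (\<forall>k t. (G k has_real_derivative G (Suc k) t) (at t)) \<and> (\<forall>k m. \<exists>C. \<forall>t. \<bar>t\<bar> ^ m * \<bar>G k t\<bar> \<le> C)" for i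
      by (rule bump_derivatives[of "real (Suc n)" "a \<bullet> i" "b \<bullet> i"]) auto
    then obtain G where G: "\<And>i. G i 0 = bump (real (Suc n)) (a \<bullet> i) (b \<bullet> i)"
        "\<And>i k t. (G i k has_real_derivative G i (Suc k) t) (at t)" "\<And>i k m. \<exists>C. \<forall>t. \<bar>t\<bar> ^ m * \<bar>G i k t\<bar> \<le> C"
      by metis
    have "schwartz (\<lambda>x::'a. complex_of_real (\<Prod>i\<in>Basis. G i 0 (x \<bullet> i)))"
      by (rule schwartz_tensor) (use G in auto)
    then show ?thesis by (simp add: G(1) u_def[abs_def])
  qed
  have "\<exists>C. \<forall>n t. bump (real (Suc n)) (a \<bullet> i) (b \<bullet> i) t \<le> C * (1 / (1 + t\<^sup>2))" for i
  proof -
    obtain C2 where C2: "\<And>r t. r \<ge> 1 \<Longrightarrow> \<bar>t\<bar> ^ 2 * bump r (a \<bullet> i) (b \<bullet> i) t \<le> C2"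
      using bump_decay[of 2 "a \<bullet> i" "b \<bullet> i"] by blast
    have "bump (real (Suc n)) (a \<bullet> i) (b \<bullet> i) t \<le> (1 + C2) * (1 / (1 + t\<^sup>2))" for n t
    proof -
      have "bump (real (Suc n)) (a \<bullet> i) (b \<bullet> i) t * (1 + t\<^sup>2) \<le> 1 + C2"
        using bump_bounds(2)[of "real (Suc n)" "a \<bullet> i" "b \<bullet> i" t] C2[of "real (Suc n)" t] by (simp add: algebra_simps)
      then show ?thesis by (simp add: pos_le_divide_eq add_pos_nonneg)
    qed
    then show ?thesis by blast
  qed
  then obtain C where C: "\<And>i n t. bump (real (Suc n)) (a \<bullet> i) (b \<bullet> i) t \<le> C i * (1 / (1 + t\<^sup>2))" by metis
  have "(\<lambda>n. abs_L2 (u n)) \<longlonglongrightarrow> abs_L2 (indicator (box a b))"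
  proof (rule abs_L2_dominated_convergence[where h = "\<lambda>x. (\<Prod>i\<in>Basis. C i) * prod_decay x"])
    show "u n \<in> borel_measurable borel" for n by (rule schwartz_borel[OF sch])
    show "AE x in lborel. cmod (u n x) \<le> (\<Prod>i\<in>Basis. C i) * prod_decay x" for n
    proof (rule AE_I2)
      fix x :: 'a
      have "cmod (u n x) = (\<Prod>i\<in>Basis. bump (real (Suc n)) (a \<bullet> i) (b \<bullet> i) (x \<bullet> i))"
        unfolding u_def norm_of_real using bump_bounds(1) by (intro abs_of_nonneg prod_nonneg) (auto intro: less_imp_le)
      also have "\<dots> \<le> (\<Prod>i\<in>Basis. C i * (1 / (1 + (x \<bullet> i)\<^sup>2)))"
        by (intro prod_mono conjI C less_imp_le[OF bump_bounds(1)])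
      finally show "cmod (u n x) \<le> (\<Prod>i\<in>Basis. C i) * prod_decay x" by (simp only: prod.distrib prod_decay_def)
    qed
    show "integrable lborel (\<lambda>x::'a. ((\<Prod>i\<in>Basis. C i) * prod_decay x)\<^sup>2)" by (rule integrable_prod_decay_sq)
    show "AE x in lborel. (\<lambda>n. u n x) \<longlonglongrightarrow> indicator (box a b) x"
    proof -
      have ae: "AE x in lborel. x \<notin> cbox a b - box a b"
      proof (rule AE_not_in)
        show "cbox a b - box a b \<in> null_sets lborel"
        proof (rule null_setsI)
          have "emeasure lborel (cbox a b - box a b) = emeasure lborel (cbox a b) - emeasure lborel (box a b)"
            by (rule emeasure_Diff) (use box_subset_cbox[of a b] less_imp_neq[OF emeasure_lborel_box_finite[of a b]] in auto)
          also have "\<dots> = 0" by (simp add: emeasure_lborel_cbox_eq emeasure_lborel_box_eq)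
          finally show "emeasure lborel (cbox a b - box a b) = 0" .
        qed simp
      qed
      then show ?thesis
      proof eventually_elim
        case (elim x)
        show ?case
        proof (cases "x \<in> box a b")
          case True
          have "(\<lambda>n. u n x) \<longlonglongrightarrow> complex_of_real (\<Prod>i\<in>(Basis::'a set). 1 * 1)"
            unfolding u_def bump_def
            by (intro tendsto_of_real tendsto_prod tendsto_mult logistic_limits(1)) (use True in \<open>auto simp: mem_box\<close>)
          then show ?thesis using True by simp
        next
          case False
          then have "x \<notin> cbox a b" using elim by auto
          then obtain i where i: "i \<in> Basis" "x \<bullet> i < a \<bullet> i \<or> b \<bullet> i < x \<bullet> i" by (auto simp: mem_box not_le)
          let ?f = "\<lambda>n j. bump (real (Suc n)) (a \<bullet> j) (b \<bullet> j) (x \<bullet> j)"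
          have lim0: "(\<lambda>n. ?f n i) \<longlonglongrightarrow> 0"
            using i(2)
          proof
            assume "x \<bullet> i < a \<bullet> i"
            then have "(\<lambda>n. logistic (real (Suc n) * (x \<bullet> i - a \<bullet> i))) \<longlonglongrightarrow> 0" by (intro logistic_limits(2)) simp
            then show ?thesis
              by (rule tendsto_sandwich[OF _ _ tendsto_const, rotated 2])
                (use logistic_bounds less_imp_le[OF bump_bounds(1)] in \<open>auto intro!: always_eventually mult_left_le simp: bump_def less_imp_le\<close>)
          next
            assume "b \<bullet> i < x \<bullet> i"
            then have "(\<lambda>n. logistic (real (Suc n) * (b \<bullet> i - x \<bullet> i))) \<longlonglongrightarrow> 0" by (intro logistic_limits(2)) simp
            then show ?thesis
              by (rule tendsto_sandwich[OF _ _ tendsto_const, rotated 2])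
                (use logistic_bounds less_imp_le[OF bump_bounds(1)] in \<open>auto intro!: always_eventually mult_left_le_one_le simp: bump_def less_imp_le\<close>)
          qed
          have "(\<lambda>n. u n x) \<longlonglongrightarrow> 0"
          proof (rule Lim_null_comparison[OF _ lim0], intro always_eventually allI)
            fix n
            have "norm (u n x) = (\<Prod>j\<in>Basis. ?f n j)"
              unfolding u_def norm_of_real
              using bump_bounds(1) by (intro abs_of_nonneg prod_nonneg) (auto intro: less_imp_le)
            also have "\<dots> = ?f n i * (\<Prod>j\<in>Basis - {i}. ?f n j)" using i(1) by (simp add: prod.remove)
            also have "\<dots> \<le> ?f n i * 1"
              by (intro mult_left_mono prod_le_1 conjI less_imp_le[OF bump_bounds(1)] bump_bounds(2))
            finally show "norm (u n x) \<le> ?f n i" by simp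
          qed
          then show ?thesis using False by simp
        qed
      qed
    qed
  qed simp
  then show thesis using that sch by blast
qed

text \<open>The two operators agree on Schwartz functions; these approximate the indicators of boxes, which
  generate a dense subspace.\<close>

lemma P_op_eq_freq_proj:
  fixes \<Omega> :: "'a::euclidean_space set"
  assumes \<Omega>[measurable]: "\<Omega> \<in> sets borel" and b: "bounded \<Omega>" and \<alpha>: "\<alpha> > 0"
    and E: "E = (*\<^sub>R) \<alpha> ` \<Omega>" "E \<in> sets borel" "bounded E"
  shows "P_op \<Omega> \<alpha> = freq_proj E"
  unfolding P_op_def Op_def
proof (rule the_equality)
  note bc = bounded_clinear_freq_proj[OF E(2,3)]
  have on_schwartz: "AE x in lborel. rep_L2 (freq_proj E (abs_L2 u)) x = Op_formula \<alpha> (indicator \<Omega>) u x"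
    if u: "schwartz u" for u
    unfolding freq_proj_abs[OF E(2,3) schwartz_integrable(1)[OF u]]
      Op_formula_indicator[OF \<Omega> b \<alpha> schwartz_integrable(2)[OF u] E]
    by (rule rep_abs_L2[OF proj_fun_L2(1)[OF E(2,3) schwartz_integrable(1)[OF u]]])
  then show "bounded_clinear (freq_proj E) \<and> (\<forall>u. schwartz u \<longrightarrow>
      (AE x in lborel. rep_L2 (freq_proj E (abs_L2 u)) x = Op_formula \<alpha> (indicator \<Omega>) u x))"
    using bc by blast
  fix T :: "'a L2 \<Rightarrow> 'a L2"
  assume T: "bounded_clinear T \<and> (\<forall>u. schwartz u \<longrightarrow>
      (AE x in lborel. rep_L2 (T (abs_L2 u)) x = Op_formula \<alpha> (indicator \<Omega>) u x))"
  then have Tb: "bounded_clinear T" by blast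
  define V where "V = {u. T u = freq_proj E u}"
  have schw: "abs_L2 u \<in> V" if u: "schwartz u" for u
  proof -
    have "AE x in lborel. rep_L2 (T (abs_L2 u)) x = Op_formula \<alpha> (indicator \<Omega>) u x" using T u by blast
    with on_schwartz[OF u]
    have "AE x in lborel. rep_L2 (T (abs_L2 u)) x = rep_L2 (freq_proj E (abs_L2 u)) x"
      by eventually_elim simp
    from abs_L2_eqI[OF square_integrable_rep square_integrable_rep this]
    show ?thesis by (simp add: V_def abs_rep_L2)
  qed
  have closed: "u \<in> V" if X: "\<And>n::nat. X n \<in> V" "X \<longlonglongrightarrow> u" for X u
  proof -
    have "(\<lambda>n. T (X n)) \<longlonglongrightarrow> T u" by (rule bounded_linear.tendsto[OF bounded_clinearD(5)[OF Tb] X(2)])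
    moreover have "(\<lambda>n. freq_proj E (X n)) \<longlonglongrightarrow> freq_proj E u"
      by (rule bounded_linear.tendsto[OF bounded_clinearD(5)[OF bc] X(2)])
    moreover have "(\<lambda>n. T (X n)) = (\<lambda>n. freq_proj E (X n))" using X(1) by (simp add: V_def)
    ultimately show ?thesis unfolding V_def using LIMSEQ_unique by auto
  qed
  have "u \<in> V" for u
  proof (rule L2_closed_subspace_UNIV[of V])
    show "u + v \<in> V" if "u \<in> V" "v \<in> V" for u v
      using that by (simp add: V_def bounded_clinearD[OF Tb] bounded_clinearD[OF bc])
    show "scaleC c u \<in> V" if "u \<in> V" for c u
      using that by (simp add: V_def bounded_clinearD[OF Tb] bounded_clinearD[OF bc])
    show "abs_L2 (indicator (box a b)) \<in> V" for a b :: 'a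
    proof -
      obtain u where "\<And>n::nat. schwartz (u n)" "(\<lambda>n. abs_L2 (u n)) \<longlonglongrightarrow> abs_L2 (indicator (box a b))"
        using schwartz_approx_box[of a b] by blast
      then show ?thesis using closed[of "\<lambda>n. abs_L2 (u n)"] schw by blast
    qed
  qed (rule closed)
  then show "T = freq_proj E" by (auto simp: V_def)
qed

section \<open>Wave packets\<close>

text \<open>Powers of the cosine, cut off at the first zeros, are the windows: two integrations by parts
  relate the transforms of consecutive even powers explicitly.\<close>

definition cos_transform :: "nat \<Rightarrow> real \<Rightarrow> complex" where
  "cos_transform N s = (LINT t|lborel. indicator {- (pi / 2) .. pi / 2} t *\<^sub>R
    (cos (complex_of_real t) ^ N * exp (- (\<i> * complex_of_real s * complex_of_real t))))"

lemma cos_transform_bound: "cmod (cos_transform N s) \<le> pi"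
proof -
  have "cmod (cos_transform N s) \<le> (LINT t|lborel. norm (indicator {- (pi / 2) .. pi / 2} t *\<^sub>R
      (cos (complex_of_real t) ^ N * exp (- (\<i> * complex_of_real s * complex_of_real t)))))"
    unfolding cos_transform_def by (rule integral_norm_bound)
  also have "\<dots> \<le> (LINT t|lborel. indicator {- (pi / 2) .. pi / 2} (t::real))"
  proof (rule integral_mono_AE')
    show "AE t in lborel. norm (indicator {- (pi / 2) .. pi / 2} t *\<^sub>R
      (cos (complex_of_real t) ^ N * exp (- (\<i> * complex_of_real s * complex_of_real t)))) \<le>
      indicator {- (pi / 2) .. pi / 2} (t::real)"
      by (intro AE_I2) (auto simp: indicator_def norm_mult norm_power cos_of_real power_le_one simp del: of_real_mult)
  qed (auto intro!: AE_I2 integrable_real_indicator)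
  also have "\<dots> = pi" by simp
  finally show ?thesis .
qed

text \<open>The boundary terms of the two integrations by parts vanish, since \<open>cos\<close> vanishes at the end points
  and occurs in positive powers.\<close>

lemma cos_transform_recurrence:
  assumes N: "N \<ge> 2"
  shows "((of_nat N)\<^sup>2 - (complex_of_real s)\<^sup>2) * cos_transform N s =
    of_nat N * of_nat (N - 1) * cos_transform (N - 2) s"
proof -
  obtain M where M: "N = Suc (Suc M)" using N by (metis add_2_eq_Suc le_Suc_ex)
  let ?e = "\<lambda>z. exp (- (\<i> * complex_of_real s * z))"
  let ?I = "{- (pi / 2) .. pi / 2}"
  define G where "G z = (of_nat N * cos z ^ Suc M * sin z - \<i> * complex_of_real s * cos z ^ N) * ?e z" for z
  define g where "g z = ((of_nat N)\<^sup>2 - (complex_of_real s)\<^sup>2) * (cos z ^ N * ?e z) -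
    of_nat N * of_nat (N - 1) * (cos z ^ M * ?e z)" for z
  have dG: "(G has_field_derivative g z) (at z)" for z
  proof -
    have "(G has_field_derivative
        ((of_nat N * (of_nat (Suc M) * cos z ^ M * (- sin z)) * sin z + of_nat N * cos z ^ Suc M * cos z
          - \<i> * complex_of_real s * (of_nat N * cos z ^ Suc M * (- sin z))) * ?e z
        + (of_nat N * cos z ^ Suc M * sin z - \<i> * complex_of_real s * cos z ^ N) * (?e z * (- (\<i> * complex_of_real s))))) (at z)"
    proof -
      have c: "((\<lambda>z. cos z ^ Suc n) has_field_derivative of_nat (Suc n) * cos z ^ n * (- sin z)) (at z)" for n
        using DERIV_power_Suc[OF DERIV_cos[of z], of n] by (simp add: mult_ac)
      have e: "(?e has_field_derivative ?e z * (- (\<i> * complex_of_real s))) (at z)"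
        by (auto intro!: derivative_eq_intros)
      have "((\<lambda>z. of_nat N * (cos z ^ Suc M * sin z) - \<i> * complex_of_real s * cos z ^ Suc (Suc M)) has_field_derivative
          of_nat N * (of_nat (Suc M) * cos z ^ M * (- sin z) * sin z + cos z * cos z ^ Suc M) -
          \<i> * complex_of_real s * (of_nat (Suc (Suc M)) * cos z ^ Suc M * (- sin z))) (at z)"
        by (intro DERIV_diff DERIV_cmult DERIV_mult c DERIV_sin)
      from DERIV_mult[OF this e] show ?thesis
        unfolding G_def[abs_def] M mult.assoc by (rule DERIV_cong) (simp only: distrib_left mult_ac)
    qed
    also have "(of_nat N * (of_nat (Suc M) * cos z ^ M * (- sin z)) * sin z + of_nat N * cos z ^ Suc M * cos z
          - \<i> * complex_of_real s * (of_nat N * cos z ^ Suc M * (- sin z))) * ?e z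
        + (of_nat N * cos z ^ Suc M * sin z - \<i> * complex_of_real s * cos z ^ N) * (?e z * (- (\<i> * complex_of_real s)))
        = g z"
    proof -
      have s2: "sin z * sin z = 1 - cos z * cos z"
        using sin_cos_squared_add[of z] by (simp add: power2_eq_square algebra_simps)
      have alg: "(n * (m * c * (- S)) * S + n * (C * c) * C - j * w * (n * (C * c) * (- S))) * e
          + (n * (C * c) * S - j * w * (C * (C * c))) * (e * (- (j * w))) =
          (n\<^sup>2 - w\<^sup>2) * ((C * (C * c)) * e) - n * m * (c * e)"
        if "j * j = - 1" "S * S = 1 - C * C" "n = m + 1" for n m c S C w e j :: complex
        using that by algebra
      show ?thesis
        unfolding g_def M power_Suc
        using alg[OF _ s2, where j = \<i> and n = "of_nat (Suc (Suc M))" and m = "of_nat (Suc M)"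
            and w = "complex_of_real s" and c = "cos z ^ M" and e = "?e z"]
        by simp
    qed
    finally show ?thesis .
  qed
  have cont: "continuous_on ?I (\<lambda>t. g (complex_of_real t))"
    unfolding g_def by (intro continuous_intros)
  have int: "integrable lborel (\<lambda>t. indicator ?I t *\<^sub>R (cos (complex_of_real t) ^ K * ?e (complex_of_real t)))" for K
    by (intro borel_integrable_compact continuous_intros) auto
  have "(LINT t|lborel. indicator ?I t *\<^sub>R g (complex_of_real t)) = G (complex_of_real (pi / 2)) - G (complex_of_real (- (pi / 2)))"
  proof (rule integral_FTC_Icc[where F = "\<lambda>t. G (complex_of_real t)"])
    show "((\<lambda>t. G (complex_of_real t)) has_vector_derivative g (complex_of_real t)) (at t within ?I)" for t
      by (rule has_vector_derivative_real_field[OF dG])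
  qed (use cont pi_gt_zero in auto)
  also have "\<dots> = 0"
    by (simp only: G_def cos_of_real sin_of_real cos_minus cos_pi_half) (simp add: M)
  finally have "0 = (LINT t|lborel. ((of_nat N)\<^sup>2 - (complex_of_real s)\<^sup>2) *
        (indicator ?I t *\<^sub>R (cos (complex_of_real t) ^ N * ?e (complex_of_real t))) -
      of_nat N * of_nat (N - 1) * (indicator ?I t *\<^sub>R (cos (complex_of_real t) ^ M * ?e (complex_of_real t))))"
    by (simp add: g_def scaleR_conv_of_real algebra_simps)
  also have "\<dots> = ((of_nat N)\<^sup>2 - (complex_of_real s)\<^sup>2) * cos_transform N s -
      of_nat N * of_nat (N - 1) * cos_transform M s"
    unfolding cos_transform_def
    by (subst Bochner_Integration.integral_diff) (use int in \<open>auto simp only: integral_mult_right_zero integrable_mult_right\<close>)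
  finally show ?thesis by (simp add: M)
qed

text \<open>For \<open>\<bar>s\<bar>\<close> above \<open>2 N\<close> the recurrence gains a factor \<open>1 / s\<^sup>2\<close> at each step; for the other \<open>s\<close>
  the trivial bound suffices.\<close>

lemma cos_transform_decay: "\<exists>C\<ge>0. \<forall>s. cmod (cos_transform (2 * m) s) \<le> C * (1 / (1 + s\<^sup>2)) ^ m"
proof (induction m)
  case 0
  show ?case using cos_transform_bound by (intro exI[of _ pi]) auto
next
  case (Suc m)
  then obtain C where C: "C \<ge> 0" "\<And>s. cmod (cos_transform (2 * m) s) \<le> C * (1 / (1 + s\<^sup>2)) ^ m" by blast
  define N where "N = real (2 * Suc m)"
  have N: "N \<ge> 2" by (simp add: N_def)
  let ?D = "pi * (1 + 4 * N\<^sup>2) ^ Suc m + 8 / 3 * N\<^sup>2 * C"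
  have "cmod (cos_transform (2 * Suc m) s) \<le> ?D * (1 / (1 + s\<^sup>2)) ^ Suc m" for s
  proof (cases "\<bar>s\<bar> \<le> 2 * N")
    case True
    have "s\<^sup>2 \<le> (2 * N)\<^sup>2" using True by (metis abs_le_square_iff abs_of_nonneg N order_trans zero_le_numeral mult_nonneg_nonneg)
    then have "(1 + s\<^sup>2) ^ Suc m \<le> (1 + 4 * N\<^sup>2) ^ Suc m" by (intro power_mono) (auto simp: power_mult_distrib)
    then have "cmod (cos_transform (2 * Suc m) s) * (1 + s\<^sup>2) ^ Suc m \<le> pi * (1 + 4 * N\<^sup>2) ^ Suc m"
      by (intro mult_mono cos_transform_bound) auto
    also have "\<dots> \<le> ?D" using C by simp
    finally show ?thesis
      using zero_less_power[of "1 + s\<^sup>2" "Suc m"]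
      by (simp add: pos_le_divide_eq power_divide add_pos_nonneg del: power_Suc)
  next
    case False
    have s2: "s\<^sup>2 \<ge> 4 * N\<^sup>2" using False N abs_le_square_iff[of "2 * N" s] by (simp add: power_mult_distrib)
    have "N\<^sup>2 \<ge> 4" using power_mono[OF N, of 2] by simp
    then have s1: "s\<^sup>2 \<ge> 1" using s2 by simp
    have "cmod ((of_nat (2 * Suc m))\<^sup>2 - (complex_of_real s)\<^sup>2) * cmod (cos_transform (2 * Suc m) s) =
        real (2 * Suc m) * real (2 * Suc m - 1) * cmod (cos_transform (2 * Suc m - 2) s)"
      unfolding norm_mult[symmetric]
      by (subst cos_transform_recurrence) (simp, simp only: norm_mult norm_of_nat)
    moreover have "cmod ((of_nat (2 * Suc m))\<^sup>2 - (complex_of_real s)\<^sup>2) = s\<^sup>2 - N\<^sup>2"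
    proof -
      have "(of_nat (2 * Suc m))\<^sup>2 - (complex_of_real s)\<^sup>2 = complex_of_real (N\<^sup>2 - s\<^sup>2)" by (simp add: N_def)
      then have "cmod ((of_nat (2 * Suc m))\<^sup>2 - (complex_of_real s)\<^sup>2) = \<bar>N\<^sup>2 - s\<^sup>2\<bar>" by (simp only: norm_of_real)
      then show ?thesis using s2 zero_le_power2[of N] by simp
    qed
    ultimately have "(s\<^sup>2 - N\<^sup>2) * cmod (cos_transform (2 * Suc m) s) = N * (N - 1) * cmod (cos_transform (2 * m) s)"
      by (simp add: N_def of_nat_diff)
    also have "\<dots> \<le> N * N * (C * (1 / (1 + s\<^sup>2)) ^ m)"
      using N C by (intro mult_mono) auto
    finally have 1: "(s\<^sup>2 - N\<^sup>2) * cmod (cos_transform (2 * Suc m) s) \<le> N\<^sup>2 * C * (1 / (1 + s\<^sup>2)) ^ m"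
      by (simp add: power2_eq_square)
    have "3 / 8 * (1 + s\<^sup>2) \<le> s\<^sup>2 - N\<^sup>2" using s1 s2 by simp
    then have "3 / 8 * (1 + s\<^sup>2) * cmod (cos_transform (2 * Suc m) s) \<le> (s\<^sup>2 - N\<^sup>2) * cmod (cos_transform (2 * Suc m) s)"
      by (rule mult_right_mono) simp
    from order_trans[OF this 1]
    have "3 / 8 * ((1 + s\<^sup>2) * cmod (cos_transform (2 * Suc m) s)) \<le> N\<^sup>2 * C * (1 / (1 + s\<^sup>2)) ^ m"
      by (simp only: mult.assoc)
    then have "(1 + s\<^sup>2) * cmod (cos_transform (2 * Suc m) s) \<le> 8 / 3 * (N\<^sup>2 * C * (1 / (1 + s\<^sup>2)) ^ m)" by linarith
    also have "\<dots> = 8 / 3 * N\<^sup>2 * C * (1 / (1 + s\<^sup>2)) ^ m" by (simp only: mult.assoc)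
    also have "\<dots> \<le> ?D * (1 / (1 + s\<^sup>2)) ^ m" using C by (intro mult_right_mono) auto
    finally show ?thesis by (simp add: pos_le_divide_eq add_pos_nonneg mult.commute)
  qed
  moreover have "?D \<ge> 0" using C by simp
  ultimately show ?case by blast
qed

definition window :: "nat \<Rightarrow> 'a::euclidean_space \<Rightarrow> real" where
  "window m x = (\<Prod>b\<in>Basis. indicator {- (pi / 2) .. pi / 2} (x \<bullet> b) * cos (x \<bullet> b) ^ (2 * m))"

lemma window_borel [measurable]: "window m \<in> borel_measurable borel"
  unfolding window_def[abs_def] by measurable

lemma window_bounds: "0 \<le> window m x" "window m x \<le> 1"
proof -
  have *: "0 \<le> indicator {- (pi / 2) .. pi / 2} t * cos t ^ (2 * m)"
    "indicator {- (pi / 2) .. pi / 2} t * cos t ^ (2 * m) \<le> 1" for t :: real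
  proof -
    have "cos t ^ (2 * m) \<le> 1"
      unfolding power_mult by (rule power_le_one) (auto simp: abs_square_le_1)
    moreover have "0 \<le> cos t ^ (2 * m)" unfolding power_mult by (rule zero_le_power) simp
    ultimately show "0 \<le> indicator {- (pi / 2) .. pi / 2} t * cos t ^ (2 * m)"
      "indicator {- (pi / 2) .. pi / 2} t * cos t ^ (2 * m) \<le> 1"
      by (cases "t \<in> {- (pi / 2) .. pi / 2}";
          simp only: indicator_simps mult_1_left mult_zero_left order_refl zero_le_one)+
  qed
  show "0 \<le> window m x" "window m x \<le> 1"
    unfolding window_def by (intro prod_nonneg * prod_le_1 conjI)+
qed

lemma window_support:
  fixes x :: "'a::euclidean_space"
  assumes "window m x \<noteq> 0"
  shows "\<And>b. b \<in> Basis \<Longrightarrow> \<bar>x \<bullet> b\<bar> \<le> pi / 2" and "norm x \<le> 2 * DIM('a)"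
proof -
  show *: "\<bar>x \<bullet> b\<bar> \<le> pi / 2" if "b \<in> Basis" for b
    using assms that by (auto simp: window_def indicator_def abs_le_iff split: if_splits)
  have "norm x \<le> (\<Sum>b\<in>Basis. \<bar>x \<bullet> b\<bar>)" by (rule norm_le_l1)
  also have "\<dots> \<le> (\<Sum>b\<in>(Basis::'a set). 2)"
    by (intro sum_mono order_trans[OF *]) (use pi_less_4 in auto)
  finally show "norm x \<le> 2 * DIM('a)" by (simp add: mult.commute)
qed

lemma window_ge:
  fixes x :: "'a::euclidean_space"
  assumes "norm x \<le> 1"
  shows "(1 / 4) ^ (m * DIM('a)) \<le> window m x"
proof -
  have "(\<Prod>b\<in>(Basis::'a set). (1 / 4) ^ m) \<le> window m x"
    unfolding window_def
  proof (intro prod_mono conjI)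
    fix b :: 'a assume b: "b \<in> Basis"
    have x1: "\<bar>x \<bullet> b\<bar> \<le> 1" using Basis_le_norm[OF b, of x] assms by linarith
    have pi3: "1 \<le> pi / 3" using pi_gt3 by simp
    have "cos (pi / 3) \<le> cos \<bar>x \<bullet> b\<bar>"
      using x1 pi3 pi_gt3 by (intro cos_monotone_0_pi_le) auto
    then have "1 / 2 \<le> cos (x \<bullet> b)" by (simp add: cos_60)
    then have "(1 / 2) ^ (2 * m) \<le> cos (x \<bullet> b) ^ (2 * m)" by (intro power_mono) auto
    then have "(1 / 4) ^ m \<le> cos (x \<bullet> b) ^ (2 * m)" by (simp add: power_mult power2_eq_square)
    moreover have "x \<bullet> b \<in> {- (pi / 2) .. pi / 2}" using x1 pi_gt3 by (auto simp: abs_le_iff)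
    ultimately show "(1 / 4) ^ m \<le> indicator {- (pi / 2) .. pi / 2} (x \<bullet> b) * cos (x \<bullet> b) ^ (2 * m)" by simp
  qed simp
  then show ?thesis by (simp add: power_mult)
qed

lemma fourier_window:
  "fourier (\<lambda>x. complex_of_real (window m x)) \<xi> = (\<Prod>b\<in>Basis. cos_transform (2 * m) (\<xi> \<bullet> b))"
proof -
  let ?f = "\<lambda>b t. indicator {- (pi / 2) .. pi / 2} t *\<^sub>R
    (cos (complex_of_real t) ^ (2 * m) * exp (- (\<i> * complex_of_real (\<xi> \<bullet> b) * complex_of_real t)))"
  have eq: "cis (- (x \<bullet> \<xi>)) * complex_of_real (window m x) = (\<Prod>b\<in>Basis. ?f b (x \<bullet> b))" for x
    unfolding cis_inner_prod window_def of_real_prod prod.distrib[symmetric]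
    by (intro prod.cong refl)
      (simp add: cis_conv_exp cos_of_real scaleR_conv_of_real mult_ac flip: of_real_power)
  show ?thesis
    unfolding fourier_def eq cos_transform_def
    by (rule lborel_integrable_prod(2)) (intro borel_integrable_compact continuous_intros; simp)
qed

lemma prod_decay_le: "prod_decay x \<le> 1 / (1 + (norm (x::'a::euclidean_space))\<^sup>2)"
proof -
  have "1 + (norm x)\<^sup>2 = 1 + (\<Sum>b\<in>Basis. (x \<bullet> b)\<^sup>2)"
    unfolding power2_norm_eq_inner euclidean_inner[of x x] by (simp add: power2_eq_square)
  also have "\<dots> \<le> (\<Prod>b\<in>Basis. 1 + (x \<bullet> b)\<^sup>2)" by (rule sum_le_prod_1_plus) simp
  finally have "1 / (\<Prod>b\<in>Basis. 1 + (x \<bullet> b)\<^sup>2) \<le> 1 / (1 + (norm x)\<^sup>2)"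
    by (intro divide_left_mono mult_pos_pos prod_pos) (auto simp: add_pos_nonneg)
  then show ?thesis by (simp add: prod_decay_def prod_dividef)
qed

text \<open>One factor of the decay is kept for integrability, the others give the rate.\<close>

lemma window_fourier_tail:
  obtains C where "C \<ge> 0" "\<And>R. R \<ge> 0 \<Longrightarrow>
    (\<integral>\<^sup>+\<zeta>. indicator {\<zeta>. norm \<zeta> \<ge> R} \<zeta> *
      ennreal ((cmod (fourier (\<lambda>x::'a::euclidean_space. complex_of_real (window (Suc m) x)) \<zeta>))\<^sup>2) \<partial>lborel)
    \<le> ennreal (C * (1 / (1 + R\<^sup>2)) ^ m)"
proof -
  let ?w = "fourier (\<lambda>x::'a. complex_of_real (window (Suc m) x))"
  obtain C where C: "C \<ge> 0" "\<And>s. cmod (cos_transform (2 * Suc m) s) \<le> C * (1 / (1 + s\<^sup>2)) ^ Suc m"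
    using cos_transform_decay by blast
  define K where "K = C ^ DIM('a)"
  have K: "K \<ge> 0" using C by (simp add: K_def)
  have w: "cmod (?w \<zeta>) \<le> K * prod_decay \<zeta> ^ Suc m" for \<zeta>
  proof -
    have "cmod (?w \<zeta>) \<le> (\<Prod>b\<in>(Basis::'a set). C * (1 / (1 + (\<zeta> \<bullet> b)\<^sup>2)) ^ Suc m)"
      unfolding fourier_window prod_norm[symmetric] by (intro prod_mono conjI C) auto
    also have "\<dots> = K * prod_decay \<zeta> ^ Suc m"
      unfolding prod.distrib prod_decay_def K_def prod_power_distrib by simp
    finally show ?thesis .
  qed
  have w2: "(cmod (?w \<zeta>))\<^sup>2 \<le> K\<^sup>2 * (1 / (1 + (norm \<zeta>)\<^sup>2)) ^ m * prod_decay \<zeta>" for \<zeta>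
  proof -
    note pd = prod_decay_bounds[of \<zeta>]
    have "(cmod (?w \<zeta>))\<^sup>2 \<le> (K * prod_decay \<zeta> ^ Suc m)\<^sup>2" by (intro power_mono w) auto
    also have "\<dots> = K\<^sup>2 * (prod_decay \<zeta> ^ m * (prod_decay \<zeta> * prod_decay \<zeta> ^ Suc m))"
      by (simp add: power2_eq_square mult_ac)
    also have "\<dots> \<le> K\<^sup>2 * ((1 / (1 + (norm \<zeta>)\<^sup>2)) ^ m * (prod_decay \<zeta> * 1))"
      using pd by (intro mult_left_mono mult_mono power_mono prod_decay_le power_le_one) (auto intro: less_imp_le simp: add_nonneg_nonneg)
    finally show ?thesis by (simp add: mult_ac)
  qed
  define B where "B = (LINT \<zeta>|lborel. prod_decay (\<zeta>::'a))"
  have B: "B \<ge> 0" unfolding B_def using prod_decay_bounds(1) by (intro integral_nonneg_AE) (auto intro: less_imp_le)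
  show thesis
  proof (rule that[of "K\<^sup>2 * B"])
    show "K\<^sup>2 * B \<ge> 0" using B by simp
    fix R :: real assume R: "R \<ge> 0"
    have "(\<integral>\<^sup>+\<zeta>. indicator {\<zeta>. norm \<zeta> \<ge> R} \<zeta> * ennreal ((cmod (?w \<zeta>))\<^sup>2) \<partial>lborel) \<le>
        (\<integral>\<^sup>+\<zeta>. ennreal (K\<^sup>2 * (1 / (1 + R\<^sup>2)) ^ m * prod_decay (\<zeta>::'a)) \<partial>lborel)"
    proof (rule nn_integral_mono)
      fix \<zeta> :: 'a
      show "indicator {\<zeta>. norm \<zeta> \<ge> R} \<zeta> * ennreal ((cmod (?w \<zeta>))\<^sup>2) \<le> ennreal (K\<^sup>2 * (1 / (1 + R\<^sup>2)) ^ m * prod_decay \<zeta>)"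
      proof (cases "norm \<zeta> \<ge> R")
        case True
        have "1 / (1 + (norm \<zeta>)\<^sup>2) \<le> 1 / (1 + R\<^sup>2)"
          using True R by (intro divide_left_mono mult_pos_pos add_left_mono power_mono) (auto simp: add_pos_nonneg)
        then have "(1 / (1 + (norm \<zeta>)\<^sup>2)) ^ m \<le> (1 / (1 + R\<^sup>2)) ^ m" by (intro power_mono) auto
        then have "K\<^sup>2 * (1 / (1 + (norm \<zeta>)\<^sup>2)) ^ m * prod_decay \<zeta> \<le> K\<^sup>2 * (1 / (1 + R\<^sup>2)) ^ m * prod_decay \<zeta>"
          using prod_decay_bounds(1)[of \<zeta>] by (intro mult_right_mono mult_left_mono) auto
        with w2[of \<zeta>] True show ?thesis by (simp add: ennreal_leI)
      qed simp
    qed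
    also have "\<dots> = ennreal (LINT \<zeta>|lborel. K\<^sup>2 * (1 / (1 + R\<^sup>2)) ^ m * prod_decay (\<zeta>::'a))"
      using prod_decay_bounds(1)
      by (intro nn_integral_eq_integral integrable_mult_right integrable_prod_decay AE_I2 mult_nonneg_nonneg)
        (auto intro: less_imp_le)
    also have "\<dots> = ennreal (K\<^sup>2 * B * (1 / (1 + R\<^sup>2)) ^ m)" by (simp add: B_def mult_ac)
    finally show "(\<integral>\<^sup>+\<zeta>. indicator {\<zeta>. norm \<zeta> \<ge> R} \<zeta> * ennreal ((cmod (?w \<zeta>))\<^sup>2) \<partial>lborel) \<le>
      ennreal (K\<^sup>2 * B * (1 / (1 + R\<^sup>2)) ^ m)" .
  qed
qed

definition local_window :: "nat \<Rightarrow> 'a::euclidean_space \<Rightarrow> real \<Rightarrow> 'a \<Rightarrow> real" where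
  "local_window m y r x = window m ((1 / r) *\<^sub>R (x - y))"

definition packet :: "nat \<Rightarrow> 'a::euclidean_space \<Rightarrow> real \<Rightarrow> 'a \<Rightarrow> 'a \<Rightarrow> complex" where
  "packet m y r \<eta> x = complex_of_real (local_window m y r x) * cis (x \<bullet> \<eta>)"

lemma local_window_borel [measurable]: "local_window m y r \<in> borel_measurable borel"
  unfolding local_window_def[abs_def] by measurable

lemma packet_borel [measurable]: "packet m y r \<eta> \<in> borel_measurable borel"
  unfolding packet_def[abs_def] by measurable

lemma local_window_bounds: "0 \<le> local_window m y r x" "local_window m y r x \<le> 1"
  by (auto simp: local_window_def window_bounds)

lemma local_window_support:
  fixes x :: "'a::euclidean_space" and r :: real
  assumes "r > 0" "local_window m y r x \<noteq> 0"
  shows "dist x y \<le> 2 * DIM('a) * r"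
  using window_support(2)[of m "(1 / r) *\<^sub>R (x - y)"] assms
  by (simp add: local_window_def dist_norm divide_le_eq)

lemma local_window_ge:
  fixes x :: "'a::euclidean_space"
  assumes "r > 0" "dist x y \<le> r"
  shows "(1 / 4) ^ (m * DIM('a)) \<le> local_window m y r x"
  unfolding local_window_def using assms by (intro window_ge) (simp add: dist_norm)

lemma bounded_support_local_window:
  fixes y :: "'a::euclidean_space" and f :: "'a \<Rightarrow> complex" and r :: real
  assumes "r > 0"
  shows "bounded_support (\<lambda>x. complex_of_real (local_window m y r x) * f x)"
  unfolding bounded_support_def
proof (intro exI allI impI)
  fix x :: 'a assume x: "norm x > norm y + 2 * DIM('a) * r"
  have "norm x \<le> norm y + dist x y" using norm_triangle_sub[of x y] by (simp add: dist_norm)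
  then have "local_window m y r x = 0" using local_window_support[OF assms, of m y x] x by force
  then show "complex_of_real (local_window m y r x) * f x = 0" by simp
qed

lemma square_integrable_mult_bounded:
  fixes f g :: "'a::euclidean_space \<Rightarrow> complex"
  assumes f: "square_integrable f" and g: "g \<in> borel_measurable borel" "\<And>x. cmod (g x) \<le> C"
  shows "square_integrable (\<lambda>x. g x * f x)"
proof (rule square_integrable_dominated[where h = "\<lambda>x. C * cmod (f x)"])
  show "(\<lambda>x. g x * f x) \<in> borel_measurable borel" using borel_square_integrable[OF f] g(1) by measurable
  show "integrable lborel (\<lambda>x. (C * cmod (f x))\<^sup>2)"
    using integrable_square_integrable[OF f] by (simp add: power_mult_distrib)
qed (auto simp: norm_mult intro!: mult_right_mono g(2))

lemma packet_square_integrable: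
  fixes y :: "'a::euclidean_space"
  assumes r: "r > 0"
  shows "square_integrable (packet m y r \<eta>)" "bounded_support (packet m y r \<eta>)"
proof -
  show bs: "bounded_support (packet m y r \<eta>)"
    unfolding packet_def[abs_def] by (rule bounded_support_local_window[OF r])
  obtain a b where ab: "\<And>x. x \<notin> box a b \<Longrightarrow> packet m y r \<eta> x = 0" using bounded_support_box[OF bs] by blast
  have "packet m y r \<eta> = (\<lambda>x. packet m y r \<eta> x * indicator (box a b) x)"
    by (rule ext) (use ab in \<open>auto simp: indicator_def\<close>)
  moreover have "square_integrable (\<lambda>x. packet m y r \<eta> x * indicator (box a b) x)"
    by (rule square_integrable_mult_bounded[where C = 1, OF square_integrable_indicator_box])
      (auto simp: packet_def norm_mult local_window_bounds abs_le_iff intro: order_trans[OF _ local_window_bounds(1)])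
  ultimately show "square_integrable (packet m y r \<eta>)" by simp
qed

lemma fourier_packet:
  fixes y :: "'a::euclidean_space"
  assumes r: "r > 0"
  shows "(cmod (fourier (packet m y r \<eta>) \<xi>))\<^sup>2 =
    (r ^ DIM('a))\<^sup>2 * (cmod (fourier (\<lambda>x. complex_of_real (window m x)) (r *\<^sub>R (\<xi> - \<eta>))))\<^sup>2"
proof -
  have "fourier (packet m y r \<eta>) \<xi> = \<bar>r\<bar> ^ DIM('a) *\<^sub>R
      (LINT z|lborel. cis (- ((y + r *\<^sub>R z) \<bullet> \<xi>)) * packet m y r \<eta> (y + r *\<^sub>R z))"
    unfolding fourier_def by (rule lborel_integral_affine) (use r in auto)
  also have "(\<lambda>z. cis (- ((y + r *\<^sub>R z) \<bullet> \<xi>)) * packet m y r \<eta> (y + r *\<^sub>R z)) =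
      (\<lambda>z. cis (- (y \<bullet> (\<xi> - \<eta>))) * (cis (- (z \<bullet> (r *\<^sub>R (\<xi> - \<eta>)))) * complex_of_real (window m z)))"
  proof
    fix z
    have "- ((y + r *\<^sub>R z) \<bullet> \<xi>) + (y + r *\<^sub>R z) \<bullet> \<eta> = - (y \<bullet> (\<xi> - \<eta>)) + - (z \<bullet> (r *\<^sub>R (\<xi> - \<eta>)))"
      by (simp add: inner_add_left inner_diff_right algebra_simps)
    then have "cis (- ((y + r *\<^sub>R z) \<bullet> \<xi>)) * cis ((y + r *\<^sub>R z) \<bullet> \<eta>) =
        cis (- (y \<bullet> (\<xi> - \<eta>))) * cis (- (z \<bullet> (r *\<^sub>R (\<xi> - \<eta>))))" by (simp only: cis_mult)
    moreover have "local_window m y r (y + r *\<^sub>R z) = window m z" using r by (simp add: local_window_def)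
    ultimately show "cis (- ((y + r *\<^sub>R z) \<bullet> \<xi>)) * packet m y r \<eta> (y + r *\<^sub>R z) =
      cis (- (y \<bullet> (\<xi> - \<eta>))) * (cis (- (z \<bullet> (r *\<^sub>R (\<xi> - \<eta>)))) * complex_of_real (window m z))"
      by (simp add: packet_def mult_ac)
  qed
  also have "(LINT z|lborel. cis (- (y \<bullet> (\<xi> - \<eta>))) * (cis (- (z \<bullet> (r *\<^sub>R (\<xi> - \<eta>)))) * complex_of_real (window m z))) =
      cis (- (y \<bullet> (\<xi> - \<eta>))) * fourier (\<lambda>x. complex_of_real (window m x)) (r *\<^sub>R (\<xi> - \<eta>))"
    unfolding fourier_def by (rule integral_mult_right_zero)
  finally have "cmod (fourier (packet m y r \<eta>) \<xi>) =
      r ^ DIM('a) * cmod (fourier (\<lambda>x. complex_of_real (window m x)) (r *\<^sub>R (\<xi> - \<eta>)))"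
    using r by (simp add: norm_mult)
  then show ?thesis by (simp add: power_mult_distrib)
qed

lemma packet_fourier_tail:
  obtains C where "C \<ge> 0" "\<And>y r \<eta> d. r > 0 \<Longrightarrow> d \<ge> 0 \<Longrightarrow>
    (\<integral>\<^sup>+\<xi>. indicator {\<xi>. dist \<xi> \<eta> \<ge> d} \<xi> * ennreal ((cmod (fourier (packet (Suc m) y r \<eta>) (\<xi>::'a::euclidean_space)))\<^sup>2) \<partial>lborel)
    \<le> ennreal (C * r ^ DIM('a) * (1 / (1 + (r * d)\<^sup>2)) ^ m)"
proof -
  let ?w = "fourier (\<lambda>x::'a. complex_of_real (window (Suc m) x))"
  obtain C where C: "C \<ge> 0" "\<And>R. R \<ge> 0 \<Longrightarrow>
    (\<integral>\<^sup>+\<zeta>. indicator {\<zeta>. norm \<zeta> \<ge> R} \<zeta> * ennreal ((cmod (?w \<zeta>))\<^sup>2) \<partial>lborel) \<le> ennreal (C * (1 / (1 + R\<^sup>2)) ^ m)"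
    using window_fourier_tail[where 'a = 'a and m = m] by blast
  show thesis
  proof (rule that[OF C(1)])
    fix y \<eta> :: 'a and r d :: real assume r: "r > 0" and d: "d \<ge> 0"
    let ?g = "\<lambda>\<zeta>. indicator {\<zeta>. norm \<zeta> \<ge> r * d} \<zeta> * ennreal ((cmod (?w \<zeta>))\<^sup>2)"
    let ?J = "\<integral>\<^sup>+\<xi>. ?g (- (r *\<^sub>R \<eta>) + r *\<^sub>R \<xi>) \<partial>lborel"
    have "(\<integral>\<^sup>+\<xi>. indicator {\<xi>. dist \<xi> \<eta> \<ge> d} \<xi> * ennreal ((cmod (fourier (packet (Suc m) y r \<eta>) \<xi>))\<^sup>2) \<partial>lborel) =
        (\<integral>\<^sup>+\<xi>. ennreal ((r ^ DIM('a))\<^sup>2) * ?g (- (r *\<^sub>R \<eta>) + r *\<^sub>R \<xi>) \<partial>lborel)"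
    proof (rule nn_integral_cong)
      fix \<xi> :: 'a
      have arg: "- (r *\<^sub>R \<eta>) + r *\<^sub>R \<xi> = r *\<^sub>R (\<xi> - \<eta>)" by (simp add: algebra_simps)
      have "(norm (r *\<^sub>R (\<xi> - \<eta>)) \<ge> r * d) = (dist \<xi> \<eta> \<ge> d)" using r by (simp add: dist_norm)
      then show "indicator {\<xi>. dist \<xi> \<eta> \<ge> d} \<xi> * ennreal ((cmod (fourier (packet (Suc m) y r \<eta>) \<xi>))\<^sup>2) =
        ennreal ((r ^ DIM('a))\<^sup>2) * ?g (- (r *\<^sub>R \<eta>) + r *\<^sub>R \<xi>)"
        unfolding arg fourier_packet[OF r] by (simp add: indicator_def ennreal_mult)
    qed
    also have "\<dots> = ennreal ((r ^ DIM('a))\<^sup>2) * ?J"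
      by (rule nn_integral_cmult) measurable
    also have "\<dots> = ennreal (r ^ DIM('a)) * (ennreal (\<bar>r\<bar> ^ DIM('a)) * ?J)"
      using r by (simp add: power2_eq_square ennreal_mult mult.assoc)
    also have "ennreal (\<bar>r\<bar> ^ DIM('a)) * ?J = (\<integral>\<^sup>+\<zeta>. ?g \<zeta> \<partial>lborel)"
      by (rule lborel_nn_integral_affine[symmetric]) (use r in auto)
    also have "ennreal (r ^ DIM('a)) * \<dots> \<le> ennreal (r ^ DIM('a)) * ennreal (C * (1 / (1 + (r * d)\<^sup>2)) ^ m)"
      using r d by (intro mult_left_mono C(2)) auto
    also have "\<dots> = ennreal (C * r ^ DIM('a) * (1 / (1 + (r * d)\<^sup>2)) ^ m)"
      using r C(1) by (subst ennreal_mult[symmetric]) (auto simp: mult_ac)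
    finally show "(\<integral>\<^sup>+\<xi>. indicator {\<xi>. dist \<xi> \<eta> \<ge> d} \<xi> *
        ennreal ((cmod (fourier (packet (Suc m) y r \<eta>) \<xi>))\<^sup>2) \<partial>lborel)
      \<le> ennreal (C * r ^ DIM('a) * (1 / (1 + (r * d)\<^sup>2)) ^ m)" .
  qed
qed

section \<open>Volumes of boundary layers\<close>

definition tube :: "'a::metric_space set \<Rightarrow> real \<Rightarrow> 'a set" where
  "tube S t = (\<Union>z\<in>S. ball z t)"

lemma open_tube: "open (tube S t)" by (auto simp: tube_def)

lemma tube_borel [measurable]: "tube S t \<in> sets borel" by (intro borel_open open_tube)

lemma in_tubeI: "z \<in> S \<Longrightarrow> dist x z < t \<Longrightarrow> x \<in> tube S t"
  by (auto simp: tube_def dist_commute)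

lemma in_tubeE:
  assumes "x \<in> tube S t" obtains z where "z \<in> S" "dist x z < t"
  using assms by (auto simp: tube_def dist_commute)

lemma infdist_less_imp_in_tube:
  assumes "S \<noteq> {}" "infdist x S < t"
  shows "x \<in> tube S t"
proof -
  have "\<exists>z\<in>S. dist x z < t"
    using assms cInf_lessD[of "(dist x) ` S" t] by (auto simp: infdist_def)
  then show ?thesis by (auto intro: in_tubeI)
qed

lemma emeasure_translation:
  fixes A :: "'a::euclidean_space set"
  assumes [measurable]: "A \<in> sets borel"
  shows "emeasure lborel {x. x - c \<in> A} = emeasure lborel A"
proof -
  have "emeasure lborel A = emeasure (distr lborel borel ((+) (- c))) A" by (simp add: lborel_distr_plus)
  also have "\<dots> = emeasure lborel ((+) (- c) -` A \<inter> space lborel)" by (rule emeasure_distr) auto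
  also have "(+) (- c) -` A \<inter> space lborel = {x. x - c \<in> A}" by auto
  finally show ?thesis by simp
qed

text \<open>The translates of a layer \<open>|F| < s\<close> along a direction in which \<open>F\<close> grows with unit speed, by
  multiples of \<open>2 s\<close>, are disjoint. About \<open>1 / s\<close> of them fit into a bounded set, which bounds the
  volume of the layer by a multiple of \<open>s\<close>; no coordinates have to be straightened.\<close>

lemma layer_volume:
  fixes A :: "'a::euclidean_space set" and F :: "'a \<Rightarrow> real"
  assumes A[measurable]: "A \<in> sets borel" and sub: "A \<subseteq> ball z R"
    and s: "s > 0" and F: "\<And>x. x \<in> A \<Longrightarrow> \<bar>F x\<bar> < s"
    and e: "norm e = 1" "\<And>x c. F (x + c *\<^sub>R e) = F x + c"
  shows "emeasure lborel A \<le> ennreal (4 * s) * emeasure lborel (ball z (R + 1))"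
proof (cases "2 * s \<le> 1 / 2")
  case False
  have "emeasure lborel A \<le> emeasure lborel (ball z (R + 1))"
    using sub by (intro emeasure_mono) (auto intro: order_trans[OF _ subset_ball])
  also have "\<dots> \<le> ennreal (4 * s) * emeasure lborel (ball z (R + 1))"
  proof -
    have "ennreal 1 \<le> ennreal (4 * s)" using False by (intro ennreal_leI) simp
    then have "1 \<le> ennreal (4 * s)" by (simp only: ennreal_1)
    from mult_right_mono[OF this, of "emeasure lborel (ball z (R + 1))"] show ?thesis by simp
  qed
  finally show ?thesis .
next
  case True
  define n where "n = nat \<lfloor>1 / (2 * s)\<rfloor>"
  have n1: "real n \<le> 1 / (2 * s)" "1 / (2 * s) < real n + 1"
  proof -
    have "0 \<le> 1 / (2 * s)" using s by simp
    then show "real n \<le> 1 / (2 * s)" unfolding n_def by (rule of_nat_floor)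
    have "real n = real_of_int \<lfloor>1 / (2 * s)\<rfloor>" using \<open>0 \<le> 1 / (2 * s)\<close> by (simp add: n_def)
    then show "1 / (2 * s) < real n + 1" using floor_correct[of "1 / (2 * s)"] by simp
  qed
  have "1 / (4 * s) \<ge> 1" using True s by (simp add: pos_le_divide_eq)
  moreover have "1 / (2 * s) = 2 * (1 / (4 * s))" by simp
  ultimately have n2: "1 / (4 * s) \<le> real n" using n1(2) by linarith
  define T where "T j = {x. x - (2 * s * real j) *\<^sub>R e \<in> A}" for j :: nat
  have T[measurable]: "T j \<in> sets borel" for j unfolding T_def by measurable
  have FT: "\<bar>F x - 2 * s * real j\<bar> < s" if "x \<in> T j" for x j
    using F[of "x - (2 * s * real j) *\<^sub>R e"] e(2)[of "x - (2 * s * real j) *\<^sub>R e" "2 * s * real j"] that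
    by (simp add: T_def)
  have disj: "disjoint_family_on T {..<n}"
    unfolding disjoint_family_on_def
  proof (intro ballI impI equals0I)
    fix i j x assume ij: "i \<noteq> j" and "x \<in> T i \<inter> T j"
    then have "\<bar>2 * s * real i - 2 * s * real j\<bar> < 2 * s" using FT[of x i] FT[of x j] by auto
    then have "2 * s * \<bar>real i - real j\<bar> < 2 * s * 1"
      using s by (simp add: abs_mult flip: right_diff_distrib)
    then have "\<bar>real i - real j\<bar> < 1" by (rule mult_left_less_imp_less) (use s in simp)
    then show False using ij by (cases "i < j") auto
  qed
  have Tsub: "T j \<subseteq> ball z (R + 1)" if "j < n" for j
  proof
    fix x assume "x \<in> T j"
    then have d: "dist z (x - (2 * s * real j) *\<^sub>R e) < R" using sub by (auto simp: T_def)
    have "2 * s * real j \<le> 2 * s * real n" using that s by simp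
    also have "\<dots> \<le> 1" using n1(1) s by (simp add: field_simps)
    finally have "dist (x - (2 * s * real j) *\<^sub>R e) x \<le> 1" using s e(1) by (simp add: dist_norm)
    then show "x \<in> ball z (R + 1)"
      using dist_triangle[of z x "x - (2 * s * real j) *\<^sub>R e"] d by simp
  qed
  have "of_nat n * emeasure lborel A = (\<Sum>j<n. emeasure lborel (T j))"
    by (simp add: T_def emeasure_translation)
  also have "\<dots> = emeasure lborel (\<Union>j<n. T j)"
    by (rule sum_emeasure[OF _ disj]) auto
  also have "\<dots> \<le> emeasure lborel (ball z (R + 1))"
    using Tsub by (intro emeasure_mono) auto
  finally have le: "of_nat n * emeasure lborel A \<le> emeasure lborel (ball z (R + 1))" .
  have "1 \<le> 4 * s * real n" using n2 s by (simp add: field_simps)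
  then have "1 \<le> ennreal (4 * s * real n)" by (simp flip: ennreal_1 add: ennreal_leI)
  then have "1 * emeasure lborel A \<le> ennreal (4 * s * real n) * emeasure lborel A" by (rule mult_right_mono) simp
  also have "\<dots> = ennreal (4 * s) * (of_nat n * emeasure lborel A)"
    using s by (simp add: ennreal_mult ennreal_of_nat_eq_real_of_nat mult.assoc)
  also have "\<dots> \<le> ennreal (4 * s) * emeasure lborel (ball z (R + 1))" by (intro mult_left_mono le) simp
  finally show ?thesis by simp
qed

text \<open>The height above the graph is a Lipschitz function that vanishes on the boundary, so a tube around
  the boundary is contained in a layer around the zero set of this function.\<close>

lemma lipschitz_tube_local:
  fixes \<Lambda> :: "'a::euclidean_space set"
  assumes \<Lambda>: "open \<Lambda>" and r: "r > 0" and bd: "basic_domain \<Lambda>\<^sub>0" and eq: "ball z r \<inter> \<Lambda> = ball z r \<inter> \<Lambda>\<^sub>0"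
  shows "\<exists>C\<ge>0. \<forall>t. 0 < t \<and> t \<le> r / 2 \<longrightarrow>
    emeasure lborel (ball z (r / 2) \<inter> tube (frontier \<Lambda>) t) \<le> ennreal (C * t)"
proof -
  obtain e \<Phi> L where e: "norm e = 1" and L: "L-lipschitz_on {y. y \<bullet> e = 0} \<Phi>"
    and \<Lambda>0: "\<Lambda>\<^sub>0 = {x. x \<bullet> e > \<Phi> (x - (x \<bullet> e) *\<^sub>R e)}"
    using bd unfolding basic_domain_def by blast
  define F where "F x = x \<bullet> e - \<Phi> (x - (x \<bullet> e) *\<^sub>R e)" for x
  define K where "K = 1 + 2 * L"
  have L0: "L \<ge> 0" using L by (rule lipschitz_on_nonneg)
  have K: "K > 0" using L0 by (simp add: K_def)
  have ee: "e \<bullet> e = 1" using e by (simp add: dot_square_norm)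
  have proj: "x - (x \<bullet> e) *\<^sub>R e \<in> {y. y \<bullet> e = 0}" for x by (simp add: inner_diff_left ee)
  have F_lip: "\<bar>F x - F y\<bar> \<le> K * dist x y" for x y
  proof -
    have ip: "\<bar>(x - y) \<bullet> e\<bar> \<le> dist x y"
      using Cauchy_Schwarz_ineq2[of "x - y" e] e by (simp add: dist_norm)
    have "dist (x - (x \<bullet> e) *\<^sub>R e) (y - (y \<bullet> e) *\<^sub>R e) = norm ((x - y) - ((x - y) \<bullet> e) *\<^sub>R e)"
      by (simp add: dist_norm inner_diff_left scaleR_diff_left algebra_simps)
    also have "\<dots> \<le> norm (x - y) + norm (((x - y) \<bullet> e) *\<^sub>R e)" by (rule norm_triangle_ineq4)
    also have "\<dots> \<le> 2 * dist x y" using ip e by (simp add: dist_norm)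
    finally have "L * dist (x - (x \<bullet> e) *\<^sub>R e) (y - (y \<bullet> e) *\<^sub>R e) \<le> L * (2 * dist x y)"
      using L0 by (rule mult_left_mono)
    moreover have "dist (\<Phi> (x - (x \<bullet> e) *\<^sub>R e)) (\<Phi> (y - (y \<bullet> e) *\<^sub>R e)) \<le>
        L * dist (x - (x \<bullet> e) *\<^sub>R e) (y - (y \<bullet> e) *\<^sub>R e)"
      by (rule lipschitz_onD[OF L proj proj])
    ultimately have "\<bar>\<Phi> (x - (x \<bullet> e) *\<^sub>R e) - \<Phi> (y - (y \<bullet> e) *\<^sub>R e)\<bar> \<le> L * (2 * dist x y)"
      by (simp add: dist_real_def)
    then show ?thesis using ip by (simp add: F_def K_def inner_diff_left algebra_simps abs_if split: if_splits)
  qed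
  have F_shift: "F (x + c *\<^sub>R e) = F x + c" for x c
  proof -
    have "(x + c *\<^sub>R e) - ((x + c *\<^sub>R e) \<bullet> e) *\<^sub>R e = x - (x \<bullet> e) *\<^sub>R e"
      by (simp add: inner_add_left ee scaleR_add_left)
    then show ?thesis by (simp only: F_def inner_add_left inner_scaleR_left ee)
  qed
  have F_cont: "continuous_on UNIV F"
  proof (rule lipschitz_on_continuous_on[where L = K])
    show "K-lipschitz_on UNIV F" using F_lip K by (intro lipschitz_onI) (auto simp: dist_real_def)
  qed
  have mem: "x \<in> \<Lambda> \<longleftrightarrow> F x > 0" if "x \<in> ball z r" for x
  proof -
    have "x \<in> ball z r \<inter> \<Lambda> \<longleftrightarrow> x \<in> ball z r \<inter> \<Lambda>\<^sub>0" by (simp only: eq)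
    then show ?thesis using that by (simp add: \<Lambda>0 F_def)
  qed
  have F_zero: "F y = 0" if y: "y \<in> frontier \<Lambda>" "y \<in> ball z r" for y
  proof (rule ccontr)
    assume "F y \<noteq> 0"
    then consider "F y > 0" | "F y < 0" by linarith
    then show False
    proof cases
      case 1
      have "open ({x. F x > 0} \<inter> ball z r)"
        using F_cont by (intro open_Int open_Collect_less continuous_intros) auto
      moreover have "{x. F x > 0} \<inter> ball z r \<subseteq> \<Lambda>" using mem by blast
      ultimately have "y \<in> interior \<Lambda>" using 1 y(2) by (auto intro: interiorI)
      then show False using y(1) by (simp add: frontier_def)
    next
      case 2
      have "open ({x. F x < 0} \<inter> ball z r)"
        using F_cont by (intro open_Int open_Collect_less continuous_intros) auto
      moreover have "({x. F x < 0} \<inter> ball z r) \<inter> \<Lambda> = {}" using mem by force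
      ultimately have "({x. F x < 0} \<inter> ball z r) \<inter> closure \<Lambda> = {}"
        using open_Int_closure_eq_empty by blast
      moreover have "y \<in> {x. F x < 0} \<inter> ball z r" using 2 y(2) by simp
      moreover have "y \<in> closure \<Lambda>" using y(1) by (simp add: frontier_def)
      ultimately show False by blast
    qed
  qed
  define B where "B = measure lborel (ball z (r / 2 + 1))"
  have B: "emeasure lborel (ball z (r / 2 + 1)) = ennreal B" unfolding B_def
    by (rule emeasure_eq_ennreal_measure) (use less_imp_neq[OF emeasure_bounded_finite[OF bounded_ball]] in auto)
  have "emeasure lborel (ball z (r / 2) \<inter> tube (frontier \<Lambda>) t) \<le> ennreal ((4 * K * B) * t)"
    if t: "0 < t" "t \<le> r / 2" for t
  proof -
    have "emeasure lborel (ball z (r / 2) \<inter> tube (frontier \<Lambda>) t) \<le>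
        ennreal (4 * (K * t)) * emeasure lborel (ball z (r / 2 + 1))"
    proof (rule layer_volume[where F = F and e = e])
      fix x assume x: "x \<in> ball z (r / 2) \<inter> tube (frontier \<Lambda>) t"
      then obtain y where y: "y \<in> frontier \<Lambda>" "dist x y < t" by (auto elim: in_tubeE)
      have "dist z y < r" using x y t dist_triangle[of z y x] by auto
      then have "F y = 0" using F_zero y by simp
      then have "\<bar>F x\<bar> \<le> K * dist x y" using F_lip[of x y] by simp
      also have "\<dots> < K * t" using y K by simp
      finally show "\<bar>F x\<bar> < K * t" .
    qed (use K t e F_shift in auto)
    also have "\<dots> = ennreal ((4 * K * B) * t)"
      unfolding B using K t by (subst ennreal_mult[symmetric]) (auto simp: B_def mult_ac)
    finally show ?thesis .
  qed
  moreover have "4 * K * B \<ge> 0" using K by (simp add: B_def)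
  ultimately show ?thesis by blast
qed

lemma emeasure_ball_unit:
  fixes c :: "'a::euclidean_space"
  assumes "r \<ge> 0"
  shows "emeasure lborel (ball c r) = ennreal (unit_ball_vol (real DIM('a)) * r ^ DIM('a))"
  using assms by (rule emeasure_ball)

lemma admissible_domain_basic:
  fixes \<Lambda> :: "'a::euclidean_space set"
  assumes "admissible_domain \<Lambda>"
  shows "open \<Lambda>" "bounded \<Lambda>"
  using assms by (auto simp: admissible_domain_def lipschitz_domain_def split: if_splits)

lemma tube_volume_large:
  fixes S :: "'a::euclidean_space set"
  assumes "bounded S" and t0: "t0 > 0"
  shows "\<exists>C\<ge>0. \<forall>t\<ge>t0. emeasure lborel (tube S t) \<le> ennreal (C * t ^ DIM('a))"
proof -
  obtain R where R: "R > 0" "\<And>x. x \<in> S \<Longrightarrow> norm x \<le> R" using assms(1) by (auto simp: bounded_pos)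
  let ?V = "unit_ball_vol (real DIM('a))"
  have "emeasure lborel (tube S t) \<le> ennreal (?V * (R / t0 + 1) ^ DIM('a) * t ^ DIM('a))" if t: "t \<ge> t0" for t
  proof -
    have "tube S t \<subseteq> ball 0 ((R / t0 + 1) * t)"
    proof
      fix x assume "x \<in> tube S t"
      then obtain z where z: "z \<in> S" "dist x z < t" by (rule in_tubeE)
      have "norm x \<le> norm z + dist x z" using norm_triangle_sub[of x z] by (simp add: dist_norm)
      also have "\<dots> < R + t" using R(2)[OF z(1)] z(2) by simp
      also have "\<dots> \<le> (R / t0 + 1) * t" using t t0 R(1) by (simp add: field_simps)
      finally show "x \<in> ball 0 ((R / t0 + 1) * t)" by simp
    qed
    then have "emeasure lborel (tube S t) \<le> emeasure lborel (ball (0::'a) ((R / t0 + 1) * t))"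
      by (rule emeasure_mono) simp
    also have "\<dots> = ennreal (?V * ((R / t0 + 1) * t) ^ DIM('a))"
      using t t0 R(1) by (intro emeasure_ball_unit) auto
    finally show ?thesis by (simp add: power_mult_distrib mult.assoc)
  qed
  moreover have "?V * (R / t0 + 1) ^ DIM('a) \<ge> 0" using t0 R(1) by simp
  ultimately show ?thesis by blast
qed

text \<open>Finitely many local estimates cover the compact boundary when \<open>t\<close> is small; for large \<open>t\<close> the tube lies
  in a ball of radius comparable to \<open>t\<close>, which the term \<open>t\<^sup>d\<close> accounts for.\<close>

lemma tube_volume_lipschitz:
  fixes \<Lambda> :: "'a::euclidean_space set"
  assumes b: "bounded \<Lambda>" and lip: "lipschitz_domain \<Lambda>"
  shows "\<exists>C\<ge>0. \<forall>t>0. emeasure lborel (tube (frontier \<Lambda>) t) \<le> ennreal (C * (t + t ^ DIM('a)))"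
proof -
  have op: "open \<Lambda>" using lip by (simp add: lipschitz_domain_def)
  have "\<forall>z. \<exists>r>0. \<exists>C\<ge>0. \<forall>t. 0 < t \<and> t \<le> r / 2 \<longrightarrow>
    emeasure lborel (ball z (r / 2) \<inter> tube (frontier \<Lambda>) t) \<le> ennreal (C * t)"
  proof
    fix z
    obtain r \<Lambda>\<^sub>0 where "r > 0" "basic_domain \<Lambda>\<^sub>0" "ball z r \<inter> \<Lambda> = ball z r \<inter> \<Lambda>\<^sub>0"
      using lip unfolding lipschitz_domain_def by meson
    then show "\<exists>r>0. \<exists>C\<ge>0. \<forall>t. 0 < t \<and> t \<le> r / 2 \<longrightarrow>
      emeasure lborel (ball z (r / 2) \<inter> tube (frontier \<Lambda>) t) \<le> ennreal (C * t)"
      using lipschitz_tube_local[OF op] by blast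
  qed
  then obtain r C where r: "\<And>z. r z > 0" and C: "\<And>z. C z \<ge> 0"
    and loc: "\<And>z t. 0 < t \<Longrightarrow> t \<le> r z / 2 \<Longrightarrow>
      emeasure lborel (ball z (r z / 2) \<inter> tube (frontier \<Lambda>) t) \<le> ennreal (C z * t)"
    by metis
  have "compact (frontier \<Lambda>)" using b by (rule compact_frontier_bounded)
  then obtain Z where Z: "Z \<subseteq> frontier \<Lambda>" "finite Z" "frontier \<Lambda> \<subseteq> (\<Union>z\<in>Z. ball z (r z / 4))"
    by (rule compactE_image[where C = "frontier \<Lambda>" and f = "\<lambda>z. ball z (r z / 4)"]) (use r in force)+
  define t0 where "t0 = Min (insert 1 ((\<lambda>z. r z / 4) ` Z))"
  have t0: "t0 > 0" unfolding t0_def using Z(2) r by (subst Min_gr_iff) auto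
  have t0_le: "t0 \<le> r z / 4" if "z \<in> Z" for z unfolding t0_def using Z(2) that by (intro Min_le) auto
  obtain C' where C': "C' \<ge> 0" "\<And>t. t \<ge> t0 \<Longrightarrow> emeasure lborel (tube (frontier \<Lambda>) t) \<le> ennreal (C' * t ^ DIM('a))"
    using tube_volume_large[OF compact_imp_bounded[OF compact_frontier_bounded[OF b]] t0] by blast
  let ?S = "\<Sum>z\<in>Z. C z"
  have S0: "?S \<ge> 0" using C by (intro sum_nonneg) auto
  have "emeasure lborel (tube (frontier \<Lambda>) t) \<le> ennreal ((?S + C') * (t + t ^ DIM('a)))" if t: "t > 0" for t
  proof (cases "t \<le> t0")
    case True
    have "tube (frontier \<Lambda>) t \<subseteq> (\<Union>z\<in>Z. ball z (r z / 2) \<inter> tube (frontier \<Lambda>) t)"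
    proof
      fix x assume x: "x \<in> tube (frontier \<Lambda>) t"
      then obtain y where y: "y \<in> frontier \<Lambda>" "dist x y < t" by (rule in_tubeE)
      then obtain z where z: "z \<in> Z" "dist z y < r z / 4" using Z(3) by auto
      have "dist z x < r z / 2"
        using dist_triangle[of z x y] y(2) z(2) True t0_le[OF z(1)] by (simp add: dist_commute)
      then show "x \<in> (\<Union>z\<in>Z. ball z (r z / 2) \<inter> tube (frontier \<Lambda>) t)" using x z(1) by auto
    qed
    then have "emeasure lborel (tube (frontier \<Lambda>) t) \<le>
        emeasure lborel (\<Union>z\<in>Z. ball z (r z / 2) \<inter> tube (frontier \<Lambda>) t)"
      by (rule emeasure_mono) (auto intro!: borel_open open_UN open_Int open_tube simp del: UN_simps)
    also have "\<dots> \<le> (\<Sum>z\<in>Z. emeasure lborel (ball z (r z / 2) \<inter> tube (frontier \<Lambda>) t))"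
      by (rule emeasure_subadditive_finite) (use Z(2) in auto)
    also have "\<dots> \<le> (\<Sum>z\<in>Z. ennreal (C z * t))"
    proof (intro sum_mono loc t)
      fix z assume "z \<in> Z"
      then show "t \<le> r z / 2" using t0_le True r[of z] by force
    qed
    also have "\<dots> = ennreal (?S * t)"
      using C t by (subst sum_ennreal) (auto simp: sum_distrib_right)
    also have "\<dots> \<le> ennreal ((?S + C') * (t + t ^ DIM('a)))"
      using S0 C'(1) t by (intro ennreal_leI mult_mono) auto
    finally show ?thesis .
  next
    case False
    then have "emeasure lborel (tube (frontier \<Lambda>) t) \<le> ennreal (C' * t ^ DIM('a))" by (intro C'(2)) simp
    also have "\<dots> \<le> ennreal ((?S + C') * (t + t ^ DIM('a)))"
      using S0 C'(1) t by (intro ennreal_leI mult_mono) auto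
    finally show ?thesis .
  qed
  moreover have "?S + C' \<ge> 0" using S0 C'(1) by simp
  ultimately show ?thesis by blast
qed

lemma tube_volume:
  fixes \<Lambda> :: "'a::euclidean_space set"
  assumes "admissible_domain \<Lambda>"
  shows "\<exists>C\<ge>0. \<forall>t>0. emeasure lborel (tube (frontier \<Lambda>) t) \<le> ennreal (C * (t + t ^ DIM('a)))"
proof (cases "DIM('a) = 1")
  case False
  then show ?thesis using assms tube_volume_lipschitz by (auto simp: admissible_domain_def)
next
  case True
  then obtain a b where ab: "\<Lambda> = box a b" using assms by (auto simp: admissible_domain_def)
  obtain i where i: "(Basis :: 'a set) = {i}" using True by (rule card_1_singletonE)
  have fr: "frontier \<Lambda> \<subseteq> {a, b}"
  proof
    fix x assume "x \<in> frontier \<Lambda>"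
    then have "x \<in> cbox a b - box a b" by (auto simp: ab frontier_box split: if_splits)
    then have "x \<bullet> i = a \<bullet> i \<or> x \<bullet> i = b \<bullet> i" by (auto simp: mem_box i)
    then have "x = a \<or> x = b" unfolding euclidean_eq_iff[of x] i by simp
    then show "x \<in> {a, b}" by simp
  qed
  let ?V = "unit_ball_vol (real DIM('a))"
  have "emeasure lborel (tube (frontier \<Lambda>) t) \<le> ennreal (2 * ?V * (t + t ^ DIM('a)))" if t: "t > 0" for t
  proof -
    have "tube (frontier \<Lambda>) t \<subseteq> ball a t \<union> ball b t" using fr by (auto simp: tube_def)
    then have "emeasure lborel (tube (frontier \<Lambda>) t) \<le> emeasure lborel (ball a t \<union> ball b t)"
      by (rule emeasure_mono) simp
    also have "\<dots> \<le> emeasure lborel (ball a t) + emeasure lborel (ball b t)" by (rule emeasure_subadditive) auto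
    also have "\<dots> = ennreal (?V * t ^ DIM('a) + ?V * t ^ DIM('a))"
      using t by (simp only: emeasure_ball_unit less_imp_le) (subst ennreal_plus[symmetric], auto)
    also have "\<dots> \<le> ennreal (2 * ?V * (t + t ^ DIM('a)))" using t by (intro ennreal_leI) (simp add: algebra_simps)
    finally show ?thesis .
  qed
  moreover have "2 * ?V \<ge> 0" by simp
  ultimately show ?thesis by blast
qed

text \<open>The layer of width \<open>n / \<rho>\<close> around the dilated set \<open>\<alpha> S\<close> has volume at most about
  \<open>n\<^sup>d \<alpha>\<^sup>d\<^sup>-\<^sup>1 / \<rho>\<close>, and the decay in the distance outweighs the power of \<open>n\<close>.\<close>

lemma boundary_decay_integral:
  fixes S :: "'a::euclidean_space set"
  assumes S: "S \<noteq> {}" and C: "C \<ge> 0" "\<And>t. t > 0 \<Longrightarrow> emeasure lborel (tube S t) \<le> ennreal (C * (t + t ^ DIM('a)))"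
  shows "\<exists>C'\<ge>0. \<forall>\<alpha> \<rho>. \<alpha> > 0 \<and> \<rho> > 0 \<and> \<alpha> * \<rho> \<ge> 1 \<longrightarrow>
    (\<integral>\<^sup>+\<eta>. ennreal ((1 / (1 + (\<rho> * (\<alpha> * infdist ((1 / \<alpha>) *\<^sub>R \<eta>) S))\<^sup>2)) ^ Suc DIM('a)) \<partial>lborel)
      \<le> ennreal (C' * \<alpha> ^ (DIM('a) - 1) / \<rho>)"
proof -
  let ?D = "DIM('a)"
  have "?D = Suc (?D - 1)" using DIM_positive[where 'a = 'a] by simp
  then have D: "x ^ ?D = x * x ^ (?D - 1)" for x :: real by (metis power_Suc)
  have summ: "summable (\<lambda>n. 1 / (1 + (real n)\<^sup>2))"
  proof (rule summable_comparison_test'[of "\<lambda>n. 1 / (real n)\<^sup>2" 1])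
    show "summable (\<lambda>n. 1 / (real n)\<^sup>2)" using inverse_power_summable[of 2] by (simp add: inverse_eq_divide)
    show "norm (1 / (1 + (real n)\<^sup>2)) \<le> 1 / (real n)\<^sup>2" if "n \<ge> 1" for n
      using that by (auto intro!: divide_left_mono mult_pos_pos add_pos_nonneg)
  qed
  define Z where "Z = (\<Sum>n. 1 / (1 + (real n)\<^sup>2))"
  have Z: "Z \<ge> 0" unfolding Z_def by (intro suminf_nonneg summ) auto
  show ?thesis
  proof (intro exI[of _ "2 * C * 2 ^ ?D * Z"] conjI allI impI)
    show "0 \<le> 2 * C * 2 ^ ?D * Z" using C(1) Z by simp
    fix \<alpha> \<rho> :: real assume *: "\<alpha> > 0 \<and> \<rho> > 0 \<and> \<alpha> * \<rho> \<ge> 1"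
    then have \<alpha>: "\<alpha> > 0" and \<rho>: "\<rho> > 0" and \<alpha>\<rho>: "\<alpha> * \<rho> \<ge> 1" by auto
    define d where "d \<eta> = \<rho> * (\<alpha> * infdist ((1 / \<alpha>) *\<^sub>R \<eta>) S)" for \<eta> :: 'a
    define s where "s n = (real n + 1) / (\<alpha> * \<rho>)" for n
    define A where "A n = {\<eta>. (1 / \<alpha>) *\<^sub>R \<eta> \<in> tube S (s n)}" for n
    have A[measurable]: "A n \<in> sets borel" for n unfolding A_def by measurable
    define c where "c n = (1 / (1 + (real n)\<^sup>2)) ^ Suc ?D" for n
    have c0: "c n \<ge> 0" for n by (simp add: c_def)
    have d0: "d \<eta> \<ge> 0" for \<eta> using \<alpha> \<rho> by (simp add: d_def infdist_nonneg)
    have pw: "ennreal ((1 / (1 + (d \<eta>)\<^sup>2)) ^ Suc ?D) \<le> (\<Sum>n. ennreal (c n) * indicator (A n) \<eta>)" for \<eta>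
    proof -
      define n where "n = nat \<lfloor>d \<eta>\<rfloor>"
      have n: "real n \<le> d \<eta>" "d \<eta> < real n + 1" using d0[of \<eta>] by (auto simp: n_def)
      have "infdist ((1 / \<alpha>) *\<^sub>R \<eta>) S < s n"
        using n(2) \<alpha> \<rho> by (simp add: d_def s_def field_simps)
      then have "\<eta> \<in> A n" using infdist_less_imp_in_tube[OF S] by (simp add: A_def)
      have "(1 / (1 + (d \<eta>)\<^sup>2)) ^ Suc ?D \<le> c n"
        unfolding c_def using n(1)
        by (intro power_mono divide_left_mono mult_pos_pos add_left_mono) (auto simp: add_pos_nonneg)
      then have "ennreal ((1 / (1 + (d \<eta>)\<^sup>2)) ^ Suc ?D) \<le> ennreal (c n) * indicator (A n) \<eta>"
        using \<open>\<eta> \<in> A n\<close> by (simp add: ennreal_leI)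
      also have "\<dots> \<le> (\<Sum>n. ennreal (c n) * indicator (A n) \<eta>)"
      proof -
        have "f n \<le> (\<Sum>n. f n)" for f :: "nat \<Rightarrow> ennreal" using sum_le_suminf[of f "{n}"] by simp
        then show ?thesis .
      qed
      finally show ?thesis .
    qed
    have emA: "ennreal (c n) * emeasure lborel (A n) \<le> ennreal (2 * C * 2 ^ ?D * \<alpha> ^ (?D - 1) / \<rho> * (1 / (1 + (real n)\<^sup>2)))" for n
    proof -
      have "emeasure lborel (tube S (s n)) = (\<integral>\<^sup>+x. indicator (tube S (s n)) x \<partial>lborel)" by simp
      also have "\<dots> = ennreal (\<bar>1 / \<alpha>\<bar> ^ ?D) * (\<integral>\<^sup>+\<eta>. indicator (tube S (s n)) (0 + (1 / \<alpha>) *\<^sub>R \<eta>) \<partial>lborel)"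
        by (rule lborel_nn_integral_affine) (use \<alpha> in auto)
      also have "(\<lambda>\<eta>::'a. indicator (tube S (s n)) (0 + (1 / \<alpha>) *\<^sub>R \<eta>) :: ennreal) = indicator (A n)"
        by (auto simp: A_def indicator_def)
      finally have "emeasure lborel (tube S (s n)) = ennreal (\<bar>1 / \<alpha>\<bar> ^ ?D) * emeasure lborel (A n)" by simp
      then have "ennreal (\<alpha> ^ ?D) * emeasure lborel (tube S (s n)) = emeasure lborel (A n)"
        using \<alpha> by (simp add: mult.assoc[symmetric] ennreal_mult[symmetric] power_divide)
      then have "emeasure lborel (A n) \<le> ennreal (\<alpha> ^ ?D) * ennreal (C * (s n + s n ^ ?D))"
        using C(2)[of "s n"] \<alpha> \<rho> by (metis mult_left_mono zero_le s_def divide_pos_pos mult_pos_pos add_nonneg_pos of_nat_0_le_iff zero_less_one)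
      also have "\<dots> = ennreal (\<alpha> ^ ?D * (C * (s n + s n ^ ?D)))"
        using \<alpha> by (intro ennreal_mult'[symmetric]) simp
      finally have 1: "emeasure lborel (A n) \<le> ennreal (\<alpha> ^ ?D * (C * (s n + s n ^ ?D)))" .
      have sn: "0 \<le> s n" "s n \<le> real n + 1"
        using \<alpha> \<rho> \<alpha>\<rho> by (auto simp: s_def divide_le_eq mult_le_cancel_left1)
      have "s n ^ ?D = s n * s n ^ (?D - 1)" by (rule D)
      also have "\<dots> \<le> s n * (real n + 1) ^ (?D - 1)" using sn by (intro mult_left_mono power_mono) auto
      finally have "s n + s n ^ ?D \<le> s n * (2 * (real n + 1) ^ (?D - 1))"
        using mult_left_mono[of 1 "(real n + 1) ^ (?D - 1)" "s n"] sn by simp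
      then have "\<alpha> ^ ?D * (C * (s n + s n ^ ?D)) \<le> \<alpha> ^ ?D * (C * (s n * (2 * (real n + 1) ^ (?D - 1))))"
        using \<alpha> C(1) by (intro mult_left_mono) auto
      also have "\<dots> = 2 * C * \<alpha> ^ (?D - 1) / \<rho> * (real n + 1) ^ ?D"
      proof -
        have *: "(a * x) * (C * ((y / (a * \<rho>)) * (2 * z))) = 2 * C * x / \<rho> * (y * z)" if "a > 0" for a x y z :: real
          using that by simp
        show ?thesis unfolding D[of \<alpha>] D[of "real n + 1"] s_def by (rule *) (rule \<alpha>)
      qed
      finally have 2: "\<alpha> ^ ?D * (C * (s n + s n ^ ?D)) \<le> 2 * C * \<alpha> ^ (?D - 1) / \<rho> * (real n + 1) ^ ?D" .
      have 3: "c n * (real n + 1) ^ ?D \<le> 2 ^ ?D * (1 / (1 + (real n)\<^sup>2))"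
      proof -
        have "(real n + 1) ^ ?D \<le> ((real n + 1)\<^sup>2) ^ ?D"
          by (intro power_mono) (auto simp: power2_eq_square)
        also have "\<dots> \<le> (2 * (1 + (real n)\<^sup>2)) ^ ?D"
          using zero_le_power2[of "real n - 1"] by (intro power_mono) (auto simp: power2_eq_square algebra_simps)
        finally have "c n * (real n + 1) ^ ?D \<le> c n * (2 * (1 + (real n)\<^sup>2)) ^ ?D" using c0 by (rule mult_left_mono)
        also have "\<dots> = 2 ^ ?D * (1 / (1 + (real n)\<^sup>2))"
        proof -
          have *: "(1 / a) ^ Suc ?D * (2 * a) ^ ?D = 2 ^ ?D * (1 / a)" if "a > 0" for a :: real
            using that by (simp add: power_mult_distrib field_simps)
          show ?thesis unfolding c_def by (rule *) (simp add: add_pos_nonneg)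
        qed
        finally show ?thesis .
      qed
      have "ennreal (c n) * emeasure lborel (A n) \<le> ennreal (c n) * ennreal (2 * C * \<alpha> ^ (?D - 1) / \<rho> * (real n + 1) ^ ?D)"
        using 2 by (intro mult_left_mono order_trans[OF 1] ennreal_leI) auto
      also have "\<dots> = ennreal (2 * C * \<alpha> ^ (?D - 1) / \<rho> * (c n * (real n + 1) ^ ?D))"
        by (subst ennreal_mult'[symmetric, OF c0]) (simp add: mult_ac)
      also have "\<dots> \<le> ennreal (2 * C * \<alpha> ^ (?D - 1) / \<rho> * (2 ^ ?D * (1 / (1 + (real n)\<^sup>2))))"
        using 3 \<alpha> \<rho> C(1) by (intro ennreal_leI mult_left_mono) auto
      finally show ?thesis by (simp add: mult_ac)
    qed
    have "(\<integral>\<^sup>+\<eta>. ennreal ((1 / (1 + (d \<eta>)\<^sup>2)) ^ Suc ?D) \<partial>lborel) \<le> (\<integral>\<^sup>+\<eta>. (\<Sum>n. ennreal (c n) * indicator (A n) \<eta>) \<partial>lborel)"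
      by (intro nn_integral_mono pw)
    also have "\<dots> = (\<Sum>n. \<integral>\<^sup>+\<eta>. ennreal (c n) * indicator (A n) \<eta> \<partial>lborel)"
      by (rule nn_integral_suminf) measurable
    also have "\<dots> = (\<Sum>n. ennreal (c n) * emeasure lborel (A n))"
      by (intro suminf_cong nn_integral_cmult_indicator) simp
    also have "\<dots> \<le> (\<Sum>n. ennreal (2 * C * 2 ^ ?D * \<alpha> ^ (?D - 1) / \<rho> * (1 / (1 + (real n)\<^sup>2))))"
      by (intro suminf_le emA) auto
    also have "\<dots> = ennreal (\<Sum>n. 2 * C * 2 ^ ?D * \<alpha> ^ (?D - 1) / \<rho> * (1 / (1 + (real n)\<^sup>2)))"
      using \<alpha> \<rho> C(1) summ by (intro suminf_ennreal2 summable_mult) auto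
    also have "(\<Sum>n. 2 * C * 2 ^ ?D * \<alpha> ^ (?D - 1) / \<rho> * (1 / (1 + (real n)\<^sup>2))) = 2 * C * 2 ^ ?D * \<alpha> ^ (?D - 1) / \<rho> * Z"
      unfolding Z_def by (rule suminf_mult[OF summ])
    finally show "(\<integral>\<^sup>+\<eta>. ennreal ((1 / (1 + (\<rho> * (\<alpha> * infdist ((1 / \<alpha>) *\<^sub>R \<eta>) S))\<^sup>2)) ^ Suc ?D) \<partial>lborel)
      \<le> ennreal (2 * C * 2 ^ ?D * Z * \<alpha> ^ (?D - 1) / \<rho>)"
      by (simp add: d_def mult_ac)
  qed
qed

section \<open>Centres and scales\<close>

lemma disjoint_balls_card:
  fixes S :: "'a::euclidean_space set"
  assumes S: "finite S" and disj: "\<And>x y. x \<in> S \<Longrightarrow> y \<in> S \<Longrightarrow> x \<noteq> y \<Longrightarrow> ball x (s x) \<inter> ball y (s y) = {}"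
    and s0: "s0 \<ge> 0" "\<And>x. x \<in> S \<Longrightarrow> s0 \<le> s x" and sub: "\<And>x. x \<in> S \<Longrightarrow> ball x (s x) \<subseteq> A"
    and A: "A \<in> sets borel" "emeasure lborel A \<le> ennreal B" and B: "B \<ge> 0"
  shows "real (card S) * (unit_ball_vol (real DIM('a)) * s0 ^ DIM('a)) \<le> B"
proof -
  let ?V = "unit_ball_vol (real DIM('a)) * s0 ^ DIM('a)"
  have subs: "ball x s0 \<subseteq> ball x (s x)" if "x \<in> S" for x using s0(2)[OF that] by (rule subset_ball)
  have "ennreal (real (card S) * ?V) = (\<Sum>x\<in>S. ennreal ?V)"
    using s0(1) by (subst sum_ennreal) auto
  also have "\<dots> = (\<Sum>x\<in>S. emeasure lborel (ball x s0))" by (simp add: emeasure_ball_unit[OF s0(1)])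
  also have "\<dots> = emeasure lborel (\<Union>x\<in>S. ball x s0)"
  proof (rule sum_emeasure)
    show "disjoint_family_on (\<lambda>x. ball x s0) S"
      unfolding disjoint_family_on_def using disj subs by blast
  qed (use S in auto)
  also have "\<dots> \<le> emeasure lborel A" using subs sub A(1) by (intro emeasure_mono) (blast, simp)
  also have "\<dots> \<le> ennreal B" by (rule A(2))
  finally show ?thesis using B by (subst (asm) ennreal_le_iff) auto
qed

text \<open>Comparing volumes bounds the cardinality of families of centres with disjoint balls. In a family
  of maximal cardinality every further point is blocked by some ball, whose radius is comparable because
  the radius function varies slowly.\<close>

lemma separated_centres:
  fixes \<Lambda> :: "'a::euclidean_space set" and \<rho> :: "'a \<Rightarrow> real"
  assumes bd: "bounded \<Lambda>" and r0: "r0 > 0" "\<And>x. r0 \<le> \<rho> x" and R1: "\<And>x. x \<in> \<Lambda> \<Longrightarrow> \<rho> x \<le> R1"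
    and lip: "\<And>x y. \<rho> x \<le> \<rho> y + dist x y / 4"
  obtains S where "finite S" "S \<subseteq> \<Lambda>"
    "\<And>x y. x \<in> S \<Longrightarrow> y \<in> S \<Longrightarrow> x \<noteq> y \<Longrightarrow> ball x (\<rho> x / 4) \<inter> ball y (\<rho> y / 4) = {}"
    "\<And>x. x \<in> \<Lambda> \<Longrightarrow> \<exists>y\<in>S. dist x y \<le> \<rho> y"
proof -
  define P where "P S \<longleftrightarrow> finite S \<and> S \<subseteq> \<Lambda> \<and>
    (\<forall>x\<in>S. \<forall>y\<in>S. x \<noteq> y \<longrightarrow> ball x (\<rho> x / 4) \<inter> ball y (\<rho> y / 4) = {})" for S
  obtain R where R: "\<And>x. x \<in> \<Lambda> \<Longrightarrow> norm x \<le> R" using bd by (auto simp: bounded_iff)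
  let ?A = "ball (0::'a) (R + R1)"
  define B where "B = measure lborel ?A"
  have B: "emeasure lborel ?A = ennreal B" unfolding B_def
    by (rule emeasure_eq_ennreal_measure) (use less_imp_neq[OF emeasure_bounded_finite[OF bounded_ball]] in auto)
  let ?v = "unit_ball_vol (real DIM('a)) * (r0 / 4) ^ DIM('a)"
  have v: "?v > 0" using r0(1) by simp
  have card: "card S \<le> nat \<lceil>B / ?v\<rceil>" if S: "P S" for S
  proof -
    have "real (card S) * ?v \<le> B"
    proof (rule disjoint_balls_card[where s = "\<lambda>x. \<rho> x / 4" and A = ?A])
      fix x assume x: "x \<in> S"
      then have x\<Lambda>: "x \<in> \<Lambda>" using S by (auto simp: P_def)
      show "ball x (\<rho> x / 4) \<subseteq> ?A"
      proof
        fix p assume "p \<in> ball x (\<rho> x / 4)"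
        then have "dist x p < \<rho> x / 4" by simp
        moreover have "norm p \<le> norm x + dist x p" using norm_triangle_sub[of p x] by (simp add: dist_norm norm_minus_commute)
        moreover have "\<rho> x > 0" using r0 by (meson less_le_trans)
        ultimately show "p \<in> ?A" using R[OF x\<Lambda>] R1[OF x\<Lambda>] by simp
      qed
    qed (use S r0 B in \<open>auto simp: P_def B_def\<close>)
    then have "real (card S) \<le> B / ?v" using v by (simp add: pos_le_divide_eq)
    then show ?thesis by linarith
  qed
  have "P {}" by (simp add: P_def)
  then have "\<exists>S. P S \<and> (\<forall>S'. P S' \<longrightarrow> card S' \<le> card S)"
    by (rule ex_has_greatest_nat[of P "{}" card "Suc (nat \<lceil>B / ?v\<rceil>)"]) (use card in \<open>auto simp: less_Suc_eq_le\<close>)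
  then obtain S where S: "P S" "\<And>S'. P S' \<Longrightarrow> card S' \<le> card S" by auto
  show thesis
  proof (rule that[of S])
    show "finite S" "S \<subseteq> \<Lambda>" using S(1) by (auto simp: P_def)
    show "ball x (\<rho> x / 4) \<inter> ball y (\<rho> y / 4) = {}" if "x \<in> S" "y \<in> S" "x \<noteq> y" for x y
      using S(1) that by (simp add: P_def)
    fix x assume x: "x \<in> \<Lambda>"
    show "\<exists>y\<in>S. dist x y \<le> \<rho> y"
    proof (cases "x \<in> S")
      case True
      then show ?thesis using r0 by (intro bexI[of _ x]) (auto intro: less_imp_le less_le_trans)
    next
      case False
      have "finite S" using S(1) by (simp add: P_def)
      then have "\<not> P (insert x S)" using S(2)[of "insert x S"] False by auto
      moreover have "P (insert x S)" if "\<And>y. y \<in> S \<Longrightarrow> ball x (\<rho> x / 4) \<inter> ball y (\<rho> y / 4) = {}"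
        using S(1) x that by (simp add: P_def Int_commute)
      ultimately obtain y where y: "y \<in> S" "ball x (\<rho> x / 4) \<inter> ball y (\<rho> y / 4) \<noteq> {}" by blast
      then obtain p where "dist x p < \<rho> x / 4" "dist y p < \<rho> y / 4" by auto
      then have "dist x y < \<rho> x / 4 + \<rho> y / 4" using dist_triangle2[of x y p] by linarith
      moreover have "\<rho> y > 0" using r0 by (meson less_le_trans)
      ultimately have "dist x y \<le> \<rho> y" using lip[of x y] by linarith
      then show ?thesis using y(1) by blast
    qed
  qed
qed

text \<open>The scale is proportional to the distance from the boundary, but never below the wavelength
  \<open>1 / \<alpha>\<close>. A window of scale \<open>r\<close> reaches to distance \<open>2 d r\<close> from its centre, so in the first
  regime the factor \<open>4 d\<close> keeps it inside the domain.\<close>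

definition local_scale :: "'a::euclidean_space set \<Rightarrow> real \<Rightarrow> 'a \<Rightarrow> real" where
  "local_scale \<Lambda> \<alpha> y = max (1 / \<alpha>) (infdist y (frontier \<Lambda>) / (4 * DIM('a)))"

lemma local_scale_lipschitz:
  fixes x y :: "'a::euclidean_space"
  shows "local_scale \<Lambda> \<alpha> x \<le> local_scale \<Lambda> \<alpha> y + dist x y / 4"
proof -
  have D: "real DIM('a) \<ge> 1" using DIM_positive[where 'a = 'a] by linarith
  have "infdist x (frontier \<Lambda>) \<le> infdist y (frontier \<Lambda>) + dist x y" by (rule infdist_triangle)
  then have "infdist x (frontier \<Lambda>) / (4 * DIM('a)) \<le> (infdist y (frontier \<Lambda>) + dist x y) / (4 * DIM('a))"
    by (rule divide_right_mono) simp
  also have "\<dots> = infdist y (frontier \<Lambda>) / (4 * DIM('a)) + dist x y / (4 * DIM('a))" by (rule add_divide_distrib)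
  also have "dist x y / (4 * DIM('a)) \<le> dist x y / 4"
    using D by (intro divide_left_mono) auto
  finally have "infdist x (frontier \<Lambda>) / (4 * DIM('a)) \<le> infdist y (frontier \<Lambda>) / (4 * DIM('a)) + dist x y / 4"
    by simp
  moreover have "0 \<le> dist x y / 4" by simp
  ultimately show ?thesis unfolding local_scale_def by linarith
qed

lemma frontier_nonempty:
  fixes \<Lambda> :: "'a::euclidean_space set"
  assumes "bounded \<Lambda>" "\<Lambda> \<noteq> {}"
  shows "frontier \<Lambda> \<noteq> {}"
proof -
  have "\<Lambda> \<noteq> UNIV" using assms(1) not_bounded_UNIV[where 'a = 'a] by auto
  then show ?thesis using assms(2) by (simp add: frontier_eq_empty)
qed

lemma local_scale_bounded:
  fixes \<Lambda> :: "'a::euclidean_space set"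
  assumes bd: "bounded \<Lambda>" and ne: "\<Lambda> \<noteq> {}"
  obtains R where "R \<ge> 1" "\<And>\<alpha> y. \<alpha> \<ge> 2 \<Longrightarrow> y \<in> \<Lambda> \<Longrightarrow> local_scale \<Lambda> \<alpha> y \<le> R"
proof -
  obtain z where z: "z \<in> frontier \<Lambda>" using frontier_nonempty[OF bd ne] by blast
  obtain R where R: "\<And>y. y \<in> \<Lambda> \<Longrightarrow> dist z y \<le> R" using bd by (meson bounded_any_center)
  show thesis
  proof (rule that[of "max 1 (R / (4 * DIM('a)))"])
    fix \<alpha> :: real and y assume \<alpha>: "\<alpha> \<ge> 2" and y: "y \<in> \<Lambda>"
    have "1 / \<alpha> \<le> 1" using \<alpha> by (simp add: divide_le_eq)
    moreover have "infdist y (frontier \<Lambda>) \<le> R" using infdist_le[OF z, of y] R[OF y] by (simp add: dist_commute)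
    then have "infdist y (frontier \<Lambda>) / (4 * DIM('a)) \<le> R / (4 * DIM('a))" by (rule divide_right_mono) simp
    ultimately show "local_scale \<Lambda> \<alpha> y \<le> max 1 (R / (4 * DIM('a)))" by (auto simp: local_scale_def)
  qed simp
qed

lemma dyadic_exponent:
  assumes "x \<ge> (1::real)"
  shows "\<exists>k::nat. 2 ^ k \<le> x \<and> x < 2 * 2 ^ k"
proof -
  define k where "k = nat \<lfloor>log 2 x\<rfloor>"
  have "log 2 x \<ge> 0" using assms by simp
  then have k: "real k \<le> log 2 x" "log 2 x < real k + 1" by (auto simp: k_def)
  have "2 powr real k \<le> 2 powr log 2 x" "2 powr log 2 x < 2 powr (real k + 1)" using k by simp_all
  then show ?thesis using assms by (intro exI[of _ k]) (simp add: powr_realpow powr_add mult.commute)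
qed

text \<open>The balls of radius about \<open>h\<close> lie in a layer of width about \<open>h\<close>, hence there are at most about
  \<open>h / h\<^sup>d\<close> of them; each dyadic size contributes a bounded amount, and there are about \<open>ln \<alpha>\<close>
  sizes between \<open>1 / \<alpha>\<close> and \<open>1\<close>.\<close>

lemma scale_sum_bound:
  fixes \<Lambda> :: "'a::euclidean_space set"
  assumes adm: "admissible_domain \<Lambda>" and ne: "\<Lambda> \<noteq> {}"
  shows "\<exists>C\<ge>0. \<forall>\<alpha>\<ge>2. \<forall>S. finite S \<and> S \<subseteq> \<Lambda> \<and>
    (\<forall>x\<in>S. \<forall>y\<in>S. x \<noteq> y \<longrightarrow> ball x (local_scale \<Lambda> \<alpha> x / 4) \<inter> ball y (local_scale \<Lambda> \<alpha> y / 4) = {}) \<longrightarrow>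
    (\<Sum>y\<in>S. local_scale \<Lambda> \<alpha> y ^ (DIM('a) - 1)) \<le> C * ln \<alpha>"
proof -
  let ?D = "DIM('a)" and ?V = "unit_ball_vol (real DIM('a))"
  have bd: "bounded \<Lambda>" by (rule admissible_domain_basic[OF adm])
  note fne = frontier_nonempty[OF bd ne]
  have "?D = Suc (?D - 1)" using DIM_positive[where 'a = 'a] by simp
  then have D: "x ^ ?D = x * x ^ (?D - 1)" for x :: real by (metis power_Suc)
  obtain R where R: "R \<ge> 1" "\<And>\<alpha> y. \<alpha> \<ge> 2 \<Longrightarrow> y \<in> \<Lambda> \<Longrightarrow> local_scale \<Lambda> \<alpha> y \<le> R"
    using local_scale_bounded[OF bd ne] by blast
  obtain C where C: "C \<ge> 0" "\<And>t. t > 0 \<Longrightarrow> emeasure lborel (tube (frontier \<Lambda>) t) \<le> ennreal (C * (t + t ^ ?D))"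
    using tube_volume[OF adm] by blast
  \<comment> \<open>A ball around a centre of scale below \<open>2 h\<close> lies within distance \<open>c h\<close> of the boundary.\<close>
  define c where "c = (4 * real ?D + 1) * 2"
  have c: "c > 0" by (simp add: c_def add_nonneg_pos)
  define M where "M = C * c * (1 + (c * R) ^ (?D - 1)) * 4 ^ ?D / ?V"
  have M: "M \<ge> 0" using C(1) c R(1) by (simp add: M_def)
  define Q where "Q = 2 ^ (?D - 1) * M"
  have Q: "Q \<ge> 0" using M by (simp add: Q_def)
  define L where "L = 1 / ln 2 + ln R / (ln 2)\<^sup>2 + 1 / ln 2"
  have L: "L \<ge> 0" using R(1) by (simp add: L_def)
  show ?thesis
  proof (intro exI[of _ "L * Q"] conjI allI impI)
    show "L * Q \<ge> 0" using L Q by simp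
    fix \<alpha> :: real and S assume \<alpha>: "\<alpha> \<ge> 2"
    let ?\<rho> = "local_scale \<Lambda> \<alpha>"
    assume "finite S \<and> S \<subseteq> \<Lambda> \<and> (\<forall>x\<in>S. \<forall>y\<in>S. x \<noteq> y \<longrightarrow> ball x (?\<rho> x / 4) \<inter> ball y (?\<rho> y / 4) = {})"
    then have S: "finite S" "S \<subseteq> \<Lambda>"
      and disj: "\<And>x y. x \<in> S \<Longrightarrow> y \<in> S \<Longrightarrow> x \<noteq> y \<Longrightarrow> ball x (?\<rho> x / 4) \<inter> ball y (?\<rho> y / 4) = {}" by auto
    have \<rho>1: "\<alpha> * ?\<rho> y \<ge> 1" for y
    proof -
      have "\<alpha> * (1 / \<alpha>) \<le> \<alpha> * ?\<rho> y" using \<alpha> by (intro mult_left_mono) (auto simp: local_scale_def)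
      then show ?thesis using \<alpha> by simp
    qed
    obtain k where k: "\<And>y. 2 ^ k y \<le> \<alpha> * ?\<rho> y" "\<And>y. \<alpha> * ?\<rho> y < 2 * 2 ^ k y"
      using dyadic_exponent[OF \<rho>1] by metis
    define N where "N = nat \<lfloor>log 2 (\<alpha> * R)\<rfloor>"
    have \<alpha>R: "\<alpha> * R \<ge> 1" using \<alpha> R(1) mult_mono[of 1 \<alpha> 1 R] by simp
    have kN: "k y \<le> N" if y: "y \<in> S" for y
    proof -
      have "2 ^ k y \<le> \<alpha> * R"
      proof (rule order_trans[OF k(1)[of y]])
        have "y \<in> \<Lambda>" using S(2) y by (rule subsetD)
        then show "\<alpha> * ?\<rho> y \<le> \<alpha> * R" using R(2)[OF \<alpha>] \<alpha> by (intro mult_left_mono) auto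
      qed
      then have "2 powr real (k y) \<le> \<alpha> * R" by (simp add: powr_realpow)
      then have "real (k y) \<le> log 2 (\<alpha> * R)" using \<alpha>R by (simp add: le_log_iff)
      then show ?thesis by (simp add: N_def le_nat_iff le_floor_iff)
    qed
    have level: "(\<Sum>y\<in>{y \<in> S. k y = j}. ?\<rho> y ^ (?D - 1)) \<le> Q" for j
    proof (cases "{y \<in> S. k y = j} = {}")
      case True
      then show ?thesis using Q by (simp only: sum.empty)
    next
      case False
      let ?S = "{y \<in> S. k y = j}"
      define h where "h = 2 ^ j / \<alpha>"
      have h: "h > 0" using \<alpha> by (simp add: h_def)
      have h\<rho>: "h \<le> ?\<rho> y" "?\<rho> y < 2 * h" if "y \<in> ?S" for y
        using k[of y] that \<alpha> by (auto simp: h_def field_simps)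
      have hR: "h \<le> R" 
      proof -
        obtain y where y: "y \<in> ?S" using False by auto
        then have "y \<in> \<Lambda>" using S(2) by auto
        then show ?thesis using h\<rho>(1)[OF y] R(2)[OF \<alpha>] order_trans by blast
      qed
      have "real (card ?S) * (?V * (h / 4) ^ ?D) \<le> C * (c * h + (c * h) ^ ?D)"
      proof (rule disjoint_balls_card[where s = "\<lambda>y. ?\<rho> y / 4" and A = "tube (frontier \<Lambda>) (c * h)"])
        show "ball y (?\<rho> y / 4) \<subseteq> tube (frontier \<Lambda>) (c * h)" if y: "y \<in> ?S" for y
        proof
          fix p assume p: "p \<in> ball y (?\<rho> y / 4)"
          have "infdist y (frontier \<Lambda>) / (4 * ?D) \<le> ?\<rho> y" by (simp add: local_scale_def)
          then have "infdist y (frontier \<Lambda>) \<le> 4 * ?D * ?\<rho> y" by (simp add: divide_le_eq mult_ac)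
          then have "infdist p (frontier \<Lambda>) < ?\<rho> y / 4 + 4 * ?D * ?\<rho> y"
            using infdist_triangle[of p "frontier \<Lambda>" y] p by (simp add: dist_commute)
          also have "\<dots> \<le> (4 * real ?D + 1) * ?\<rho> y" using h\<rho>[OF y] h by (simp add: algebra_simps)
          also have "\<dots> \<le> (4 * real ?D + 1) * (2 * h)" using h\<rho>[OF y] by (intro mult_left_mono) auto
          also have "\<dots> = c * h" by (simp add: c_def)
          finally show "p \<in> tube (frontier \<Lambda>) (c * h)" by (rule infdist_less_imp_in_tube[OF fne])
        qed
        show "emeasure lborel (tube (frontier \<Lambda>) (c * h)) \<le> ennreal (C * (c * h + (c * h) ^ ?D))"
          using c h by (intro C(2)) simp
        show "C * (c * h + (c * h) ^ ?D) \<ge> 0" using C(1) c h by simp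
      qed (use S disj h h\<rho> in auto)
      also have "\<dots> \<le> C * (c * h * (1 + (c * R) ^ (?D - 1)))"
      proof -
        have "(c * h) ^ ?D \<le> (c * h) * (c * R) ^ (?D - 1)"
          unfolding D[of "c * h"] using c h hR by (intro mult_left_mono power_mono) auto
        then show ?thesis using C(1) by (intro mult_left_mono) (auto simp: algebra_simps)
      qed
      finally have "real (card ?S) * h ^ (?D - 1) * (?V / 4 ^ ?D) * h \<le> (C * c * (1 + (c * R) ^ (?D - 1))) * h"
        unfolding power_divide D[of h] by (simp add: mult_ac)
      then have "real (card ?S) * h ^ (?D - 1) * (?V / 4 ^ ?D) \<le> C * c * (1 + (c * R) ^ (?D - 1))"
        using h by (rule mult_right_le_imp_le)
      then have card: "real (card ?S) * h ^ (?D - 1) \<le> M"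
        by (simp add: M_def pos_le_divide_eq divide_le_eq mult_ac)
      have "(\<Sum>y\<in>?S. ?\<rho> y ^ (?D - 1)) \<le> (\<Sum>y\<in>?S. (2 * h) ^ (?D - 1))"
        using h\<rho> h by (intro sum_mono power_mono) (auto intro: less_imp_le order_trans[of 0 h])
      also have "\<dots> = 2 ^ (?D - 1) * (real (card ?S) * h ^ (?D - 1))" by (simp add: power_mult_distrib)
      also have "\<dots> \<le> Q" unfolding Q_def by (intro mult_left_mono card) simp
      finally show ?thesis .
    qed
    have "(\<Sum>y\<in>S. ?\<rho> y ^ (?D - 1)) = (\<Sum>j\<in>{..N}. \<Sum>y\<in>{y \<in> S. k y = j}. ?\<rho> y ^ (?D - 1))"
      by (rule sum.group[symmetric]) (use S kN in auto)
    also have "\<dots> \<le> (\<Sum>j\<in>{..N}. Q)" by (intro sum_mono level)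
    also have "\<dots> = (real N + 1) * Q" by simp
    also have "\<dots> \<le> (L * ln \<alpha>) * Q"
    proof (rule mult_right_mono[OF _ Q])
      have l2: "ln 2 > (0::real)" by simp
      have la: "ln \<alpha> \<ge> ln 2" using \<alpha> by simp
      have "0 \<le> log 2 (\<alpha> * R)" using \<alpha>R by simp
      then have "real N \<le> log 2 (\<alpha> * R)" by (simp add: N_def)
      also have "\<dots> = ln \<alpha> / ln 2 + ln R / ln 2"
        using \<alpha> R(1) by (simp add: log_def ln_mult add_divide_distrib)
      finally have 1: "real N \<le> ln \<alpha> / ln 2 + ln R / ln 2" .
      have 2: "1 \<le> ln \<alpha> / ln 2" using la l2 by (simp add: pos_le_divide_eq)
      have 3: "ln R / ln 2 * 1 \<le> ln R / ln 2 * (ln \<alpha> / ln 2)" using R(1) l2 2 by (intro mult_left_mono) auto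
      have "L * ln \<alpha> = ln \<alpha> / ln 2 + ln R / ln 2 * (ln \<alpha> / ln 2) + ln \<alpha> / ln 2"
        by (simp add: L_def algebra_simps power2_eq_square)
      then show "real N + 1 \<le> L * ln \<alpha>" using 1 2 3 by linarith
    qed
    finally show "(\<Sum>y\<in>S. ?\<rho> y ^ (?D - 1)) \<le> L * Q * ln \<alpha>" by (simp add: mult_ac)
  qed
qed

section \<open>Multiplication operators and localised wave packets\<close>

definition mult_op :: "('a::euclidean_space \<Rightarrow> real) \<Rightarrow> 'a L2 \<Rightarrow> 'a L2" where
  "mult_op f u = abs_L2 (\<lambda>x. complex_of_real (f x) * rep_L2 u x)"

context
  fixes f :: "'a::euclidean_space \<Rightarrow> real" and C :: real
  assumes f_borel [measurable]: "f \<in> borel_measurable borel" and f_bound: "\<And>x. \<bar>f x\<bar> \<le> C"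
begin

lemma square_integrable_mult_op:
  assumes "square_integrable g"
  shows "square_integrable (\<lambda>x. complex_of_real (f x) * g x)"
  by (rule square_integrable_mult_bounded[OF assms, where C = C]) (use f_bound in auto)

lemma mult_op_abs:
  assumes g: "square_integrable g"
  shows "mult_op f (abs_L2 g) = abs_L2 (\<lambda>x. complex_of_real (f x) * g x)"
  unfolding mult_op_def
proof (rule abs_L2_eqI)
  show "AE x in lborel. complex_of_real (f x) * rep_L2 (abs_L2 g) x = complex_of_real (f x) * g x"
    using rep_abs_L2[OF g] by eventually_elim simp
qed (intro square_integrable_mult_op square_integrable_rep g)+

lemma norm_mult_op:
  assumes g: "square_integrable g"
  shows "ennreal ((norm (mult_op f (abs_L2 g)))\<^sup>2) = (\<integral>\<^sup>+x. ennreal ((f x)\<^sup>2 * (cmod (g x))\<^sup>2) \<partial>lborel)"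
  unfolding mult_op_abs[OF g] ennreal_norm_abs_L2[OF square_integrable_mult_op[OF g]]
  by (simp add: norm_mult power_mult_distrib)

lemma bounded_clinear_mult_op: "bounded_clinear (mult_op f)"
proof (rule bounded_clinearI[where K = C])
  fix u v :: "'a L2" and c :: complex
  obtain g where g: "square_integrable g" "u = abs_L2 g" by (rule L2_cases)
  obtain h where h: "square_integrable h" "v = abs_L2 h" by (rule L2_cases)
  show "mult_op f (u + v) = mult_op f u + mult_op f v"
    by (simp add: g h abs_L2_add mult_op_abs square_integrable_add square_integrable_mult_op distrib_left)
  show "mult_op f (scaleC c u) = scaleC c (mult_op f u)"
    by (simp add: g abs_L2_scaleC mult_op_abs square_integrable_scale square_integrable_mult_op mult.left_commute)
  have C0: "C \<ge> 0" using f_bound[of 0] abs_ge_zero order_trans by blast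
  have "(norm (mult_op f u))\<^sup>2 \<le> (C * norm u)\<^sup>2"
    unfolding g(2) mult_op_abs[OF g(1)] power_mult_distrib norm_abs_L2[OF square_integrable_mult_op[OF g(1)]]
      norm_abs_L2[OF g(1)] integral_mult_right_zero[symmetric]
  proof (rule integral_mono)
    show "integrable lborel (\<lambda>x. (cmod (complex_of_real (f x) * g x))\<^sup>2)"
      by (rule integrable_square_integrable[OF square_integrable_mult_op[OF g(1)]])
    show "integrable lborel (\<lambda>x. C\<^sup>2 * (cmod (g x))\<^sup>2)"
      using integrable_square_integrable[OF g(1)] by simp
    fix x
    have "(f x)\<^sup>2 \<le> C\<^sup>2" using f_bound[of x] C0 by (simp add: abs_le_square_iff[symmetric])
    then show "(cmod (complex_of_real (f x) * g x))\<^sup>2 \<le> C\<^sup>2 * (cmod (g x))\<^sup>2"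
      by (simp add: norm_mult power_mult_distrib mult_right_mono)
  qed
  then show "norm (mult_op f u) \<le> C * norm u" by (rule power2_le_imp_le) (use C0 in simp)
qed

lemma mult_op_self_adjoint: "adjoint_pair (mult_op f) (mult_op f)"
  unfolding adjoint_pair_def
proof (intro allI)
  fix u v :: "'a L2"
  obtain g where g: "square_integrable g" "u = abs_L2 g" by (rule L2_cases)
  obtain h where h: "square_integrable h" "v = abs_L2 h" by (rule L2_cases)
  show "cinner (mult_op f u) v = cinner u (mult_op f v)"
    unfolding g(2) h(2) mult_op_abs[OF g(1)] mult_op_abs[OF h(1)]
      cinner_abs_L2[OF square_integrable_mult_op[OF g(1)] h(1)]
      cinner_abs_L2[OF g(1) square_integrable_mult_op[OF h(1)]]
    by (simp add: mult_ac)
qed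

end

lemma chi_op_eq_mult_op: "chi_op \<Lambda> = mult_op (indicator \<Lambda>)"
proof -
  have "complex_of_real (indicator \<Lambda> x) = indicator \<Lambda> x" for x :: 'a by (simp add: indicator_def)
  then show ?thesis by (simp add: chi_op_def mult_op_def fun_eq_iff)
qed

lemma indicator_abs_le: "\<bar>indicator A x :: real\<bar> \<le> 1" by (simp add: indicator_def)

lemma chi_op_complement:
  fixes \<Lambda> :: "'a::euclidean_space set"
  assumes [measurable]: "\<Lambda> \<in> sets borel"
  shows "u - chi_op \<Lambda> u = mult_op (indicator (- \<Lambda>)) u"
proof -
  obtain g where g: "square_integrable g" "u = abs_L2 g" by (rule L2_cases)
  have 1: "square_integrable (\<lambda>x. complex_of_real (indicator \<Lambda> x) * g x)"
    by (rule square_integrable_mult_op[OF _ indicator_abs_le g(1)]) simp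
  have "(\<lambda>x. g x - complex_of_real (indicator \<Lambda> x) * g x) = (\<lambda>x. complex_of_real (indicator (- \<Lambda>) x) * g x)"
    by (auto simp: indicator_def)
  then show ?thesis
    unfolding chi_op_eq_mult_op g(2)
    by (subst (1 2) mult_op_abs[OF _ indicator_abs_le g(1)]) (auto simp: abs_L2_diff[OF g(1) 1])
qed

lemma ball_infdist_frontier:
  fixes \<Omega> :: "'a::euclidean_space set"
  assumes ne: "frontier \<Omega> \<noteq> {}" and z: "dist \<xi> \<zeta> < infdist \<xi> (frontier \<Omega>)"
  shows "\<zeta> \<in> \<Omega> \<longleftrightarrow> \<xi> \<in> \<Omega>"
proof (rule ccontr)
  let ?B = "ball \<xi> (infdist \<xi> (frontier \<Omega>))"
  assume neq: "\<not> ?thesis"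
  have \<xi>: "\<xi> \<in> ?B" "\<zeta> \<in> ?B" using z by (auto intro: le_less_trans[OF zero_le_dist])
  have "?B \<inter> frontier \<Omega> \<noteq> {}"
    by (rule connected_Int_frontier[OF connected_ball]) (use neq \<xi> in blast)+
  then obtain p where p: "p \<in> frontier \<Omega>" "dist \<xi> p < infdist \<xi> (frontier \<Omega>)" by auto
  with infdist_le[OF p(1), of \<xi>] show False by simp
qed

text \<open>A packet with frequency far inside the frequency domain is almost reproduced by the projection,
  one with frequency far outside is almost annihilated. If its window lies in \<open>\<Lambda>\<close>, restriction to the
  complement of \<open>\<Lambda>\<close> turns both into smallness, as it kills the packet itself. The other packets have
  the scale \<open>1 / \<alpha>\<close>, for which no frequency in the domain is far inside.\<close>

lemma packet_bound:
  fixes \<Lambda> \<Omega> :: "'a::euclidean_space set"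
  assumes \<Lambda>: "open \<Lambda>" "bounded \<Lambda>" "\<Lambda> \<noteq> {}" and \<Omega>: "open \<Omega>" "bounded \<Omega>" "\<Omega> \<noteq> {}"
  shows "\<exists>C\<ge>0. \<forall>\<alpha>\<ge>2. \<forall>y\<in>\<Lambda>. \<forall>\<eta>.
    (norm (mult_op (indicator (- \<Lambda>)) (freq_proj ((*\<^sub>R) \<alpha> ` \<Omega>) (abs_L2 (packet (Suc m) y (local_scale \<Lambda> \<alpha> y) \<eta>)))))\<^sup>2
      \<le> C * local_scale \<Lambda> \<alpha> y ^ DIM('a) *
        (1 / (1 + (local_scale \<Lambda> \<alpha> y * (\<alpha> * infdist ((1 / \<alpha>) *\<^sub>R \<eta>) (frontier \<Omega>)))\<^sup>2)) ^ m"
proof -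
  let ?D = "DIM('a)"
  obtain C where C: "C \<ge> 0" "\<And>y r \<eta> d. r > 0 \<Longrightarrow> d \<ge> 0 \<Longrightarrow>
    (\<integral>\<^sup>+\<xi>. indicator {\<xi>. dist \<xi> \<eta> \<ge> d} \<xi> * ennreal ((cmod (fourier (packet (Suc m) y r \<eta>) (\<xi>::'a)))\<^sup>2) \<partial>lborel)
    \<le> ennreal (C * r ^ ?D * (1 / (1 + (r * d)\<^sup>2)) ^ m)"
    using packet_fourier_tail[where 'a = 'a and m = m] by blast
  note fne = frontier_nonempty[OF \<Omega>(2,3)]
  obtain z where z: "z \<in> frontier \<Omega>" using fne by blast
  obtain W where W: "\<And>\<xi>. \<xi> \<in> \<Omega> \<Longrightarrow> dist z \<xi> \<le> W" using \<Omega>(2) by (meson bounded_any_center)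
  define K where "K = 1 / (2 * pi) ^ ?D * C"
  have K: "K \<ge> 0" using C(1) by (simp add: K_def)
  have W1: "(1 + W\<^sup>2) ^ m \<ge> 1" by (intro one_le_power) simp
  show ?thesis
  proof (intro exI[of _ "K * (1 + W\<^sup>2) ^ m"] conjI allI impI ballI)
    show "K * (1 + W\<^sup>2) ^ m \<ge> 0" using K W1 by simp
    fix \<alpha> :: real and y \<eta> :: 'a assume \<alpha>: "\<alpha> \<ge> 2" and y: "y \<in> \<Lambda>"
    define E where "E = (*\<^sub>R) \<alpha> ` \<Omega>"
    have E_iff: "\<xi> \<in> E \<longleftrightarrow> (1 / \<alpha>) *\<^sub>R \<xi> \<in> \<Omega>" for \<xi>
    proof
      assume "(1 / \<alpha>) *\<^sub>R \<xi> \<in> \<Omega>"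
      then have "\<alpha> *\<^sub>R ((1 / \<alpha>) *\<^sub>R \<xi>) \<in> E" unfolding E_def by (rule imageI)
      then show "\<xi> \<in> E" using \<alpha> by simp
    qed (use \<alpha> in \<open>auto simp: E_def\<close>)
    have E: "E \<in> sets borel" "bounded E"
      using \<alpha> \<Omega> by (auto simp: E_def intro!: borel_open open_scaling bounded_scaling)
    define r where "r = local_scale \<Lambda> \<alpha> y"
    define \<xi> where "\<xi> = (1 / \<alpha>) *\<^sub>R \<eta>"
    define d where "d = \<alpha> * infdist \<xi> (frontier \<Omega>)"
    define f where "f = packet (Suc m) y r \<eta>"
    define P where "P = freq_proj E (abs_L2 f)"
    let ?X = "mult_op (indicator (- \<Lambda>)) :: 'a L2 \<Rightarrow> 'a L2"
    have r: "r > 0" using \<alpha> by (auto simp: r_def local_scale_def less_max_iff_disj)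
    have d: "d \<ge> 0" using \<alpha> by (simp add: d_def infdist_nonneg)
    have f: "square_integrable f" "bounded_support f" unfolding f_def by (rule packet_square_integrable[OF r])+
    have bX: "-\<Lambda> \<in> sets borel" using \<Lambda>(1) by simp
    have Xm: "(indicator (- \<Lambda>) :: 'a \<Rightarrow> real) \<in> borel_measurable borel" using bX by simp
    have X_le: "norm (?X u) \<le> norm u" for u
    proof -
      obtain g where g: "square_integrable g" "u = abs_L2 g" by (rule L2_cases)
      have "ennreal ((norm (?X u))\<^sup>2) \<le> ennreal ((norm u)\<^sup>2)"
        unfolding g(2) norm_mult_op[OF Xm indicator_abs_le g(1)] ennreal_norm_abs_L2[OF g(1)]
        by (intro nn_integral_mono ennreal_leI) (auto simp: indicator_def)
      then have "(norm (?X u))\<^sup>2 \<le> (norm u)\<^sup>2" by (subst (asm) ennreal_le_iff) auto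
      then show ?thesis by (rule power2_le_imp_le) simp
    qed
    have far: "\<zeta> \<in> E \<longleftrightarrow> \<eta> \<in> E" if "dist \<zeta> \<eta> < d" for \<zeta>
    proof -
      have "dist \<xi> ((1 / \<alpha>) *\<^sub>R \<zeta>) = dist \<zeta> \<eta> / \<alpha>"
        using \<alpha> by (simp add: \<xi>_def dist_norm norm_minus_commute flip: scaleR_diff_right)
      also have "\<dots> < infdist \<xi> (frontier \<Omega>)" using that \<alpha> by (simp add: d_def divide_less_eq mult.commute)
      finally show ?thesis using ball_infdist_frontier[OF fne] by (simp add: E_iff \<xi>_def)
    qed
    let ?T = "\<lambda>\<rho>. K * r ^ ?D * (1 / (1 + (r * \<rho>)\<^sup>2)) ^ m"
    have tail: "ennreal (1 / (2 * pi) ^ ?D) * (\<integral>\<^sup>+\<xi>. indicator A \<xi> * ennreal ((cmod (fourier f \<xi>))\<^sup>2) \<partial>lborel) \<le> ennreal (?T \<rho>)"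
      if A: "\<And>\<xi>. \<xi> \<in> A \<Longrightarrow> dist \<xi> \<eta> \<ge> \<rho>" and \<rho>: "\<rho> \<ge> 0" for A \<rho>
    proof -
      have "(\<integral>\<^sup>+\<xi>. indicator A \<xi> * ennreal ((cmod (fourier f \<xi>))\<^sup>2) \<partial>lborel) \<le>
          (\<integral>\<^sup>+\<xi>. indicator {\<xi>. dist \<xi> \<eta> \<ge> \<rho>} \<xi> * ennreal ((cmod (fourier f \<xi>))\<^sup>2) \<partial>lborel)"
        using A by (intro nn_integral_mono mult_right_mono) (auto simp: indicator_def)
      also have "\<dots> \<le> ennreal (C * r ^ ?D * (1 / (1 + (r * \<rho>)\<^sup>2)) ^ m)" unfolding f_def by (rule C(2)[OF r \<rho>])
      finally have "ennreal (1 / (2 * pi) ^ ?D) * (\<integral>\<^sup>+\<xi>. indicator A \<xi> * ennreal ((cmod (fourier f \<xi>))\<^sup>2) \<partial>lborel) \<le>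
          ennreal (1 / (2 * pi) ^ ?D) * ennreal (C * r ^ ?D * (1 / (1 + (r * \<rho>)\<^sup>2)) ^ m)"
        by (rule mult_left_mono) simp
      also have "\<dots> = ennreal (?T \<rho>)"
        using C(1) r by (subst ennreal_mult[symmetric]) (auto simp: K_def mult_ac)
      finally show ?thesis .
    qed
    have T0: "?T \<rho> \<ge> 0" for \<rho> using K r by simp
    have bound_P: "(norm (?X P))\<^sup>2 \<le> ?T \<rho>" if "\<And>\<xi>. \<xi> \<in> E \<Longrightarrow> dist \<xi> \<eta> \<ge> \<rho>" "\<rho> \<ge> 0" for \<rho>
    proof -
      have "ennreal ((norm P)\<^sup>2) \<le> ennreal (?T \<rho>)"
        unfolding P_def norm_freq_proj[OF E f] by (rule tail[OF that])
      then have "(norm P)\<^sup>2 \<le> ?T \<rho>" using T0[of \<rho>] by (subst (asm) ennreal_le_iff) auto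
      moreover have "(norm (?X P))\<^sup>2 \<le> (norm P)\<^sup>2" by (intro power_mono X_le) simp
      ultimately show ?thesis by linarith
    qed
    have "(norm (?X P))\<^sup>2 \<le> (1 + W\<^sup>2) ^ m * ?T d"
    proof (cases "\<eta> \<in> E")
      case False
      have "(norm (?X P))\<^sup>2 \<le> ?T d" by (rule bound_P[OF _ d]) (use far False in \<open>force simp: not_less\<close>)
      also have "\<dots> \<le> (1 + W\<^sup>2) ^ m * ?T d" using mult_right_mono[OF W1 T0[of d]] by simp
      finally show ?thesis .
    next
      case True
      show ?thesis
      proof (cases "infdist y (frontier \<Lambda>) / (4 * ?D) \<le> 1 / \<alpha>")
        case near: True
        then have r\<alpha>: "r = 1 / \<alpha>" by (simp add: r_def local_scale_def max_def)
        have "\<xi> \<in> \<Omega>" using True by (simp add: E_iff \<xi>_def)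
        then have "infdist \<xi> (frontier \<Omega>) \<le> W" using infdist_le[OF z, of \<xi>] W[of \<xi>] by (simp add: dist_commute)
        then have "r * d \<le> W" using \<alpha> by (simp add: r\<alpha> d_def)
        then have "(r * d)\<^sup>2 \<le> W\<^sup>2" using r d by (intro power_mono) auto
        then have "1 \<le> ((1 + W\<^sup>2) * (1 / (1 + (r * d)\<^sup>2))) ^ m"
          by (intro one_le_power) (simp add: pos_le_divide_eq add_pos_nonneg)
        then have "K * r ^ ?D * 1 \<le> K * r ^ ?D * ((1 + W\<^sup>2) * (1 / (1 + (r * d)\<^sup>2))) ^ m"
          using K r by (intro mult_left_mono) auto
        moreover have "(norm (?X P))\<^sup>2 \<le> ?T 0" by (rule bound_P) auto
        moreover have "?T 0 = K * r ^ ?D * 1" by simp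
        ultimately have "(norm (?X P))\<^sup>2 \<le> K * r ^ ?D * ((1 + W\<^sup>2) * (1 / (1 + (r * d)\<^sup>2))) ^ m" by linarith
        then show ?thesis unfolding power_mult_distrib by (simp only: mult_ac)
      next
        case far': False
        have rd: "r = infdist y (frontier \<Lambda>) / (4 * ?D)" using far' by (simp add: r_def local_scale_def max_def)
        have supp: "f x = 0" if x: "x \<in> - \<Lambda>" for x
        proof (rule ccontr)
          assume "f x \<noteq> 0"
          then have "local_window (Suc m) y r x \<noteq> 0" by (auto simp: f_def packet_def)
          then have "dist x y \<le> 2 * real ?D * r" using local_window_support[OF r, of "Suc m" y x] by (simp add: mult_ac)
          also have "\<dots> < 4 * real ?D * r" using r by simp
          also have "\<dots> = infdist y (frontier \<Lambda>)" by (simp add: rd)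
          finally have "x \<in> \<Lambda> \<longleftrightarrow> y \<in> \<Lambda>"
            using ball_infdist_frontier[OF frontier_nonempty[OF \<Lambda>(2,3)]] by (simp add: dist_commute)
          then show False using x y by simp
        qed
        have "?X (abs_L2 f) = 0"
          unfolding mult_op_abs[OF Xm indicator_abs_le f(1)]
        proof -
          have "(\<lambda>x. complex_of_real (indicator (- \<Lambda>) x) * f x) = (\<lambda>_. 0)" 
          proof
            fix x show "complex_of_real (indicator (- \<Lambda>) x) * f x = 0" using supp[of x] by (cases "x \<in> \<Lambda>") auto
          qed
          then show "abs_L2 (\<lambda>x. complex_of_real (indicator (- \<Lambda>) x) * f x) = 0" by (simp only: abs_L2_zero)
        qed
        then have "?X (abs_L2 f - P) = - ?X P"
          using bounded_clinearD(4)[OF bounded_clinear_mult_op[OF Xm indicator_abs_le], of "abs_L2 f" P] by simp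
        then have "norm (?X P) \<le> norm (abs_L2 f - P)" using X_le[of "abs_L2 f - P"] by simp
        then have "(norm (?X P))\<^sup>2 \<le> (norm (abs_L2 f - P))\<^sup>2" by (intro power_mono) auto
        also have "\<dots> \<le> ?T d"
        proof -
          have "ennreal ((norm (abs_L2 f - P))\<^sup>2) \<le> ennreal (?T d)"
            unfolding P_def norm_complement_freq_proj[OF E f]
            by (rule tail[OF _ d]) (use far True in \<open>force simp: not_less\<close>)
          then show ?thesis using T0[of d] by (subst (asm) ennreal_le_iff) auto
        qed
        also have "\<dots> \<le> (1 + W\<^sup>2) ^ m * ?T d" using mult_right_mono[OF W1 T0[of d]] by simp
        finally show ?thesis .
      qed
    qed
    then show "(norm (mult_op (indicator (- \<Lambda>)) (freq_proj ((*\<^sub>R) \<alpha> ` \<Omega>) (abs_L2 (packet (Suc m) y (local_scale \<Lambda> \<alpha> y) \<eta>)))))\<^sup>2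
      \<le> K * (1 + W\<^sup>2) ^ m * local_scale \<Lambda> \<alpha> y ^ ?D *
        (1 / (1 + (local_scale \<Lambda> \<alpha> y * (\<alpha> * infdist ((1 / \<alpha>) *\<^sub>R \<eta>) (frontier \<Omega>)))\<^sup>2)) ^ m"
      unfolding P_def E_def f_def r_def d_def \<xi>_def by (simp only: mult_ac)
  qed
qed

section \<open>The covering frame\<close>

lemma norm_mult_op_le:
  fixes f g :: "'a::euclidean_space \<Rightarrow> real"
  assumes [measurable]: "f \<in> borel_measurable borel" "g \<in> borel_measurable borel"
    and b: "\<And>x. \<bar>f x\<bar> \<le> C" "\<And>x. \<bar>g x\<bar> \<le> C'" and K: "K \<ge> 0" and le: "\<And>x. \<bar>f x\<bar> \<le> K * \<bar>g x\<bar>"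
  shows "norm (mult_op f u) \<le> K * norm (mult_op g u)"
proof -
  obtain h where h: "square_integrable h" "u = abs_L2 h" by (rule L2_cases)
  note [measurable] = borel_square_integrable[OF h(1)]
  have "ennreal ((norm (mult_op f u))\<^sup>2) \<le> (\<integral>\<^sup>+x. ennreal (K\<^sup>2) * ennreal ((g x)\<^sup>2 * (cmod (h x))\<^sup>2) \<partial>lborel)"
    unfolding h(2) norm_mult_op[OF assms(1) b(1) h(1)]
  proof (rule nn_integral_mono)
    fix x
    have "\<bar>f x\<bar>\<^sup>2 \<le> (K * \<bar>g x\<bar>)\<^sup>2" by (rule power_mono[OF le]) simp
    then have "(f x)\<^sup>2 * (cmod (h x))\<^sup>2 \<le> K\<^sup>2 * (g x)\<^sup>2 * (cmod (h x))\<^sup>2"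
      by (intro mult_right_mono) (auto simp: power_mult_distrib)
    then show "ennreal ((f x)\<^sup>2 * (cmod (h x))\<^sup>2) \<le> ennreal (K\<^sup>2) * ennreal ((g x)\<^sup>2 * (cmod (h x))\<^sup>2)"
      by (subst ennreal_mult[symmetric]) (auto intro!: ennreal_leI simp: mult_ac)
  qed
  also have "\<dots> = ennreal (K\<^sup>2) * (\<integral>\<^sup>+x. ennreal ((g x)\<^sup>2 * (cmod (h x))\<^sup>2) \<partial>lborel)"
    by (rule nn_integral_cmult) measurable
  also have "\<dots> = ennreal (K\<^sup>2) * ennreal ((norm (mult_op g u))\<^sup>2)"
    unfolding h(2) norm_mult_op[OF assms(2) b(2) h(1)] ..
  also have "\<dots> = ennreal ((K * norm (mult_op g u))\<^sup>2)"
    by (subst ennreal_mult[symmetric]) (auto simp: power_mult_distrib)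
  finally have "(norm (mult_op f u))\<^sup>2 \<le> (K * norm (mult_op g u))\<^sup>2" by (subst (asm) ennreal_le_iff) auto
  then show ?thesis by (rule power2_le_imp_le) (use K in simp)
qed

lemma local_window_abs_le: "\<bar>local_window m y r x\<bar> \<le> 1"
  using local_window_bounds[of m y r x] by simp

lemma cinner_packet:
  fixes f :: "'a::euclidean_space \<Rightarrow> complex"
  assumes f: "square_integrable f" and r: "r > 0"
  shows "cinner (abs_L2 f) (abs_L2 (packet m y r \<eta>)) = fourier (\<lambda>x. complex_of_real (local_window m y r x) * f x) \<eta>"
  unfolding cinner_abs_L2[OF f packet_square_integrable(1)[OF r]] fourier_def packet_def
  by (intro Bochner_Integration.integral_cong refl) (simp add: cis_cnj mult_ac)

lemma packet_Plancherel:
  fixes u :: "'a::euclidean_space L2"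
  assumes r: "r > 0"
  shows "(\<integral>\<^sup>+\<eta>. ennreal ((cmod (cinner u (abs_L2 (packet m y r \<eta>))))\<^sup>2) \<partial>lborel) =
    ennreal ((2 * pi) ^ DIM('a) * (norm (mult_op (local_window m y r) u))\<^sup>2)"
    and "(\<lambda>\<eta>. cinner u (abs_L2 (packet m y r \<eta>))) \<in> borel_measurable borel"
proof -
  obtain f where f: "square_integrable f" "u = abs_L2 f" by (rule L2_cases)
  note [measurable] = borel_square_integrable[OF f(1)]
  let ?f = "\<lambda>x. complex_of_real (local_window m y r x) * f x"
  have sq: "square_integrable ?f" by (rule square_integrable_mult_op[OF local_window_borel local_window_abs_le f(1)])
  have bs: "bounded_support ?f" by (rule bounded_support_local_window[OF r])
  show "(\<integral>\<^sup>+\<eta>. ennreal ((cmod (cinner u (abs_L2 (packet m y r \<eta>))))\<^sup>2) \<partial>lborel) =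
    ennreal ((2 * pi) ^ DIM('a) * (norm (mult_op (local_window m y r) u))\<^sup>2)"
    unfolding f(2) cinner_packet[OF f(1) r] mult_op_abs[OF local_window_borel local_window_abs_le f(1)]
    unfolding ennreal_norm_abs_L2[OF Plancherel(1)[OF sq bs], symmetric] Plancherel(2)[OF sq bs] ..
  show "(\<lambda>\<eta>. cinner u (abs_L2 (packet m y r \<eta>))) \<in> borel_measurable borel"
    unfolding f(2) cinner_packet[OF f(1) r] by measurable
qed

lemma cinner_packet_le:
  fixes u :: "'a::euclidean_space L2" and r :: real
  assumes r: "r > 0"
  shows "cmod (cinner u (abs_L2 (packet m y r \<eta>))) \<le>
    sqrt (unit_ball_vol (real DIM('a)) * (2 * DIM('a) * r) ^ DIM('a)) * norm (mult_op (local_window m y r) u)"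
proof -
  obtain f where f: "square_integrable f" "u = abs_L2 f" by (rule L2_cases)
  let ?f = "\<lambda>x. complex_of_real (local_window m y r x) * f x" and ?B = "cball y (2 * DIM('a) * r)"
  define e where "e x = cis (x \<bullet> \<eta>) * (indicator ?B x :: complex)" for x
  have sq: "square_integrable ?f" by (rule square_integrable_mult_op[OF local_window_borel local_window_abs_le f(1)])
  have e: "square_integrable e" unfolding e_def
    by (rule square_integrable_mult_bounded[OF square_integrable_indicator, where C = 1])
      (use emeasure_bounded_finite[OF bounded_cball, of y "2 * DIM('a) * r"] in auto)
  have "cinner (abs_L2 f) (abs_L2 (packet m y r \<eta>)) = cinner (abs_L2 ?f) (abs_L2 e)"
    unfolding cinner_abs_L2[OF f(1) packet_square_integrable(1)[OF r]] cinner_abs_L2[OF sq e]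
  proof (intro Bochner_Integration.integral_cong refl)
    fix x
    show "f x * cnj (packet m y r \<eta> x) = ?f x * cnj (e x)"
    proof (cases "x \<in> ?B")
      case False
      then have "local_window m y r x = 0" using local_window_support[OF r, of m y x] by (auto simp: dist_commute)
      then show ?thesis by (simp add: packet_def)
    qed (simp add: packet_def e_def mult_ac)
  qed
  then have "cmod (cinner u (abs_L2 (packet m y r \<eta>))) \<le> norm (abs_L2 ?f) * norm (abs_L2 e)"
    unfolding f(2) using cinner_Cauchy_Schwarz[of "abs_L2 ?f" "abs_L2 e"] by simp
  also have "norm (abs_L2 e) = sqrt (unit_ball_vol (real DIM('a)) * (2 * DIM('a) * r) ^ DIM('a))"
  proof -
    have "(norm (abs_L2 e))\<^sup>2 = (LINT x|lborel. indicator ?B x)"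
      unfolding norm_abs_L2[OF e] by (intro Bochner_Integration.integral_cong refl) (simp add: e_def norm_mult indicator_def)
    also have "\<dots> = measure lborel ?B" by simp
    also have "\<dots> = unit_ball_vol (real DIM('a)) * (2 * DIM('a) * r) ^ DIM('a)"
      using r by (simp add: content_cball)
    finally show ?thesis by (metis norm_ge_zero real_sqrt_unique)
  qed
  finally show ?thesis
    unfolding f(2) mult_op_abs[OF local_window_borel local_window_abs_le f(1)] by (simp add: mult.commute)
qed

text \<open>By Plancherel's theorem the squared packet coefficients of \<open>u\<close> at all centres and frequencies integrate
  to \<open>\<parallel>W u\<parallel>\<^sup>2\<close>, where \<open>W\<^sup>2\<close> is the sum of the squared windows. As the balls around the centres cover
  \<open>\<Lambda>\<close>, multiplication by \<open>W\<close> dominates the restriction to \<open>\<Lambda>\<close>, and the frame criterion applies with \<open>W\<close>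
  in place of the indicator. A single coefficient only sees \<open>u\<close> near its centre, hence the volume of
  the window in the bound.\<close>

lemma covering_schatten_bound:
  fixes \<Lambda> E :: "'a::euclidean_space set" and \<rho> :: "'a \<Rightarrow> real"
  assumes \<Lambda>: "\<Lambda> \<in> sets borel" and E: "E \<in> sets borel" "bounded E"
    and S: "finite S" and \<rho>: "\<And>y. y \<in> S \<Longrightarrow> \<rho> y > 0"
    and cover: "\<And>x. x \<in> \<Lambda> \<Longrightarrow> \<exists>y\<in>S. dist x y \<le> \<rho> y" and q: "0 < q" "q < 2"
    and G: "\<And>y. y \<in> S \<Longrightarrow> G y \<in> borel_measurable lborel"
      "\<And>y \<eta>. y \<in> S \<Longrightarrow>
        ennreal (norm (mult_op (indicator (- \<Lambda>)) (freq_proj E (abs_L2 (packet m y (\<rho> y) \<eta>)))) powr q) \<le> G y \<eta>"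
    and total: "(\<Sum>y\<in>S. ennreal (sqrt (\<rho> y ^ DIM('a)) powr (2 - q)) * (\<integral>\<^sup>+\<eta>. G y \<eta> \<partial>lborel)) \<le> ennreal F"
    and F: "F \<ge> 0"
    and \<kappa>: "\<kappa> = sqrt (1 / (2 * pi) ^ DIM('a))"
    and \<beta>: "\<beta> = \<kappa> * sqrt (unit_ball_vol (real DIM('a)) * (2 * DIM('a)) ^ DIM('a))"
  defines "T \<equiv> mult_op (indicator \<Lambda>) \<circ> freq_proj E \<circ> mult_op (indicator (- \<Lambda>))"
  shows "T \<in> schatten_class q"
    and "schatten_norm q T \<le> ((4 ^ (m * DIM('a))) powr q * (\<beta> powr (2 - q) * \<kappa> powr q * F)) powr (1 / q)"
proof -
  let ?D = "DIM('a)" and ?X = "mult_op (indicator (- \<Lambda>)) :: 'a L2 \<Rightarrow> 'a L2" and ?P = "freq_proj E"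
  let ?w = "\<lambda>y. local_window m y (\<rho> y)"
  define W where "W x = sqrt (\<Sum>y\<in>S. (?w y x)\<^sup>2)" for x
  define T' where "T' = mult_op W \<circ> ?P \<circ> ?X"
  define p where "p y \<eta> = abs_L2 (packet m y (\<rho> y) \<eta>)" for y \<eta>
  define g where "g y \<eta> = scaleC (complex_of_real \<kappa>) (?X (?P (p y \<eta>)))" for y \<eta>
  have \<kappa>0: "\<kappa> \<ge> 0" by (simp add: \<kappa>)
  have \<kappa>2: "\<kappa>\<^sup>2 * (2 * pi) ^ ?D = 1" by (simp add: \<kappa>)
  have \<beta>0: "\<beta> \<ge> 0" using \<kappa>0 by (simp add: \<beta>)
  have ind: "(indicator \<Lambda> :: 'a \<Rightarrow> real) \<in> borel_measurable borel" "(indicator (- \<Lambda>) :: 'a \<Rightarrow> real) \<in> borel_measurable borel"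
    using \<Lambda> by auto
  have W[measurable]: "W \<in> borel_measurable borel" unfolding W_def[abs_def] by measurable
  have sum0: "(\<Sum>y\<in>S. (?w y x)\<^sup>2) \<ge> 0" for x by (simp add: sum_nonneg)
  have W2: "(W x)\<^sup>2 = (\<Sum>y\<in>S. (?w y x)\<^sup>2)" for x unfolding W_def by (rule real_sqrt_pow2[OF sum0])
  have W0: "W x \<ge> 0" for x by (simp add: W_def sum0)
  have wW: "\<bar>?w y x\<bar> \<le> 1 * \<bar>W x\<bar>" if y: "y \<in> S" for x y
  proof -
    have "(?w y x)\<^sup>2 \<le> (W x)\<^sup>2" unfolding W2 by (rule member_le_sum[OF y _ S]) simp
    then show ?thesis by (simp add: abs_le_square_iff)
  qed
  have W_bound: "\<bar>W x\<bar> \<le> sqrt (real (card S))" for x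
  proof -
    have "(\<Sum>y\<in>S. (?w y x)\<^sup>2) \<le> (\<Sum>y\<in>S. 1)"
      by (intro sum_mono) (simp add: abs_square_le_1 local_window_abs_le)
    then show ?thesis using W0[of x] by (simp add: W_def)
  qed
  note bc = bounded_clinear_freq_proj[OF E] and sa = freq_proj_self_adjoint[OF E]
  note X = bounded_clinear_mult_op[OF ind(2) indicator_abs_le] mult_op_self_adjoint[OF ind(2) indicator_abs_le]
  have c: "cinner u (?X (?P v)) = cinner (?P (?X u)) v" for u v
    by (simp add: adjoint_pairD[OF X(2)] adjoint_pairD[OF sa])
  have cg: "cinner u (g y \<eta>) = complex_of_real \<kappa> * cinner (?P (?X u)) (p y \<eta>)" for u y \<eta>
    by (simp add: g_def cinner_scaleC_right c)
  have T: "bounded_clinear T" unfolding T_def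
    by (intro bounded_clinear_comp bc X(1) bounded_clinear_mult_op[OF ind(1) indicator_abs_le])
  have Ta: "adjoint_pair T (?X \<circ> (?P \<circ> mult_op (indicator \<Lambda>)))" unfolding T_def
    by (intro adjoint_pair_comp sa X(2) mult_op_self_adjoint[OF ind(1) indicator_abs_le])
  have T': "bounded_clinear T'" unfolding T'_def
    by (intro bounded_clinear_comp bc X(1) bounded_clinear_mult_op[OF W W_bound])
  have Ta': "adjoint_pair T' (?X \<circ> (?P \<circ> mult_op W))" unfolding T'_def
    by (intro adjoint_pair_comp sa X(2) mult_op_self_adjoint[OF W W_bound])
  have dom: "norm (T u) \<le> 4 ^ (m * ?D) * norm (T' u)" for u
    unfolding T_def T'_def o_def
  proof (rule norm_mult_op_le[OF ind(1) W indicator_abs_le W_bound])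
    fix x
    show "\<bar>indicator \<Lambda> x :: real\<bar> \<le> 4 ^ (m * ?D) * \<bar>W x\<bar>"
    proof (cases "x \<in> \<Lambda>")
      case True
      then obtain y where y: "y \<in> S" "dist x y \<le> \<rho> y" using cover by blast
      have "(1 / 4) ^ (m * ?D) \<le> ?w y x" by (rule local_window_ge[OF \<rho>[OF y(1)] y(2)])
      also have "\<dots> \<le> \<bar>W x\<bar>" using wW[OF y(1), of x] by simp
      finally have "4 ^ (m * ?D) * (1 / 4) ^ (m * ?D) \<le> 4 ^ (m * ?D) * \<bar>W x\<bar>" by (rule mult_left_mono) simp
      moreover have "4 ^ (m * ?D) * (1 / 4) ^ (m * ?D) = (1::real)" by (simp flip: power_mult_distrib)
      ultimately show ?thesis using True by simp
    qed simp
  qed simp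
  have meas: "(\<lambda>\<eta>. cinner u (g y \<eta>)) \<in> borel_measurable lborel" if y: "y \<in> S" for u y
    unfolding cg p_def using packet_Plancherel(2)[OF \<rho>[OF y], of "?P (?X u)" m]
    by (auto intro: borel_measurable_times)
  have frame: "ennreal ((norm (T' u))\<^sup>2) \<le> (\<Sum>y\<in>S. \<integral>\<^sup>+\<eta>. ennreal ((cmod (cinner u (g y \<eta>)))\<^sup>2) \<partial>lborel)" for u
  proof -
    define h where "h = ?P (?X u)"
    obtain f where f: "square_integrable f" "h = abs_L2 f" by (rule L2_cases)
    note [measurable] = borel_square_integrable[OF f(1)]
    have "ennreal ((norm (T' u))\<^sup>2) = (\<integral>\<^sup>+x. ennreal ((W x)\<^sup>2 * (cmod (f x))\<^sup>2) \<partial>lborel)"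
      unfolding T'_def o_def h_def[symmetric] f(2) by (rule norm_mult_op[OF W W_bound f(1)])
    also have "\<dots> = (\<integral>\<^sup>+x. (\<Sum>y\<in>S. ennreal ((?w y x)\<^sup>2 * (cmod (f x))\<^sup>2)) \<partial>lborel)"
      unfolding W2 sum_distrib_right by (subst sum_ennreal) auto
    also have "\<dots> = (\<Sum>y\<in>S. \<integral>\<^sup>+x. ennreal ((?w y x)\<^sup>2 * (cmod (f x))\<^sup>2) \<partial>lborel)"
      by (rule nn_integral_sum) measurable
    also have "\<dots> = (\<Sum>y\<in>S. \<integral>\<^sup>+\<eta>. ennreal ((cmod (cinner u (g y \<eta>)))\<^sup>2) \<partial>lborel)"
    proof (rule sum.cong[OF refl])
      fix y assume y: "y \<in> S"
      have "(\<integral>\<^sup>+\<eta>. ennreal ((cmod (cinner u (g y \<eta>)))\<^sup>2) \<partial>lborel) =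
          (\<integral>\<^sup>+\<eta>. ennreal (\<kappa>\<^sup>2) * ennreal ((cmod (cinner h (p y \<eta>)))\<^sup>2) \<partial>lborel)"
        unfolding cg h_def[symmetric] by (intro nn_integral_cong, subst ennreal_mult[symmetric]) (auto simp: norm_mult power_mult_distrib)
      also have "\<dots> = ennreal (\<kappa>\<^sup>2) * (\<integral>\<^sup>+\<eta>. ennreal ((cmod (cinner h (p y \<eta>)))\<^sup>2) \<partial>lborel)"
        unfolding p_def using packet_Plancherel(2)[OF \<rho>[OF y], of h m] by (intro nn_integral_cmult) measurable
      also have "\<dots> = ennreal (\<kappa>\<^sup>2) * ennreal ((2 * pi) ^ ?D * (norm (mult_op (?w y) h))\<^sup>2)"
        unfolding p_def packet_Plancherel(1)[OF \<rho>[OF y]] ..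
      also have "\<dots> = ennreal ((\<kappa>\<^sup>2 * (2 * pi) ^ ?D) * (norm (mult_op (?w y) h))\<^sup>2)"
        by (subst ennreal_mult[symmetric]) (auto simp: mult_ac)
      also have "\<dots> = ennreal ((norm (mult_op (?w y) (abs_L2 f)))\<^sup>2)" unfolding \<kappa>2 f(2) by simp
      also have "\<dots> = (\<integral>\<^sup>+x. ennreal ((?w y x)\<^sup>2 * (cmod (f x))\<^sup>2) \<partial>lborel)"
        by (rule norm_mult_op[OF local_window_borel local_window_abs_le f(1)])
      finally show "(\<integral>\<^sup>+x. ennreal ((?w y x)\<^sup>2 * (cmod (f x))\<^sup>2) \<partial>lborel) =
        (\<integral>\<^sup>+\<eta>. ennreal ((cmod (cinner u (g y \<eta>)))\<^sup>2) \<partial>lborel)" by (rule sym)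
    qed
    finally show ?thesis by (rule eq_refl)
  qed
  define b where "b y = \<beta> * sqrt (\<rho> y ^ ?D)" for y
  have b0: "b y \<ge> 0" if "y \<in> S" for y using \<beta>0 \<rho>[OF that] by (simp add: b_def)
  have single: "cmod (cinner u (g y \<eta>)) \<le> b y * norm (T' u)" if y: "y \<in> S" for y \<eta> u
  proof -
    define h where "h = ?P (?X u)"
    have "cmod (cinner u (g y \<eta>)) = \<kappa> * cmod (cinner h (p y \<eta>))"
      unfolding cg h_def[symmetric] norm_mult using \<kappa>0 by simp
    also have "\<dots> \<le> \<kappa> * (sqrt (unit_ball_vol (real ?D) * (2 * ?D * \<rho> y) ^ ?D) * norm (mult_op (?w y) h))"
      unfolding p_def by (intro mult_left_mono cinner_packet_le \<rho> y \<kappa>0)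
    also have "\<dots> = b y * norm (mult_op (?w y) h)"
    proof -
      have "sqrt (unit_ball_vol (real ?D) * (2 * ?D * \<rho> y) ^ ?D) =
          sqrt (unit_ball_vol (real ?D) * (2 * ?D) ^ ?D) * sqrt (\<rho> y ^ ?D)"
        by (simp only: power_mult_distrib real_sqrt_mult mult_ac of_nat_mult of_nat_power of_nat_numeral)
      then show ?thesis unfolding b_def \<beta> by (simp only: mult_ac)
    qed
    also have "\<dots> \<le> b y * (1 * norm (mult_op W h))"
      by (rule mult_left_mono[OF norm_mult_op_le[OF local_window_borel W local_window_abs_le W_bound _ wW[OF y]] b0[OF y]]) simp
    also have "\<dots> = b y * norm (T' u)" by (simp add: T'_def h_def)
    finally show ?thesis .
  qed
  define G' where "G' y \<eta> = ennreal (\<kappa> powr q) * G y \<eta>" for y \<eta>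
  have G': "G' y \<in> borel_measurable lborel" "ennreal (norm (g y \<eta>) powr q) \<le> G' y \<eta>" if y: "y \<in> S" for y \<eta>
  proof -
    show "G' y \<in> borel_measurable lborel" unfolding G'_def[abs_def] using G(1)[OF y] by simp
    have "norm (g y \<eta>) powr q = \<kappa> powr q * norm (?X (?P (p y \<eta>))) powr q"
      unfolding g_def norm_scaleC using \<kappa>0 by (simp add: powr_mult)
    then show "ennreal (norm (g y \<eta>) powr q) \<le> G' y \<eta>"
      unfolding G'_def p_def using mult_left_mono[OF G(2)[OF y, of \<eta>], of "ennreal (\<kappa> powr q)"]
      by (simp add: ennreal_mult)
  qed
  have tot: "(\<Sum>y\<in>S. ennreal (b y powr (2 - q)) * (\<integral>\<^sup>+\<eta>. G' y \<eta> \<partial>lborel)) \<le> ennreal (\<beta> powr (2 - q) * \<kappa> powr q * F)"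
  proof -
    have "(\<Sum>y\<in>S. ennreal (b y powr (2 - q)) * (\<integral>\<^sup>+\<eta>. G' y \<eta> \<partial>lborel)) =
      (\<Sum>y\<in>S. ennreal (\<beta> powr (2 - q) * \<kappa> powr q) * (ennreal (sqrt (\<rho> y ^ ?D) powr (2 - q)) * (\<integral>\<^sup>+\<eta>. G y \<eta> \<partial>lborel)))"
    proof (rule sum.cong[OF refl])
      fix y assume y: "y \<in> S"
      have 1: "b y powr (2 - q) = \<beta> powr (2 - q) * sqrt (\<rho> y ^ ?D) powr (2 - q)"
        unfolding b_def using \<beta>0 \<rho>[OF y] by (intro powr_mult)
      have 2: "(\<integral>\<^sup>+\<eta>. G' y \<eta> \<partial>lborel) = ennreal (\<kappa> powr q) * (\<integral>\<^sup>+\<eta>. G y \<eta> \<partial>lborel)"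
        unfolding G'_def by (rule nn_integral_cmult[OF G(1)[OF y]])
      show "ennreal (b y powr (2 - q)) * (\<integral>\<^sup>+\<eta>. G' y \<eta> \<partial>lborel) =
        ennreal (\<beta> powr (2 - q) * \<kappa> powr q) * (ennreal (sqrt (\<rho> y ^ ?D) powr (2 - q)) * (\<integral>\<^sup>+\<eta>. G y \<eta> \<partial>lborel))"
        unfolding 1 2 by (simp add: ennreal_mult mult_ac)
    qed
    also have "\<dots> = ennreal (\<beta> powr (2 - q) * \<kappa> powr q) *
        (\<Sum>y\<in>S. ennreal (sqrt (\<rho> y ^ ?D) powr (2 - q)) * (\<integral>\<^sup>+\<eta>. G y \<eta> \<partial>lborel))"
      by (rule sum_distrib_left[symmetric])
    also have "\<dots> \<le> ennreal (\<beta> powr (2 - q) * \<kappa> powr q) * ennreal F" by (rule mult_left_mono[OF total]) simp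
    also have "\<dots> = ennreal (\<beta> powr (2 - q) * \<kappa> powr q * F)" using F by (subst ennreal_mult[symmetric]) auto
    finally show ?thesis .
  qed
  have K: "(0::real) \<le> 4 ^ (m * ?D)" by simp
  have F': "0 \<le> \<beta> powr (2 - q) * \<kappa> powr q * F" using F by simp
  note crit = schatten_frame_criterion[OF T Ta T' Ta' q K dom S meas frame single b0 G' tot F']
  show "T \<in> schatten_class q" by (rule crit(1))
  show "schatten_norm q T \<le> ((4 ^ (m * ?D)) powr q * (\<beta> powr (2 - q) * \<kappa> powr q * F)) powr (1 / q)"
    by (rule crit(2))
qed

lemma schatten_zero:
  assumes q: "0 < q" "q < 2"
  shows "(\<lambda>u::'a::euclidean_space L2. 0) \<in> schatten_class q" "schatten_norm q (\<lambda>u::'a L2. 0) \<le> 0"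
proof -
  have z: "bounded_clinear (\<lambda>u::'a L2. 0 :: 'a L2)" by (rule bounded_clinearI[where K = 0]) auto
  have a: "adjoint_pair (\<lambda>u::'a L2. 0 :: 'a L2) (\<lambda>u. 0)" by (simp add: adjoint_pair_def)
  note crit = schatten_frame_criterion[OF z a z a q, where I = "{}" and K = 0 and F = 0 and M = "count_space (UNIV :: unit set)"
    and b = "\<lambda>_::unit. 0" and g = "\<lambda>_ _. 0" and G = "\<lambda>_ _. 0"]
  show "(\<lambda>u::'a L2. 0) \<in> schatten_class q" by (rule crit(1)) auto
  have "schatten_norm q (\<lambda>u::'a L2. 0 :: 'a L2) \<le> (0 powr q * 0) powr (1 / q)" by (rule crit(2)) auto
  then show "schatten_norm q (\<lambda>u::'a L2. 0 :: 'a L2) \<le> 0" by simp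
qed

theorem corollary4p7:
  fixes \<Lambda> \<Omega> :: "(real ^ 'd) set" and q :: real
  assumes "admissible_domain \<Lambda>" and "admissible_domain \<Omega>"
    and "0 < q" and "q \<le> 1"
  shows "\<exists>C. \<forall>\<alpha>\<ge>2.
    chi_op \<Lambda> \<circ> P_op \<Omega> \<alpha> \<circ> (\<lambda>u. u - chi_op \<Lambda> u) \<in> schatten_class q \<and>
    schatten_norm q (chi_op \<Lambda> \<circ> P_op \<Omega> \<alpha> \<circ> (\<lambda>u. u - chi_op \<Lambda> u))
      \<le> C * (\<alpha> ^ (CARD('d) - 1) * ln \<alpha>) powr (1 / q)"
proof -
  let ?D = "DIM(real ^ 'd)"
  have q2: "q < 2" using assms(4) by simp
  note \<Lambda> = admissible_domain_basic[OF assms(1)] and \<Omega> = admissible_domain_basic[OF assms(2)]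
  have b\<Lambda>: "\<Lambda> \<in> sets borel" "\<Omega> \<in> sets borel" using \<Lambda>(1) \<Omega>(1) by auto
  let ?T = "\<lambda>\<alpha>. chi_op \<Lambda> \<circ> P_op \<Omega> \<alpha> \<circ> (\<lambda>u. u - chi_op \<Lambda> u)"
  define E where "E \<alpha> = (*\<^sub>R) \<alpha> ` \<Omega>" for \<alpha> :: real
  have E: "E \<alpha> \<in> sets borel" "bounded (E \<alpha>)" if "\<alpha> \<ge> 2" for \<alpha>
    using that \<Omega> by (auto simp: E_def intro!: borel_open open_scaling bounded_scaling)
  have P: "P_op \<Omega> \<alpha> = freq_proj (E \<alpha>)" if "\<alpha> \<ge> 2" for \<alpha>
    by (rule P_op_eq_freq_proj[OF b\<Lambda>(2) \<Omega>(2) _ E_def E[OF that]]) (use that in simp)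
  have T: "?T \<alpha> = mult_op (indicator \<Lambda>) \<circ> freq_proj (E \<alpha>) \<circ> mult_op (indicator (- \<Lambda>))" if "\<alpha> \<ge> 2" for \<alpha>
    unfolding P[OF that] by (simp only: chi_op_complement[OF b\<Lambda>(1)]) (simp only: chi_op_eq_mult_op)
  show ?thesis
  proof (cases "\<Lambda> = {} \<or> \<Omega> = {}")
    case True
    have "?T \<alpha> = (\<lambda>u. 0)" if \<alpha>: "\<alpha> \<ge> 2" for \<alpha>
    proof (cases "\<Lambda> = {}")
      case empty: True
      show ?thesis by (simp add: empty fun_eq_iff chi_op_def abs_L2_zero)
    next
      case False
      then have "E \<alpha> = {}" using True by (simp add: E_def)
      then have "freq_proj (E \<alpha>) u = 0" for u
        by (simp add: freq_proj_def proj_fun_def[abs_def] proj_kernel_def fourier_def abs_L2_zero)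
      moreover have "mult_op (indicator \<Lambda>) 0 = 0"
        by (rule bounded_clinearD(3)[OF bounded_clinear_mult_op[OF _ indicator_abs_le]]) (use b\<Lambda>(1) in simp)
      ultimately show ?thesis by (simp add: P[OF \<alpha>] fun_eq_iff chi_op_eq_mult_op)
    qed
    then show ?thesis
      using schatten_zero[OF assms(3) q2, where 'a = "real ^ 'd"] by (intro exI[of _ 0]) auto
  next
    case False
    then have ne: "\<Lambda> \<noteq> {}" "\<Omega> \<noteq> {}" by auto
    \<comment> \<open>The decay of order \<open>m\<close> concerns squared norms, so its power \<open>q / 2\<close> enters; at least \<open>d + 1\<close>
       has to remain for the frequency integral.\<close>
    define m where "m = nat \<lceil>(real ?D + 1) * 2 / q\<rceil>"
    have "(real ?D + 1) * 2 / q \<le> real m" unfolding m_def by linarith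
    then have m: "real (Suc ?D) \<le> real m * (q / 2)" using assms(3) by (simp add: pos_divide_le_eq)
    obtain A where A: "A \<ge> 0" "\<And>\<alpha> y \<eta>. \<alpha> \<ge> 2 \<Longrightarrow> y \<in> \<Lambda> \<Longrightarrow>
      (norm (mult_op (indicator (- \<Lambda>)) (freq_proj (E \<alpha>) (abs_L2 (packet (Suc m) y (local_scale \<Lambda> \<alpha> y) \<eta>)))))\<^sup>2
      \<le> A * local_scale \<Lambda> \<alpha> y ^ ?D *
        (1 / (1 + (local_scale \<Lambda> \<alpha> y * (\<alpha> * infdist ((1 / \<alpha>) *\<^sub>R \<eta>) (frontier \<Omega>)))\<^sup>2)) ^ m"
      using packet_bound[OF \<Lambda> ne(1) \<Omega> ne(2), of m] unfolding E_def by auto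
    obtain C\<^sub>\<Omega> where C\<^sub>\<Omega>: "C\<^sub>\<Omega> \<ge> 0"
      "\<And>t. t > 0 \<Longrightarrow> emeasure lborel (tube (frontier \<Omega>) t) \<le> ennreal (C\<^sub>\<Omega> * (t + t ^ ?D))"
      using tube_volume[OF assms(2)] by auto
    obtain B where B: "B \<ge> 0" "\<And>\<alpha> \<rho>. \<alpha> > 0 \<Longrightarrow> \<rho> > 0 \<Longrightarrow> \<alpha> * \<rho> \<ge> 1 \<Longrightarrow>
      (\<integral>\<^sup>+\<eta>. ennreal ((1 / (1 + (\<rho> * (\<alpha> * infdist ((1 / \<alpha>) *\<^sub>R \<eta>) (frontier \<Omega>)))\<^sup>2)) ^ Suc ?D) \<partial>lborel)
      \<le> ennreal (B * \<alpha> ^ (?D - 1) / \<rho>)"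
      using boundary_decay_integral[OF frontier_nonempty[OF \<Omega>(2) ne(2)] C\<^sub>\<Omega>] by auto
    obtain N where N: "N \<ge> 0" "\<And>\<alpha> S. \<alpha> \<ge> 2 \<Longrightarrow> finite S \<Longrightarrow> S \<subseteq> \<Lambda> \<Longrightarrow>
      (\<forall>x\<in>S. \<forall>y\<in>S. x \<noteq> y \<longrightarrow> ball x (local_scale \<Lambda> \<alpha> x / 4) \<inter> ball y (local_scale \<Lambda> \<alpha> y / 4) = {}) \<Longrightarrow>
      (\<Sum>y\<in>S. local_scale \<Lambda> \<alpha> y ^ (?D - 1)) \<le> N * ln \<alpha>"
      using scale_sum_bound[OF assms(1) ne(1)] by auto
    obtain R where R: "\<And>\<alpha> y. \<alpha> \<ge> 2 \<Longrightarrow> y \<in> \<Lambda> \<Longrightarrow> local_scale \<Lambda> \<alpha> y \<le> R"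
      using local_scale_bounded[OF \<Lambda>(2) ne(1)] by metis
    define \<kappa> where "\<kappa> = sqrt (1 / (2 * pi) ^ ?D)"
    define \<beta> where "\<beta> = \<kappa> * sqrt (unit_ball_vol (real ?D) * (2 * ?D) ^ ?D)"
    define c where "c = (4 ^ (Suc m * ?D)) powr q * (\<beta> powr (2 - q) * \<kappa> powr q * (A powr (q / 2) * B * N))"
    have c: "c \<ge> 0" using B N by (simp add: c_def)
    have main: "?T \<alpha> \<in> schatten_class q \<and> schatten_norm q (?T \<alpha>) \<le> (c * (\<alpha> ^ (CARD('d) - 1) * ln \<alpha>)) powr (1 / q)"
      if \<alpha>: "\<alpha> \<ge> 2" for \<alpha>
    proof -
      let ?\<rho> = "local_scale \<Lambda> \<alpha>"
      have \<rho>: "1 / \<alpha> \<le> ?\<rho> y" for y by (simp add: local_scale_def)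
      have \<rho>0: "?\<rho> y > 0" for y using \<rho>[of y] \<alpha> by (intro less_le_trans[OF _ \<rho>]) simp
      have \<alpha>\<rho>: "\<alpha> * ?\<rho> y \<ge> 1" for y using \<rho>[of y] \<alpha> by (simp add: divide_le_eq mult.commute)
      obtain S where S: "finite S" "S \<subseteq> \<Lambda>"
        "\<And>x y. x \<in> S \<Longrightarrow> y \<in> S \<Longrightarrow> x \<noteq> y \<Longrightarrow> ball x (?\<rho> x / 4) \<inter> ball y (?\<rho> y / 4) = {}"
        "\<And>x. x \<in> \<Lambda> \<Longrightarrow> \<exists>y\<in>S. dist x y \<le> ?\<rho> y"
      proof (rule separated_centres[OF \<Lambda>(2) _ \<rho> R[OF \<alpha>] local_scale_lipschitz])
        show "1 / \<alpha> > 0" using \<alpha> by simp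
      next
        fix S
        assume "finite S" "S \<subseteq> \<Lambda>"
          "\<And>x y. x \<in> S \<Longrightarrow> y \<in> S \<Longrightarrow> x \<noteq> y \<Longrightarrow> ball x (?\<rho> x / 4) \<inter> ball y (?\<rho> y / 4) = {}"
          "\<And>x. x \<in> \<Lambda> \<Longrightarrow> \<exists>y\<in>S. dist x y \<le> ?\<rho> y"
        then show thesis by (rule that)
      qed
      define z where "z y \<eta> = 1 / (1 + (?\<rho> y * (\<alpha> * infdist ((1 / \<alpha>) *\<^sub>R \<eta>) (frontier \<Omega>)))\<^sup>2)" for y \<eta>
      have z: "0 < z y \<eta>" "z y \<eta> \<le> 1" for y \<eta> by (auto simp: z_def add_pos_nonneg)
      have z_meas[measurable]: "z y \<in> borel_measurable borel" for y
        unfolding z_def[abs_def] by (intro borel_measurable_continuous_onI continuous_intros) (auto simp: add_nonneg_eq_0_iff)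
      define a where "a y = A powr (q / 2) * (?\<rho> y ^ ?D) powr (q / 2)" for y
      define G where "G y \<eta> = ennreal (a y) * ennreal (z y \<eta> ^ Suc ?D)" for y \<eta>
      have G: "ennreal (norm (mult_op (indicator (- \<Lambda>)) (freq_proj (E \<alpha>) (abs_L2 (packet (Suc m) y (?\<rho> y) \<eta>)))) powr q) \<le> G y \<eta>"
        if y: "y \<in> S" for y \<eta>
      proof -
        let ?n = "norm (mult_op (indicator (- \<Lambda>)) (freq_proj (E \<alpha>) (abs_L2 (packet (Suc m) y (?\<rho> y) \<eta>))))"
        have y\<Lambda>: "y \<in> \<Lambda>" using S(2) y by auto
        have "?n powr q = (?n\<^sup>2) powr (q / 2)"
          by (cases "?n = 0") (simp_all add: powr_powr flip: powr_numeral)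
        also have "\<dots> \<le> (A * ?\<rho> y ^ ?D * z y \<eta> ^ m) powr (q / 2)"
          using A(2)[OF \<alpha> y\<Lambda>, of \<eta>] assms(3) unfolding z_def by (intro powr_mono2) auto
        also have "\<dots> = a y * (z y \<eta> ^ m) powr (q / 2)"
          unfolding a_def using A(1) \<rho>0[of y] z(1)[of y \<eta>] by (simp add: powr_mult)
        also have "(z y \<eta> ^ m) powr (q / 2) = z y \<eta> powr (real m * (q / 2))"
          using z(1)[of y \<eta>] by (simp add: powr_powr flip: powr_realpow)
        also have "\<dots> \<le> z y \<eta> powr real (Suc ?D)"
          using z[of y \<eta>] m by (intro powr_mono') auto
        also have "\<dots> = z y \<eta> ^ Suc ?D" by (rule powr_realpow[OF z(1)])
        finally have "?n powr q \<le> a y * z y \<eta> ^ Suc ?D" by (simp add: a_def mult_left_mono)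
        then show ?thesis unfolding G_def using z(1)[of y \<eta>] by (subst ennreal_mult[symmetric]) (auto simp: a_def)
      qed
      have term_le: "ennreal (sqrt (?\<rho> y ^ ?D) powr (2 - q)) * (\<integral>\<^sup>+\<eta>. G y \<eta> \<partial>lborel) \<le>
        ennreal (A powr (q / 2) * B * \<alpha> ^ (?D - 1) * ?\<rho> y ^ (?D - 1))" for y
      proof -
        have "(\<integral>\<^sup>+\<eta>. G y \<eta> \<partial>lborel) = ennreal (a y) * (\<integral>\<^sup>+\<eta>. ennreal (z y \<eta> ^ Suc ?D) \<partial>lborel)"
          unfolding G_def by (rule nn_integral_cmult) measurable
        also have "\<dots> \<le> ennreal (a y) * ennreal (B * \<alpha> ^ (?D - 1) / ?\<rho> y)"
          unfolding z_def by (intro mult_left_mono B(2) \<rho>0 \<alpha>\<rho>) (use \<alpha> in auto)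
        finally have "ennreal (sqrt (?\<rho> y ^ ?D) powr (2 - q)) * (\<integral>\<^sup>+\<eta>. G y \<eta> \<partial>lborel) \<le>
          ennreal (sqrt (?\<rho> y ^ ?D) powr (2 - q)) * (ennreal (a y) * ennreal (B * \<alpha> ^ (?D - 1) / ?\<rho> y))"
          by (rule mult_left_mono) simp
        also have "\<dots> = ennreal (sqrt (?\<rho> y ^ ?D) powr (2 - q) * (a y * (B * \<alpha> ^ (?D - 1) / ?\<rho> y)))"
        proof -
          have "a y \<ge> 0" "B * \<alpha> ^ (?D - 1) / ?\<rho> y \<ge> 0" using B(1) \<alpha> \<rho>0[of y] by (simp_all add: a_def)
          then show ?thesis by (simp only: ennreal_mult[symmetric] powr_ge_zero mult_nonneg_nonneg)
        qed
        also have "sqrt (?\<rho> y ^ ?D) powr (2 - q) * (a y * (B * \<alpha> ^ (?D - 1) / ?\<rho> y)) =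
          A powr (q / 2) * B * \<alpha> ^ (?D - 1) * ?\<rho> y ^ (?D - 1)"
        proof -
          have pos: "?\<rho> y ^ ?D > 0" using \<rho>0[of y] by simp
          have "sqrt (?\<rho> y ^ ?D) powr (2 - q) * (?\<rho> y ^ ?D) powr (q / 2) = (?\<rho> y ^ ?D) powr ((1 / 2) * (2 - q) + q / 2)"
            using pos by (simp add: powr_half_sqrt[symmetric] powr_powr powr_add del: powr_half_sqrt)
          also have "(1 / 2) * (2 - q) + q / 2 = 1" by (simp add: field_simps)
          also have "(?\<rho> y ^ ?D) powr 1 = ?\<rho> y ^ ?D" using pos by simp
          also have "\<dots> = ?\<rho> y * ?\<rho> y ^ (?D - 1)"
            using power_minus_mult[OF DIM_positive[where 'a = "real ^ 'd"], of "?\<rho> y"] by (simp only: mult.commute)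
          finally have *: "sqrt (?\<rho> y ^ ?D) powr (2 - q) * (?\<rho> y ^ ?D) powr (q / 2) = ?\<rho> y * ?\<rho> y ^ (?D - 1)" .
          have "sqrt (?\<rho> y ^ ?D) powr (2 - q) * (a y * (B * \<alpha> ^ (?D - 1) / ?\<rho> y)) =
            (sqrt (?\<rho> y ^ ?D) powr (2 - q) * (?\<rho> y ^ ?D) powr (q / 2)) * (A powr (q / 2) * B * \<alpha> ^ (?D - 1)) / ?\<rho> y"
            unfolding a_def by (simp only: times_divide_eq_right times_divide_eq_left mult_ac)
          also have "\<dots> = A powr (q / 2) * B * \<alpha> ^ (?D - 1) * ?\<rho> y ^ (?D - 1)"
            unfolding * using \<rho>0[of y] by simp
          finally show ?thesis .
        qed
        finally show ?thesis .
      qed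
      define F where "F = A powr (q / 2) * B * \<alpha> ^ (?D - 1) * (N * ln \<alpha>)"
      have F: "F \<ge> 0" using B(1) N(1) \<alpha> by (simp add: F_def)
      have total: "(\<Sum>y\<in>S. ennreal (sqrt (?\<rho> y ^ ?D) powr (2 - q)) * (\<integral>\<^sup>+\<eta>. G y \<eta> \<partial>lborel)) \<le> ennreal F"
      proof -
        have "(\<Sum>y\<in>S. ennreal (sqrt (?\<rho> y ^ ?D) powr (2 - q)) * (\<integral>\<^sup>+\<eta>. G y \<eta> \<partial>lborel)) \<le>
          (\<Sum>y\<in>S. ennreal (A powr (q / 2) * B * \<alpha> ^ (?D - 1) * ?\<rho> y ^ (?D - 1)))"
          by (intro sum_mono term_le)
        also have "\<dots> = ennreal (\<Sum>y\<in>S. A powr (q / 2) * B * \<alpha> ^ (?D - 1) * ?\<rho> y ^ (?D - 1))"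
          by (rule sum_ennreal) (use B(1) \<alpha> less_imp_le[OF \<rho>0] in simp)
        also have "(\<Sum>y\<in>S. A powr (q / 2) * B * \<alpha> ^ (?D - 1) * ?\<rho> y ^ (?D - 1)) =
          A powr (q / 2) * B * \<alpha> ^ (?D - 1) * (\<Sum>y\<in>S. ?\<rho> y ^ (?D - 1))"
          by (rule sum_distrib_left[symmetric])
        also have "ennreal \<dots> \<le> ennreal F"
          unfolding F_def using S N(2)[OF \<alpha> S(1,2)] B(1) \<alpha> by (intro ennreal_leI mult_left_mono) auto
        finally show ?thesis .
      qed
      have Gm: "G y \<in> borel_measurable lborel" for y unfolding G_def[abs_def] by measurable
      note bound = covering_schatten_bound[OF b\<Lambda>(1) E[OF \<alpha>] S(1) \<rho>0 S(4) assms(3) q2 Gm G total F \<kappa>_def \<beta>_def,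
          folded T[OF \<alpha>]]
      have "(4 ^ (Suc m * ?D)) powr q * (\<beta> powr (2 - q) * \<kappa> powr q * F) = c * (\<alpha> ^ (CARD('d) - 1) * ln \<alpha>)"
        by (simp add: c_def F_def)
      then show ?thesis using bound by simp
    qed
    show ?thesis
    proof (intro exI[of _ "c powr (1 / q)"] allI impI)
      fix \<alpha> :: real assume \<alpha>: "\<alpha> \<ge> 2"
      have "(c * (\<alpha> ^ (CARD('d) - 1) * ln \<alpha>)) powr (1 / q) = c powr (1 / q) * (\<alpha> ^ (CARD('d) - 1) * ln \<alpha>) powr (1 / q)"
        using c \<alpha> by (intro powr_mult)
      then show "?T \<alpha> \<in> schatten_class q \<and> schatten_norm q (?T \<alpha>) \<le> c powr (1 / q) * (\<alpha> ^ (CARD('d) - 1) * ln \<alpha>) powr (1 / q)"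
        using main[OF \<alpha>] by simp
    qed
  qed
qed

end
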